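(* Assume that $G$ satisfies condition (G) (stated in the context) for some $\gamma\in\mathbf{N}$, $d>0$ and $L>0$. Let $0\le K<L$ with $[K]+1\le\gamma$ and $1\le q\le\infty$. Let $f$ be a measurable function in $\mathbf R^N\times(0,\infty)$ such that $$E_{K,q}[f](t):=(1+t)^{\frac Kd}\left[t^{\frac Nd(1-\frac1q)}\|f(t)\|_q+\|f(t)\|_1\right]+|||f(t)|||_K\in L^\infty(0,T)$$ for any $T>0$. Then the following holds. (i) For any $\alpha\in\mathbf M_K$, there exists a constant $C_1$ such that $$|M_\alpha(f(t),t)|\le C_1(1+t)^{-\frac{K-|\alpha|}{d}}E_{K,q}[f](t)$$ for almost all $t>0$. (ii) Put $$R_K[f](t):=\int_0^te^{(t-s)\mathcal L}P_K(s)f(s)\,ds=\int_0^te^{(t-s)\mathcal L}f(s)\,ds-\sum_{|\alpha|\le K}\left[\int_0^tM_\alpha(f(s),s)\,ds\right]g_\alpha(t).$$ Let $0\le\ell\le K$, let $j\in\{0,\dots,\gamma\}$ with $j<d$, and let $T_0>0$. Then there exists a constant $C_2$ such that, for any $\epsilon>0$ and $T\ge T_0$, $$t^{\frac Nd(1-\frac1q)}\|\nabla^jR_K[f](t)\|_q+t^{-\frac{\ell}{d}}|||\nabla^jR_K[f](t)|||_\ell\le\epsilon t^{-\frac{K+j}{d}}+C_2t^{-\frac Kd}\int_T^t(t-s)^{-\frac jd}E_{K,q}[f](s)\,ds$$ for all sufficiently large $t>0$. In particular, if $\int_0^\infty E_{K,q}[f](s)\,ds<\infty$, then $$\lim_{t\to\infty}t^{\frac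 Kd}\left[t^{\frac Nd(1-\frac1q)}\|R_K[f](t)\|_q+t^{-\frac{\ell}{d}}|||R_K[f](t)|||_\ell\right]=0.$$
   Context: $N\ge1$ is an integer and $\mathbf N=\{1,2,\dots\}$. For $k\ge0$, $[k]$ is the integer with $k-1<[k]\le k$. $\mathbf M=(\mathbf N\cup\{0\})^N$ is the set of multi-indices, with the usual $|\alpha|$, $\alpha!$, $x^\alpha$, $\partial_x^\alpha$; $\beta\le\alpha$ means $\beta_i\le\alpha_i$ for all $i$; $\mathbf M_k=\{\alpha\in\mathbf M:|\alpha|\le k\}$. $\nabla^j$ denotes the collection of all $x$-derivatives of order $j$. $\|\cdot\|_r$ is the norm of $L^r(\mathbf R^N)$. For $k\ge0$, $L^1_k=L^1(\mathbf R^N,(1+|x|^k)dx)$ with norm $|||f|||_k=\int_{\mathbf R^N}|f(x)|(1+|x|^k)\,dx$. For a function $f$ on $\mathbf R^N\times(0,\infty)$, $f(t)$ denotes $f(\cdot,t)$. Condition (G) (for $\gamma\in\mathbf N$, $d>0$, $L>0$) on a kernel $G:\mathbf R^N\times(0,\infty)\to\mathbf R$: (i) $G\in C^\gamma(\mathbf R^N\times(0,\infty))$; (ii) $G(x,t)=t^{-N/d}G(x/t^{1/d},1)$ for $x\in\mathbf R^N$, $t>0$, and $\sup_{x\in\mathbf R^N}(1+|x|)^{N+L+j}|\nabla_x^jG(x,1)|<\infty$ for $j=0,\dots,\gamma$; (iii) $G(x,t)=\int_{\mathbf R^N}G(x-y,t-s)G(y,s)\,dy$ for $x\in\mathbf R^N$,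 $t>s>0$. Put $e^{t\mathcal L}\varphi(x)=\int_{\mathbf R^N}G(x-y,t)\varphi(y)\,dy$ for $t>0$, $g(x,t)=G(x,t+1)$, and $g_\alpha(x,t)=\frac{(-1)^{|\alpha|}}{\alpha!}\partial_x^\alpha g(x,t)$ for $|\alpha|\le\gamma$. For $f\in L^1_k$ with $0\le k<L$, $[k]\le\gamma$, and $t\ge0$, the numbers $M_\alpha(f,t)$ ($|\alpha|\le k$) are defined inductively by $M_0(f,t)=\int_{\mathbf R^N}f(x)\,dx$ and, for $\alpha\ne0$, $$M_\alpha(f,t)=\int_{\mathbf R^N}x^\alpha f(x)\,dx-\sum_{\beta\le\alpha,\ \beta\ne\alpha}M_\beta(f,t)\int_{\mathbf R^N}x^\alpha g_\beta(x,t)\,dx,$$ and $[P_k(t)f](x)=f(x)-\sum_{|\alpha|\le k}M_\alpha(f,t)g_\alpha(x,t)$. *)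

theory Defs
  imports "HOL-Probability.Essential_Supremum"
begin

text \<open>Multi-indices are functions \<open>'n \<Rightarrow> nat\<close>; the order \<open>\<le>\<close> on them is the pointwise one.\<close>

definition mi_len :: "('n::finite \<Rightarrow> nat) \<Rightarrow> nat" where
  "mi_len \<alpha> = (\<Sum>i\<in>UNIV. \<alpha> i)"

definition mi_fact :: "('n::finite \<Rightarrow> nat) \<Rightarrow> real" where
  "mi_fact \<alpha> = (\<Prod>i\<in>UNIV. fact (\<alpha> i))"

definition mi_pow :: "real ^ 'n \<Rightarrow> ('n::finite \<Rightarrow> nat) \<Rightarrow> real" where
  "mi_pow x \<alpha> = (\<Prod>i\<in>UNIV. (x $ i) ^ \<alpha> i)"

definition mi_upto :: "real \<Rightarrow> ('n::finite \<Rightarrow> nat) set" where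
  "mi_upto k = {\<alpha>. real (mi_len \<alpha>) \<le> k}"


text \<open>\<open>C^k\<close> regularity on an open set.\<close>

primrec Ck_on :: "nat \<Rightarrow> 'a::real_normed_vector set \<Rightarrow> ('a \<Rightarrow> real) \<Rightarrow> bool" where
  "Ck_on 0 S h \<longleftrightarrow> continuous_on S h"
| "Ck_on (Suc k) S h \<longleftrightarrow>
     (\<forall>x\<in>S. h differentiable (at x)) \<and> (\<forall>v. Ck_on k S (\<lambda>x. frechet_derivative h (at x) v))"

definition partial :: "'n::finite \<Rightarrow> (real ^ 'n \<Rightarrow> real) \<Rightarrow> real ^ 'n \<Rightarrow> real" where
  "partial i h x = deriv (\<lambda>r. h (x + r *\<^sub>R axis i 1)) 0"

text \<open>The \<open>\<alpha>\<close>-th partial derivative takes the single derivatives in an arbitrary but fixed order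
  (the index type carries no order); it is only applied to functions of class \<open>C^|\<alpha>|\<close>, for which
  the order does not matter.\<close>

definition mpartial :: "('n::finite \<Rightarrow> nat) \<Rightarrow> (real ^ 'n \<Rightarrow> real) \<Rightarrow> real ^ 'n \<Rightarrow> real" where
  "mpartial \<alpha> h = foldr partial (SOME is. \<forall>i. count_list is i = \<alpha> i) h"

text \<open>Pointwise Euclidean length of a collection \<open>D\<close> of functions indexed by the multi-indices of
  order \<open>j\<close>; with \<open>D \<alpha> = \<partial>\<^sup>\<alpha> h\<close> this is \<open>|\<nabla>\<^sup>j h|\<close>.\<close>

definition order_len ::
  "nat \<Rightarrow> (('n::finite \<Rightarrow> nat) \<Rightarrow> real ^ 'n \<Rightarrow> real) \<Rightarrow> real ^ 'n \<Rightarrow> real" where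
  "order_len j D x = sqrt (\<Sum>\<alpha> | mi_len \<alpha> = j. (D \<alpha> x)\<^sup>2)"


text \<open>Weak derivatives. For sources that are merely integrable in space, the Duhamel integral
  \<open>R\<^sub>K[f](t)\<close> below is in general determined only almost everywhere and need not be differentiable
  at every point, so its \<open>x\<close>-derivatives are taken in the weak sense.\<close>

definition test_function :: "(real ^ 'n::finite \<Rightarrow> real) \<Rightarrow> bool" where
  "test_function \<phi> \<longleftrightarrow>
     (\<forall>k. Ck_on k UNIV \<phi>) \<and> (\<exists>C. compact C \<and> (\<forall>x. x \<notin> C \<longrightarrow> \<phi> x = 0))"

definition locally_integrable :: "(real ^ 'n::finite \<Rightarrow> real) \<Rightarrow> bool" where
  "locally_integrable u \<longleftrightarrow> (\<forall>C. compact C \<longrightarrow> u absolutely_integrable_on C)"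

definition has_weak_mpartial ::
  "('n::finite \<Rightarrow> nat) \<Rightarrow> (real ^ 'n \<Rightarrow> real) \<Rightarrow> (real ^ 'n \<Rightarrow> real) \<Rightarrow> bool" where
  "has_weak_mpartial \<alpha> u v \<longleftrightarrow>
     locally_integrable u \<and> locally_integrable v \<and>
     (\<forall>\<phi>. test_function \<phi> \<longrightarrow>
        (LINT x|lebesgue. u x * mpartial \<alpha> \<phi> x) = (-1) ^ mi_len \<alpha> * (LINT x|lebesgue. v x * \<phi> x))"

definition weak_mpartial ::
  "('n::finite \<Rightarrow> nat) \<Rightarrow> (real ^ 'n \<Rightarrow> real) \<Rightarrow> real ^ 'n \<Rightarrow> real" where
  "weak_mpartial \<alpha> u = (SOME v. has_weak_mpartial \<alpha> u v)"

definition weak_nabla :: "nat \<Rightarrow> (real ^ 'n::finite \<Rightarrow> real) \<Rightarrow> real ^ 'n \<Rightarrow> real" where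
  "weak_nabla j u = order_len j (\<lambda>\<alpha>. weak_mpartial \<alpha> u)"


text \<open>The norms take values in \<open>[0,\<infinity>]\<close>, with value \<open>\<infinity>\<close> outside the corresponding space (in particular
  for non-measurable functions).\<close>

definition Lnorm :: "ennreal \<Rightarrow> (real ^ 'n::finite \<Rightarrow> real) \<Rightarrow> ennreal" where
  "Lnorm r h =
     (if h \<notin> borel_measurable lebesgue then \<infinity>
      else if r = \<infinity> then esssup lebesgue (\<lambda>x. ennreal \<bar>h x\<bar>)
      else let p = enn2real r; I = (\<integral>\<^sup>+ x. ennreal (\<bar>h x\<bar> powr p) \<partial>lebesgue)
           in if I = \<infinity> then \<infinity> else ennreal (enn2real I powr (1 / p)))"

text \<open>At the single point \<open>x = 0\<close> the weight differs from \<open>1 + |x|^k\<close> when \<open>k = 0\<close>, because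
  \<open>0 powr 0 = 0\<close>; this does not affect the integral.\<close>

definition wnorm :: "real \<Rightarrow> (real ^ 'n::finite \<Rightarrow> real) \<Rightarrow> ennreal" where
  "wnorm k h =
     (if h \<notin> borel_measurable lebesgue then \<infinity>
      else (\<integral>\<^sup>+ x. ennreal (\<bar>h x\<bar> * (1 + norm x powr k)) \<partial>lebesgue))"

text \<open>\<open>esssup\<close> is \<open>\<infinity>\<close> for non-measurable functions, so this includes measurability.\<close>

definition in_Linfty :: "real \<Rightarrow> (real \<Rightarrow> ennreal) \<Rightarrow> bool" where
  "in_Linfty T h \<longleftrightarrow> esssup (lebesgue_on {0<..<T}) h < \<infinity>"


definition condition_G :: "nat \<Rightarrow> real \<Rightarrow> real \<Rightarrow> (real ^ 'n::finite \<Rightarrow> real \<Rightarrow> real) \<Rightarrow> bool" where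
  "condition_G \<gamma> d L G \<longleftrightarrow>
     Ck_on \<gamma> (UNIV \<times> {0<..}) (\<lambda>(x, t). G x t) \<and>
     (\<forall>x. \<forall>t>0. G x t =
        t powr (- real CARD('n) / d) * G ((1 / t powr (1 / d)) *\<^sub>R x) 1) \<and>
     (\<forall>j\<le>\<gamma>. bdd_above (range (\<lambda>x.
        (1 + norm x) powr (real CARD('n) + L + real j)
          * order_len j (\<lambda>\<alpha>. mpartial \<alpha> (\<lambda>z. G z 1)) x))) \<and>
     (\<forall>x t s. 0 < s \<and> s < t \<longrightarrow>
        G x t = (LINT y|lebesgue. G (x - y) (t - s) * G y s))"

definition semigrp ::
  "(real ^ 'n::finite \<Rightarrow> real \<Rightarrow> real) \<Rightarrow> real \<Rightarrow> (real ^ 'n \<Rightarrow> real) \<Rightarrow> real ^ 'n \<Rightarrow> real" where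
  "semigrp G t \<phi> x = (LINT y|lebesgue. G (x - y) t * \<phi> y)"

definition g_kernel ::
  "(real ^ 'n::finite \<Rightarrow> real \<Rightarrow> real) \<Rightarrow> ('n \<Rightarrow> nat) \<Rightarrow> real \<Rightarrow> real ^ 'n \<Rightarrow> real" where
  "g_kernel G \<alpha> t x =
     (-1) ^ mi_len \<alpha> / mi_fact \<alpha> * mpartial \<alpha> (\<lambda>z. G z (t + 1)) x"

text \<open>For \<open>\<alpha> = 0\<close> the sum is empty and the first integral is that of \<open>h\<close>.\<close>

function moment ::
  "(real ^ 'n::finite \<Rightarrow> real \<Rightarrow> real) \<Rightarrow> (real ^ 'n \<Rightarrow> real) \<Rightarrow> real \<Rightarrow> ('n \<Rightarrow> nat) \<Rightarrow> real" where
  "moment G h t \<alpha> =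
     (LINT x|lebesgue. mi_pow x \<alpha> * h x) -
     (\<Sum>\<beta> | \<beta> \<le> \<alpha> \<and> \<beta> \<noteq> \<alpha>.
        moment G h t \<beta> * (LINT x|lebesgue. mi_pow x \<alpha> * g_kernel G \<beta> t x))"
  by auto
termination
proof (relation "Wellfounded.measure (\<lambda>(G, h, t, \<alpha>). mi_len \<alpha>)", goal_cases)
  case 1
  show ?case by simp
next
  case (2 G h t \<alpha> \<beta>)
  then have le: "\<And>i. \<beta> i \<le> \<alpha> i" and "\<beta> \<noteq> \<alpha>"
    by (auto simp: le_fun_def)
  then obtain i where "\<beta> i < \<alpha> i"
    by (metis ext nat_less_le)
  then have "mi_len \<beta> < mi_len \<alpha>"
    unfolding mi_len_def by (intro sum_strict_mono_ex1) (auto simp: le)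
  then show ?case by simp
qed

declare moment.simps [simp del]

definition P_op ::
  "(real ^ 'n::finite \<Rightarrow> real \<Rightarrow> real) \<Rightarrow> real \<Rightarrow> real \<Rightarrow> (real ^ 'n \<Rightarrow> real) \<Rightarrow> real ^ 'n \<Rightarrow> real" where
  "P_op G k t h x = h x - (\<Sum>\<alpha>\<in>mi_upto k. moment G h t \<alpha> * g_kernel G \<alpha> t x)"

text \<open>The exponent \<open>N/d (1 - 1/q)\<close>; for \<open>q = \<infinity>\<close> the quotient \<open>1 / q\<close> is \<open>0\<close>.\<close>

definition scal_exp :: "'n::finite itself \<Rightarrow> real \<Rightarrow> ennreal \<Rightarrow> real" where
  "scal_exp _ d q = real CARD('n) / d * (1 - enn2real (1 / q))"

definition E_fun ::
  "real \<Rightarrow> real \<Rightarrow> ennreal \<Rightarrow> (real ^ 'n::finite \<Rightarrow> real \<Rightarrow> real) \<Rightarrow> real \<Rightarrow> ennreal" where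
  "E_fun d K q f t =
     ennreal ((1 + t) powr (K / d)) *
       (ennreal (t powr scal_exp TYPE('n) d q) * Lnorm q (\<lambda>x. f x t) + Lnorm 1 (\<lambda>x. f x t))
     + wnorm K (\<lambda>x. f x t)"

definition R_op ::
  "(real ^ 'n::finite \<Rightarrow> real \<Rightarrow> real) \<Rightarrow> real \<Rightarrow> (real ^ 'n \<Rightarrow> real \<Rightarrow> real) \<Rightarrow> real \<Rightarrow>
     real ^ 'n \<Rightarrow> real" where
  "R_op G K f t x =
     (LINT s:{0<..<t}|lebesgue. semigrp G (t - s) (P_op G K s (\<lambda>y. f y s)) x)"

end

theory Submission
  imports Defs
begin

text \<open>The moments of \<open>P\<^sub>K(s)f(s)\<close> up to order \<open>K\<close> vanish, so the Taylor polynomial of the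
  kernel may be subtracted in \<open>\<nabla>\<^sup>je\<^bsup>\<tau>\<L>\<^esup>P\<^sub>K(s)f(s)\<close>. By scaling, the weight \<open>|y|\<^sup>K\<close> is then gained
  together with the factor \<open>min(1, (|y|\<tau>\<^bsup>-1/d\<^esup>)\<^bsup>[K]+1-K\<^esup>)\<close>, which tends to \<open>0\<close> as \<open>\<tau> \<rightarrow> \<infinity>\<close>.
  The Duhamel integral is split at \<open>s = t/2\<close>. For \<open>s < t/2\<close> half of the semigroup absorbs the
  derivatives and the norms, and the other half provides this decay; for \<open>s \<ge> t/2\<close> Young's
  inequality suffices, and \<open>j < d\<close> makes the singularity \<open>(t - s)\<^bsup>-j/d\<^esup>\<close> integrable.
  Minkowski's integral inequality sums up the time slices. The derivatives of \<open>R\<^sub>K[f](t)\<close> are the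
  Duhamel integrals of the differentiated kernel, by Fubini's theorem against test functions.\<close>

section \<open>Partial derivatives of functions of class \<open>C^k\<close>\<close>

text \<open>Condition (G) does not prescribe the mass of the kernel, yet the moments of P_K(s)f(s)
  vanish only if that mass is 1. The semigroup law leaves just mass 1 or G = 0, and for G = 0 the
  decay estimate is trivial. Given mass 1, the matrix of the moments of x^\<alpha> against g_\<beta>
  is triangular with unit diagonal, and the inductive definition of the moments solves that system.
  The exponent [K]+1-K comes from two bounds on the Taylor remainder: |y|^([K]+1) for small |y|, and
  |y|^K for large |y|, where each term is estimated by itself; [K]+1 <= \<gamma> and K < L make both
  available. The quantity \<epsilon> arises only from s in (0,T]: there the gain factor tends to 0
  under a majorant C E(s), whereas for s > T the bound C E(s) is kept, which is why C2 depends on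
  neither \<epsilon> nor T. Since f is only Lebesgue measurable and E only essentially bounded, the
  work is done on Borel representatives for which the slice bounds hold at every s > 0; the moments
  and the Duhamel integral do not see the change.\<close>

lemma Ck_on_imp_continuous: "Ck_on k S h \<Longrightarrow> continuous_on S h"
  by (cases k) (auto intro!: continuous_at_imp_continuous_on differentiable_imp_continuous_within)

lemma Ck_on_SucD: "Ck_on (Suc k) S h \<Longrightarrow> Ck_on k S h"
proof (induction k arbitrary: h)
  case 0
  then show ?case
    by (auto intro!: continuous_at_imp_continuous_on differentiable_imp_continuous_within)
next
  case (Suc k)
  then show ?case by (metis Ck_on.simps(2))
qed

text \<open>The chain rule turns a directional derivative of the composite into that of
  \<open>H\<close> in the fixed direction \<open>A v\<close>, so the claim reproduces itself with
  one order less. It serves to pass from G on space-time to its slice at time 1 and to build test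
  functions from functions of one variable.\<close>

lemma Ck_on_affine:
  fixes H :: "'b::real_normed_vector \<Rightarrow> real"
  assumes A: "bounded_linear A" and S: "\<And>x. A x + c \<in> S" and H: "Ck_on k S H"
  shows "Ck_on k UNIV (\<lambda>x. H (A x + c))"
  using H
proof (induction k arbitrary: H)
  case 0
  have "continuous_on UNIV (\<lambda>x. A x + c)"
    using A by (intro continuous_intros linear_continuous_on)
  with 0 show ?case
    using S by (auto intro!: continuous_on_compose2[of S H])
next
  case (Suc k)
  have der: "((\<lambda>x. H (A x + c)) has_derivative (\<lambda>v. frechet_derivative H (at (A x + c)) (A v))) (at x)" for x
  proof -
    have "(H has_derivative frechet_derivative H (at (A x + c))) (at (A x + c))"
      using Suc.prems S unfolding frechet_derivative_works[symmetric] by simp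
    moreover have "((\<lambda>x. A x + c) has_derivative A) (at x)"
      using has_derivative_add[OF bounded_linear_imp_has_derivative[OF A] has_derivative_const[of c]] by simp
    ultimately show ?thesis
      using has_derivative_compose[of "\<lambda>x. A x + c" A x UNIV H] by simp
  qed
  have fd: "frechet_derivative (\<lambda>x. H (A x + c)) (at x) = (\<lambda>v. frechet_derivative H (at (A x + c)) (A v))" for x
    by (rule frechet_derivative_at[OF der, symmetric])
  have "(\<lambda>x. H (A x + c)) differentiable at x" for x
    using der by (auto simp: differentiable_def)
  moreover have "Ck_on k UNIV (\<lambda>x. frechet_derivative H (at (A x + c)) (A v))" for v
    by (rule Suc.IH) (use Suc.prems in auto)
  ultimately show ?case by (simp add: fd)
qed

text \<open>The product rule produces a sum of products, so the induction rests on closure under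
  sums, which is the auxiliary fact \<open>add\<close>.\<close>

lemma Ck_on_mult:
  assumes "Ck_on k UNIV f" "Ck_on k UNIV g"
  shows "Ck_on k UNIV (\<lambda>x. f x * g x)"
proof -
  have add: "Ck_on k UNIV f \<Longrightarrow> Ck_on k UNIV g \<Longrightarrow> Ck_on k UNIV (\<lambda>x. f x + g x)"
    for k :: nat and f g :: "'a \<Rightarrow> real"
  proof (induction k arbitrary: f g)
    case 0
    then show ?case by (auto intro!: continuous_intros)
  next
    case (Suc k)
    have der: "((\<lambda>x. f x + g x) has_derivative (\<lambda>v. frechet_derivative f (at x) v + frechet_derivative g (at x) v)) (at x)" for x
      using Suc.prems by (intro has_derivative_add) (simp_all flip: frechet_derivative_works)
    have "frechet_derivative (\<lambda>x. f x + g x) (at x) = (\<lambda>v. frechet_derivative f (at x) v + frechet_derivative g (at x) v)" for x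
      by (rule frechet_derivative_at[OF der, symmetric])
    moreover have "(\<lambda>x. f x + g x) differentiable at x" for x
      using der by (auto simp: differentiable_def)
    moreover have "Ck_on k UNIV (\<lambda>x. frechet_derivative f (at x) v + frechet_derivative g (at x) v)" for v
      by (rule Suc.IH) (use Suc.prems in auto)
    ultimately show ?case by simp
  qed
  show ?thesis using assms
  proof (induction k arbitrary: f g)
    case 0
    then show ?case by (auto intro!: continuous_intros)
  next
    case (Suc k)
    have der: "((\<lambda>x. f x * g x) has_derivative (\<lambda>v. f x * frechet_derivative g (at x) v + frechet_derivative f (at x) v * g x)) (at x)" for x
      using Suc.prems by (intro has_derivative_mult) (simp_all flip: frechet_derivative_works)
    have fd: "frechet_derivative (\<lambda>x. f x * g x) (at x) = (\<lambda>v. f x * frechet_derivative g (at x) v + frechet_derivative f (at x) v * g x)" for x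
      by (rule frechet_derivative_at[OF der, symmetric])
    have "Ck_on k UNIV f" "Ck_on k UNIV g" using Suc.prems[THEN Ck_on_SucD] .
    moreover have "(\<lambda>x. f x * g x) differentiable at x" for x
      using der by (auto simp: differentiable_def)
    moreover have "Ck_on k UNIV (\<lambda>x. f x * frechet_derivative g (at x) v + frechet_derivative f (at x) v * g x)" for v
      by (intro add Suc.IH \<open>Ck_on k UNIV f\<close> \<open>Ck_on k UNIV g\<close>) (use Suc.prems in auto)
    ultimately show ?case by (simp add: fd)
  qed
qed

lemma Ck_on_const: "Ck_on k UNIV (\<lambda>x. c)"
proof (induction k arbitrary: c)
  case (Suc k)
  have "frechet_derivative (\<lambda>x. c) (at x) = (\<lambda>v. 0)" for x :: 'a
    using frechet_derivative_at[OF has_derivative_const[of c "at x"]] by simp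
  with Suc show ?case by (simp del: Ck_on.simps(1))
qed simp

lemma Ck_on_prod:
  assumes "\<And>i. i \<in> I \<Longrightarrow> Ck_on k UNIV (f i)"
  shows "Ck_on k UNIV (\<lambda>x. \<Prod>i\<in>I. f i x)"
  using assms
proof (induction I rule: infinite_finite_induct)
  case (insert i I)
  then show ?case using Ck_on_mult[of k "f i" "\<lambda>x. \<Prod>i\<in>I. f i x"] by simp
qed (auto simp: Ck_on_const)

section \<open>Partial derivatives along the axes and their symmetry\<close>

text \<open>\<open>partial\<close> is defined through \<open>deriv\<close>, whose value is
  unspecified where no derivative exists; the relation records existence at every point together
  with the value.\<close>

definition has_pd :: "'n::finite \<Rightarrow> (real ^ 'n \<Rightarrow> real) \<Rightarrow> (real ^ 'n \<Rightarrow> real) \<Rightarrow> bool" where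
  "has_pd i u u' \<longleftrightarrow> (\<forall>x. ((\<lambda>r. u (x + r *\<^sub>R axis i 1)) has_real_derivative u' x) (at 0))"

lemma has_pd_imp_partial: "has_pd i u u' \<Longrightarrow> partial i u = u'"
  by (auto simp: has_pd_def partial_def fun_eq_iff intro!: DERIV_imp_deriv)

lemma has_pd_at:
  assumes "has_pd i u u'"
  shows "((\<lambda>r. u (x + r *\<^sub>R axis i 1)) has_real_derivative u' (x + r *\<^sub>R axis i 1)) (at r)"
proof -
  have "((\<lambda>h. u ((x + r *\<^sub>R axis i 1) + h *\<^sub>R axis i 1)) has_real_derivative u' (x + r *\<^sub>R axis i 1)) (at 0)"
    using assms by (simp add: has_pd_def)
  then have "((\<lambda>h. u (x + (h + r) *\<^sub>R axis i 1)) has_real_derivative u' (x + r *\<^sub>R axis i 1)) (at 0)"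
    by (simp add: algebra_simps)
  then show ?thesis
    using DERIV_shift[of "\<lambda>r. u (x + r *\<^sub>R axis i 1)" _ 0 r] by simp
qed

lemma has_pd_mult:
  "has_pd i u u' \<Longrightarrow> has_pd i v v' \<Longrightarrow> has_pd i (\<lambda>x. u x * v x) (\<lambda>x. u' x * v x + u x * v' x)"
  unfolding has_pd_def by (auto intro!: derivative_eq_intros)

lemma has_pd_scale:
  assumes "has_pd i u u'"
  shows "has_pd i (\<lambda>x. c * u (a *\<^sub>R x)) (\<lambda>x. c * a * u' (a *\<^sub>R x))"
  unfolding has_pd_def
proof
  fix x
  have "((\<lambda>r. u (a *\<^sub>R x + r *\<^sub>R axis i 1)) has_real_derivative u' (a *\<^sub>R x)) (at (a * 0))"
    using assms by (simp add: has_pd_def)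
  then have "((\<lambda>r. u (a *\<^sub>R x + (a * r) *\<^sub>R axis i 1)) has_real_derivative u' (a *\<^sub>R x) * a) (at 0)"
    by (rule DERIV_chain2) (auto intro!: derivative_eq_intros)
  then have "((\<lambda>r. c * u (a *\<^sub>R x + (a * r) *\<^sub>R axis i 1)) has_real_derivative c * (u' (a *\<^sub>R x) * a)) (at 0)"
    by (rule DERIV_cmult)
  then show "((\<lambda>r. c * u (a *\<^sub>R (x + r *\<^sub>R axis i 1))) has_real_derivative c * a * u' (a *\<^sub>R x)) (at 0)"
    by (simp add: algebra_simps)
qed

text \<open>Coordinates are recovered from the Frechet derivative by expanding the direction in the
  standard basis. The third conclusion, the total derivative, serves Taylor's formula along lines of
  arbitrary direction.\<close>

lemma Ck_on_Suc_partial: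
  assumes "Ck_on (Suc k) UNIV h"
  shows "has_pd i h (partial i h)" "Ck_on k UNIV (partial i h)"
    "(h has_derivative (\<lambda>v. \<Sum>i\<in>UNIV. v $ i * partial i h x)) (at x)"
proof -
  have D: "(h has_derivative frechet_derivative h (at x)) (at x)" for x
    using assms by (simp flip: frechet_derivative_works)
  have pd: "has_pd i h (\<lambda>x. frechet_derivative h (at x) (axis i 1))" for i
    unfolding has_pd_def
  proof
    fix x
    have "((\<lambda>r. x + r *\<^sub>R axis i 1) has_derivative (\<lambda>r. r *\<^sub>R axis i (1::real))) (at 0)"
      by (auto intro!: derivative_eq_intros)
    from has_derivative_compose[OF this, of h] D[of x]
    have "((\<lambda>r. h (x + r *\<^sub>R axis i 1)) has_derivative (\<lambda>r. frechet_derivative h (at x) (r *\<^sub>R axis i 1))) (at 0)"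
      by simp
    moreover have "linear (frechet_derivative h (at x))"
      using D has_derivative_linear by blast
    ultimately show "((\<lambda>r. h (x + r *\<^sub>R axis i 1)) has_real_derivative frechet_derivative h (at x) (axis i 1)) (at 0)"
      unfolding has_field_derivative_def
      by (elim back_subst[where P = "\<lambda>D. (_ has_derivative D) _"]) (auto simp: fun_eq_iff linear_cmul)
  qed
  have p: "partial i h = (\<lambda>x. frechet_derivative h (at x) (axis i 1))" for i
    by (rule has_pd_imp_partial[OF pd])
  show "has_pd i h (partial i h)" using pd by (simp add: p)
  show "Ck_on k UNIV (partial i h)" using assms by (simp add: p)
  have "frechet_derivative h (at x) v = (\<Sum>i\<in>UNIV. v $ i * partial i h x)" for v
  proof -
    have lin: "linear (frechet_derivative h (at x))"
      using D has_derivative_linear by blast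
    have "frechet_derivative h (at x) v = frechet_derivative h (at x) (\<Sum>i\<in>UNIV. v $ i *\<^sub>R axis i 1)"
      by (simp add: basis_expansion flip: scalar_mult_eq_scaleR)
    also have "\<dots> = (\<Sum>i\<in>UNIV. v $ i * partial i h x)"
      by (simp add: linear_sum[OF lin] linear_cmul[OF lin] p)
    finally show ?thesis .
  qed
  then have "frechet_derivative h (at x) = (\<lambda>v. \<Sum>i\<in>UNIV. v $ i * partial i h x)" by auto
  with D[of x] show "(h has_derivative (\<lambda>v. \<Sum>i\<in>UNIV. v $ i * partial i h x)) (at x)" by simp
qed

text \<open>Two applications of the mean value theorem: in direction i to the increment of h over r
  e_j, and in direction j to \<open>hi\<close>. The double difference on the left is symmetric in i
  and j, which makes it a route to Schwarz's theorem.\<close>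

lemma second_difference:
  assumes i: "has_pd i h hi" and ji: "has_pd j hi hji" and r: "0 < r"
  shows "\<exists>\<rho> \<sigma>. 0 < \<rho> \<and> \<rho> < r \<and> 0 < \<sigma> \<and> \<sigma> < r \<and>
    h (x + r *\<^sub>R axis i 1 + r *\<^sub>R axis j 1) - h (x + r *\<^sub>R axis i 1) - h (x + r *\<^sub>R axis j 1) + h x
      = r * r * hji (x + \<rho> *\<^sub>R axis i 1 + \<sigma> *\<^sub>R axis j 1)"
proof -
  define p where "p s = h (x + r *\<^sub>R axis j 1 + s *\<^sub>R axis i 1) - h (x + s *\<^sub>R axis i 1)" for s
  have "\<exists>z>0. z < r \<and> p r - p 0 = (r - 0) * (hi (x + r *\<^sub>R axis j 1 + z *\<^sub>R axis i 1) - hi (x + z *\<^sub>R axis i 1))"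
    by (rule MVT2) (use r in \<open>auto simp: p_def intro!: derivative_intros has_pd_at[OF i]\<close>)
  then obtain \<rho> where \<rho>: "0 < \<rho>" "\<rho> < r"
    "p r - p 0 = r * (hi (x + r *\<^sub>R axis j 1 + \<rho> *\<^sub>R axis i 1) - hi (x + \<rho> *\<^sub>R axis i 1))"
    by auto
  have "\<exists>z>0. z < r \<and> hi (x + \<rho> *\<^sub>R axis i 1 + r *\<^sub>R axis j 1) - hi (x + \<rho> *\<^sub>R axis i 1 + 0 *\<^sub>R axis j 1)
      = (r - 0) * hji (x + \<rho> *\<^sub>R axis i 1 + z *\<^sub>R axis j 1)"
    by (rule MVT2) (use r in \<open>auto intro!: has_pd_at[OF ji]\<close>)
  then obtain \<sigma> where \<sigma>: "0 < \<sigma>" "\<sigma> < r"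
    "hi (x + \<rho> *\<^sub>R axis i 1 + r *\<^sub>R axis j 1) - hi (x + \<rho> *\<^sub>R axis i 1) = r * hji (x + \<rho> *\<^sub>R axis i 1 + \<sigma> *\<^sub>R axis j 1)"
    by auto
  show ?thesis
    using \<rho> \<sigma> by (intro exI[of _ \<rho>] exI[of _ \<sigma>]) (simp add: p_def algebra_simps)
qed

lemma second_partial_limit:
  assumes i: "has_pd i h hi" and ji: "has_pd j hi hji" and c: "continuous_on UNIV hji"
  shows "((\<lambda>r. (h (x + r *\<^sub>R axis i 1 + r *\<^sub>R axis j 1) - h (x + r *\<^sub>R axis i 1) - h (x + r *\<^sub>R axis j 1) + h x) / (r * r))
    \<longlongrightarrow> hji x) (at_right 0)"
proof (rule tendstoI)
  fix e :: real assume "e > 0"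
  obtain \<delta> where \<delta>: "\<delta> > 0" "\<And>y. dist y x < \<delta> \<Longrightarrow> dist (hji y) (hji x) < e"
    using c \<open>e > 0\<close> by (metis UNIV_I continuous_on_iff)
  \<comment> \<open>The intermediate point lies within \<rho> + \<sigma> < 2r of x, hence the
    restriction to r < \<delta>/2.\<close>
  have "dist ((h (x + r *\<^sub>R axis i 1 + r *\<^sub>R axis j 1) - h (x + r *\<^sub>R axis i 1) - h (x + r *\<^sub>R axis j 1) + h x) / (r * r)) (hji x) < e"
    if r: "0 < r" "r < \<delta> / 2" for r
  proof -
    obtain \<rho> \<sigma> where *: "0 < \<rho>" "\<rho> < r" "0 < \<sigma>" "\<sigma> < r"
      "h (x + r *\<^sub>R axis i 1 + r *\<^sub>R axis j 1) - h (x + r *\<^sub>R axis i 1) - h (x + r *\<^sub>R axis j 1) + h x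
      = r * r * hji (x + \<rho> *\<^sub>R axis i 1 + \<sigma> *\<^sub>R axis j 1)"
      using second_difference[OF i ji r(1)] by blast
    have "dist (x + \<rho> *\<^sub>R axis i 1 + \<sigma> *\<^sub>R axis j 1) x = norm (\<rho> *\<^sub>R axis i (1::real) + \<sigma> *\<^sub>R axis j 1)"
      by (simp add: dist_norm add.assoc)
    also have "\<dots> \<le> \<rho> + \<sigma>"
      by (rule norm_triangle_le) (use * in \<open>simp add: norm_axis_1\<close>)
    also have "\<dots> < \<delta>" using * r by simp
    finally have "dist (hji (x + \<rho> *\<^sub>R axis i 1 + \<sigma> *\<^sub>R axis j 1)) (hji x) < e" by (rule \<delta>(2))
    then show ?thesis using * r by simp
  qed
  then show "\<forall>\<^sub>F r in at_right 0. dist ((h (x + r *\<^sub>R axis i 1 + r *\<^sub>R axis j 1) - h (x + r *\<^sub>R axis i 1) - h (x + r *\<^sub>R axis j 1) + h x) / (r * r)) (hji x) < e"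
    using \<open>\<delta> > 0\<close> by (auto simp: eventually_at_right_field intro!: exI[of _ "\<delta> / 2"])
qed

text \<open>Both mixed derivatives are limits of the same second difference quotient, which does not
  change when i and j are exchanged.\<close>

lemma partial_commute:
  assumes "Ck_on (Suc (Suc k)) UNIV h"
  shows "partial j (partial i h) = partial i (partial j h)"
proof
  fix x
  have C: "Ck_on (Suc k) UNIV (partial i h)" for i
    using assms by (rule Ck_on_Suc_partial)
  have cont: "continuous_on UNIV (partial j (partial i h))" for i j
    by (rule Ck_on_imp_continuous[OF Ck_on_Suc_partial(2)[OF C]])
  have lim: "((\<lambda>r. (h (x + r *\<^sub>R axis i 1 + r *\<^sub>R axis j 1) - h (x + r *\<^sub>R axis i 1) - h (x + r *\<^sub>R axis j 1) + h x) / (r * r))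
    \<longlongrightarrow> partial j (partial i h) x) (at_right 0)" for i j
    by (rule second_partial_limit[OF Ck_on_Suc_partial(1)[OF assms] Ck_on_Suc_partial(1)[OF C] cont])
  have eq: "(\<lambda>r. (h (x + r *\<^sub>R axis j 1 + r *\<^sub>R axis i 1) - h (x + r *\<^sub>R axis j 1) - h (x + r *\<^sub>R axis i 1) + h x) / (r * r))
    = (\<lambda>r. (h (x + r *\<^sub>R axis i 1 + r *\<^sub>R axis j 1) - h (x + r *\<^sub>R axis i 1) - h (x + r *\<^sub>R axis j 1) + h x) / (r * r))"
    by (simp add: algebra_simps)
  show "partial j (partial i h) x = partial i (partial j h) x"
    using lim[of j i] unfolding eq by (rule tendsto_unique[OF trivial_limit_at_right_real lim])
qed

section \<open>Iterated derivatives along lists of directions\<close>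

lemma Ck_on_foldr_partial:
  "Ck_on k UNIV h \<Longrightarrow> length is \<le> k \<Longrightarrow> Ck_on (k - length is) UNIV (foldr partial is h)"
proof (induction "is")
  case (Cons i "is")
  then have "Ck_on (Suc (k - length (i # is))) UNIV (foldr partial is h)"
    by (simp add: Suc_diff_Suc)
  then show ?case using Ck_on_Suc_partial(2) by simp
qed simp

lemma has_pd_foldr_partial:
  assumes "Ck_on k UNIV h" "length is < k"
  shows "has_pd i (foldr partial is h) (foldr partial (i # is) h)"
  using Ck_on_Suc_partial(1)[of "k - Suc (length is)" "foldr partial is h" i]
    Ck_on_foldr_partial[of k h "is"] assms by (simp add: Suc_diff_Suc)

lemma continuous_foldr_partial:
  "Ck_on k UNIV h \<Longrightarrow> length is \<le> k \<Longrightarrow> continuous_on UNIV (foldr partial is h)"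
  by (rule Ck_on_imp_continuous[OF Ck_on_foldr_partial])

text \<open>The derivative in direction i is carried past the entries of \<open>xs\<close> one at a
  time; the strict bound on the total length leaves the two orders of smoothness that each exchange
  consumes.\<close>

lemma foldr_partial_move:
  assumes "Ck_on k UNIV h" "length xs + length ys < k"
  shows "foldr partial (xs @ i # ys) h = foldr partial (i # xs @ ys) h"
  using assms
proof (induction xs)
  case (Cons x xs)
  have "Ck_on (Suc (Suc (k - Suc (Suc (length (xs @ ys)))))) UNIV (foldr partial (xs @ ys) h)"
    using Ck_on_foldr_partial[of k h "xs @ ys"] Cons.prems by (simp add: Suc_diff_Suc)
  then have "partial x (partial i (foldr partial (xs @ ys) h)) = partial i (partial x (foldr partial (xs @ ys) h))"
    by (rule partial_commute)
  moreover have "foldr partial (xs @ i # ys) h = partial i (foldr partial (xs @ ys) h)"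
    using Cons by simp
  ultimately show ?case by (metis append_Cons foldr_Cons comp_apply)
qed simp

text \<open>Consequently the order of differentiation chosen in \<open>mpartial\<close> has no
  influence. The head of \<open>xs\<close> is located in \<open>ys\<close> and moved to the
  front.\<close>

lemma foldr_partial_perm:
  assumes "mset xs = mset ys" "Ck_on k UNIV h" "length xs \<le> k"
  shows "foldr partial xs h = foldr partial ys h"
  using assms
proof (induction xs arbitrary: ys)
  case (Cons x xs)
  from Cons.prems(1) have "x \<in> set ys" by (metis list.set_intros(1) set_mset_mset)
  then obtain us vs where ys: "ys = us @ x # vs" by (meson split_list)
  with Cons.prems(1) have m: "mset xs = mset (us @ vs)" by simp
  have len: "length xs = length us + length vs" using mset_eq_length[OF m] by simp
  have "foldr partial (x # xs) h = foldr partial (x # us @ vs) h"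
    using Cons.IH[OF m] Cons.prems by simp
  also have "\<dots> = foldr partial ys h"
    using foldr_partial_move[of k h us vs x] Cons.prems len by (simp add: ys)
  finally show ?case .
qed simp

text \<open>Guarantees a witness for the choice in \<open>mpartial\<close>: \<alpha> i copies of
  each i, concatenated.\<close>

lemma ex_count_list: "\<exists>is. \<forall>i::'n::finite. count_list is i = \<alpha> i"
proof -
  obtain xs where xs: "set xs = (UNIV :: 'n set)" "distinct xs"
    using finite_distinct_list[of "UNIV :: 'n set"] by auto
  have rep: "count_list (replicate n j) i = (if i = j then n else 0)" for n and i j :: 'n
    by (induction n) auto
  have "count_list (concat (map (\<lambda>i. replicate (\<alpha> i) i) ys)) i = (if i \<in> set ys then \<alpha> i else 0)"
    if "distinct ys" for ys and i :: 'n
    using that by (induction ys) (auto simp: rep)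
  with xs show ?thesis by (metis UNIV_I)
qed

text \<open>The same choice term as in \<open>mpartial\<close>, so that the two agree by
  unfolding.\<close>

definition mi_list :: "('n::finite \<Rightarrow> nat) \<Rightarrow> 'n list" where
  "mi_list \<alpha> = (SOME is. \<forall>i. count_list is i = \<alpha> i)"

lemma count_mi_list [simp]: "count_list (mi_list \<alpha>) i = \<alpha> i"
  using someI_ex[OF ex_count_list[of \<alpha>]] unfolding mi_list_def by blast

lemma mpartial_eq: "mpartial \<alpha> h = foldr partial (mi_list \<alpha>) h"
  by (simp add: mpartial_def mi_list_def)

lemma length_eq_mi_len: "length is = mi_len (count_list is)"
  unfolding mi_len_def by (rule sum_count_set[symmetric]) auto

lemma length_mi_list [simp]: "length (mi_list \<alpha>) = mi_len \<alpha>"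
  by (simp add: length_eq_mi_len mi_len_def)

text \<open>Derivatives are handled as lists throughout, since a list peels off one derivative at a
  time; this is the bridge back to multi-indices.\<close>

lemma foldr_partial_eq_mpartial:
  assumes "Ck_on k UNIV h" "length is \<le> k"
  shows "foldr partial is h = mpartial (count_list is) h"
  unfolding mpartial_eq
proof (rule foldr_partial_perm[OF _ assms])
  show "mset is = mset (mi_list (count_list is))"
    by (rule multiset_eqI) (simp add: count_mset)
qed

lemma foldr_partial_scale:
  assumes "Ck_on k UNIV u" "length is \<le> k"
  shows "foldr partial is (\<lambda>x. c * u (a *\<^sub>R x)) = (\<lambda>x. c * a ^ length is * foldr partial is u (a *\<^sub>R x))"
  using assms(2)
proof (induction "is")
  case (Cons i "is")
  have "has_pd i (\<lambda>x. (c * a ^ length is) * foldr partial is u (a *\<^sub>R x))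
     (\<lambda>x. (c * a ^ length is) * a * foldr partial (i # is) u (a *\<^sub>R x))"
    by (rule has_pd_scale[OF has_pd_foldr_partial[OF assms(1)]]) (use Cons.prems in simp)
  then have "partial i (\<lambda>x. (c * a ^ length is) * foldr partial is u (a *\<^sub>R x))
     = (\<lambda>x. (c * a ^ length is) * a * foldr partial (i # is) u (a *\<^sub>R x))"
    by (rule has_pd_imp_partial)
  moreover have "foldr partial is (\<lambda>x. c * u (a *\<^sub>R x)) = (\<lambda>x. c * a ^ length is * foldr partial is u (a *\<^sub>R x))"
    using Cons by simp
  moreover have "c * a ^ length (i # is) = (c * a ^ length is) * a" by simp
  ultimately show ?case unfolding foldr_Cons comp_apply by (simp only:)
qed simp

lemma finite_mi_len: "finite {\<alpha>::'n::finite \<Rightarrow> nat. mi_len \<alpha> \<le> k}"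
proof (rule finite_subset)
  show "{\<alpha>::'n \<Rightarrow> nat. mi_len \<alpha> \<le> k} \<subseteq> count_list ` {is. set is \<subseteq> UNIV \<and> length is \<le> k}"
  proof
    fix \<alpha> :: "'n \<Rightarrow> nat" assume "\<alpha> \<in> {\<alpha>. mi_len \<alpha> \<le> k}"
    then show "\<alpha> \<in> count_list ` {is. set is \<subseteq> UNIV \<and> length is \<le> k}"
      by (intro image_eqI[of _ _ "mi_list \<alpha>"]) (simp_all add: fun_eq_iff)
  qed
  show "finite (count_list ` {is::'n list. set is \<subseteq> UNIV \<and> length is \<le> k})"
    by (intro finite_imageI finite_lists_length_le finite)
qed

section \<open>Minkowski's integral inequality and convolutions\<close>

lemma nn_integral_euclidean_affine:
  fixes f :: "'a::euclidean_space \<Rightarrow> ennreal"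
  assumes [measurable]: "f \<in> borel_measurable borel" and c: "c \<noteq> 0"
  shows "(\<integral>\<^sup>+x. f x \<partial>lborel) = \<bar>c\<bar> ^ DIM('a) * (\<integral>\<^sup>+x. f (t + c *\<^sub>R x) \<partial>lborel)"
  by (subst lborel_affine[OF c, of t])
     (simp add: nn_integral_density nn_integral_distr nn_integral_cmult ennreal_power)

lemma nn_integral_translate:
  fixes f :: "'a::euclidean_space \<Rightarrow> ennreal"
  assumes "f \<in> borel_measurable borel"
  shows "(\<integral>\<^sup>+x. f (x - t) \<partial>lborel) = (\<integral>\<^sup>+x. f x \<partial>lborel)"
  using nn_integral_euclidean_affine[OF assms, of 1 "-t"] by simp

lemma nn_integral_reflect:
  fixes f :: "'a::euclidean_space \<Rightarrow> ennreal"
  assumes "f \<in> borel_measurable borel"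
  shows "(\<integral>\<^sup>+x. f (t - x) \<partial>lborel) = (\<integral>\<^sup>+x. f x \<partial>lborel)"
  using nn_integral_euclidean_affine[OF assms, of "-1" t] by simp

lemma integral_euclidean_affine:
  fixes f :: "'a::euclidean_space \<Rightarrow> real"
  assumes [measurable]: "f \<in> borel_measurable borel" and c: "c \<noteq> 0"
  shows "(\<integral>x. f x \<partial>lborel) = \<bar>c\<bar> ^ DIM('a) * (\<integral>x. f (t + c *\<^sub>R x) \<partial>lborel)"
  by (subst lborel_affine[OF c, of t]) (simp add: integral_density integral_distr)

lemma integral_reflect:
  fixes f :: "'a::euclidean_space \<Rightarrow> real"
  assumes "f \<in> borel_measurable borel"
  shows "(\<integral>x. f (t - x) \<partial>lborel) = (\<integral>x. f x \<partial>lborel)"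
  using integral_euclidean_affine[OF assms, of "-1" t] by simp

lemma integral_translate:
  fixes f :: "'a::euclidean_space \<Rightarrow> real"
  assumes "f \<in> borel_measurable borel"
  shows "(\<integral>x. f (x - t) \<partial>lborel) = (\<integral>x. f x \<partial>lborel)"
  using integral_euclidean_affine[OF assms, of 1 "-t"] by simp

lemma integrable_translate:
  fixes f :: "'a::euclidean_space \<Rightarrow> real"
  assumes "integrable lborel f"
  shows "integrable lborel (\<lambda>x. f (x - t))"
proof -
  have [measurable]: "f \<in> borel_measurable borel" using assms by auto
  show ?thesis
    using assms nn_integral_translate[of "\<lambda>x. ennreal (norm (f x))" t]
    by (simp add: integrable_iff_bounded)
qed

lemma AE_lborel_translate:
  fixes t :: "'a::euclidean_space"
  assumes [measurable]: "Measurable.pred borel P" and "AE x in lborel. P x"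
  shows "AE x in lborel. P (x - t)"
proof -
  have "AE x in distr lborel borel ((+) (-t)). P x"
    using assms(2) by (simp only: lborel_distr_plus)
  then show ?thesis by (simp add: AE_distr_iff)
qed

lemma integral_abs_le_nn_integral:
  fixes f :: "'a \<Rightarrow> real"
  shows "ennreal \<bar>integral\<^sup>L M f\<bar> \<le> (\<integral>\<^sup>+x. ennreal \<bar>f x\<bar> \<partial>M)"
  using integral_norm_bound_ennreal[of M f] by (cases "integrable M f") (auto simp: not_integrable_integral_eq)

section \<open>Minkowski's inequality for bounds in L^q\<close>

text \<open>A real bound for the L^q norm of a Borel function. Comparing the integral of |h|^q with
  c^q avoids roots of possibly infinite integrals; nonnegativity of c is included for the sake of
  the monotonicity of c^q in c.\<close>

definition Lq_le :: "ennreal \<Rightarrow> ('a::euclidean_space \<Rightarrow> real) \<Rightarrow> real \<Rightarrow> bool" where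
  "Lq_le q h c \<longleftrightarrow> h \<in> borel_measurable borel \<and> 0 \<le> c \<and>
     (if q = \<infinity> then AE x in lborel. \<bar>h x\<bar> \<le> c
      else (\<integral>\<^sup>+ x. ennreal (\<bar>h x\<bar> powr enn2real q) \<partial>lborel) \<le> ennreal (c powr enn2real q))"

text \<open>Young's inequality for the product of t and 1 with the conjugate exponents p and
  p/(p-1).\<close>

lemma Bernoulli_powr:
  fixes t p :: real
  assumes "1 \<le> p" "0 \<le> t"
  shows "t \<le> t powr p / p + (1 - 1 / p)"
proof (cases "p = 1")
  case False
  then have "t * 1 \<le> t powr p / p + 1 powr (p / (p - 1)) / (p / (p - 1))"
    using assms by (intro Youngs_inequality) (auto simp: field_simps)
  then show ?thesis using assms False by (simp add: field_simps)
qed (use assms in auto)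

text \<open>The preceding inequality at t = k/(a \<mu>), multiplied by a \<mu>. At a = 0 the
  right-hand side vanishes, whence the side condition on k.\<close>

lemma weighted_Young:
  fixes k a \<mu> p :: real
  assumes "1 \<le> p" "0 \<le> k" "0 \<le> a" "0 < \<mu>" "a = 0 \<longrightarrow> k = 0"
  shows "k \<le> \<mu> powr (1 - p) / p * (a powr (1 - p) * k powr p) + (1 - 1 / p) * \<mu> * a"
proof (cases "a = 0")
  case False
  then have a: "a > 0" using assms by simp
  define t where "t = k / (a * \<mu>)"
  have t: "t \<le> t powr p / p + (1 - 1 / p)"
    using assms a by (intro Bernoulli_powr) (auto simp: t_def)
  have "k = a * \<mu> * t" using a assms by (simp add: t_def)
  also have "\<dots> \<le> a * \<mu> * (t powr p / p + (1 - 1 / p))"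
    using t a assms by (intro mult_left_mono) auto
  also have "\<dots> = \<mu> powr (1 - p) / p * (a powr (1 - p) * k powr p) + (1 - 1 / p) * \<mu> * a"
    using a assms by (simp add: t_def powr_divide powr_mult powr_diff algebra_simps)
  finally show ?thesis .
qed (use assms in auto)

text \<open>Jensen's inequality for the measure with density \<open>a\<close>, applied to \<open>k / a\<close>; optimising
  \<open>\<mu>\<close> in the weighted Young inequality gives it.\<close>

lemma Jensen_powr:
  fixes k a :: "'b \<Rightarrow> real"
  assumes [measurable]: "k \<in> borel_measurable M" "a \<in> borel_measurable M"
    and p: "1 \<le> p" and nn: "\<And>s. 0 \<le> k s" "\<And>s. 0 \<le> a s"
    and z: "AE s in M. a s = 0 \<longrightarrow> k s = 0"
    and B: "(\<integral>\<^sup>+ s. ennreal (a s) \<partial>M) \<le> ennreal B" "0 < B"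
    and w: "0 \<le> w" "ennreal w \<le> (\<integral>\<^sup>+ s. ennreal (k s) \<partial>M)"
  shows "ennreal (w powr p) \<le> ennreal (B powr (p - 1)) * (\<integral>\<^sup>+ s. ennreal (a s powr (1 - p) * k s powr p) \<partial>M)"
    (is "_ \<le> _ * ?H")
proof (cases "?H = \<infinity>")
  case True
  then show ?thesis using B by (simp add: ennreal_mult_top)
next
  case False
  then obtain H where H: "?H = ennreal H" "0 \<le> H" by (cases ?H) auto
  have *: "w \<le> \<mu> powr (1 - p) / p * H + (1 - 1 / p) * \<mu> * B" if "0 < \<mu>" for \<mu>
  proof -
    have "ennreal w \<le> (\<integral>\<^sup>+ s. ennreal (k s) \<partial>M)" by fact
    also have "\<dots> \<le> (\<integral>\<^sup>+ s. ennreal (\<mu> powr (1 - p) / p) * ennreal (a s powr (1 - p) * k s powr p) + ennreal ((1 - 1 / p) * \<mu>) * ennreal (a s) \<partial>M)"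
    proof (rule nn_integral_mono_AE, use z in eventually_elim)
      fix s assume "a s = 0 \<longrightarrow> k s = 0"
      then have "k s \<le> \<mu> powr (1 - p) / p * (a s powr (1 - p) * k s powr p) + (1 - 1 / p) * \<mu> * a s"
        using p nn that by (intro weighted_Young) auto
      then show "ennreal (k s) \<le> ennreal (\<mu> powr (1 - p) / p) * ennreal (a s powr (1 - p) * k s powr p) + ennreal ((1 - 1 / p) * \<mu>) * ennreal (a s)"
        using p nn that by (simp add: ennreal_leI flip: ennreal_mult ennreal_plus)
    qed
    also have "\<dots> = ennreal (\<mu> powr (1 - p) / p) * ?H + ennreal ((1 - 1 / p) * \<mu>) * (\<integral>\<^sup>+ s. ennreal (a s) \<partial>M)"
      by (simp add: nn_integral_add nn_integral_cmult)
    also have "\<dots> \<le> ennreal (\<mu> powr (1 - p) / p) * ennreal H + ennreal ((1 - 1 / p) * \<mu>) * ennreal B"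
      using H B by (intro add_mono mult_left_mono) auto
    also have "\<dots> = ennreal (\<mu> powr (1 - p) / p * H + (1 - 1 / p) * \<mu> * B)"
      using H B p that by (simp flip: ennreal_mult ennreal_plus)
    finally show ?thesis
      using H B p that by (subst (asm) ennreal_le_iff) auto
  qed
  show ?thesis
  proof (cases "H = 0")
    case True
    \<comment> \<open>If H = 0 only the term linear in \<mu> remains, and \<mu> = e/B brings it
      below any given e.\<close>
    have "w \<le> e" if "e > 0" for e
    proof -
      have "w \<le> (1 - 1 / p) * (e / B) * B" using *[of "e / B"] B that True by simp
      also have "\<dots> \<le> e" using B that p by (simp add: field_simps)
      finally show ?thesis .
    qed
    then have "w = 0" using w by (meson dense_ge_bounded field_le_epsilon antisym le_add_same_cancel2 add_0 dense not_le)
    then show ?thesis by simp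
  next
    case False
    then have Hp: "H > 0" using H by simp
    \<comment> \<open>The value of \<mu> at which \<mu>^(1-p) H = \<mu> B; the two terms, with
      weights 1/p and 1-1/p, then add up to \<mu> B.\<close>
    define \<mu> where "\<mu> = (H / B) powr (1 / p)"
    have l: "\<mu> > 0" "\<mu> powr p = H / B" using Hp B p by (auto simp: \<mu>_def powr_powr)
    have "\<mu> powr (1 - p) * H = \<mu> * B"
      using l Hp B by (simp add: powr_diff field_simps)
    then have "w \<le> \<mu> * B" using *[OF l(1)] p by (simp add: field_simps)
    then have "w powr p \<le> (\<mu> * B) powr p" using w p by (intro powr_mono2) auto
    also have "\<dots> = H / B * B powr p" using l B by (simp add: powr_mult)
    also have "\<dots> = B powr (p - 1) * H" using B by (simp add: powr_diff)
    finally show ?thesis unfolding H(1) using H by (simp add: ennreal_leI flip: ennreal_mult)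
  qed
qed

text \<open>For finite q, \<open>Jensen_powr\<close> is applied at each x with the weight A, and
  Tonelli integrates over x: the slice bound contributes A^(1-p) A^p = A. For q = \<infinity> the
  null sets of the slices are exchanged by Fubini. Asking for a pointwise majorant of |W| by the
  integral of |k| covers integrals and finite sums alike.\<close>

lemma Lq_le_Minkowski:
  fixes k :: "'a::euclidean_space \<Rightarrow> 'b \<Rightarrow> real"
  assumes "sigma_finite_measure M" and q: "1 \<le> q"
    and k[measurable]: "(\<lambda>(x, s). k x s) \<in> borel_measurable (borel \<Otimes>\<^sub>M M)"
    and A[measurable]: "A \<in> borel_measurable M"
    and Lq: "\<And>s. s \<in> space M \<Longrightarrow> Lq_le q (\<lambda>x. k x s) (A s)"
    and b: "(\<integral>\<^sup>+ s. ennreal (A s) \<partial>M) \<le> ennreal b" "0 \<le> b"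
    and W[measurable]: "W \<in> borel_measurable borel"
    and Wk: "AE x in lborel. ennreal \<bar>W x\<bar> \<le> (\<integral>\<^sup>+ s. ennreal \<bar>k x s\<bar> \<partial>M)"
  shows "Lq_le q W b"
proof -
  interpret M: sigma_finite_measure M by fact
  interpret P: pair_sigma_finite lborel M ..
  note [measurable_cong] = sets_pair_measure_cong[OF sets_lborel refl]
  have k'[measurable]: "(\<lambda>z. k (fst z) (snd z)) \<in> borel_measurable (lborel \<Otimes>\<^sub>M M)"
    using k by (simp add: case_prod_beta' sets_pair_measure_cong[OF sets_lborel refl] cong: measurable_cong_sets)
  have A0: "0 \<le> A s" if "s \<in> space M" for s using Lq[OF that] by (auto simp: Lq_le_def)
  show ?thesis
  proof (cases "q = \<infinity>")
    case True
    have "AE s in M. AE x in lborel. \<bar>k x s\<bar> \<le> A s"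
      using Lq True by - (rule AE_I2, simp add: Lq_le_def)
    then have "AE x in lborel. AE s in M. \<bar>k x s\<bar> \<le> A s"
      by (subst P.AE_commute) measurable
    with Wk have "AE x in lborel. \<bar>W x\<bar> \<le> b"
    proof eventually_elim
      fix x assume 1: "ennreal \<bar>W x\<bar> \<le> (\<integral>\<^sup>+ s. ennreal \<bar>k x s\<bar> \<partial>M)" and 2: "AE s in M. \<bar>k x s\<bar> \<le> A s"
      have "(\<integral>\<^sup>+ s. ennreal \<bar>k x s\<bar> \<partial>M) \<le> (\<integral>\<^sup>+ s. ennreal (A s) \<partial>M)"
        using 2 by (intro nn_integral_mono_AE) (auto elim: eventually_mono intro: ennreal_leI)
      with 1 b have "ennreal \<bar>W x\<bar> \<le> ennreal b" by (meson order_trans)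
      then show "\<bar>W x\<bar> \<le> b" using b by simp
    qed
    then show ?thesis using True b by (simp add: Lq_le_def)
  next
    case False
    define p where "p = enn2real q"
    have p: "1 \<le> p" using q False unfolding p_def
      by (metis enn2real_1 enn2real_mono infinity_ennreal_def less_top)
    have kp: "(\<integral>\<^sup>+ x. ennreal (\<bar>k x s\<bar> powr p) \<partial>lborel) \<le> ennreal (A s powr p)" if "s \<in> space M" for s
      using Lq[OF that] False by (simp add: Lq_le_def p_def)
    \<comment> \<open>A slice with A s = 0 vanishes almost everywhere; after the exchange of null
      sets this is the side condition of \<open>Jensen_powr\<close>.\<close>
    have "AE s in M. AE x in lborel. A s = 0 \<longrightarrow> k x s = 0"
    proof (rule AE_I2)
      fix s assume s: "s \<in> space M"
      have [measurable]: "(\<lambda>x. k x s) \<in> borel_measurable borel" using Lq[OF s] by (simp add: Lq_le_def)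
      show "AE x in lborel. A s = 0 \<longrightarrow> k x s = 0"
      proof (cases "A s = 0")
        case True
        then have "(\<integral>\<^sup>+ x. ennreal (\<bar>k x s\<bar> powr p) \<partial>lborel) = 0" using kp[OF s] by simp
        then have "AE x in lborel. ennreal (\<bar>k x s\<bar> powr p) = 0" by (subst (asm) nn_integral_0_iff_AE) auto
        then show ?thesis using p by (auto elim!: eventually_mono)
      qed simp
    qed
    then have z: "AE x in lborel. AE s in M. A s = 0 \<longrightarrow> k x s = 0"
      by (subst P.AE_commute) measurable
    \<comment> \<open>\<open>Jensen_powr\<close> needs a positive total mass, while b may be 0: the
      estimate is shown for every positive B above b, and B tends to b afterwards.\<close>
    have main: "(\<integral>\<^sup>+ x. ennreal (\<bar>W x\<bar> powr p) \<partial>lborel) \<le> ennreal (B powr p)" if B: "b \<le> B" "0 < B" for B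
    proof -
      have IA: "(\<integral>\<^sup>+ s. ennreal (A s) \<partial>M) \<le> ennreal B"
        using b B by (meson ennreal_leI order_trans)
      have "(\<integral>\<^sup>+ x. ennreal (\<bar>W x\<bar> powr p) \<partial>lborel)
        \<le> (\<integral>\<^sup>+ x. ennreal (B powr (p - 1)) * (\<integral>\<^sup>+ s. ennreal (A s powr (1 - p) * \<bar>k x s\<bar> powr p) \<partial>M) \<partial>lborel)"
      proof (rule nn_integral_mono_AE, use Wk z in eventually_elim)
        fix x assume 1: "ennreal \<bar>W x\<bar> \<le> (\<integral>\<^sup>+ s. ennreal \<bar>k x s\<bar> \<partial>M)" and 2: "AE s in M. A s = 0 \<longrightarrow> k x s = 0"
        have [measurable]: "(\<lambda>s. k x s) \<in> borel_measurable M"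
          using measurable_Pair2[OF k, of x] by simp
        \<comment> \<open>\<open>A\<close> is known to be nonnegative only on the space of M, but
          \<open>Jensen_powr\<close> wants nonnegativity everywhere; passing to the absolute value
          changes no integral.\<close>
        have aA: "(\<integral>\<^sup>+ s. ennreal \<bar>A s\<bar> \<partial>M) = (\<integral>\<^sup>+ s. ennreal (A s) \<partial>M)"
          using A0 by (intro nn_integral_cong) auto
        have "ennreal (\<bar>W x\<bar> powr p) \<le> ennreal (B powr (p - 1)) * (\<integral>\<^sup>+ s. ennreal (\<bar>A s\<bar> powr (1 - p) * \<bar>k x s\<bar> powr p) \<partial>M)"
          using 1 2 IA B p by (intro Jensen_powr) (auto simp: aA)
        also have "(\<integral>\<^sup>+ s. ennreal (\<bar>A s\<bar> powr (1 - p) * \<bar>k x s\<bar> powr p) \<partial>M) = (\<integral>\<^sup>+ s. ennreal (A s powr (1 - p) * \<bar>k x s\<bar> powr p) \<partial>M)"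
          using A0 by (intro nn_integral_cong) auto
        finally show "ennreal (\<bar>W x\<bar> powr p) \<le> ennreal (B powr (p - 1)) * (\<integral>\<^sup>+ s. ennreal (A s powr (1 - p) * \<bar>k x s\<bar> powr p) \<partial>M)" .
      qed
      also have "\<dots> = ennreal (B powr (p - 1)) * (\<integral>\<^sup>+ x. (\<integral>\<^sup>+ s. ennreal (A s powr (1 - p) * \<bar>k x s\<bar> powr p) \<partial>M) \<partial>lborel)"
        by (rule nn_integral_cmult) measurable
      also have "(\<integral>\<^sup>+ x. (\<integral>\<^sup>+ s. ennreal (A s powr (1 - p) * \<bar>k x s\<bar> powr p) \<partial>M) \<partial>lborel)
        = (\<integral>\<^sup>+ s. (\<integral>\<^sup>+ x. ennreal (A s powr (1 - p) * \<bar>k x s\<bar> powr p) \<partial>lborel) \<partial>M)"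
        by (rule P.Fubini'[symmetric]) measurable
      also have "\<dots> \<le> (\<integral>\<^sup>+ s. ennreal (A s) \<partial>M)"
      proof (rule nn_integral_mono)
        fix s assume s: "s \<in> space M"
        have [measurable]: "(\<lambda>x. k x s) \<in> borel_measurable borel" using Lq[OF s] by (simp add: Lq_le_def)
        have "(\<integral>\<^sup>+ x. ennreal (A s powr (1 - p) * \<bar>k x s\<bar> powr p) \<partial>lborel)
          = ennreal (A s powr (1 - p)) * (\<integral>\<^sup>+ x. ennreal (\<bar>k x s\<bar> powr p) \<partial>lborel)"
          by (simp add: ennreal_mult nn_integral_cmult)
        also have "\<dots> \<le> ennreal (A s powr (1 - p)) * ennreal (A s powr p)"
          using kp[OF s] by (rule mult_left_mono) simp
        also have "\<dots> = ennreal (A s)"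
          using A0[OF s] by (cases "A s = 0") (auto simp: powr_add[symmetric] simp flip: ennreal_mult)
        finally show "(\<integral>\<^sup>+ x. ennreal (A s powr (1 - p) * \<bar>k x s\<bar> powr p) \<partial>lborel) \<le> ennreal (A s)" .
      qed
      also have "\<dots> \<le> ennreal B" by fact
      also have "ennreal (B powr (p - 1)) * ennreal B = ennreal (B powr p)"
        using B by (simp add: powr_diff flip: ennreal_mult)
      finally show ?thesis by (simp add: mult_left_mono)
    qed
    have "(\<integral>\<^sup>+ x. ennreal (\<bar>W x\<bar> powr p) \<partial>lborel) \<le> ennreal (b powr p)"
    proof (rule tendsto_lowerbound)
      show "((\<lambda>e. ennreal ((b + e) powr p)) \<longlongrightarrow> ennreal (b powr p)) (at_right 0)"
      proof (intro tendsto_ennrealI)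
        have "((\<lambda>e. (b + e) powr p) \<longlongrightarrow> (b + 0) powr p) (at_right 0)"
        proof (rule tendsto_powr')
          show "((\<lambda>e. b + e) \<longlongrightarrow> b + 0) (at_right 0)" by (intro tendsto_intros)
          show "b + 0 \<noteq> 0 \<or> 0 < p \<and> (\<forall>\<^sub>F e in at_right 0. 0 \<le> b + e)"
            using p b by (auto simp: eventually_at_right_field intro!: exI[of _ 1])
        qed (rule tendsto_const)
        then show "((\<lambda>e. (b + e) powr p) \<longlongrightarrow> b powr p) (at_right 0)" by simp
      qed
      show "\<forall>\<^sub>F e in at_right 0. (\<integral>\<^sup>+ x. ennreal (\<bar>W x\<bar> powr p) \<partial>lborel) \<le> ennreal ((b + e) powr p)"
        using b by (auto simp: eventually_at_right_field intro!: exI[of _ 1] main)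
    qed simp
    then show ?thesis using False b by (simp add: Lq_le_def p_def)
  qed
qed

lemma Lq_le_mono:
  assumes "Lq_le q h c" "c \<le> c'"
  shows "Lq_le q h c'"
proof -
  have "ennreal (c powr enn2real q) \<le> ennreal (c' powr enn2real q)"
    using assms by (intro ennreal_leI powr_mono2) (auto simp: Lq_le_def)
  then show ?thesis
    using assms unfolding Lq_le_def by (auto split: if_splits elim!: eventually_mono intro: order_trans)
qed

lemma Lq_le_1_iff:
  "Lq_le 1 h c \<longleftrightarrow> h \<in> borel_measurable borel \<and> 0 \<le> c \<and> (\<integral>\<^sup>+ x. ennreal \<bar>h x\<bar> \<partial>lborel) \<le> ennreal c"
  by (auto simp: Lq_le_def)

lemma Lq_le_cmult:
  assumes "Lq_le q h c" "1 \<le> q"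
  shows "Lq_le q (\<lambda>x. a * h x) (\<bar>a\<bar> * c)"
proof -
  have [measurable]: "h \<in> borel_measurable borel" and c: "0 \<le> c" using assms by (auto simp: Lq_le_def)
  show ?thesis
  proof (cases "q = \<infinity>")
    case True
    then show ?thesis using assms by (auto simp: Lq_le_def abs_mult elim!: eventually_mono intro!: mult_left_mono)
  next
    case False
    then have "(\<integral>\<^sup>+ x. ennreal (\<bar>h x\<bar> powr enn2real q) \<partial>lborel) \<le> ennreal (c powr enn2real q)"
      using assms by (simp add: Lq_le_def)
    then have "ennreal (\<bar>a\<bar> powr enn2real q) * (\<integral>\<^sup>+ x. ennreal (\<bar>h x\<bar> powr enn2real q) \<partial>lborel) \<le> ennreal (\<bar>a\<bar> powr enn2real q) * ennreal (c powr enn2real q)"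
      by (rule mult_left_mono) simp
    then show ?thesis using False c
      by (simp add: Lq_le_def abs_mult powr_mult ennreal_mult nn_integral_cmult)
  qed
qed

lemma Lq_le_translate:
  assumes "Lq_le q h c"
  shows "Lq_le q (\<lambda>x. h (x - t)) c"
proof -
  have [measurable]: "h \<in> borel_measurable borel" using assms by (auto simp: Lq_le_def)
  show ?thesis
    using assms nn_integral_translate[of "\<lambda>x. ennreal (\<bar>h x\<bar> powr enn2real q)" t]
      AE_lborel_translate[of "\<lambda>x. \<bar>h x\<bar> \<le> c" t]
    by (auto simp: Lq_le_def split: if_splits)
qed

lemma Lq_le_zero: "1 \<le> q \<Longrightarrow> 0 \<le> c \<Longrightarrow> Lq_le q (\<lambda>x. 0) c"
  by (auto simp: Lq_le_def)

text \<open>The triangle inequality, read as Minkowski's integral inequality for the counting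
  measure on I.\<close>

lemma Lq_le_sum:
  fixes h :: "'i \<Rightarrow> 'a::euclidean_space \<Rightarrow> real"
  assumes "finite I" "1 \<le> q" "\<And>i. i \<in> I \<Longrightarrow> Lq_le q (h i) (c i)"
    and W: "W \<in> borel_measurable borel" "AE x in lborel. \<bar>W x\<bar> \<le> (\<Sum>i\<in>I. \<bar>h i x\<bar>)"
  shows "Lq_le q W (\<Sum>i\<in>I. c i)"
proof (rule Lq_le_Minkowski[where M = "count_space I" and k = "\<lambda>x i. h i x" and A = c])
  show "sigma_finite_measure (count_space I)"
    using assms(1) by (intro sigma_finite_measure_count_space_finite)
  show "(\<lambda>(x, i). h i x) \<in> borel_measurable (borel \<Otimes>\<^sub>M count_space I)"
  proof -
    have "(\<lambda>z. h (snd z) (fst z)) \<in> borel_measurable (borel \<Otimes>\<^sub>M count_space I)"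
    proof (rule measurable_compose_countable'[where I = I and g = snd and f = "\<lambda>i z. h i (fst z)"])
      fix i assume "i \<in> I"
      then have [measurable]: "h i \<in> borel_measurable borel" using assms(3) by (auto simp: Lq_le_def)
      show "(\<lambda>z. h i (fst z)) \<in> borel_measurable (borel \<Otimes>\<^sub>M count_space I)" by measurable
    qed (use assms(1) in \<open>auto intro: countable_finite\<close>)
    then show ?thesis by (simp add: case_prod_beta')
  qed
  have c: "i \<in> I \<Longrightarrow> 0 \<le> c i" for i using assms(3)[of i] by (auto simp: Lq_le_def)
  show "(\<integral>\<^sup>+ i. ennreal (c i) \<partial>count_space I) \<le> ennreal (\<Sum>i\<in>I. c i)"
    using assms(1) c by (simp add: nn_integral_count_space_finite sum_ennreal)
  show "0 \<le> (\<Sum>i\<in>I. c i)" using c by (rule sum_nonneg)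
  show "AE x in lborel. ennreal \<bar>W x\<bar> \<le> (\<integral>\<^sup>+ i. ennreal \<bar>h i x\<bar> \<partial>count_space I)"
    using W(2) assms(1) by (auto simp: nn_integral_count_space_finite sum_ennreal elim!: eventually_mono intro: ennreal_leI)
qed (use assms in auto)

section \<open>Convolutions: norms, weights, associativity, derivatives\<close>

text \<open>Taken over \<open>lborel\<close> rather than \<open>lebesgue\<close>, so that Fubini and
  the measurability prover act in Borel product spaces; \<open>semigrp_eq_conv\<close> makes the
  transition.\<close>

definition conv :: "('a::euclidean_space \<Rightarrow> real) \<Rightarrow> ('a \<Rightarrow> real) \<Rightarrow> 'a \<Rightarrow> real" where
  "conv h u x = (\<integral>y. h (x - y) * u y \<partial>lborel)"

lemma borel_measurable_conv [measurable]:
  assumes [measurable]: "h \<in> borel_measurable borel" "u \<in> borel_measurable borel"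
  shows "conv h u \<in> borel_measurable borel"
  unfolding conv_def by measurable

lemma conv_commute:
  assumes [measurable]: "h \<in> borel_measurable borel" "u \<in> borel_measurable borel"
  shows "conv h u = conv u h"
proof
  fix x
  show "conv h u x = conv u h x"
    using integral_reflect[of "\<lambda>y. h (x - y) * u y" x] by (simp add: conv_def mult.commute)
qed

text \<open>Young's inequality with one factor in L^1: the convolution is a superposition of
  translates of h with total weight at most b, so Minkowski applies.\<close>

lemma Lq_le_conv:
  fixes h u :: "'a::euclidean_space \<Rightarrow> real"
  assumes q: "1 \<le> q" and h: "Lq_le q h a" and u: "Lq_le 1 u b"
  shows "Lq_le q (conv h u) (a * b)"
proof -
  have [measurable]: "h \<in> borel_measurable borel" "u \<in> borel_measurable borel"
    and a: "0 \<le> a" and b: "0 \<le> b" "(\<integral>\<^sup>+ x. ennreal \<bar>u x\<bar> \<partial>lborel) \<le> ennreal b"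
    using h u by (auto simp: Lq_le_1_iff) (auto simp: Lq_le_def)
  show ?thesis
  proof (rule Lq_le_Minkowski[where M = lborel and k = "\<lambda>x y. h (x - y) * u y" and A = "\<lambda>y. \<bar>u y\<bar> * a"])
    show "Lq_le q (\<lambda>x. h (x - y) * u y) (\<bar>u y\<bar> * a)" for y
      using Lq_le_cmult[OF Lq_le_translate[OF h] q, of "u y" y] by (simp add: mult.commute)
    have "(\<integral>\<^sup>+ y. ennreal (\<bar>u y\<bar> * a) \<partial>lborel) = (\<integral>\<^sup>+ y. ennreal \<bar>u y\<bar> \<partial>lborel) * ennreal a"
      using a by (simp add: ennreal_mult nn_integral_multc)
    also have "\<dots> \<le> ennreal b * ennreal a" using b by (intro mult_right_mono) auto
    finally show "(\<integral>\<^sup>+ y. ennreal (\<bar>u y\<bar> * a) \<partial>lborel) \<le> ennreal (a * b)"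
      using a b by (simp add: mult.commute flip: ennreal_mult)
    show "AE x in lborel. ennreal \<bar>conv h u x\<bar> \<le> (\<integral>\<^sup>+ y. ennreal \<bar>h (x - y) * u y\<bar> \<partial>lborel)"
      unfolding conv_def by (intro AE_I2 integral_abs_le_nn_integral)
  qed (use q a b in \<open>auto intro: lborel.sigma_finite_measure_axioms\<close>)
qed

lemma integrable_iff_Lq_le: "integrable lborel h \<longleftrightarrow> (\<exists>c. Lq_le 1 h c)"
proof
  assume "integrable lborel h"
  then show "\<exists>c. Lq_le 1 h c"
    by (intro exI[of _ "enn2real (\<integral>\<^sup>+ x. ennreal \<bar>h x\<bar> \<partial>lborel)"]) (auto simp: Lq_le_1_iff integrable_iff_bounded ennreal_enn2real)
next
  assume "\<exists>c. Lq_le 1 h c"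
  then obtain c where "Lq_le 1 h c" by blast
  then show "integrable lborel h"
    by (auto simp: Lq_le_1_iff integrable_iff_bounded intro: le_less_trans)
qed

lemma integrable_conv: "integrable lborel h \<Longrightarrow> integrable lborel u \<Longrightarrow> integrable lborel (conv h u)"
  using Lq_le_conv[of 1 h _ u] unfolding integrable_iff_Lq_le by auto

text \<open>With m the larger of the two norms, |x+y| <= 2m, and m^l is one of the two terms on the
  right.\<close>

lemma norm_powr_add_le:
  fixes x y :: "'a::real_normed_vector"
  assumes "0 \<le> l"
  shows "norm (x + y) powr l \<le> 2 powr l * (norm x powr l + norm y powr l)"
proof (cases "x + y = 0")
  case False
  define m where "m = max (norm x) (norm y)"
  have m: "0 \<le> m" "norm (x + y) \<le> 2 * m" using norm_triangle_ineq[of x y] by (auto simp: m_def le_max_iff_disj)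
  have "norm (x + y) powr l \<le> (2 * m) powr l" using m assms by (intro powr_mono2) auto
  also have "\<dots> = 2 powr l * m powr l" using m by (simp add: powr_mult)
  also have "m powr l \<le> norm x powr l + norm y powr l" by (auto simp: m_def max_def)
  finally show ?thesis by simp
qed simp

text \<open>Writing x = (x-y) + y distributes the weight |x|^l over the two factors by
  \<open>norm_powr_add_le\<close>; Tonelli does the rest.\<close>

lemma weighted_conv:
  fixes h u :: "'a::euclidean_space \<Rightarrow> real"
  assumes [measurable]: "h \<in> borel_measurable borel" "u \<in> borel_measurable borel" and l: "0 \<le> l"
  shows "(\<integral>\<^sup>+ x. ennreal (\<bar>conv h u x\<bar> * norm x powr l) \<partial>lborel)
    \<le> ennreal (2 powr l) * ((\<integral>\<^sup>+ x. ennreal (\<bar>h x\<bar> * norm x powr l) \<partial>lborel) * (\<integral>\<^sup>+ x. ennreal \<bar>u x\<bar> \<partial>lborel)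
        + (\<integral>\<^sup>+ x. ennreal \<bar>h x\<bar> \<partial>lborel) * (\<integral>\<^sup>+ x. ennreal (\<bar>u x\<bar> * norm x powr l) \<partial>lborel))"
proof -
  have "(\<integral>\<^sup>+ x. ennreal (\<bar>conv h u x\<bar> * norm x powr l) \<partial>lborel)
    \<le> (\<integral>\<^sup>+ x. (\<integral>\<^sup>+ y. ennreal (\<bar>h (x - y) * u y\<bar> * norm x powr l) \<partial>lborel) \<partial>lborel)"
  proof (rule nn_integral_mono)
    fix x
    have "ennreal (\<bar>conv h u x\<bar> * norm x powr l) \<le> (\<integral>\<^sup>+ y. ennreal \<bar>h (x - y) * u y\<bar> \<partial>lborel) * ennreal (norm x powr l)"
      unfolding conv_def by (simp add: ennreal_mult integral_abs_le_nn_integral mult_right_mono)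
    then show "ennreal (\<bar>conv h u x\<bar> * norm x powr l) \<le> (\<integral>\<^sup>+ y. ennreal (\<bar>h (x - y) * u y\<bar> * norm x powr l) \<partial>lborel)"
      by (simp add: ennreal_mult nn_integral_multc)
  qed
  also have "\<dots> = (\<integral>\<^sup>+ y. (\<integral>\<^sup>+ x. ennreal (\<bar>h (x - y) * u y\<bar> * norm x powr l) \<partial>lborel) \<partial>lborel)"
    by (rule lborel_pair.Fubini') measurable
  also have "\<dots> \<le> (\<integral>\<^sup>+ y. ennreal (2 powr l) * ((\<integral>\<^sup>+ x. ennreal (\<bar>h x\<bar> * norm x powr l) \<partial>lborel) * ennreal \<bar>u y\<bar>
        + (\<integral>\<^sup>+ x. ennreal \<bar>h x\<bar> \<partial>lborel) * ennreal (\<bar>u y\<bar> * norm y powr l)) \<partial>lborel)"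
  proof (rule nn_integral_mono)
    fix y
    have "(\<integral>\<^sup>+ x. ennreal (\<bar>h (x - y) * u y\<bar> * norm x powr l) \<partial>lborel)
      = (\<integral>\<^sup>+ x. ennreal (\<bar>h x * u y\<bar> * norm (x + y) powr l) \<partial>lborel)"
      using nn_integral_translate[of "\<lambda>x. ennreal (\<bar>h x * u y\<bar> * norm (x + y) powr l)" y] by simp
    also have "\<dots> \<le> (\<integral>\<^sup>+ x. ennreal (2 powr l) * (ennreal (\<bar>h x\<bar> * norm x powr l) * ennreal \<bar>u y\<bar> + ennreal \<bar>h x\<bar> * ennreal (\<bar>u y\<bar> * norm y powr l)) \<partial>lborel)"
    proof (rule nn_integral_mono)
      fix x
      have "\<bar>h x * u y\<bar> * norm (x + y) powr l \<le> \<bar>h x * u y\<bar> * (2 powr l * (norm x powr l + norm y powr l))"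
        by (intro mult_left_mono norm_powr_add_le l) auto
      also have "\<dots> = 2 powr l * ((\<bar>h x\<bar> * norm x powr l) * \<bar>u y\<bar> + \<bar>h x\<bar> * (\<bar>u y\<bar> * norm y powr l))"
        by (simp add: abs_mult algebra_simps)
      finally show "ennreal (\<bar>h x * u y\<bar> * norm (x + y) powr l) \<le> ennreal (2 powr l) * (ennreal (\<bar>h x\<bar> * norm x powr l) * ennreal \<bar>u y\<bar> + ennreal \<bar>h x\<bar> * ennreal (\<bar>u y\<bar> * norm y powr l))"
        by (simp add: ennreal_leI flip: ennreal_mult ennreal_plus)
    qed
    also have "\<dots> = ennreal (2 powr l) * ((\<integral>\<^sup>+ x. ennreal (\<bar>h x\<bar> * norm x powr l) \<partial>lborel) * ennreal \<bar>u y\<bar>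
        + (\<integral>\<^sup>+ x. ennreal \<bar>h x\<bar> \<partial>lborel) * ennreal (\<bar>u y\<bar> * norm y powr l))"
      by (simp add: nn_integral_cmult nn_integral_multc nn_integral_add)
    finally show "(\<integral>\<^sup>+ x. ennreal (\<bar>h (x - y) * u y\<bar> * norm x powr l) \<partial>lborel)
      \<le> ennreal (2 powr l) * ((\<integral>\<^sup>+ x. ennreal (\<bar>h x\<bar> * norm x powr l) \<partial>lborel) * ennreal \<bar>u y\<bar>
        + (\<integral>\<^sup>+ x. ennreal \<bar>h x\<bar> \<partial>lborel) * ennreal (\<bar>u y\<bar> * norm y powr l))" .
  qed
  also have "\<dots> = ennreal (2 powr l) * ((\<integral>\<^sup>+ x. ennreal (\<bar>h x\<bar> * norm x powr l) \<partial>lborel) * (\<integral>\<^sup>+ x. ennreal \<bar>u x\<bar> \<partial>lborel)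
        + (\<integral>\<^sup>+ x. ennreal \<bar>h x\<bar> \<partial>lborel) * (\<integral>\<^sup>+ x. ennreal (\<bar>u x\<bar> * norm x powr l) \<partial>lborel))"
    by (simp add: nn_integral_cmult nn_integral_add)
  finally show ?thesis .
qed

lemma conv_integrand_integrable:
  fixes h u :: "'a::euclidean_space \<Rightarrow> real"
  assumes [measurable]: "h \<in> borel_measurable borel" and B: "\<And>x. \<bar>h x\<bar> \<le> B" and u: "integrable lborel u"
  shows "integrable lborel (\<lambda>y. h (x - y) * u y)"
proof (rule Bochner_Integration.integrable_bound[where f = "\<lambda>y. B * u y"])
  have [measurable]: "u \<in> borel_measurable borel" using u by auto
  show "(\<lambda>y. h (x - y) * u y) \<in> borel_measurable lborel" by measurable
  show "integrable lborel (\<lambda>y. B * u y)" using u by simp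
  show "AE y in lborel. norm (h (x - y) * u y) \<le> norm (B * u y)"
    using B by (intro AE_I2) (auto simp: abs_mult intro!: mult_right_mono order_trans[OF B])
qed

text \<open>Fubini for h(x-z) u(z-y) v(y), whose absolute integrability in (y,z) follows from the
  bound B on h.\<close>

lemma conv_assoc:
  fixes h u v :: "'a::euclidean_space \<Rightarrow> real"
  assumes [measurable]: "h \<in> borel_measurable borel" and B: "\<And>x. \<bar>h x\<bar> \<le> B"
    and u: "integrable lborel u" and v: "integrable lborel v"
  shows "conv (conv h u) v x = conv h (conv u v) x"
proof -
  have [measurable]: "u \<in> borel_measurable borel" "v \<in> borel_measurable borel" using u v by auto
  have sub: "conv h u (x - y) = (\<integral>z. h (x - z) * u (z - y) \<partial>lborel)" for y
    using integral_translate[of "\<lambda>z. h (x - y - z) * u z" y] by (simp add: conv_def algebra_simps)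
  have int: "integrable (lborel \<Otimes>\<^sub>M lborel) (\<lambda>(y, z). h (x - z) * u (z - y) * v y)"
  proof (rule lborel_pair.Fubini_integrable)
    have 1: "integrable lborel (\<lambda>z. h (x - z) * u (z - y))" for y
      using conv_integrand_integrable[OF assms(1,2) integrable_translate[OF u, of y]] .
    then show "AE y in lborel. integrable lborel (\<lambda>z. case (y, z) of (y, z) \<Rightarrow> h (x - z) * u (z - y) * v y)"
      by (intro AE_I2) (simp add: integrable_mult_left)
    show "integrable lborel (\<lambda>y. \<integral>z. norm (case (y, z) of (y, z) \<Rightarrow> h (x - z) * u (z - y) * v y) \<partial>lborel)"
    proof (rule Bochner_Integration.integrable_bound[where f = "\<lambda>y. (B * (\<integral>z. \<bar>u z\<bar> \<partial>lborel)) * v y"])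
      show "AE y in lborel. norm (\<integral>z. norm (case (y, z) of (y, z) \<Rightarrow> h (x - z) * u (z - y) * v y) \<partial>lborel) \<le> norm ((B * (\<integral>z. \<bar>u z\<bar> \<partial>lborel)) * v y)"
      proof (rule AE_I2)
        fix y
        have "0 \<le> B" using B[of 0] by simp
        have "(\<integral>z. \<bar>h (x - z) * u (z - y)\<bar> \<partial>lborel) \<le> (\<integral>z. B * \<bar>u (z - y)\<bar> \<partial>lborel)"
          using integrable_abs[OF 1[of y]] B integrable_translate[OF u, of y] by (intro integral_mono) (auto simp: abs_mult intro!: mult_right_mono)
        also have "\<dots> = B * (\<integral>z. \<bar>u z\<bar> \<partial>lborel)"
          using integral_translate[of "\<lambda>z. \<bar>u z\<bar>" y] by simp
        finally have "(\<integral>z. \<bar>h (x - z) * u (z - y)\<bar> \<partial>lborel) * \<bar>v y\<bar> \<le> B * (\<integral>z. \<bar>u z\<bar> \<partial>lborel) * \<bar>v y\<bar>"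
          by (rule mult_right_mono) simp
        moreover have "(\<integral>z. norm (case (y, z) of (y, z) \<Rightarrow> h (x - z) * u (z - y) * v y) \<partial>lborel) = (\<integral>z. \<bar>h (x - z) * u (z - y)\<bar> \<partial>lborel) * \<bar>v y\<bar>"
          by (simp add: abs_mult)
        ultimately show "norm (\<integral>z. norm (case (y, z) of (y, z) \<Rightarrow> h (x - z) * u (z - y) * v y) \<partial>lborel) \<le> norm ((B * (\<integral>z. \<bar>u z\<bar> \<partial>lborel)) * v y)"
          using \<open>0 \<le> B\<close> by (simp add: abs_mult)
      qed
    qed (use v in auto)
  qed measurable
  have "conv (conv h u) v x = (\<integral>y. (\<integral>z. h (x - z) * u (z - y) * v y \<partial>lborel) \<partial>lborel)"
    unfolding conv_def[of "conv h u"] sub by simp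
  also have "\<dots> = (\<integral>z. (\<integral>y. h (x - z) * u (z - y) * v y \<partial>lborel) \<partial>lborel)"
    using lborel_pair.Fubini_integral[OF int] by simp
  also have "\<dots> = conv h (conv u v) x"
    by (simp add: conv_def mult.assoc)
  finally show ?thesis .
qed

text \<open>Dyadic shells: where 2^n <= 1+|x| < 2^(n+1) the integrand is at most 2^(-na), and the
  shell lies in a ball of volume proportional to 2^((n+1)N). The resulting geometric series has
  ratio 2^(N-a) < 1.\<close>

lemma nn_integral_polynomial_decay:
  assumes a: "real DIM('a::euclidean_space) < a"
  shows "(\<integral>\<^sup>+ x. ennreal ((1 + norm (x::'a)) powr (- a)) \<partial>lborel) < \<infinity>"
proof -
  define N where "N = DIM('a)"
  define c where "c = unit_ball_vol (real N) * 2 ^ N"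
  define \<rho> where "\<rho> = 2 powr (real N - a)"
  have c: "0 \<le> c" by (simp add: c_def)
  have \<rho>: "0 \<le> \<rho>" "\<rho> < 1" using a by (auto simp: \<rho>_def N_def powr_less_one)
  have "(\<integral>\<^sup>+ x. ennreal ((1 + norm (x::'a)) powr (- a)) \<partial>lborel)
    \<le> (\<integral>\<^sup>+ x. (\<Sum>n. ennreal ((2 ^ n) powr (- a)) * indicator (ball 0 (2 ^ Suc n)) (x::'a)) \<partial>lborel)"
  proof (rule nn_integral_mono)
    fix x :: 'a
    define n where "n = (LEAST n. 1 + norm x < 2 ^ Suc n)"
    have ex: "\<exists>n. 1 + norm x < 2 ^ Suc n"
      using real_arch_pow[of 2 "1 + norm x"] by (metis less_trans one_less_numeral_iff power_strict_increasing_iff semiring_norm(76) lessI)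
    have up: "1 + norm x < 2 ^ Suc n" unfolding n_def by (rule LeastI_ex[OF ex])
    have lo: "2 ^ n \<le> 1 + norm x"
    proof (cases n)
      case (Suc m)
      then have "\<not> 1 + norm x < 2 ^ Suc m"
        using not_less_Least[of m "\<lambda>n. 1 + norm x < 2 ^ Suc n"] by (simp add: n_def)
      then show ?thesis using Suc by simp
    qed simp
    have "(1 + norm x) powr (- a) \<le> (2 ^ n) powr (- a)"
      using lo a by (intro powr_mono2') auto
    then have "ennreal ((1 + norm x) powr (- a)) \<le> ennreal ((2 ^ n) powr (- a)) * indicator (ball 0 (2 ^ Suc n)) x"
      using up by (simp add: ennreal_leI indicator_def)
    also have "\<dots> \<le> (\<Sum>n. ennreal ((2 ^ n) powr (- a)) * indicator (ball 0 (2 ^ Suc n)) x)"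
    proof -
      have "F n \<le> suminf F" for F :: "nat \<Rightarrow> ennreal"
        using sum_le_suminf[of F "{n}"] by simp
      then show ?thesis .
    qed
    finally show "ennreal ((1 + norm x) powr (- a)) \<le> (\<Sum>n. ennreal ((2 ^ n) powr (- a)) * indicator (ball 0 (2 ^ Suc n)) x)" .
  qed
  also have "\<dots> = (\<Sum>n. \<integral>\<^sup>+ x. ennreal ((2 ^ n) powr (- a)) * indicator (ball 0 (2 ^ Suc n)) (x::'a) \<partial>lborel)"
  proof (rule nn_integral_suminf)
    fix n
    have "ball (0::'a) (2 ^ Suc n) \<in> sets borel" by (rule borel_open) simp
    then show "(\<lambda>x::'a. ennreal ((2 ^ n) powr (- a)) * indicator (ball 0 (2 ^ Suc n)) x) \<in> borel_measurable lborel"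
      by (intro borel_measurable_times_ennreal borel_measurable_const borel_measurable_indicator) simp_all
  qed
  also have "\<dots> = (\<Sum>n. ennreal (c * \<rho> ^ n))"
  proof (rule suminf_cong)
    fix n
    have "(2 ^ n) powr (- a) * (2 ^ Suc n) ^ N = 2 ^ N * \<rho> ^ n"
    proof -
      have p2: "(2::real) ^ m = 2 powr real m" for m by (simp add: powr_realpow)
      have "((2::real) ^ n) powr (- a) = 2 powr (- a * real n)" unfolding p2 powr_powr by (simp add: mult.commute)
      moreover have "\<rho> ^ n = 2 powr (real n * (real N - a))" unfolding \<rho>_def by (rule powr_power) simp
      moreover have "((2::real) ^ Suc n) ^ N = 2 ^ N * 2 powr (real n * real N)"
      proof -
        have "((2::real) ^ Suc n) ^ N = 2 ^ N * 2 ^ (n * N)" by (simp add: power_mult_distrib power_mult)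
        also have "(2::real) ^ (n * N) = 2 powr (real n * real N)" unfolding p2 by simp
        finally show ?thesis .
      qed
      moreover have "- a * real n + real n * real N = real n * (real N - a)" by (simp add: algebra_simps)
      ultimately show ?thesis by (metis mult.left_commute powr_add)
    qed
    then have "(2 ^ n) powr (- a) * (unit_ball_vol (real N) * (2 ^ Suc n) ^ N) = c * \<rho> ^ n"
      by (simp add: c_def mult_ac)
    then show "(\<integral>\<^sup>+ x. ennreal ((2 ^ n) powr (- a)) * indicator (ball 0 (2 ^ Suc n)) (x::'a) \<partial>lborel) = ennreal (c * \<rho> ^ n)"
      by (simp add: nn_integral_cmult_indicator emeasure_ball N_def flip: ennreal_mult)
  qed
  also have "\<dots> < \<infinity>"
    using c \<rho> by (subst suminf_ennreal2) (auto intro!: summable_mult summable_geometric)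
  finally show ?thesis .
qed

lemma conv_continuous:
  fixes h u :: "'a::euclidean_space \<Rightarrow> real"
  assumes h: "continuous_on UNIV h" and B: "\<And>x. \<bar>h x\<bar> \<le> B" and u: "integrable lborel u"
  shows "continuous_on UNIV (conv h u)"
proof (rule continuous_at_imp_continuous_on, intro ballI)
  fix x
  have [measurable]: "h \<in> borel_measurable borel" by (rule borel_measurable_continuous_onI[OF h])
  have [measurable]: "u \<in> borel_measurable borel" using u by auto
  show "isCont (conv h u) x"
    unfolding continuous_at_sequentially
  proof (intro allI impI)
    fix X assume X: "X \<longlonglongrightarrow> x"
    show "(conv h u \<circ> X) \<longlonglongrightarrow> conv h u x"
      unfolding conv_def comp_def
    proof (rule integral_dominated_convergence[where w = "\<lambda>y. B * \<bar>u y\<bar>"])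
      show "AE y in lborel. (\<lambda>n. h (X n - y) * u y) \<longlonglongrightarrow> h (x - y) * u y"
        using X h by (intro AE_I2 tendsto_intros continuous_on_tendsto_compose[OF h]) auto
      show "AE y in lborel. norm (h (X n - y) * u y) \<le> B * \<bar>u y\<bar>" for n
        using B by (intro AE_I2) (auto simp: abs_mult intro!: mult_right_mono)
    qed (use u in auto)
  qed
qed

lemma has_pd_lipschitz:
  assumes "has_pd i h h'" "\<And>x. \<bar>h' x\<bar> \<le> B"
  shows "\<bar>h (x + r *\<^sub>R axis i 1) - h x\<bar> \<le> B * \<bar>r\<bar>"
  using field_differentiable_bound[of UNIV "\<lambda>r. h (x + r *\<^sub>R axis i 1)" "\<lambda>r. h' (x + r *\<^sub>R axis i 1)" B r 0]
    has_pd_at[OF assms(1)] assms(2) by simp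

text \<open>Differentiation under the integral sign: by the mean value inequality the difference
  quotients of h are bounded by B', so B'|u| dominates.\<close>

lemma conv_has_pd:
  fixes h u :: "real ^ 'n::finite \<Rightarrow> real"
  assumes pd: "has_pd i h h'"
    and [measurable]: "h \<in> borel_measurable borel" "h' \<in> borel_measurable borel"
    and B: "\<And>x. \<bar>h x\<bar> \<le> B" and B': "\<And>x. \<bar>h' x\<bar> \<le> B'" and u: "integrable lborel u"
  shows "has_pd i (conv h u) (conv h' u)"
  unfolding has_pd_def
proof
  fix x
  have [measurable]: "u \<in> borel_measurable borel" using u by auto
  have "((\<lambda>r. (conv h u (x + r *\<^sub>R axis i 1) - conv h u x) / r) \<longlongrightarrow> conv h' u x) (at 0)"
    unfolding tendsto_at_iff_sequentially comp_def
  proof (intro allI impI)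
    fix X :: "nat \<Rightarrow> real" assume X0: "\<forall>n. X n \<in> UNIV - {0}" and X: "X \<longlonglongrightarrow> 0"
    have eq: "(conv h u (x + X n *\<^sub>R axis i 1) - conv h u x) / X n
      = (\<integral>y. (h (x - y + X n *\<^sub>R axis i 1) - h (x - y)) / X n * u y \<partial>lborel)" for n
    proof -
      have "conv h u (x + X n *\<^sub>R axis i 1) - conv h u x
        = (\<integral>y. h (x + X n *\<^sub>R axis i 1 - y) * u y - h (x - y) * u y \<partial>lborel)"
        unfolding conv_def by (intro Bochner_Integration.integral_diff[symmetric] conv_integrand_integrable[where B = B] B u) auto
      then have "(conv h u (x + X n *\<^sub>R axis i 1) - conv h u x) / X n
        = (\<integral>y. (h (x + X n *\<^sub>R axis i 1 - y) * u y - h (x - y) * u y) / X n \<partial>lborel)"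
        by simp
      then show ?thesis by (simp add: algebra_simps diff_divide_distrib)
    qed
    show "(\<lambda>n. (conv h u (x + X n *\<^sub>R axis i 1) - conv h u x) / X n) \<longlonglongrightarrow> conv h' u x"
      unfolding eq conv_def[of h']
    proof (rule integral_dominated_convergence[where w = "\<lambda>y. B' * \<bar>u y\<bar>"])
      show "AE y in lborel. (\<lambda>n. (h (x - y + X n *\<^sub>R axis i 1) - h (x - y)) / X n * u y) \<longlonglongrightarrow> h' (x - y) * u y"
      proof (intro AE_I2 tendsto_intros)
        fix y
        have "((\<lambda>r. h (x - y + r *\<^sub>R axis i 1)) has_real_derivative h' (x - y)) (at 0)"
          using pd by (simp add: has_pd_def)
        then have "((\<lambda>r. (h (x - y + r *\<^sub>R axis i 1) - h (x - y)) / r) \<longlongrightarrow> h' (x - y)) (at 0)"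
          by (simp add: DERIV_def)
        with X0 X show "(\<lambda>n. (h (x - y + X n *\<^sub>R axis i 1) - h (x - y)) / X n) \<longlonglongrightarrow> h' (x - y)"
          unfolding tendsto_at_iff_sequentially comp_def by auto
      qed
      show "AE y in lborel. norm ((h (x - y + X n *\<^sub>R axis i 1) - h (x - y)) / X n * u y) \<le> B' * \<bar>u y\<bar>" for n
      proof (rule AE_I2)
        fix y
        have "X n \<noteq> 0" using X0 by simp
        then have "\<bar>(h (x - y + X n *\<^sub>R axis i 1) - h (x - y)) / X n\<bar> \<le> B'"
          using has_pd_lipschitz[OF pd B', of "x - y" "X n"] by (simp add: field_simps)
        then show "norm ((h (x - y + X n *\<^sub>R axis i 1) - h (x - y)) / X n * u y) \<le> B' * \<bar>u y\<bar>"
          unfolding real_norm_def abs_mult by (rule mult_right_mono) simp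
      qed
    qed (use u in auto)
  qed
  then show "((\<lambda>r. conv h u (x + r *\<^sub>R axis i 1)) has_real_derivative conv h' u x) (at 0)"
    by (simp add: DERIV_def)
qed

section \<open>Integration by parts on the whole space\<close>

text \<open>Integrating u' over a unit segment gives u(x+e) - u(x), whose integral over x is 0 by
  translation invariance. By Fubini the same double integral equals that of u', as all translates of
  u' have the same integral. Integrability thus takes the place of boundary terms.\<close>

lemma integral_partial_eq_0:
  fixes u :: "real ^ 'n::finite \<Rightarrow> real"
  assumes pd: "has_pd i u u'" and c: "continuous_on UNIV u'"
    and u: "integrable lborel u" and u': "integrable lborel u'"
  shows "(\<integral>x. u' x \<partial>lborel) = 0"
proof -
  have [measurable]: "u \<in> borel_measurable borel" "u' \<in> borel_measurable borel" using u u' by auto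
  let ?e = "axis i 1 :: real ^ 'n"
  have ftc: "(\<integral>r. u' (x + r *\<^sub>R ?e) * indicator {0..1} r \<partial>lborel) = u (x + ?e) - u x" for x
  proof -
    have "(\<integral>r. u' (x + r *\<^sub>R ?e) * indicator {0..1} r \<partial>lborel) = u (x + 1 *\<^sub>R ?e) - u (x + 0 *\<^sub>R ?e)"
      by (rule integral_FTC_Icc_real)
        (use c in \<open>auto intro!: has_pd_at[OF pd] continuous_intros simp: continuous_on_eq_continuous_at continuous_on_interior
           intro: continuous_at_compose[unfolded comp_def, of _ "\<lambda>r. x + r *\<^sub>R ?e" u']\<close>)
    then show ?thesis by simp
  qed
  have sh: "(\<integral>x. u' (x + r *\<^sub>R ?e) \<partial>lborel) = (\<integral>x. u' x \<partial>lborel)" for r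
    using integral_translate[of u' "- r *\<^sub>R ?e"] by simp
  have shn: "(\<integral>x. \<bar>u' (x + r *\<^sub>R ?e)\<bar> \<partial>lborel) = (\<integral>x. \<bar>u' x\<bar> \<partial>lborel)" for r
    using integral_translate[of "\<lambda>x. \<bar>u' x\<bar>" "- r *\<^sub>R ?e"] by simp
  have int: "integrable (lborel \<Otimes>\<^sub>M lborel) (\<lambda>(r, x). u' (x + r *\<^sub>R ?e) * indicator {0..1} r)"
  proof (rule lborel_pair.Fubini_integrable)
    have *: "integrable lborel (\<lambda>x. u' (x + r *\<^sub>R ?e))" for r
      using integrable_translate[OF u', of "- r *\<^sub>R ?e"] by simp
    then show "AE r in lborel. integrable lborel (\<lambda>x. case (r, x) of (r, x) \<Rightarrow> u' (x + r *\<^sub>R ?e) * indicator {0..1} r)"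
      by simp
    show "integrable lborel (\<lambda>r. \<integral>x. norm (case (r, x) of (r, x) \<Rightarrow> u' (x + r *\<^sub>R ?e) * indicator {0..1} r) \<partial>lborel)"
      by (simp add: abs_mult shn)
  qed measurable
  have "0 = (\<integral>x. u (x + ?e) - u x \<partial>lborel)"
    using integral_translate[of u "- ?e"] integrable_translate[OF u, of "- ?e"] u by simp
  also have "\<dots> = (\<integral>x. (\<integral>r. u' (x + r *\<^sub>R ?e) * indicator {0..1} r \<partial>lborel) \<partial>lborel)"
    by (simp only: ftc)
  also have "\<dots> = (\<integral>r. (\<integral>x. u' (x + r *\<^sub>R ?e) * indicator {0..1} r \<partial>lborel) \<partial>lborel)"
    using lborel_pair.Fubini_integral[OF int] by simp
  also have "\<dots> = (\<integral>r. (\<integral>x. u' x \<partial>lborel) * indicator {0..1::real} r \<partial>lborel)"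
    by (simp add: sh)
  also have "\<dots> = (\<integral>x. u' x \<partial>lborel)" by simp
  finally show ?thesis by simp
qed

lemma integration_by_parts:
  fixes u v :: "real ^ 'n::finite \<Rightarrow> real"
  assumes "has_pd i u u'" "has_pd i v v'"
    and "continuous_on UNIV u" "continuous_on UNIV u'" "continuous_on UNIV v" "continuous_on UNIV v'"
    and "integrable lborel (\<lambda>x. u x * v x)" "integrable lborel (\<lambda>x. u' x * v x)" "integrable lborel (\<lambda>x. u x * v' x)"
  shows "(\<integral>x. u x * v' x \<partial>lborel) = - (\<integral>x. u' x * v x \<partial>lborel)"
proof -
  have "(\<integral>x. u' x * v x + u x * v' x \<partial>lborel) = 0"
    by (rule integral_partial_eq_0[OF has_pd_mult[OF assms(1,2)]])
      (use assms in \<open>auto intro!: continuous_intros\<close>)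
  then show ?thesis using assms by simp
qed

section \<open>Test functions and uniqueness of weak derivatives\<close>

text \<open>The polynomial factor makes the family closed under differentiation.\<close>

definition bump :: "real poly \<Rightarrow> real \<Rightarrow> real" where
  "bump p r = (if 0 < r then poly p (1 / r) * exp (- 1 / r) else 0)"

lemma tendsto_poly_div_exp: "((\<lambda>x. poly p x * exp (- x)) \<longlongrightarrow> (0::real)) at_top"
proof -
  have "((\<lambda>x. \<Sum>i\<le>degree p. coeff p i * (x ^ i / exp x)) \<longlongrightarrow> (\<Sum>i\<le>degree p. coeff p i * 0)) at_top"
    by (intro tendsto_intros tendsto_power_div_exp_0)
  then show ?thesis by (simp add: poly_altdef sum_distrib_right sum_divide_distrib exp_minus field_simps)
qed

text \<open>For r > 0 differentiation gives r^(-2) (p - p')(1/r) exp(-1/r), which is where the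
  polynomial X^2 (p - p') comes from. At r = 0 the right difference quotient is X p(X) exp(-X) with
  X = 1/r, and this tends to 0.\<close>

lemma bump_has_derivative: "(bump p has_real_derivative bump ([:0, 0, 1:] * (p - pderiv p)) r) (at r)"
proof -
  consider "r < 0" | "r = 0" | "r > 0" by linarith
  then show ?thesis
  proof cases
    case 1
    have "((\<lambda>_. 0) has_real_derivative 0) (at r)" by simp
    then have "(bump p has_real_derivative 0) (at r)"
      by (rule has_field_derivative_transform_within_open[of _ _ _ "{..<0}"]) (use 1 in \<open>auto simp: bump_def\<close>)
    then show ?thesis using 1 by (simp add: bump_def)
  next
    case 2
    have "((\<lambda>x. bump p x / x) \<longlongrightarrow> 0) (at_right 0)"
    proof (rule Lim_transform_eventually)
      show "((\<lambda>x. poly ([:0, 1:] * p) (inverse x) * exp (- inverse x)) \<longlongrightarrow> 0) (at_right (0::real))"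
        by (rule filterlim_compose[OF tendsto_poly_div_exp filterlim_inverse_at_top_right])
      show "\<forall>\<^sub>F x in at_right 0. poly ([:0, 1:] * p) (inverse x) * exp (- inverse x) = bump p x / x"
        by (auto simp: eventually_at_right_field bump_def field_simps intro!: exI[of _ 1])
    qed
    moreover have "((\<lambda>x. bump p x / x) \<longlongrightarrow> 0) (at_left 0)"
      by (rule Lim_transform_eventually[OF tendsto_const])
        (auto simp: eventually_at_left_field bump_def intro!: exI[of _ "-1"])
    ultimately have "((\<lambda>x. bump p x / x) \<longlongrightarrow> 0) (at 0)"
      by (simp add: filterlim_split_at)
    then show ?thesis using 2 by (simp add: DERIV_def bump_def)
  next
    case 3
    have "((\<lambda>r. poly p (1 / r) * exp (- 1 / r)) has_real_derivative bump ([:0, 0, 1:] * (p - pderiv p)) r) (at r)"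
      using 3 by (auto intro!: derivative_eq_intros DERIV_chain2[OF poly_DERIV] simp: bump_def field_simps power2_eq_square)
    then show ?thesis
      by (rule has_field_derivative_transform_within_open[of _ _ _ "{0<..}"]) (use 3 in \<open>auto simp: bump_def\<close>)
  qed
qed

lemma Ck_on_bump: "Ck_on k UNIV (bump p)"
proof (induction k arbitrary: p)
  case 0
  have "isCont (bump p) x" for x using DERIV_isCont[OF bump_has_derivative] .
  then show ?case by (auto intro!: continuous_at_imp_continuous_on)
next
  case (Suc k)
  have D: "(bump p has_derivative (\<lambda>v. bump ([:0, 0, 1:] * (p - pderiv p)) x * v)) (at x)" for x
    using bump_has_derivative[of p x] by (simp add: has_field_derivative_def)
  \<comment> \<open>Directional derivatives carry a factor v; absorbed into the polynomial, it keeps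
    them inside the family, as the induction hypothesis requires.\<close>
  have sm: "bump q x * v = bump (smult v q) x" for q x v by (simp add: bump_def)
  have fd: "frechet_derivative (bump p) (at x) = (\<lambda>v. bump (smult v ([:0, 0, 1:] * (p - pderiv p))) x)" for x
    using frechet_derivative_at[OF D] by (simp only: sm)
  have "bump p differentiable at x" for x using D by (auto simp: differentiable_def)
  then show ?case unfolding Ck_on.simps fd using Suc.IH by simp
qed

text \<open>\<open>bump 1 (n t)\<close> is exp(-1/(n t)) for n t > 0 and 0 otherwise, so these
  products are smooth, vanish off the closed box, and tend to the indicator of the open box as n
  grows.\<close>

definition box_bump :: "nat \<Rightarrow> real ^ 'n::finite \<Rightarrow> real ^ 'n \<Rightarrow> real ^ 'n \<Rightarrow> real" where
  "box_bump n a b x = (\<Prod>i\<in>UNIV. bump 1 (real n * (x $ i - a $ i)) * bump 1 (real n * (b $ i - x $ i)))"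

lemma box_bump_eq_0: "x \<notin> cbox a b \<Longrightarrow> box_bump n a b x = 0"
proof -
  assume "x \<notin> cbox a b"
  then obtain i where i: "x $ i < a $ i \<or> b $ i < x $ i" by (auto simp: mem_box_cart not_le)
  have "bump 1 (real n * (x $ i - a $ i)) * bump 1 (real n * (b $ i - x $ i)) = 0"
    using i by (auto simp: bump_def zero_less_mult_iff)
  then show ?thesis unfolding box_bump_def by (auto intro!: prod_zero)
qed

lemma test_function_box_bump:
  fixes a b :: "real ^ 'n::finite"
  shows "test_function (box_bump n a b)"
  unfolding test_function_def
proof (intro conjI allI exI)
  fix k
  have lin: "bounded_linear (\<lambda>x::real^'n. c * x $ i)" for c i
    using bounded_linear_compose[OF bounded_linear_mult_right bounded_linear_vec_nth] by blast
  have 1: "Ck_on k UNIV (\<lambda>x::real^'n. bump 1 (real n * (x $ i - a $ i)))" for i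
    using Ck_on_affine[OF lin[of "real n" i], of "- real n * a $ i" UNIV k "bump 1"] Ck_on_bump
    by (simp add: algebra_simps)
  have 2: "Ck_on k UNIV (\<lambda>x::real^'n. bump 1 (real n * (b $ i - x $ i)))" for i
    using Ck_on_affine[OF lin[of "- real n" i], of "real n * b $ i" UNIV k "bump 1"] Ck_on_bump
    by (simp add: algebra_simps)
  show "Ck_on k UNIV (box_bump n a b)"
    unfolding box_bump_def[abs_def] by (intro Ck_on_prod Ck_on_mult 1 2)
next
  show "compact (cbox a b)" by (rule compact_cbox)
next
  fix x
  show "x \<notin> cbox a b \<longrightarrow> box_bump n a b x = 0"
    by (simp add: box_bump_eq_0)
qed

lemma box_bump_bounds: "0 \<le> box_bump n a b x" "box_bump n a b x \<le> indicator (cbox a b) x"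
proof -
  have b: "0 \<le> bump 1 r" "bump 1 r \<le> 1" for r by (auto simp: bump_def)
  show "0 \<le> box_bump n a b x" unfolding box_bump_def by (intro prod_nonneg) (auto intro!: mult_nonneg_nonneg b)
  have "box_bump n a b x \<le> 1"
    unfolding box_bump_def by (intro prod_le_1) (auto intro!: mult_nonneg_nonneg mult_le_one b)
  then show "box_bump n a b x \<le> indicator (cbox a b) x" by (simp add: indicator_def box_bump_eq_0)
qed

lemma box_bump_tendsto: "(\<lambda>n. box_bump n a b x) \<longlonglongrightarrow> indicator (box a b) x"
proof -
  have lim: "(\<lambda>n. bump 1 (real n * t)) \<longlonglongrightarrow> (if 0 < t then 1 else 0)" for t
  proof (cases "0 < t")
    case True
    have "(\<lambda>n. exp (- (1 / t) * inverse (real n))) \<longlonglongrightarrow> exp (- (1 / t) * 0)"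
      by (intro tendsto_intros LIMSEQ_inverse_real_of_nat lim_inverse_n)
    moreover have "\<forall>\<^sub>F n in sequentially. exp (- (1 / t) * inverse (real n)) = bump 1 (real n * t)"
      using eventually_gt_at_top[of 0] by eventually_elim (use True in \<open>auto simp: bump_def field_simps\<close>)
    ultimately show ?thesis using True by (simp add: Lim_transform_eventually)
  next
    case False
    then have "bump 1 (real n * t) = 0" for n by (auto simp: bump_def mult_le_0_iff not_less zero_less_mult_iff)
    then show ?thesis using False by simp
  qed
  have "(\<lambda>n. box_bump n a b x) \<longlonglongrightarrow> (\<Prod>i\<in>UNIV. (if 0 < x $ i - a $ i then 1 else 0) * (if 0 < b $ i - x $ i then 1 else 0))"
    unfolding box_bump_def by (intro tendsto_intros lim)
  also have "(\<Prod>i\<in>UNIV. (if 0 < x $ i - a $ i then 1 else 0) * (if 0 < b $ i - x $ i then 1 else 0)) = (indicator (box a b) x :: real)"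
  proof (cases "x \<in> box a b")
    case True
    then show ?thesis by (auto simp: mem_box_cart intro!: prod.neutral)
  next
    case False
    then obtain i where "\<not> (a $ i < x $ i \<and> x $ i < b $ i)" by (auto simp: mem_box_cart)
    then show ?thesis using False by (auto intro!: prod_zero bexI[of _ i])
  qed
  finally show ?thesis .
qed

lemma test_function_continuous: "test_function \<phi> \<Longrightarrow> continuous_on UNIV \<phi>"
  unfolding test_function_def by (metis Ck_on.simps(1))

lemma locally_integrable_times_bounded:
  assumes w: "locally_integrable w" and \<phi>: "\<phi> \<in> borel_measurable lebesgue" "\<And>x. \<bar>\<phi> x\<bar> \<le> B"
    and C: "compact C" "\<And>x. x \<notin> C \<Longrightarrow> \<phi> x = 0"
  shows "integrable lebesgue (\<lambda>x. w x * \<phi> x)"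
proof (rule Bochner_Integration.integrable_bound[where f = "\<lambda>x. B * (indicator C x * w x)"])
  have iw: "integrable lebesgue (\<lambda>x. indicator C x * w x)"
    using w C by (auto simp: locally_integrable_def set_integrable_def)
  then show "integrable lebesgue (\<lambda>x. B * (indicator C x * w x))" by simp
  have "(\<lambda>x. w x * \<phi> x) = (\<lambda>x. (indicator C x * w x) * \<phi> x)"
    using C(2) by (intro ext) (auto split: split_indicator)
  then show "(\<lambda>x. w x * \<phi> x) \<in> borel_measurable lebesgue"
    using borel_measurable_times[OF borel_measurable_integrable[OF iw] \<phi>(1)] by simp
  have "0 \<le> B" using \<phi>(2)[of 0] by simp
  show "AE x in lebesgue. norm (w x * \<phi> x) \<le> norm (B * (indicator C x * w x))"
  proof (rule AE_I2)
    fix x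
    show "norm (w x * \<phi> x) \<le> norm (B * (indicator C x * w x))"
      using \<phi>(2)[of x] C(2)[of x] \<open>0 \<le> B\<close>
      by (cases "x \<in> C") (auto simp: abs_mult mult.commute[of "\<bar>w x\<bar>"] intro!: mult_right_mono)
  qed
qed

text \<open>Dominated convergence along \<open>box_bump\<close> gives zero integrals over open
  boxes. Boxes form an intersection-stable generator, so within one box the Dynkin argument extends
  this to all Borel sets, in particular to the set where a Borel version v of w is nonnegative; this
  forces v = 0 almost everywhere.\<close>

lemma fundamental_lemma:
  fixes w :: "real ^ 'n::finite \<Rightarrow> real"
  assumes w: "locally_integrable w"
    and 0: "\<And>\<phi>. test_function \<phi> \<Longrightarrow> (LINT x|lebesgue. w x * \<phi> x) = 0"
  shows "AE x in lebesgue. w x = 0"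
proof -
  have cint: "integrable lebesgue (\<lambda>x. w x * indicator (cbox a b) x)" for a b
    by (rule locally_integrable_times_bounded[OF w, where B = 1 and C = "cbox a b"]) (auto intro!: borel_measurable_indicator split: split_indicator)
  have bint: "integrable lebesgue (\<lambda>x. w x * indicator (box a b) x)" for a b
    by (rule locally_integrable_times_bounded[OF w, where B = 1 and C = "cbox a b"])
      (use box_subset_cbox[of a b] in \<open>auto intro!: borel_measurable_indicator split: split_indicator\<close>)
  have boxz: "(LINT x|lebesgue. w x * indicator (box a b) x) = 0" for a b
  proof -
    have "(\<lambda>n. LINT x|lebesgue. w x * box_bump n a b x) \<longlonglongrightarrow> (LINT x|lebesgue. w x * indicator (box a b) x)"
    proof (rule integral_dominated_convergence[where w = "\<lambda>x. \<bar>w x * indicator (cbox a b) x\<bar>"])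
      show "(\<lambda>x. w x * box_bump n a b x) \<in> borel_measurable lebesgue" for n
      proof (rule borel_measurable_integrable, rule locally_integrable_times_bounded[OF w, where B = 1 and C = "cbox a b"])
        show "box_bump n a b \<in> borel_measurable lebesgue"
          using borel_measurable_continuous_onI[OF test_function_continuous[OF test_function_box_bump]]
          by (intro measurable_completion) simp
        show "\<bar>box_bump n a b x\<bar> \<le> 1" for x
          using box_bump_bounds[of n a b x] by (cases "x \<in> cbox a b") auto
        show "x \<notin> cbox a b \<Longrightarrow> box_bump n a b x = 0" for x
          by (rule box_bump_eq_0)
      qed simp
      show "AE x in lebesgue. norm (w x * box_bump n a b x) \<le> \<bar>w x * indicator (cbox a b) x\<bar>" for n
      proof (rule AE_I2)
        fix x
        have "\<bar>box_bump n a b x\<bar> \<le> \<bar>indicator (cbox a b) x :: real\<bar>" using box_bump_bounds[of n a b x] by simp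
        then show "norm (w x * box_bump n a b x) \<le> \<bar>w x * indicator (cbox a b) x\<bar>"
          by (simp add: abs_mult mult_left_mono)
      qed
      show "AE x in lebesgue. (\<lambda>n. w x * box_bump n a b x) \<longlonglongrightarrow> w x * indicator (box a b) x"
        by (intro AE_I2 tendsto_intros box_bump_tendsto)
    qed (use cint bint in \<open>auto intro!: borel_measurable_integrable\<close>)
    moreover have "(LINT x|lebesgue. w x * box_bump n a b x) = 0" for n
      by (rule 0[OF test_function_box_bump])
    ultimately show ?thesis by (simp add: LIMSEQ_const_iff)
  qed
  have "AE x in lebesgue. x \<in> box a b \<longrightarrow> w x = 0" for a b
  proof -
    \<comment> \<open>Cutting off at a box makes w globally integrable, so that complements and
      countable unions can be integrated.\<close>
    define wB where "wB x = w x * indicator (box a b) x" for x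
    have iB: "integrable lebesgue wB" using bint by (simp add: wB_def[abs_def])
    have setz: "(LINT x|lebesgue. wB x * indicator S x) = 0" if "S \<in> sets borel" for S
    proof -
      have iS: "integrable lebesgue (\<lambda>x. wB x * indicator S x)" if "S \<in> sets borel" for S
        using integrable_mult_indicator[OF _ iB, of S] that by (simp add: mult.commute)
      have "Int_stable (range (\<lambda>(a, b). box a b :: (real^'n) set))"
        by (auto simp: Int_stable_def box_Int_box)
      moreover have "range (\<lambda>(a, b). box a b :: (real^'n) set) \<subseteq> Pow UNIV" by simp
      moreover have "S \<in> sigma_sets UNIV (range (\<lambda>(a, b). box a b))"
        using that unfolding borel_eq_box by simp
      ultimately show ?thesis
      proof (induction rule: sigma_sets_induct_disjoint)
        case (basic A)
        then obtain c d where "A = box c d" by auto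
        then show ?case
          using boxz by (simp add: wB_def mult.assoc box_Int_box flip: indicator_inter_arith)
      next
        case empty
        show ?case by simp
      next
        case (compl A)
        then have A: "A \<in> sets borel" unfolding borel_eq_box by simp
        have "(LINT x|lebesgue. wB x * indicator (UNIV - A) x) = (LINT x|lebesgue. wB x - wB x * indicator A x)"
          by (intro Bochner_Integration.integral_cong) (auto simp: indicator_def)
        also have "\<dots> = (LINT x|lebesgue. wB x) - (LINT x|lebesgue. wB x * indicator A x)"
          using iB iS[OF A] by (rule Bochner_Integration.integral_diff)
        finally show ?case using compl boxz[of a b] by (simp add: wB_def[abs_def])
      next
        case (union A)
        then have A: "A i \<in> sets borel" for i unfolding borel_eq_box by auto
        have ss: "set_integrable lebesgue (\<Union>i. A i) wB"
          using iS[of "\<Union>i. A i"] A by (simp add: set_integrable_def mult.commute)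
        have "(LINT x:(\<Union>i. A i)|lebesgue. wB x) = (\<Sum>i. (LINT x:A i|lebesgue. wB x))"
          by (rule lebesgue_integral_countable_add[OF _ _ ss]) (use A union in \<open>auto simp: disjoint_family_on_def\<close>)
        then show ?case using union by (simp add: set_lebesgue_integral_def mult.commute)
      qed
    qed
    have wBm: "wB \<in> borel_measurable lebesgue" using iB by auto
    \<comment> \<open>A Borel version is taken so that the set where it is nonnegative is Borel;
      \<open>setz\<close> speaks of Borel sets only.\<close>
    then obtain v where v[measurable]: "v \<in> borel_measurable borel" and vw: "AE x in lborel. wB x = v x"
      using completion_ex_borel_measurable_real[of wB lborel] by auto
    have vm: "v \<in> borel_measurable lebesgue" using v by (intro measurable_completion) simp
    have vw': "AE x in lebesgue. wB x = v x" using vw by (rule AE_completion)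
    have iv: "integrable lebesgue v"
      using integrable_cong_AE[OF wBm vm vw'] iB by simp
    have vz: "(LINT x|lebesgue. v x * indicator S x) = 0" if "S \<in> sets borel" for S
    proof -
      have "(\<lambda>x. indicator S x :: real) \<in> borel_measurable lebesgue" using that by (intro measurable_completion) simp
      then have "(LINT x|lebesgue. v x * indicator S x) = (LINT x|lebesgue. wB x * indicator S x)"
        by (intro integral_cong_AE borel_measurable_times vm wBm) (use vw' in auto)
      then show ?thesis using setz[OF that] by simp
    qed
    have s1: "{x. 0 \<le> v x} \<in> sets borel" by measurable
    have "AE x in lebesgue. \<bar>v x\<bar> = 0"
    proof (subst integral_nonneg_eq_0_iff_AE[symmetric])
      \<comment> \<open>|v| is 2v restricted to the set where v >= 0, minus v; both parts have
        integral 0.\<close>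
      have "(LINT x|lebesgue. \<bar>v x\<bar>) = (LINT x|lebesgue. v x * indicator {x. 0 \<le> v x} x * 2 - v x * indicator UNIV x)"
        by (intro Bochner_Integration.integral_cong) (auto simp: indicator_def)
      also have "\<dots> = (LINT x|lebesgue. v x * indicator {x. 0 \<le> v x} x * 2) - (LINT x|lebesgue. v x * indicator UNIV x)"
        using iv integrable_mult_indicator[OF _ iv, of "{x. 0 \<le> v x}"] s1 by (intro Bochner_Integration.integral_diff) (auto simp: mult.commute)
      also have "\<dots> = 0" using vz[OF s1] vz[of UNIV] by simp
      finally show "(LINT x|lebesgue. \<bar>v x\<bar>) = 0" .
    qed (use iv in auto)
    with vw' show ?thesis
      by eventually_elim (auto simp: wB_def indicator_def split: if_splits)
  qed
  \<comment> \<open>Countably many boxes exhaust the space, so the exceptional null sets may be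
    united.\<close>
  then have "AE x in lebesgue. \<forall>n::nat. x \<in> box (\<chi> i. - real n) (\<chi> i. real n) \<longrightarrow> w x = 0"
    unfolding AE_all_countable by blast
  then show ?thesis
  proof eventually_elim
    fix x assume *: "\<forall>n::nat. x \<in> box (\<chi> i. - real n) (\<chi> i. real n) \<longrightarrow> w x = 0"
    obtain n :: nat where n: "norm x < real n" using reals_Archimedean2 by blast
    have "x \<in> box (\<chi> i. - real n) (\<chi> i. real n)"
      unfolding mem_box_cart using component_le_norm_cart[of x] n by (auto simp: abs_le_iff) (smt (verit))+
    with * show "w x = 0" by blast
  qed
qed

text \<open>Pins down \<open>weak_mpartial\<close>, which is a mere choice: any concretely exhibited
  weak derivative agrees with it almost everywhere.\<close>

lemma weak_mpartial_unique:
  assumes "has_weak_mpartial \<alpha> u v" "has_weak_mpartial \<alpha> u v'"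
  shows "AE x in lebesgue. v x = v' x"
proof -
  have l: "locally_integrable v" "locally_integrable v'" using assms by (auto simp: has_weak_mpartial_def)
  have "AE x in lebesgue. v x - v' x = 0"
  proof (rule fundamental_lemma)
    show "locally_integrable (\<lambda>x. v x - v' x)"
      using l by (auto simp: locally_integrable_def)
    fix \<phi> :: "real^'a \<Rightarrow> real" assume t: "test_function \<phi>"
    then obtain C where C: "compact C" "\<And>x. x \<notin> C \<Longrightarrow> \<phi> x = 0" by (auto simp: test_function_def)
    have c: "continuous_on UNIV \<phi>" by (rule test_function_continuous[OF t])
    have \<phi>m: "\<phi> \<in> borel_measurable lebesgue"
      using borel_measurable_continuous_onI[OF c] by (intro measurable_completion) simp
    have "bounded (\<phi> ` C)"
      using compact_continuous_image[OF continuous_on_subset[OF c] C(1)] compact_imp_bounded by blast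
    then obtain B where "\<And>x. x \<in> C \<Longrightarrow> \<bar>\<phi> x\<bar> \<le> B" by (auto simp: bounded_iff)
    then have B: "\<bar>\<phi> x\<bar> \<le> \<bar>B\<bar>" for x using C(2)[of x] by (cases "x \<in> C") force+
    have i: "integrable lebesgue (\<lambda>x. v x * \<phi> x)" "integrable lebesgue (\<lambda>x. v' x * \<phi> x)"
      by (rule locally_integrable_times_bounded[OF _ \<phi>m B C]; use l in simp)+
    have "(-1) ^ mi_len \<alpha> * (LINT x|lebesgue. v x * \<phi> x) = (-1) ^ mi_len \<alpha> * (LINT x|lebesgue. v' x * \<phi> x)"
      using assms t unfolding has_weak_mpartial_def by metis
    then have "(LINT x|lebesgue. v x * \<phi> x) = (LINT x|lebesgue. v' x * \<phi> x)" by simp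
    then show "(LINT x|lebesgue. (v x - v' x) * \<phi> x) = 0" using i by (simp add: left_diff_distrib)
  qed
  then show ?thesis by simp
qed

section \<open>The kernel\<close>

lemma abs_mi_pow_le: "\<bar>mi_pow x \<alpha>\<bar> \<le> norm x ^ mi_len \<alpha>"
proof -
  have "\<bar>mi_pow x \<alpha>\<bar> = (\<Prod>i\<in>UNIV. \<bar>x $ i\<bar> ^ \<alpha> i)" by (simp add: mi_pow_def abs_prod power_abs)
  also have "\<dots> \<le> (\<Prod>i\<in>UNIV. norm x ^ \<alpha> i)"
    by (intro prod_mono conjI power_mono component_le_norm_cart) auto
  also have "\<dots> = norm x ^ mi_len \<alpha>" by (simp add: mi_len_def power_sum)
  finally show ?thesis .
qed

text \<open>The origin is excluded because \<open>0 powr 0\<close> is 0, whereas the empty monomial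
  has the value 1 there.\<close>

lemma abs_mi_pow_le_powr: "x \<noteq> 0 \<Longrightarrow> \<bar>mi_pow x \<alpha>\<bar> \<le> norm x powr real (mi_len \<alpha>)"
  using abs_mi_pow_le[of x \<alpha>] by (simp add: powr_realpow)

lemma AE_abs_mi_pow_le:
  fixes \<alpha> :: "'n::finite \<Rightarrow> nat"
  shows "AE x in lborel. \<bar>mi_pow x \<alpha>\<bar> \<le> norm x powr real (mi_len \<alpha>)"
  using AE_lborel_singleton[of "0 :: real ^ 'n"] by eventually_elim (auto intro: abs_mi_pow_le_powr)

lemma continuous_mi_pow: "continuous_on UNIV (\<lambda>x. mi_pow x \<alpha>)"
  unfolding mi_pow_def by (intro continuous_intros)

lemma borel_measurable_mi_pow [measurable]: "(\<lambda>x. mi_pow x \<alpha>) \<in> borel_measurable borel"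
  by (rule borel_measurable_continuous_onI[OF continuous_mi_pow])

text \<open>When \<alpha> i = 0 the truncated subtraction leaves \<alpha> unchanged and the factor
  \<open>real (\<alpha> i)\<close> annihilates the term, so one formula covers both cases.\<close>

lemma has_pd_mi_pow: "has_pd i (\<lambda>x. mi_pow x \<alpha>) (\<lambda>x. real (\<alpha> i) * mi_pow x (\<alpha>(i := \<alpha> i - 1)))"
  unfolding has_pd_def
proof
  fix x
  have split: "mi_pow y \<beta> = (y $ i) ^ \<beta> i * (\<Prod>k\<in>UNIV - {i}. (y $ k) ^ \<beta> k)" for y \<beta>
    unfolding mi_pow_def by (rule prod.remove) auto
  have c: "(x + r *\<^sub>R axis i 1) $ i = x $ i + r" "k \<noteq> i \<Longrightarrow> (x + r *\<^sub>R axis i 1) $ k = x $ k" for r k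
    by (auto simp: axis_def)
  have e1: "(\<lambda>r. mi_pow (x + r *\<^sub>R axis i 1) \<alpha>) = (\<lambda>r. (x $ i + r) ^ \<alpha> i * (\<Prod>k\<in>UNIV - {i}. (x $ k) ^ \<alpha> k))"
    unfolding split c(1) by (intro ext arg_cong2[where f = "(*)"] prod.cong refl) (auto simp: axis_def)
  have e2: "(\<Prod>k\<in>UNIV - {i}. (x $ k) ^ (\<alpha>(i := \<alpha> i - 1)) k) = (\<Prod>k\<in>UNIV - {i}. (x $ k) ^ \<alpha> k)"
    by (intro prod.cong) auto
  show "((\<lambda>r. mi_pow (x + r *\<^sub>R axis i 1) \<alpha>) has_real_derivative real (\<alpha> i) * mi_pow x (\<alpha>(i := \<alpha> i - 1))) (at 0)"
    unfolding e1 split[of x] e2 by (auto intro!: derivative_eq_intros)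
qed

lemma mi_len_upd: "0 < \<alpha> i \<Longrightarrow> Suc (mi_len (\<alpha>(i := \<alpha> i - 1))) = mi_len \<alpha>"
  by (simp add: mi_len_def sum.remove[of UNIV i])

lemma mi_fact_upd: "0 < \<alpha> i \<Longrightarrow> mi_fact \<alpha> = real (\<alpha> i) * mi_fact (\<alpha>(i := \<alpha> i - 1))"
  by (simp add: mi_fact_def prod.remove[of UNIV i] fact_reduce)

lemma mi_fact_pos: "0 < mi_fact \<alpha>"
  by (simp add: mi_fact_def prod_pos)

lemma one_plus_norm_neq_0 [simp]: "1 + norm x \<noteq> 0"
  by (metis add_pos_nonneg less_irrefl norm_ge_zero zero_less_one)

lemma scal_exp_infinity: "scal_exp TYPE('n::finite) d \<infinity> = real CARD('n) / d"
  by (simp add: scal_exp_def)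

lemma scal_exp_real:
  assumes "1 \<le> q" "q \<noteq> \<infinity>"
  shows "scal_exp TYPE('n::finite) d q = real CARD('n) / d * (1 - 1 / enn2real q)"
proof -
  obtain p where p: "q = ennreal p" "0 \<le> p" using assms by (cases q) auto
  then have "1 \<le> p" using assms by (simp add: flip: ennreal_1)
  then have "1 / q = ennreal (1 / p)" using p by (simp add: divide_ennreal flip: ennreal_1)
  then show ?thesis using p by (simp add: scal_exp_def)
qed

lemma enn2real_ge_1:
  assumes "1 \<le> q" "q \<noteq> \<infinity>"
  shows "1 \<le> enn2real q"
proof -
  obtain p where p: "q = ennreal p" "0 \<le> p" using assms by (cases q) auto
  then show ?thesis using assms by (simp flip: ennreal_1)
qed

lemma scal_exp_nonneg: "0 < d \<Longrightarrow> 1 \<le> q \<Longrightarrow> 0 \<le> scal_exp TYPE('n::finite) d q"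
  using enn2real_ge_1[of q] by (cases "q = \<infinity>") (auto simp: scal_exp_infinity[unfolded infinity_ennreal_def] scal_exp_real)

section \<open>The profile at time 1 and scaling estimates\<close>

locale scaling_kernel =
  fixes G :: "real ^ 'n::finite \<Rightarrow> real \<Rightarrow> real" and \<gamma> :: nat and d L :: real
  assumes d: "0 < d" and L: "0 < L" and G: "condition_G \<gamma> d L G"
begin

definition \<Phi> :: "real ^ 'n \<Rightarrow> real" where "\<Phi> x = G x 1"

definition D\<Phi> :: "'n list \<Rightarrow> real ^ 'n \<Rightarrow> real" where "D\<Phi> is = foldr partial is \<Phi>"

text \<open>The derivative of G(.,\<tau>) along \<open>is\<close>, written through the profile at
  time 1 (see \<open>foldr_partial_G\<close>): each derivative adds a factor \<tau>^(-1/d). In this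
  form joint measurability in (\<tau>,x) is evident, and every norm follows from one at \<tau> =
  1.\<close>

definition \<kappa> :: "'n list \<Rightarrow> real \<Rightarrow> real ^ 'n \<Rightarrow> real" where
  "\<kappa> is \<tau> x = \<tau> powr (- (real CARD('n) + real (length is)) / d) * D\<Phi> is (\<tau> powr (- 1 / d) *\<^sub>R x)"

lemma Ck_\<Phi>: "Ck_on \<gamma> UNIV \<Phi>"
proof -
  have "Ck_on \<gamma> UNIV (\<lambda>x. (\<lambda>(x, t). G x t) ((x, 0) + (0, 1)))"
  proof (rule Ck_on_affine)
    show "bounded_linear (\<lambda>x::real^'n. (x, 0::real))"
      by (intro bounded_linear_Pair bounded_linear_ident bounded_linear_zero)
    show "Ck_on \<gamma> (UNIV \<times> {0<..}) (\<lambda>(x, t). G x t)" by (rule G[unfolded condition_G_def, THEN conjunct1])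
  qed simp
  then show ?thesis by (simp add: \<Phi>_def[abs_def])
qed

lemma continuous_D\<Phi>: "length is \<le> \<gamma> \<Longrightarrow> continuous_on UNIV (D\<Phi> is)"
  unfolding D\<Phi>_def by (rule continuous_foldr_partial[OF Ck_\<Phi>])

lemma has_pd_D\<Phi>: "length is < \<gamma> \<Longrightarrow> has_pd i (D\<Phi> is) (D\<Phi> (i # is))"
  unfolding D\<Phi>_def by (rule has_pd_foldr_partial[OF Ck_\<Phi>])

lemma borel_measurable_D\<Phi>: "length is \<le> \<gamma> \<Longrightarrow> D\<Phi> is \<in> borel_measurable borel"
  by (rule borel_measurable_continuous_onI[OF continuous_D\<Phi>])

text \<open>Condition (G) bounds the Euclidean length of the derivatives of each order; a single
  derivative is smaller, and summing the bounds over the finitely many orders makes the constant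
  uniform.\<close>

lemma D\<Phi>_decay:
  obtains C where "0 < C"
    "\<And>is x. length is \<le> \<gamma> \<Longrightarrow> \<bar>D\<Phi> is x\<bar> \<le> C * (1 + norm x) powr (- (real CARD('n) + L + real (length is)))"
proof -
  have "\<forall>j\<le>\<gamma>. \<exists>c. \<forall>x. (1 + norm x) powr (real CARD('n) + L + real j) * order_len j (\<lambda>\<alpha>. mpartial \<alpha> \<Phi>) x \<le> c"
  proof (intro allI impI)
    fix j assume "j \<le> \<gamma>"
    then have "bdd_above (range (\<lambda>x. (1 + norm x) powr (real CARD('n) + L + real j) * order_len j (\<lambda>\<alpha>. mpartial \<alpha> \<Phi>) x))"
      unfolding \<Phi>_def[abs_def]
      by (rule G[unfolded condition_G_def, THEN conjunct2, THEN conjunct2, THEN conjunct1, rule_format])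
    then show "\<exists>c. \<forall>x. (1 + norm x) powr (real CARD('n) + L + real j) * order_len j (\<lambda>\<alpha>. mpartial \<alpha> \<Phi>) x \<le> c"
      unfolding bdd_above_def by blast
  qed
  then obtain c where c: "\<And>j x. j \<le> \<gamma> \<Longrightarrow> (1 + norm x) powr (real CARD('n) + L + real j) * order_len j (\<lambda>\<alpha>. mpartial \<alpha> \<Phi>) x \<le> c j"
    by metis
  define C where "C = 1 + (\<Sum>j\<le>\<gamma>. \<bar>c j\<bar>)"
  have C: "c j \<le> C" if "j \<le> \<gamma>" for j
  proof -
    have "\<bar>c j\<bar> \<le> (\<Sum>j\<le>\<gamma>. \<bar>c j\<bar>)" using that by (intro member_le_sum) auto
    then show ?thesis by (simp add: C_def)
  qed
  show ?thesis
  proof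
    show "0 < C" by (simp add: C_def add_pos_nonneg sum_nonneg)
    fix "is" :: "'n list" and x assume l: "length is \<le> \<gamma>"
    define j where "j = length is"
    have "\<bar>D\<Phi> is x\<bar> = \<bar>mpartial (count_list is) \<Phi> x\<bar>"
      unfolding D\<Phi>_def by (simp add: foldr_partial_eq_mpartial[OF Ck_\<Phi> l])
    also have "\<dots> \<le> order_len j (\<lambda>\<alpha>. mpartial \<alpha> \<Phi>) x"
    proof -
      have fin: "finite {\<alpha>::'n \<Rightarrow> nat. mi_len \<alpha> = j}"
        by (rule finite_subset[OF _ finite_mi_len[of j]]) auto
      have "(mpartial (count_list is) \<Phi> x)\<^sup>2 \<le> (\<Sum>\<alpha> | mi_len \<alpha> = j. (mpartial \<alpha> \<Phi> x)\<^sup>2)"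
        by (rule member_le_sum) (use fin in \<open>auto simp: j_def length_eq_mi_len\<close>)
      then show ?thesis unfolding order_len_def using real_le_rsqrt by fastforce
    qed
    finally have "(1 + norm x) powr (real CARD('n) + L + real j) * \<bar>D\<Phi> is x\<bar> \<le> (1 + norm x) powr (real CARD('n) + L + real j) * order_len j (\<lambda>\<alpha>. mpartial \<alpha> \<Phi>) x"
      by (rule mult_left_mono) simp
    also have "\<dots> \<le> C" using c[of j x] C[of j] l by (simp add: j_def)
    finally have "(1 + norm x) powr (real CARD('n) + L + real j) * \<bar>D\<Phi> is x\<bar> \<le> C" .
    moreover have "0 < (1 + norm x) powr (real CARD('n) + L + real j)" by (simp add: add_pos_nonneg)
    ultimately show "\<bar>D\<Phi> is x\<bar> \<le> C * (1 + norm x) powr (- (real CARD('n) + L + real (length is)))"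
      unfolding powr_minus j_def by (simp add: field_simps)
  qed
qed

lemma D\<Phi>_bounded:
  obtains C where "0 < C" "\<And>is x. length is \<le> \<gamma> \<Longrightarrow> \<bar>D\<Phi> is x\<bar> \<le> C"
proof -
  obtain C where C: "0 < C"
    "\<And>is x. length is \<le> \<gamma> \<Longrightarrow> \<bar>D\<Phi> is x\<bar> \<le> C * (1 + norm x) powr (- (real CARD('n) + L + real (length is)))"
    by (rule D\<Phi>_decay) blast
  have "\<bar>D\<Phi> is x\<bar> \<le> C" if "length is \<le> \<gamma>" for "is" x
  proof -
    have "(1 + norm x) powr (- (real CARD('n) + L + real (length is))) \<le> (1 + norm x) powr 0"
      using L by (intro powr_mono) auto
    then have "(1 + norm x) powr (- (real CARD('n) + L + real (length is))) \<le> 1" by simp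
    then have "C * (1 + norm x) powr (- (real CARD('n) + L + real (length is))) \<le> C * 1"
      using C(1) by (intro mult_left_mono) auto
    with C(2)[OF that, of x] show ?thesis by simp
  qed
  with C(1) that show ?thesis by blast
qed

text \<open>Since l < L, the weight |x|^l against (1+|x|)^(-(N+L)) leaves a decay exponent N+L-l >
  N. The last bound, in which no derivative occurs, is meant for the Taylor remainder.\<close>

lemma D\<Phi>_weighted_integral:
  assumes "0 \<le> l" "l < L"
  obtains C where "0 \<le> C"
    "\<And>is. length is \<le> \<gamma> \<Longrightarrow> (\<integral>\<^sup>+x. ennreal (\<bar>D\<Phi> is x\<bar> * norm x powr l) \<partial>lborel) \<le> ennreal C"
    "\<And>is. length is \<le> \<gamma> \<Longrightarrow> (\<integral>\<^sup>+x. ennreal \<bar>D\<Phi> is x\<bar> \<partial>lborel) \<le> ennreal C"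
    "(\<integral>\<^sup>+x. ennreal (norm (x::real^'n) powr l * (1 + norm x) powr (- (real CARD('n) + L))) \<partial>lborel) \<le> ennreal C"
proof -
  obtain C where C: "0 < C"
    "\<And>is x. length is \<le> \<gamma> \<Longrightarrow> \<bar>D\<Phi> is x\<bar> \<le> C * (1 + norm x) powr (- (real CARD('n) + L + real (length is)))"
    by (rule D\<Phi>_decay) blast
  define I where "I = (\<integral>\<^sup>+x. ennreal ((1 + norm (x::real^'n)) powr (- (real CARD('n) + L - l))) \<partial>lborel)"
  have "I < \<infinity>" unfolding I_def using assms by (intro nn_integral_polynomial_decay) simp
  then obtain J where J: "I = ennreal J" "0 \<le> J" by (cases I) auto
  have w: "norm x powr l * (1 + norm x) powr (- (real CARD('n) + L)) \<le> (1 + norm x) powr (- (real CARD('n) + L - l))" for x :: "real^'n"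
  proof -
    have "norm x powr l * (1 + norm x) powr (- (real CARD('n) + L)) \<le> (1 + norm x) powr l * (1 + norm x) powr (- (real CARD('n) + L))"
      using assms by (intro mult_right_mono powr_mono2) auto
    then show ?thesis by (simp add: powr_add[symmetric] algebra_simps)
  qed
  have w0: "(1 + norm x) powr (- (real CARD('n) + L)) \<le> (1 + norm x) powr (- (real CARD('n) + L - l))" for x :: "real^'n"
    using assms by (intro powr_mono) auto
  have lt: "\<bar>D\<Phi> is x\<bar> \<le> C * (1 + norm x) powr (- (real CARD('n) + L))" if "length is \<le> \<gamma>" for "is" x
  proof -
    have "(1 + norm x) powr (- (real CARD('n) + L + real (length is))) \<le> (1 + norm x) powr (- (real CARD('n) + L))"
      by (intro powr_mono) auto
    then have "C * (1 + norm x) powr (- (real CARD('n) + L + real (length is))) \<le> C * (1 + norm x) powr (- (real CARD('n) + L))"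
      using C(1) by (intro mult_left_mono) auto
    with C(2)[OF that, of x] show ?thesis by simp
  qed
  \<comment> \<open>With C+1 in place of C a single constant also covers the last claim, in which C
    does not occur.\<close>
  have IC: "(\<integral>\<^sup>+x. ennreal (C * (1 + norm (x::real^'n)) powr (- (real CARD('n) + L - l))) \<partial>lborel) \<le> ennreal ((C + 1) * J)"
  proof -
    have "(\<integral>\<^sup>+x. ennreal (C * (1 + norm (x::real^'n)) powr (- (real CARD('n) + L - l))) \<partial>lborel) = ennreal C * I"
      unfolding I_def using C(1) by (simp add: ennreal_mult nn_integral_cmult)
    then show ?thesis using C(1) J by (simp add: mult_right_mono flip: ennreal_mult)
  qed
  show ?thesis
  proof
    show "0 \<le> (C + 1) * J" using C(1) J by simp
    fix "is" :: "'n list" assume l: "length is \<le> \<gamma>"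
    have "\<bar>D\<Phi> is x\<bar> * norm x powr l \<le> C * (1 + norm x) powr (- (real CARD('n) + L - l))" for x
    proof -
      have "\<bar>D\<Phi> is x\<bar> * norm x powr l \<le> C * (1 + norm x) powr (- (real CARD('n) + L)) * norm x powr l"
        by (rule mult_right_mono[OF lt[OF l]]) simp
      also have "\<dots> \<le> C * (1 + norm x) powr (- (real CARD('n) + L - l))"
        using w[of x] C(1) by (simp add: mult.assoc mult.commute[of _ "norm x powr l"])
      finally show ?thesis .
    qed
    then have "(\<integral>\<^sup>+x. ennreal (\<bar>D\<Phi> is x\<bar> * norm x powr l) \<partial>lborel) \<le> (\<integral>\<^sup>+x. ennreal (C * (1 + norm (x::real^'n)) powr (- (real CARD('n) + L - l))) \<partial>lborel)"
      by (intro nn_integral_mono ennreal_leI)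
    with IC show "(\<integral>\<^sup>+x. ennreal (\<bar>D\<Phi> is x\<bar> * norm x powr l) \<partial>lborel) \<le> ennreal ((C + 1) * J)" by simp
    have "\<bar>D\<Phi> is x\<bar> \<le> C * (1 + norm x) powr (- (real CARD('n) + L - l))" for x
    proof -
      have "C * (1 + norm x) powr (- (real CARD('n) + L)) \<le> C * (1 + norm x) powr (- (real CARD('n) + L - l))"
        using C(1) by (intro mult_left_mono w0) simp
      with lt[OF l, of x] show ?thesis by simp
    qed
    then have "(\<integral>\<^sup>+x. ennreal \<bar>D\<Phi> is x\<bar> \<partial>lborel) \<le> (\<integral>\<^sup>+x. ennreal (C * (1 + norm (x::real^'n)) powr (- (real CARD('n) + L - l))) \<partial>lborel)"
      by (intro nn_integral_mono ennreal_leI)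
    with IC show "(\<integral>\<^sup>+x. ennreal \<bar>D\<Phi> is x\<bar> \<partial>lborel) \<le> ennreal ((C + 1) * J)" by simp
  next
    have "(\<integral>\<^sup>+x. ennreal (norm (x::real^'n) powr l * (1 + norm x) powr (- (real CARD('n) + L))) \<partial>lborel) \<le> I"
      unfolding I_def by (intro nn_integral_mono ennreal_leI w)
    also have "\<dots> \<le> ennreal ((C + 1) * J)" using C(1) J by (simp add: ennreal_leI mult_le_cancel_right1 algebra_simps)
    finally show "(\<integral>\<^sup>+x. ennreal (norm (x::real^'n) powr l * (1 + norm x) powr (- (real CARD('n) + L))) \<partial>lborel) \<le> ennreal ((C + 1) * J)" .
  qed
qed

lemma foldr_partial_G:
  assumes "0 < \<tau>" "length is \<le> \<gamma>"
  shows "foldr partial is (\<lambda>z. G z \<tau>) = \<kappa> is \<tau>"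
proof -
  have a: "1 / \<tau> powr (1 / d) = \<tau> powr (- 1 / d)" using assms(1) by (simp add: powr_minus divide_inverse)
  have "(\<lambda>z. G z \<tau>) = (\<lambda>z. \<tau> powr (- real CARD('n) / d) * \<Phi> (\<tau> powr (- 1 / d) *\<^sub>R z))"
    unfolding \<Phi>_def a[symmetric]
    by (intro ext G[unfolded condition_G_def, THEN conjunct2, THEN conjunct1, rule_format] assms(1))
  then have "foldr partial is (\<lambda>z. G z \<tau>) = (\<lambda>x. \<tau> powr (- real CARD('n) / d) * (\<tau> powr (- 1 / d)) ^ length is * foldr partial is \<Phi> (\<tau> powr (- 1 / d) *\<^sub>R x))"
    using foldr_partial_scale[OF Ck_\<Phi> assms(2)] by simp
  also have "\<tau> powr (- real CARD('n) / d) * (\<tau> powr (- 1 / d)) ^ length is = \<tau> powr (- (real CARD('n) + real (length is)) / d)"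
    using assms(1) by (simp add: powr_power powr_add[symmetric] diff_divide_distrib add_divide_distrib)
  finally show ?thesis by (simp add: \<kappa>_def[abs_def] D\<Phi>_def)
qed

lemma G_eq_\<kappa>: "0 < \<tau> \<Longrightarrow> G x \<tau> = \<kappa> [] \<tau> x"
  using foldr_partial_G[of \<tau> "[]"] by (simp add: fun_eq_iff)

lemma \<kappa>_1: "\<kappa> is 1 = D\<Phi> is"
  by (simp add: \<kappa>_def fun_eq_iff)

lemma continuous_\<kappa>:
  assumes "length is \<le> \<gamma>"
  shows "continuous_on UNIV (\<kappa> is \<tau>)"
proof -
  have "continuous_on UNIV (\<lambda>x. D\<Phi> is (\<tau> powr (- 1 / d) *\<^sub>R x))"
    by (rule continuous_on_compose2[OF continuous_D\<Phi>[OF assms]]) (auto intro!: continuous_intros)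
  then show ?thesis unfolding \<kappa>_def[abs_def] by (intro continuous_intros)
qed

lemma borel_measurable_\<kappa>: "length is \<le> \<gamma> \<Longrightarrow> \<kappa> is \<tau> \<in> borel_measurable borel"
  by (rule borel_measurable_continuous_onI[OF continuous_\<kappa>])

lemma borel_measurable_\<kappa>_pair:
  assumes "length is \<le> \<gamma>" and [measurable]: "\<tau> \<in> borel_measurable M" "x \<in> borel_measurable M"
  shows "(\<lambda>z. \<kappa> is (\<tau> z) (x z)) \<in> borel_measurable M"
proof -
  note [measurable] = borel_measurable_D\<Phi>[OF assms(1)]
  show ?thesis unfolding \<kappa>_def by measurable
qed

lemma has_pd_\<kappa>:
  assumes "0 < \<tau>" "length is < \<gamma>"
  shows "has_pd i (\<kappa> is \<tau>) (\<kappa> (i # is) \<tau>)"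
proof -
  have "\<tau> powr (- (real CARD('n) + real (length is)) / d) * \<tau> powr (- 1 / d) = \<tau> powr (- (real CARD('n) + real (length (i # is))) / d)"
    using assms(1) by (simp add: powr_add[symmetric] diff_divide_distrib add_divide_distrib algebra_simps)
  with has_pd_scale[OF has_pd_D\<Phi>[OF assms(2), of i], of "\<tau> powr (- (real CARD('n) + real (length is)) / d)" "\<tau> powr (- 1 / d)"]
  show ?thesis by (simp only: \<kappa>_def[abs_def])
qed

lemma \<kappa>_bounded:
  assumes "0 < \<tau>"
  obtains C where "0 < C" "\<And>is x. length is \<le> \<gamma> \<Longrightarrow> \<bar>\<kappa> is \<tau> x\<bar> \<le> C * \<tau> powr (- (real CARD('n) + real (length is)) / d)"
    "\<And>is x. length is \<le> \<gamma> \<Longrightarrow> \<bar>\<kappa> is \<tau> x\<bar> \<le> C"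
proof -
  obtain C where C: "0 < C" "\<And>is x. length is \<le> \<gamma> \<Longrightarrow> \<bar>D\<Phi> is x\<bar> \<le> C" by (rule D\<Phi>_bounded) blast
  define C' where "C' = C + C * (\<Sum>j\<le>\<gamma>. \<tau> powr (- (real CARD('n) + real j) / d))"
  have 1: "\<bar>\<kappa> is \<tau> x\<bar> \<le> C * \<tau> powr (- (real CARD('n) + real (length is)) / d)" if "length is \<le> \<gamma>" for "is" x
    unfolding \<kappa>_def using C(2)[OF that] by (simp add: abs_mult mult.commute[of C] mult_left_mono)
  have CC: "C \<le> C'" using C(1) by (auto simp: C'_def intro!: mult_nonneg_nonneg sum_nonneg)
  have 2: "C * \<tau> powr (- (real CARD('n) + real (length is)) / d) \<le> C'" if "length is \<le> \<gamma>" for "is" :: "'n list"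
  proof -
    have "\<tau> powr (- (real CARD('n) + real (length is)) / d) \<le> (\<Sum>j\<le>\<gamma>. \<tau> powr (- (real CARD('n) + real j) / d))"
      using that by (intro member_le_sum[where f = "\<lambda>j. \<tau> powr (- (real CARD('n) + real j) / d)"]) auto
    then have "C * \<tau> powr (- (real CARD('n) + real (length is)) / d) \<le> C * (\<Sum>j\<le>\<gamma>. \<tau> powr (- (real CARD('n) + real j) / d))"
      using C(1) by (intro mult_left_mono) auto
    then show ?thesis using C(1) unfolding C'_def by linarith
  qed
  show ?thesis
  proof
    show "0 < C'" using C(1) CC by simp
    fix "is" :: "'n list" and x assume l: "length is \<le> \<gamma>"
    have "C * \<tau> powr (- (real CARD('n) + real (length is)) / d) \<le> C' * \<tau> powr (- (real CARD('n) + real (length is)) / d)"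
      by (rule mult_right_mono[OF CC]) simp
    then show "\<bar>\<kappa> is \<tau> x\<bar> \<le> C' * \<tau> powr (- (real CARD('n) + real (length is)) / d)" using 1[OF l, of x] by simp
    show "\<bar>\<kappa> is \<tau> x\<bar> \<le> C'" using 1[OF l, of x] 2[OF l] by simp
  qed
qed

lemma nn_integral_rescale:
  fixes f :: "real ^ 'n \<Rightarrow> ennreal"
  assumes "f \<in> borel_measurable borel" "0 < \<tau>"
  shows "(\<integral>\<^sup>+x. f x \<partial>lborel) = ennreal (\<tau> powr (real CARD('n) / d)) * (\<integral>\<^sup>+x. f (\<tau> powr (1 / d) *\<^sub>R x) \<partial>lborel)"
  using nn_integral_euclidean_affine[OF assms(1), of "\<tau> powr (1 / d)" 0] assms(2)
  by (simp add: powr_power ennreal_power)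

lemma rescale_cancel: "0 < \<tau> \<Longrightarrow> \<tau> powr (- 1 / d) *\<^sub>R \<tau> powr (1 / d) *\<^sub>R x = (x :: real ^ 'n)"
  by (simp add: powr_add[symmetric])

lemma \<kappa>_rescaled: "0 < \<tau> \<Longrightarrow> \<kappa> is \<tau> (\<tau> powr (1 / d) *\<^sub>R x) = \<tau> powr (- (real CARD('n) + real (length is)) / d) * D\<Phi> is x"
  by (simp only: \<kappa>_def rescale_cancel)

text \<open>Under x = \<tau>^(1/d) X, the exponents N/d of the Jacobian, -(N+j)/d of the amplitude
  and l/d of the weight add up to (l-j)/d, where j is the length of the list.\<close>

lemma \<kappa>_weighted:
  assumes l: "0 \<le> l" "l < L"
  obtains C where "0 \<le> C"
    "\<And>is \<tau>. length is \<le> \<gamma> \<Longrightarrow> 0 < \<tau> \<Longrightarrow>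
      (\<integral>\<^sup>+x. ennreal (\<bar>\<kappa> is \<tau> x\<bar> * norm x powr l) \<partial>lborel) \<le> ennreal (C * \<tau> powr ((l - real (length is)) / d))"
proof -
  obtain C where C: "0 \<le> C"
    "\<And>is. length is \<le> \<gamma> \<Longrightarrow> (\<integral>\<^sup>+x. ennreal (\<bar>D\<Phi> is x\<bar> * norm x powr l) \<partial>lborel) \<le> ennreal C"
    using D\<Phi>_weighted_integral[OF l] by metis
  show ?thesis
  proof
    show "0 \<le> C" by fact
    fix "is" :: "'n list" and \<tau> :: real assume s: "length is \<le> \<gamma>" and \<tau>: "0 < \<tau>"
    note [measurable] = borel_measurable_\<kappa>[OF s] borel_measurable_D\<Phi>[OF s]
    have eq: "\<bar>\<kappa> is \<tau> (\<tau> powr (1 / d) *\<^sub>R x)\<bar> * norm (\<tau> powr (1 / d) *\<^sub>R x) powr l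
      = \<tau> powr (- (real CARD('n) + real (length is)) / d + l / d) * (\<bar>D\<Phi> is x\<bar> * norm x powr l)" for x
    proof -
      have "norm (\<tau> powr (1 / d) *\<^sub>R x) powr l = \<tau> powr (l / d) * norm x powr l"
        using \<tau> by (simp add: powr_mult powr_powr)
      then show ?thesis unfolding \<kappa>_rescaled[OF \<tau>] powr_add by (simp add: abs_mult)
    qed
    have "(\<integral>\<^sup>+x. ennreal (\<bar>\<kappa> is \<tau> x\<bar> * norm x powr l) \<partial>lborel)
      = ennreal (\<tau> powr (real CARD('n) / d)) * (\<integral>\<^sup>+x. ennreal (\<bar>\<kappa> is \<tau> (\<tau> powr (1 / d) *\<^sub>R x)\<bar> * norm (\<tau> powr (1 / d) *\<^sub>R x) powr l) \<partial>lborel)"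
      by (rule nn_integral_rescale[OF _ \<tau>]) measurable
    also have "\<dots> = ennreal (\<tau> powr (real CARD('n) / d)) * (ennreal (\<tau> powr (- (real CARD('n) + real (length is)) / d + l / d)) * (\<integral>\<^sup>+x. ennreal (\<bar>D\<Phi> is x\<bar> * norm x powr l) \<partial>lborel))"
      unfolding eq by (simp add: ennreal_mult nn_integral_cmult)
    also have "\<dots> \<le> ennreal (\<tau> powr (real CARD('n) / d)) * (ennreal (\<tau> powr (- (real CARD('n) + real (length is)) / d + l / d)) * ennreal C)"
      using C(2)[OF s] by (intro mult_left_mono) auto
    also have "\<dots> = ennreal (C * (\<tau> powr (real CARD('n) / d) * \<tau> powr (- (real CARD('n) + real (length is)) / d + l / d)))"
      using C(1) by (simp add: mult_ac flip: ennreal_mult)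
    also have "\<tau> powr (real CARD('n) / d) * \<tau> powr (- (real CARD('n) + real (length is)) / d + l / d) = \<tau> powr ((l - real (length is)) / d)"
      using \<tau> by (simp add: powr_add[symmetric] diff_divide_distrib add_divide_distrib)
    finally show "(\<integral>\<^sup>+x. ennreal (\<bar>\<kappa> is \<tau> x\<bar> * norm x powr l) \<partial>lborel) \<le> ennreal (C * \<tau> powr ((l - real (length is)) / d))" .
  qed
qed

text \<open>The endpoint bounds at \<tau> = 1, boundedness and integrability, interpolate as |D|^p
  <= C^(p-1) |D|; scaling supplies the power of \<tau>.\<close>

lemma \<kappa>_Lq:
  assumes q: "1 \<le> q"
  obtains C where "0 \<le> C"
    "\<And>is \<tau>. length is \<le> \<gamma> \<Longrightarrow> 0 < \<tau> \<Longrightarrow>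
      Lq_le q (\<kappa> is \<tau>) (C * \<tau> powr (- (scal_exp TYPE('n) d q + real (length is) / d)))"
proof -
  obtain C where C: "0 < C" "\<And>is x. length is \<le> \<gamma> \<Longrightarrow> \<bar>D\<Phi> is x\<bar> \<le> C" by (rule D\<Phi>_bounded) blast
  show ?thesis
  proof (cases "q = \<infinity>")
    case True
    show ?thesis
    proof
      show "0 \<le> C" using C by simp
      fix "is" :: "'n list" and \<tau> :: real assume s: "length is \<le> \<gamma>" and \<tau>: "0 < \<tau>"
      have "\<bar>\<kappa> is \<tau> x\<bar> \<le> C * \<tau> powr (- (scal_exp TYPE('n) d q + real (length is) / d))" for x
      proof -
        have "- (real CARD('n) + real (length is)) / d = - (scal_exp TYPE('n) d q + real (length is) / d)"
          unfolding True scal_exp_infinity by (simp add: add_divide_distrib diff_divide_distrib)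
        then show ?thesis unfolding \<kappa>_def using C(2)[OF s] by (simp add: abs_mult mult.commute[of C] mult_left_mono)
      qed
      then show "Lq_le q (\<kappa> is \<tau>) (C * \<tau> powr (- (scal_exp TYPE('n) d q + real (length is) / d)))"
        using C(1) borel_measurable_\<kappa>[OF s] True by (simp add: Lq_le_def)
    qed
  next
    case False
    define p where "p = enn2real q"
    have p: "1 \<le> p" unfolding p_def by (rule enn2real_ge_1[OF q False])
    obtain J where J: "0 \<le> J" "\<And>is. length is \<le> \<gamma> \<Longrightarrow> (\<integral>\<^sup>+x. ennreal \<bar>D\<Phi> is x\<bar> \<partial>lborel) \<le> ennreal J"
      using D\<Phi>_weighted_integral[of 0] L by (metis order_refl)
    \<comment> \<open>The p-th root of the bound C^(p-1) J for the integral of the p-th power of a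
      derivative of the profile.\<close>
    define c where "c = (C powr (p - 1) * J) powr (1 / p)"
    show ?thesis
    proof
      show "0 \<le> c" by (simp add: c_def)
      fix "is" :: "'n list" and \<tau> :: real assume s: "length is \<le> \<gamma>" and \<tau>: "0 < \<tau>"
      note [measurable] = borel_measurable_\<kappa>[OF s] borel_measurable_D\<Phi>[OF s]
      define e where "e = - (real CARD('n) + real (length is)) / d"
      have Dp: "\<bar>D\<Phi> is x\<bar> powr p \<le> C powr (p - 1) * \<bar>D\<Phi> is x\<bar>" for x
      proof -
        have "\<bar>D\<Phi> is x\<bar> powr p = \<bar>D\<Phi> is x\<bar> powr (p - 1) * \<bar>D\<Phi> is x\<bar>"
          by (cases "D\<Phi> is x = 0") (auto simp: powr_diff)
        also have "\<dots> \<le> C powr (p - 1) * \<bar>D\<Phi> is x\<bar>"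
          using p C(2)[OF s] by (intro mult_right_mono powr_mono2) auto
        finally show ?thesis .
      qed
      have "(\<integral>\<^sup>+x. ennreal (\<bar>\<kappa> is \<tau> x\<bar> powr p) \<partial>lborel)
        = ennreal (\<tau> powr (real CARD('n) / d)) * (\<integral>\<^sup>+x. ennreal (\<bar>\<kappa> is \<tau> (\<tau> powr (1 / d) *\<^sub>R x)\<bar> powr p) \<partial>lborel)"
        by (rule nn_integral_rescale[OF _ \<tau>]) measurable
      also have "\<dots> = ennreal (\<tau> powr (real CARD('n) / d)) * (\<integral>\<^sup>+x. ennreal (\<tau> powr (e * p) * \<bar>D\<Phi> is x\<bar> powr p) \<partial>lborel)"
        unfolding \<kappa>_rescaled[OF \<tau>] e_def[symmetric] by (simp add: abs_mult powr_mult powr_powr)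
      also have "\<dots> \<le> ennreal (\<tau> powr (real CARD('n) / d)) * (\<integral>\<^sup>+x. ennreal (\<tau> powr (e * p) * C powr (p - 1)) * ennreal \<bar>D\<Phi> is x\<bar> \<partial>lborel)"
        by (intro mult_left_mono nn_integral_mono)
          (use Dp in \<open>auto simp: mult.assoc simp flip: ennreal_mult intro!: ennreal_leI mult_left_mono\<close>)
      also have "\<dots> = ennreal (\<tau> powr (real CARD('n) / d)) * (ennreal (\<tau> powr (e * p) * C powr (p - 1)) * (\<integral>\<^sup>+x. ennreal \<bar>D\<Phi> is x\<bar> \<partial>lborel))"
        by (simp add: nn_integral_cmult)
      also have "\<dots> \<le> ennreal (\<tau> powr (real CARD('n) / d)) * (ennreal (\<tau> powr (e * p) * C powr (p - 1)) * ennreal J)"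
        using J(2)[OF s] by (intro mult_left_mono) auto
      also have "\<dots> = ennreal ((\<tau> powr (real CARD('n) / d) * \<tau> powr (e * p)) * (C powr (p - 1) * J))"
        using J(1) by (simp add: mult_ac flip: ennreal_mult)
      also have "(\<tau> powr (real CARD('n) / d) * \<tau> powr (e * p)) * (C powr (p - 1) * J) = (c * \<tau> powr (- (scal_exp TYPE('n) d q + real (length is) / d))) powr p"
      proof -
        have "c powr p = C powr (p - 1) * J" using p J(1) by (simp add: c_def powr_powr)
        moreover have "real CARD('n) / d + e * p = - (scal_exp TYPE('n) d q + real (length is) / d) * p"
          using p d unfolding scal_exp_real[OF q False] p_def[symmetric] e_def by (simp add: field_simps)
        ultimately show ?thesis
          using \<tau> by (simp add: powr_mult powr_powr powr_add[symmetric])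
      qed
      finally show "Lq_le q (\<kappa> is \<tau>) (c * \<tau> powr (- (scal_exp TYPE('n) d q + real (length is) / d)))"
        using False \<open>0 \<le> c\<close> by (simp add: Lq_le_def p_def)
    qed
  qed
qed

lemma \<kappa>_L1:
  obtains C where "0 \<le> C"
    "\<And>is \<tau>. length is \<le> \<gamma> \<Longrightarrow> 0 < \<tau> \<Longrightarrow> Lq_le 1 (\<kappa> is \<tau>) (C * \<tau> powr (- real (length is) / d))"
proof -
  have "scal_exp TYPE('n) d 1 = 0" by (simp add: scal_exp_def)
  then show ?thesis using \<kappa>_Lq[of 1] that by auto
qed

lemma integrable_\<kappa>: "length is \<le> \<gamma> \<Longrightarrow> 0 < \<tau> \<Longrightarrow> integrable lborel (\<kappa> is \<tau>)"
  unfolding integrable_iff_Lq_le using \<kappa>_L1 by metis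

lemma conv_\<kappa>_has_pd:
  assumes "0 < \<tau>" "length is < \<gamma>" "integrable lborel u"
  shows "has_pd i (conv (\<kappa> is \<tau>) u) (conv (\<kappa> (i # is) \<tau>) u)"
proof -
  obtain C where C: "\<And>is x. length is \<le> \<gamma> \<Longrightarrow> \<bar>\<kappa> is \<tau> x\<bar> \<le> C" using \<kappa>_bounded[OF assms(1)] by metis
  show ?thesis
    by (rule conv_has_pd[OF has_pd_\<kappa>[OF assms(1,2)], where B = C and B' = C])
      (use assms C in \<open>auto intro!: borel_measurable_\<kappa>\<close>)
qed

lemma continuous_conv_\<kappa>:
  assumes "0 < \<tau>" "length is \<le> \<gamma>" "integrable lborel u"
  shows "continuous_on UNIV (conv (\<kappa> is \<tau>) u)"
proof -
  obtain C where C: "\<And>is x. length is \<le> \<gamma> \<Longrightarrow> \<bar>\<kappa> is \<tau> x\<bar> \<le> C" using \<kappa>_bounded[OF assms(1)] by metis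
  show ?thesis by (rule conv_continuous[OF continuous_\<kappa> C]) (use assms in auto)
qed

lemma foldr_partial_conv_\<kappa>:
  assumes "0 < \<tau>" "length is \<le> \<gamma>" "integrable lborel u"
  shows "foldr partial is (conv (\<kappa> [] \<tau>) u) = conv (\<kappa> is \<tau>) u"
  using assms(2)
proof (induction "is")
  case (Cons i "is")
  then show ?case
    using has_pd_imp_partial[OF conv_\<kappa>_has_pd[OF assms(1) _ assms(3), of "is" i]] by simp
qed simp

section \<open>Semigroup law and total mass\<close>

text \<open>The semigroup law differentiated in x, with all derivatives on one factor; commutativity
  of the convolution gives the second form.\<close>

lemma conv_\<kappa>_\<kappa>:
  assumes "0 < r" "0 < s" "length is \<le> \<gamma>"
  shows "conv (\<kappa> is r) (\<kappa> [] s) = \<kappa> is (r + s)" "conv (\<kappa> [] s) (\<kappa> is r) = \<kappa> is (r + s)"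
proof -
  note [measurable] = borel_measurable_\<kappa>
  have "\<kappa> [] (r + s) = conv (\<kappa> [] r) (\<kappa> [] s)"
  proof
    fix x
    have [measurable]: "(\<lambda>y. \<kappa> [] r (x - y)) \<in> borel_measurable borel"
      by (rule measurable_compose[OF _ borel_measurable_\<kappa>]) auto
    have "\<kappa> [] (r + s) x = G x (r + s)" using assms by (simp add: G_eq_\<kappa>)
    also have "\<dots> = (LINT y|lebesgue. G (x - y) (r + s - s) * G y s)"
      by (rule G[unfolded condition_G_def, THEN conjunct2, THEN conjunct2, THEN conjunct2, rule_format])
        (use assms in simp)
    also have "\<dots> = (LINT y|lebesgue. \<kappa> [] r (x - y) * \<kappa> [] s y)"
      using assms by (simp add: G_eq_\<kappa>)
    also have "\<dots> = conv (\<kappa> [] r) (\<kappa> [] s) x"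
      unfolding conv_def by (rule integral_completion) (simp add: borel_measurable_\<kappa>)
    finally show "\<kappa> [] (r + s) x = conv (\<kappa> [] r) (\<kappa> [] s) x" .
  qed
  moreover have "foldr partial is (\<kappa> [] (r + s)) = \<kappa> is (r + s)"
    using foldr_partial_G[of "r + s" "is"] assms G_eq_\<kappa>[of "r + s"] by simp
  ultimately show *: "conv (\<kappa> is r) (\<kappa> [] s) = \<kappa> is (r + s)"
    using foldr_partial_conv_\<kappa>[OF assms(1,3) integrable_\<kappa>[of "[]" s]] assms by simp
  then show "conv (\<kappa> [] s) (\<kappa> is r) = \<kappa> is (r + s)"
    using conv_commute[of "\<kappa> is r" "\<kappa> [] s"] assms borel_measurable_\<kappa> by simp
qed

definition m\<Phi> :: real where "m\<Phi> = (\<integral>x. \<Phi> x \<partial>lborel)"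

lemma \<Phi>_eq: "\<Phi> = \<kappa> [] 1" by (simp add: \<kappa>_1 D\<Phi>_def)

lemma integral_\<kappa>: "0 < \<tau> \<Longrightarrow> (\<integral>x. \<kappa> [] \<tau> x \<partial>lborel) = m\<Phi>"
proof -
  assume \<tau>: "0 < \<tau>"
  have "(\<integral>x. \<kappa> [] \<tau> x \<partial>lborel) = \<bar>\<tau> powr (1 / d)\<bar> ^ CARD('n) * (\<integral>x. \<kappa> [] \<tau> (0 + \<tau> powr (1 / d) *\<^sub>R x) \<partial>lborel)"
    using integral_euclidean_affine[of "\<kappa> [] \<tau>" "\<tau> powr (1 / d)" 0] borel_measurable_\<kappa>[of "[]" \<tau>] \<tau> by simp
  also have "\<dots> = \<tau> powr (real CARD('n) / d) * (\<tau> powr (- real CARD('n) / d) * m\<Phi>)"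
    using \<tau> by (simp add: \<kappa>_rescaled m\<Phi>_def powr_power D\<Phi>_def)
  also have "\<dots> = m\<Phi>" using \<tau> by (simp add: mult.assoc[symmetric] powr_add[symmetric])
  finally show ?thesis .
qed

text \<open>By the semigroup law \<open>G(x, 1 + \<epsilon>) = \<integral> \<Phi>(z) \<Phi>(x - \<epsilon>\<^sup>1\<^sup>/\<^sup>d z) dz\<close>; letting \<open>\<epsilon> \<rightarrow> 0\<close>
  gives \<open>\<Phi> = (\<integral> \<Phi>) \<Phi>\<close>. The kernel \<open>G = 0\<close> is not excluded by condition (G).\<close>

lemma mass_dichotomy: "m\<Phi> = 1 \<or> (\<forall>x. \<Phi> x = 0)"
proof -
  obtain C where C: "0 < C" "\<And>is x. length is \<le> \<gamma> \<Longrightarrow> \<bar>D\<Phi> is x\<bar> \<le> C" by (rule D\<Phi>_bounded) blast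
  have \<Phi>c: "continuous_on UNIV \<Phi>" using continuous_D\<Phi>[of "[]"] by (simp add: D\<Phi>_def)
  have [measurable]: "\<Phi> \<in> borel_measurable borel" using borel_measurable_D\<Phi>[of "[]"] by (simp add: D\<Phi>_def)
  have \<Phi>B: "\<bar>\<Phi> x\<bar> \<le> C" for x using C(2)[of "[]" x] by (simp add: D\<Phi>_def)
  have \<Phi>i: "integrable lborel \<Phi>" using integrable_\<kappa>[of "[]" 1] by (simp add: \<Phi>_eq)
  have "\<Phi> x = m\<Phi> * \<Phi> x" for x
  proof -
    define e where "e n = inverse (real (Suc n))" for n
    have e: "0 < e n" for n by (simp add: e_def)
    have e0: "e \<longlonglongrightarrow> 0" unfolding e_def by (rule LIMSEQ_inverse_real_of_nat)
    have eq: "\<kappa> [] (e n + 1) x = (\<integral>z. \<Phi> z * \<Phi> (x - e n powr (1 / d) *\<^sub>R z) \<partial>lborel)" for n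
    proof -
      have "\<kappa> [] (e n + 1) x = conv \<Phi> (\<kappa> [] (e n)) x"
        using conv_\<kappa>_\<kappa>(2)[of "e n" 1 "[]"] e[of n] by (simp add: \<Phi>_eq)
      also have "\<dots> = (\<integral>z. \<Phi> (x - z) * \<kappa> [] (e n) z \<partial>lborel)" by (simp add: conv_def)
      also have "\<dots> = \<bar>e n powr (1 / d)\<bar> ^ CARD('n) * (\<integral>z. \<Phi> (x - (0 + e n powr (1 / d) *\<^sub>R z)) * \<kappa> [] (e n) (0 + e n powr (1 / d) *\<^sub>R z) \<partial>lborel)"
        using integral_euclidean_affine[of "\<lambda>z. \<Phi> (x - z) * \<kappa> [] (e n) z" "e n powr (1 / d)" 0] borel_measurable_\<kappa>[of "[]" "e n"] e[of n] by simp
      also have "\<dots> = e n powr (real CARD('n) / d) * (e n powr (- real CARD('n) / d) * (\<integral>z. \<Phi> z * \<Phi> (x - e n powr (1 / d) *\<^sub>R z) \<partial>lborel))"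
      proof -
        have "\<Phi> (x - (0 + e n powr (1 / d) *\<^sub>R z)) * \<kappa> [] (e n) (0 + e n powr (1 / d) *\<^sub>R z)
          = e n powr (- real CARD('n) / d) * (\<Phi> z * \<Phi> (x - e n powr (1 / d) *\<^sub>R z))" for z
          using e[of n] by (simp add: \<kappa>_rescaled D\<Phi>_def)
        note eqz = this
        show ?thesis unfolding eqz using e[of n] by (simp add: powr_power)
      qed
      also have "\<dots> = (\<integral>z. \<Phi> z * \<Phi> (x - e n powr (1 / d) *\<^sub>R z) \<partial>lborel)"
        using e[of n] by (simp add: mult.assoc[symmetric] powr_add[symmetric])
      finally show ?thesis .
    qed
    have "(\<lambda>n. (e n + 1) powr (- real CARD('n) / d) * \<Phi> ((e n + 1) powr (- 1 / d) *\<^sub>R x)) \<longlonglongrightarrow> (0 + 1) powr (- real CARD('n) / d) * \<Phi> ((0 + 1) powr (- 1 / d) *\<^sub>R x)"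
      by (intro tendsto_intros e0 continuous_on_tendsto_compose[OF \<Phi>c]) auto
    then have l1: "(\<lambda>n. \<kappa> [] (e n + 1) x) \<longlonglongrightarrow> \<Phi> x" by (simp add: \<kappa>_def D\<Phi>_def)
    have "(\<lambda>n. \<integral>z. \<Phi> z * \<Phi> (x - e n powr (1 / d) *\<^sub>R z) \<partial>lborel) \<longlonglongrightarrow> (\<integral>z. \<Phi> z * \<Phi> x \<partial>lborel)"
    proof (rule integral_dominated_convergence[where w = "\<lambda>z. C * \<bar>\<Phi> z\<bar>"])
      have e0': "(\<lambda>n. e n powr (1 / d)) \<longlonglongrightarrow> 0"
        using tendsto_powr'[OF e0 tendsto_const[of "1 / d"]] d e by (auto simp: less_imp_le)
      show "AE z in lborel. (\<lambda>n. \<Phi> z * \<Phi> (x - e n powr (1 / d) *\<^sub>R z)) \<longlonglongrightarrow> \<Phi> z * \<Phi> x"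
      proof (intro AE_I2 tendsto_intros)
        fix z
        have "(\<lambda>n. x - e n powr (1 / d) *\<^sub>R z) \<longlonglongrightarrow> x - 0 *\<^sub>R z" by (intro tendsto_intros e0')
        then show "(\<lambda>n. \<Phi> (x - e n powr (1 / d) *\<^sub>R z)) \<longlonglongrightarrow> \<Phi> x"
          by (intro continuous_on_tendsto_compose[OF \<Phi>c]) auto
      qed
      show "AE z in lborel. norm (\<Phi> z * \<Phi> (x - e n powr (1 / d) *\<^sub>R z)) \<le> C * \<bar>\<Phi> z\<bar>" for n
        using \<Phi>B by (intro AE_I2) (auto simp: abs_mult mult.commute[of C] intro!: mult_left_mono)
    qed (use \<Phi>i in auto)
    then have "(\<lambda>n. \<kappa> [] (e n + 1) x) \<longlonglongrightarrow> m\<Phi> * \<Phi> x" by (simp add: eq m\<Phi>_def)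
    with l1 show ?thesis by (rule LIMSEQ_unique)
  qed
  then show ?thesis by (metis mult_cancel_right1)
qed

end

context scaling_kernel
begin

section \<open>Moments of the derivatives of the kernel\<close>

lemma integrable_mi_pow_mult:
  fixes h :: "real ^ 'n \<Rightarrow> real"
  assumes [measurable]: "h \<in> borel_measurable borel"
    and w: "(\<integral>\<^sup>+x. ennreal (\<bar>h x\<bar> * norm x powr real (mi_len \<alpha>)) \<partial>lborel) < \<infinity>"
  shows "integrable lborel (\<lambda>x. mi_pow x \<alpha> * h x)"
proof -
  have "(\<integral>\<^sup>+x. ennreal (norm (mi_pow x \<alpha> * h x)) \<partial>lborel) \<le> (\<integral>\<^sup>+x. ennreal (\<bar>h x\<bar> * norm x powr real (mi_len \<alpha>)) \<partial>lborel)"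
    by (rule nn_integral_mono_AE, use AE_abs_mi_pow_le[of \<alpha>] in eventually_elim)
      (auto simp: abs_mult mult.commute intro!: ennreal_leI mult_left_mono mult_right_mono)
  with w show ?thesis by (auto simp: integrable_iff_bounded intro: le_less_trans)
qed

lemma integrable_mi_pow_\<kappa>:
  assumes \<tau>: "0 < \<tau>" and hs: "length is \<le> \<gamma>" and hl: "real (mi_len \<alpha>) < L"
  shows "integrable lborel (\<lambda>x. mi_pow x \<alpha> * \<kappa> is \<tau> x)"
proof (rule \<kappa>_weighted[of "real (mi_len \<alpha>)"])
  fix C assume C: "\<And>is \<tau>. length is \<le> \<gamma> \<Longrightarrow> 0 < \<tau> \<Longrightarrow>
    (\<integral>\<^sup>+x. ennreal (\<bar>\<kappa> is \<tau> x\<bar> * norm x powr real (mi_len \<alpha>)) \<partial>lborel) \<le> ennreal (C * \<tau> powr ((real (mi_len \<alpha>) - real (length is)) / d))"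
  from C[OF hs \<tau>] show ?thesis
    by (intro integrable_mi_pow_mult borel_measurable_\<kappa>[OF hs]) (auto intro: le_less_trans)
qed (use hl in simp_all)

text \<open>Integration by parts trades the leading derivative, in direction i, for a factor
  -\<alpha> i and lowers \<alpha> i by one. If some direction occurs in the list more often than
  \<alpha> allows, a factor 0 is met; if the counts match, the factors build up (-1)^|\<alpha>|
  \<alpha>! and the total mass is left.\<close>

lemma \<kappa>_moments:
  assumes \<tau>: "0 < \<tau>" and s: "length is \<le> \<gamma>" and \<alpha>: "real (mi_len \<alpha>) < L"
  shows "(\<exists>i. \<alpha> i < count_list is i) \<Longrightarrow> (\<integral>x. mi_pow x \<alpha> * \<kappa> is \<tau> x \<partial>lborel) = 0"
    "count_list is = \<alpha> \<Longrightarrow> (\<integral>x. mi_pow x \<alpha> * \<kappa> is \<tau> x \<partial>lborel) = (-1) ^ mi_len \<alpha> * mi_fact \<alpha> * m\<Phi>"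
proof -
  note int = integrable_mi_pow_\<kappa>[OF \<tau>]
  have step: "(\<integral>x. mi_pow x \<alpha> * \<kappa> (i # is) \<tau> x \<partial>lborel) = - (real (\<alpha> i) * (\<integral>x. mi_pow x (\<alpha>(i := \<alpha> i - 1)) * \<kappa> is \<tau> x \<partial>lborel))"
    if "length is < \<gamma>" "real (mi_len \<alpha>) < L" for i "is" and \<alpha> :: "'n \<Rightarrow> nat"
  proof -
    have i1: "integrable lborel (\<lambda>x. real (\<alpha> i) * mi_pow x (\<alpha>(i := \<alpha> i - 1)) * \<kappa> is \<tau> x)"
    proof (cases "\<alpha> i = 0")
      case False
      then have "real (mi_len (\<alpha>(i := \<alpha> i - 1))) < L" using mi_len_upd[of \<alpha> i] that by simp
      then show ?thesis using int[of "is" "\<alpha>(i := \<alpha> i - 1)"] that by (simp add: mult.assoc)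
    qed simp
    have "(\<integral>x. mi_pow x \<alpha> * \<kappa> (i # is) \<tau> x \<partial>lborel) = - (\<integral>x. real (\<alpha> i) * mi_pow x (\<alpha>(i := \<alpha> i - 1)) * \<kappa> is \<tau> x \<partial>lborel)"
      by (rule integration_by_parts[OF has_pd_mi_pow has_pd_\<kappa>[OF \<tau> that(1)]])
        (use that i1 int[of "is" \<alpha>] int[of "i # is" \<alpha>] in \<open>auto intro!: continuous_intros continuous_mi_pow continuous_\<kappa>\<close>)
    then show ?thesis by (simp add: mult.assoc)
  qed
  show "(\<exists>i. \<alpha> i < count_list is i) \<Longrightarrow> (\<integral>x. mi_pow x \<alpha> * \<kappa> is \<tau> x \<partial>lborel) = 0"
    using s \<alpha>
  proof (induction "is" arbitrary: \<alpha>)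
    case (Cons i "is")
    show ?case
    proof (cases "\<alpha> i = 0")
      case False
      obtain k where "\<alpha> k < count_list (i # is) k" using Cons.prems by blast
      then have "\<exists>k. (\<alpha>(i := \<alpha> i - 1)) k < count_list is k" using False by (intro exI[of _ k]) (auto split: if_splits)
      moreover have "real (mi_len (\<alpha>(i := \<alpha> i - 1))) < L" using mi_len_upd[of \<alpha> i] Cons.prems False by simp
      ultimately show ?thesis using Cons step[of "is" \<alpha> i] by simp
    qed (use Cons step[of "is" \<alpha> i] in simp)
  qed simp
  show "count_list is = \<alpha> \<Longrightarrow> (\<integral>x. mi_pow x \<alpha> * \<kappa> is \<tau> x \<partial>lborel) = (-1) ^ mi_len \<alpha> * mi_fact \<alpha> * m\<Phi>"
    using s \<alpha>
  proof (induction "is" arbitrary: \<alpha>)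
    case Nil
    then have "\<alpha> = (\<lambda>_. 0)" by auto
    then show ?case using integral_\<kappa>[OF \<tau>] by (simp add: mi_pow_def mi_len_def mi_fact_def)
  next
    case (Cons i "is")
    have c: "count_list (i # is) k = \<alpha> k" for k using fun_cong[OF Cons.prems(1), of k] .
    have pos: "0 < \<alpha> i" using c[of i] by simp
    define \<beta> where "\<beta> = \<alpha>(i := \<alpha> i - 1)"
    have \<beta>: "Suc (mi_len \<beta>) = mi_len \<alpha>" "mi_fact \<alpha> = real (\<alpha> i) * mi_fact \<beta>"
      using mi_len_upd[of \<alpha> i, OF pos] mi_fact_upd[of \<alpha> i, OF pos] by (simp_all add: \<beta>_def)
    have b1: "count_list is = \<beta>"
    proof
      fix k show "count_list is k = \<beta> k" using c[of k] by (auto simp: \<beta>_def split: if_splits)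
    qed
    have b2: "real (mi_len \<beta>) < L" "length is \<le> \<gamma>" "length is < \<gamma>" using \<beta>(1) Cons.prems by auto
    have "(\<integral>x. mi_pow x \<alpha> * \<kappa> (i # is) \<tau> x \<partial>lborel) = - (real (\<alpha> i) * ((-1) ^ mi_len \<beta> * mi_fact \<beta> * m\<Phi>))"
    proof -
      have "(\<integral>x. mi_pow x \<beta> * \<kappa> is \<tau> x \<partial>lborel) = (-1) ^ mi_len \<beta> * mi_fact \<beta> * m\<Phi>"
        by (rule Cons.IH[OF b1 b2(2,1)])
      then show ?thesis using step[OF b2(3) Cons.prems(3), of i] unfolding \<beta>_def[symmetric] by simp
    qed
    then show ?case by (simp add: \<beta>(2) \<beta>(1)[symmetric])
  qed
qed

lemma g_kernel_eq:
  assumes "mi_len \<alpha> \<le> \<gamma>" "-1 < t"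
  shows "g_kernel G \<alpha> t x = (-1) ^ mi_len \<alpha> / mi_fact \<alpha> * \<kappa> (mi_list \<alpha>) (t + 1) x"
  using foldr_partial_G[of "t + 1" "mi_list \<alpha>"] assms by (simp add: g_kernel_def mpartial_eq)

end

section \<open>Moments and the projection \<open>P\<^sub>K\<close>\<close>

lemma finite_mi_upto: "finite (mi_upto k :: ('n::finite \<Rightarrow> nat) set)"
  by (rule finite_subset[OF _ finite_mi_len[of "nat \<lfloor>k\<rfloor>"]]) (auto simp: mi_upto_def le_nat_floor)

lemma mi_len_mono: "\<beta> \<le> \<alpha> \<Longrightarrow> mi_len \<beta> \<le> mi_len \<alpha>"
  unfolding mi_len_def by (intro sum_mono) (simp add: le_fun_def)

lemma mi_len_strict_mono:
  assumes "\<beta> \<le> \<alpha>" "\<beta> \<noteq> \<alpha>"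
  shows "mi_len \<beta> < mi_len \<alpha>"
proof -
  have le: "\<And>i. \<beta> i \<le> \<alpha> i" using assms by (simp add: le_fun_def)
  then obtain i where "\<beta> i < \<alpha> i" using assms(2) by (metis ext nat_less_le)
  then show ?thesis unfolding mi_len_def by (intro sum_strict_mono_ex1) (auto simp: le)
qed

lemma finite_mi_below: "finite {\<beta>::'n::finite \<Rightarrow> nat. \<beta> \<le> \<alpha> \<and> P \<beta>}"
  by (rule finite_subset[OF _ finite_mi_len[of "mi_len \<alpha>"]]) (auto intro: mi_len_mono)

text \<open>Only the homogeneous part |x|^l of the weight 1+|x|^l: it scales, and the L^1 part is
  tracked separately by \<open>Lq_le 1\<close>.\<close>

definition wt :: "real \<Rightarrow> (real ^ 'n::finite \<Rightarrow> real) \<Rightarrow> ennreal" where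
  "wt l h = (\<integral>\<^sup>+x. ennreal (\<bar>h x\<bar> * norm x powr l) \<partial>lborel)"

lemma wt_0:
  fixes h :: "real ^ 'n::finite \<Rightarrow> real"
  shows "wt 0 h = (\<integral>\<^sup>+x. ennreal \<bar>h x\<bar> \<partial>lborel)"
  unfolding wt_def
  by (rule nn_integral_cong_AE, use AE_lborel_singleton[of "0 :: real ^ 'n"] in eventually_elim) simp

text \<open>Splits at |x| = R: inside, |x|^l <= R^l; outside, |x|^l <= R^(l-k) |x|^k. The radius
  stays free so that it can be matched to the time scale.\<close>

lemma wt_interpolation:
  fixes h :: "real ^ 'n::finite \<Rightarrow> real"
  assumes [measurable]: "h \<in> borel_measurable borel" and l: "0 \<le> l" "l \<le> k" and R: "0 < R"
  shows "wt l h \<le> ennreal (R powr l) * (\<integral>\<^sup>+x. ennreal \<bar>h x\<bar> \<partial>lborel) + ennreal (R powr (l - k)) * wt k h"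
proof -
  have p: "norm x powr l \<le> R powr l + R powr (l - k) * norm x powr k" for x :: "real ^ 'n"
  proof (cases "norm x \<le> R")
    case True
    then have "norm x powr l \<le> R powr l" using l by (intro powr_mono2) auto
    moreover have "0 \<le> R powr (l - k) * norm x powr k" by simp
    ultimately show ?thesis by linarith
  next
    case False
    then have "norm x powr l = norm x powr (l - k) * norm x powr k" by (simp add: powr_diff)
    also have "\<dots> \<le> R powr (l - k) * norm x powr k"
      using False l R by (intro mult_right_mono powr_mono2') auto
    also have "\<dots> \<le> R powr l + R powr (l - k) * norm x powr k" by simp
    finally show ?thesis .
  qed
  have "wt l h \<le> (\<integral>\<^sup>+x. ennreal (R powr l) * ennreal \<bar>h x\<bar> + ennreal (R powr (l - k)) * ennreal (\<bar>h x\<bar> * norm x powr k) \<partial>lborel)"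
    unfolding wt_def
  proof (rule nn_integral_mono)
    fix x
    have "\<bar>h x\<bar> * norm x powr l \<le> \<bar>h x\<bar> * (R powr l + R powr (l - k) * norm x powr k)"
      using p by (rule mult_left_mono) simp
    also have "\<dots> = R powr l * \<bar>h x\<bar> + R powr (l - k) * (\<bar>h x\<bar> * norm x powr k)" by (simp add: algebra_simps)
    finally show "ennreal (\<bar>h x\<bar> * norm x powr l) \<le> ennreal (R powr l) * ennreal \<bar>h x\<bar> + ennreal (R powr (l - k)) * ennreal (\<bar>h x\<bar> * norm x powr k)"
      by (simp add: ennreal_leI flip: ennreal_mult ennreal_plus)
  qed
  also have "\<dots> = ennreal (R powr l) * (\<integral>\<^sup>+x. ennreal \<bar>h x\<bar> \<partial>lborel) + ennreal (R powr (l - k)) * wt k h"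
    unfolding wt_def by (simp add: nn_integral_add nn_integral_cmult)
  finally show ?thesis .
qed

lemma lebesgue_integral_borel:
  fixes h :: "'a::euclidean_space \<Rightarrow> real"
  shows "h \<in> borel_measurable borel \<Longrightarrow> (LINT x|lebesgue. h x) = (\<integral>x. h x \<partial>lborel)"
  by (rule integral_completion) simp

locale duhamel_kernel = scaling_kernel G \<gamma> d L for G :: "real ^ 'n::finite \<Rightarrow> real \<Rightarrow> real" and \<gamma> d L +
  fixes K :: real
  assumes K: "0 \<le> K" "K < L" and K\<gamma>: "\<lfloor>K\<rfloor> + 1 \<le> int \<gamma>"
begin

definition k0 :: nat where "k0 = nat \<lfloor>K\<rfloor>"

lemma k0: "real k0 \<le> K" "K < real k0 + 1" "k0 < \<gamma>"
  using K K\<gamma> unfolding k0_def by linarith+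

lemma mi_upto_len: "\<alpha> \<in> mi_upto K \<Longrightarrow> mi_len \<alpha> \<le> k0"
  unfolding mi_upto_def k0_def by (simp add: le_nat_floor)

lemma mi_upto_\<gamma>: "\<alpha> \<in> mi_upto K \<Longrightarrow> mi_len \<alpha> \<le> \<gamma>"
  using mi_upto_len[of \<alpha>] k0 by simp

lemma mi_upto_L: "\<alpha> \<in> mi_upto K \<Longrightarrow> real (mi_len \<alpha>) < L"
  using K unfolding mi_upto_def by simp

lemma mi_upto_below: "\<alpha> \<in> mi_upto K \<Longrightarrow> \<beta> \<le> \<alpha> \<Longrightarrow> \<beta> \<in> mi_upto K"
  using mi_len_mono[of \<beta> \<alpha>] unfolding mi_upto_def by simp

text \<open>The bounds on a time slice \<open>h = f(s)\<close> that are contained in \<open>E\<^sub>K\<^sub>,\<^sub>q[f](s) = e\<close>.\<close>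

definition slice :: "(real ^ 'n \<Rightarrow> real) \<Rightarrow> real \<Rightarrow> real \<Rightarrow> bool" where
  "slice h s e \<longleftrightarrow> Lq_le 1 h ((1 + s) powr (- K / d) * e) \<and> wt K h \<le> ennreal e"

text \<open>Interpolation at R = (1+s)^(1/d), the length scale of the kernel at time 1+s: both terms
  become (1+s)^((l-K)/d) e, hence the factor 2.\<close>

lemma slice_wt:
  assumes h: "slice h s e" and s: "0 \<le> s" and l: "0 \<le> l" "l \<le> K" and e: "0 \<le> e"
  shows "wt l h \<le> ennreal (2 * (1 + s) powr ((l - K) / d) * e)"
proof -
  have [measurable]: "h \<in> borel_measurable borel" using h by (auto simp: slice_def Lq_le_1_iff)
  have h1: "(\<integral>\<^sup>+x. ennreal \<bar>h x\<bar> \<partial>lborel) \<le> ennreal ((1 + s) powr (- K / d) * e)"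
    and h2: "wt K h \<le> ennreal e" using h by (auto simp: slice_def Lq_le_1_iff)
  define R where "R = (1 + s) powr (1 / d)"
  have R: "0 < R" using s by (simp add: R_def)
  have "wt l h \<le> ennreal (R powr l) * (\<integral>\<^sup>+x. ennreal \<bar>h x\<bar> \<partial>lborel) + ennreal (R powr (l - K)) * wt K h"
    by (rule wt_interpolation) (use l R in auto)
  also have "\<dots> \<le> ennreal (R powr l) * ennreal ((1 + s) powr (- K / d) * e) + ennreal (R powr (l - K)) * ennreal e"
    using h1 h2 by (intro add_mono mult_left_mono) auto
  also have "\<dots> = ennreal (R powr l * ((1 + s) powr (- K / d) * e) + R powr (l - K) * e)"
    using e by (simp flip: ennreal_mult ennreal_plus)
  also have "R powr l * ((1 + s) powr (- K / d) * e) + R powr (l - K) * e = 2 * (1 + s) powr ((l - K) / d) * e"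
    by (simp add: R_def powr_powr powr_add[symmetric] mult.assoc[symmetric] diff_divide_distrib)
  finally show ?thesis .
qed

lemma slice_integrable: "slice h s e \<Longrightarrow> integrable lborel h"
  unfolding slice_def integrable_iff_Lq_le by blast

lemma borel_measurable_g_kernel:
  assumes "\<alpha> \<in> mi_upto K" "0 \<le> s"
  shows "g_kernel G \<alpha> s \<in> borel_measurable borel"
proof -
  note [measurable] = borel_measurable_\<kappa>[of "mi_list \<alpha>" "s + 1"]
  have "g_kernel G \<alpha> s = (\<lambda>x. (-1) ^ mi_len \<alpha> / mi_fact \<alpha> * \<kappa> (mi_list \<alpha>) (s + 1) x)"
    by (intro ext g_kernel_eq) (use mi_upto_\<gamma> assms in auto)
  then show ?thesis using mi_upto_\<gamma>[OF assms(1)] by simp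
qed

lemma mi_fact_ge_1: "1 \<le> mi_fact \<alpha>"
  by (simp add: mi_fact_def prod_ge_1)

lemma abs_g_kernel_le:
  assumes "\<alpha> \<in> mi_upto K" "0 \<le> s"
  shows "\<bar>g_kernel G \<alpha> s x\<bar> \<le> \<bar>\<kappa> (mi_list \<alpha>) (s + 1) x\<bar>"
proof -
  have "\<bar>g_kernel G \<alpha> s x\<bar> = \<bar>\<kappa> (mi_list \<alpha>) (s + 1) x\<bar> / mi_fact \<alpha>"
    using g_kernel_eq[of \<alpha> s x] mi_upto_\<gamma>[of \<alpha>] assms mi_fact_pos[of \<alpha>] by (simp add: abs_mult power_abs)
  also have "\<dots> \<le> \<bar>\<kappa> (mi_list \<alpha>) (s + 1) x\<bar> / 1"
    using mi_fact_ge_1[of \<alpha>] mi_fact_pos[of \<alpha>] by (intro divide_left_mono) auto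
  finally show ?thesis by simp
qed

lemma moment_borel:
  assumes [measurable]: "h \<in> borel_measurable borel" and \<alpha>: "\<alpha> \<in> mi_upto K" and s: "0 \<le> s"
  shows "moment G h s \<alpha> = (\<integral>x. mi_pow x \<alpha> * h x \<partial>lborel) -
     (\<Sum>\<beta> | \<beta> \<le> \<alpha> \<and> \<beta> \<noteq> \<alpha>. moment G h s \<beta> * (\<integral>x. mi_pow x \<alpha> * g_kernel G \<beta> s x \<partial>lborel))"
proof -
  have "(LINT x|lebesgue. mi_pow x \<alpha> * g_kernel G \<beta> s x) = (\<integral>x. mi_pow x \<alpha> * g_kernel G \<beta> s x \<partial>lborel)" if "\<beta> \<le> \<alpha>" for \<beta>
  proof -
    note [measurable] = borel_measurable_g_kernel[OF mi_upto_below[OF \<alpha> that] s]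
    show ?thesis by (rule lebesgue_integral_borel) measurable
  qed
  moreover have "(LINT x|lebesgue. mi_pow x \<alpha> * h x) = (\<integral>x. mi_pow x \<alpha> * h x \<partial>lborel)"
    by (rule lebesgue_integral_borel) measurable
  ultimately show ?thesis by (subst moment.simps) simp
qed

lemma g_moment_bound:
  assumes \<alpha>: "\<alpha> \<in> mi_upto K"
  obtains C where "0 \<le> C" "\<And>\<beta> s. \<beta> \<in> mi_upto K \<Longrightarrow> 0 \<le> s \<Longrightarrow>
    \<bar>\<integral>x. mi_pow x \<alpha> * g_kernel G \<beta> s x \<partial>lborel\<bar> \<le> C * (1 + s) powr ((real (mi_len \<alpha>) - real (mi_len \<beta>)) / d)"
proof (rule \<kappa>_weighted[of "real (mi_len \<alpha>)"])
  fix C assume C0: "0 \<le> C" and C: "\<And>is \<tau>. length is \<le> \<gamma> \<Longrightarrow> 0 < \<tau> \<Longrightarrow>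
    (\<integral>\<^sup>+x. ennreal (\<bar>\<kappa> is \<tau> x\<bar> * norm x powr real (mi_len \<alpha>)) \<partial>lborel) \<le> ennreal (C * \<tau> powr ((real (mi_len \<alpha>) - real (length is)) / d))"
  have "\<bar>\<integral>x. mi_pow x \<alpha> * g_kernel G \<beta> s x \<partial>lborel\<bar> \<le> C * (1 + s) powr ((real (mi_len \<alpha>) - real (mi_len \<beta>)) / d)"
    if \<beta>: "\<beta> \<in> mi_upto K" and s: "0 \<le> s" for \<beta> s
  proof -
    have "ennreal \<bar>\<integral>x. mi_pow x \<alpha> * g_kernel G \<beta> s x \<partial>lborel\<bar> \<le> (\<integral>\<^sup>+x. ennreal \<bar>mi_pow x \<alpha> * g_kernel G \<beta> s x\<bar> \<partial>lborel)"
      by (rule integral_abs_le_nn_integral)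
    also have "\<dots> \<le> (\<integral>\<^sup>+x. ennreal (\<bar>\<kappa> (mi_list \<beta>) (s + 1) x\<bar> * norm x powr real (mi_len \<alpha>)) \<partial>lborel)"
    proof (rule nn_integral_mono_AE, use AE_abs_mi_pow_le[of \<alpha>] in eventually_elim)
      fix x :: "real ^ 'n" assume "\<bar>mi_pow x \<alpha>\<bar> \<le> norm x powr real (mi_len \<alpha>)"
      then have "\<bar>mi_pow x \<alpha>\<bar> * \<bar>g_kernel G \<beta> s x\<bar> \<le> norm x powr real (mi_len \<alpha>) * \<bar>\<kappa> (mi_list \<beta>) (s + 1) x\<bar>"
        by (intro mult_mono abs_g_kernel_le \<beta> s) auto
      then show "ennreal \<bar>mi_pow x \<alpha> * g_kernel G \<beta> s x\<bar> \<le> ennreal (\<bar>\<kappa> (mi_list \<beta>) (s + 1) x\<bar> * norm x powr real (mi_len \<alpha>))"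
        by (intro ennreal_leI) (simp add: abs_mult mult.commute)
    qed
    also have "\<dots> \<le> ennreal (C * (s + 1) powr ((real (mi_len \<alpha>) - real (mi_len \<beta>)) / d))"
      using C[of "mi_list \<beta>" "s + 1"] mi_upto_\<gamma>[OF \<beta>] s by simp
    finally show ?thesis using C0 by (subst (asm) ennreal_le_iff) (auto simp: add.commute)
  qed
  with C0 that show ?thesis by blast
qed (use mi_upto_L[OF \<alpha>] in simp_all)

text \<open>Induction along the recursive definition. The moment of order \<beta> contributes the
  exponent (|\<beta>|-K)/d and the integral of x^\<alpha> g_\<beta> contributes
  (|\<alpha>|-|\<beta>|)/d, so |\<beta>| cancels and every term has the exponent of the
  claim.\<close>

lemma moment_bound:
  assumes "\<alpha> \<in> mi_upto K"
  shows "\<exists>C\<ge>0. \<forall>h s e. 0 \<le> s \<longrightarrow> 0 \<le> e \<longrightarrow> slice h s e \<longrightarrow>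
    \<bar>moment G h s \<alpha>\<bar> \<le> C * (1 + s) powr (- (K - real (mi_len \<alpha>)) / d) * e"
  using assms
proof (induction "mi_len \<alpha>" arbitrary: \<alpha> rule: less_induct)
  case less
  let ?B = "{\<beta>. \<beta> \<le> \<alpha> \<and> \<beta> \<noteq> \<alpha>}"
  have "\<forall>\<beta>\<in>?B. \<exists>C\<ge>0. \<forall>h s e. 0 \<le> s \<longrightarrow> 0 \<le> e \<longrightarrow> slice h s e \<longrightarrow>
    \<bar>moment G h s \<beta>\<bar> \<le> C * (1 + s) powr (- (K - real (mi_len \<beta>)) / d) * e"
    using less mi_upto_below mi_len_strict_mono by (metis (mono_tags, lifting) mem_Collect_eq)
  from bchoice[OF this] obtain c where cc: "\<forall>\<beta>\<in>?B. 0 \<le> c \<beta> \<and> (\<forall>h s e. 0 \<le> s \<longrightarrow> 0 \<le> e \<longrightarrow> slice h s e \<longrightarrow>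
    \<bar>moment G h s \<beta>\<bar> \<le> c \<beta> * (1 + s) powr (- (K - real (mi_len \<beta>)) / d) * e)" by blast
  have c0: "0 \<le> c \<beta>" if "\<beta> \<in> ?B" for \<beta> using cc that by blast
  have c: "\<bar>moment G h s \<beta>\<bar> \<le> c \<beta> * (1 + s) powr (- (K - real (mi_len \<beta>)) / d) * e"
    if "\<beta> \<in> ?B" "0 \<le> s" "0 \<le> e" "slice h s e" for \<beta> h s e using cc that by blast
  obtain C where C0: "0 \<le> C" and C: "\<And>\<beta> s. \<beta> \<in> mi_upto K \<Longrightarrow> 0 \<le> s \<Longrightarrow>
    \<bar>\<integral>x. mi_pow x \<alpha> * g_kernel G \<beta> s x \<partial>lborel\<bar> \<le> C * (1 + s) powr ((real (mi_len \<alpha>) - real (mi_len \<beta>)) / d)"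
    using g_moment_bound[OF less.prems] by blast
  \<comment> \<open>The 2 comes from \<open>slice_wt\<close> for the integral of h, the sum from the
    recursion.\<close>
  define A where "A = 2 + (\<Sum>\<beta>\<in>?B. c \<beta> * C)"
  have "\<bar>moment G h s \<alpha>\<bar> \<le> A * (1 + s) powr (- (K - real (mi_len \<alpha>)) / d) * e"
    if s: "0 \<le> s" and e: "0 \<le> e" and h: "slice h s e" for h s e
  proof -
    have hm[measurable]: "h \<in> borel_measurable borel" using h by (auto simp: slice_def Lq_le_1_iff)
    define p where "p = (1 + s) powr (- (K - real (mi_len \<alpha>)) / d)"
    have "ennreal \<bar>\<integral>x. mi_pow x \<alpha> * h x \<partial>lborel\<bar> \<le> (\<integral>\<^sup>+x. ennreal \<bar>mi_pow x \<alpha> * h x\<bar> \<partial>lborel)"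
      by (rule integral_abs_le_nn_integral)
    also have "\<dots> \<le> wt (real (mi_len \<alpha>)) h"
      unfolding wt_def
      by (rule nn_integral_mono_AE, use AE_abs_mi_pow_le[of \<alpha>] in eventually_elim)
        (auto simp: abs_mult mult.commute intro!: ennreal_leI mult_left_mono mult_right_mono)
    also have "\<dots> \<le> ennreal (2 * (1 + s) powr ((real (mi_len \<alpha>) - K) / d) * e)"
      by (rule slice_wt[OF h s _ _ e]) (use less.prems in \<open>auto simp: mi_upto_def\<close>)
    finally have 1: "\<bar>\<integral>x. mi_pow x \<alpha> * h x \<partial>lborel\<bar> \<le> 2 * p * e"
      using e by (subst (asm) ennreal_le_iff) (auto simp: p_def)
    have 2: "\<bar>\<Sum>\<beta>\<in>?B. moment G h s \<beta> * (\<integral>x. mi_pow x \<alpha> * g_kernel G \<beta> s x \<partial>lborel)\<bar> \<le> (\<Sum>\<beta>\<in>?B. c \<beta> * C * (p * e))"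
    proof (rule order_trans[OF sum_abs sum_mono])
      fix \<beta> assume \<beta>: "\<beta> \<in> ?B"
      have "\<bar>moment G h s \<beta> * (\<integral>x. mi_pow x \<alpha> * g_kernel G \<beta> s x \<partial>lborel)\<bar>
        \<le> (c \<beta> * (1 + s) powr (- (K - real (mi_len \<beta>)) / d) * e) * (C * (1 + s) powr ((real (mi_len \<alpha>) - real (mi_len \<beta>)) / d))"
        unfolding abs_mult
        using c[OF \<beta> s e h] C[of \<beta> s] mi_upto_below[OF less.prems, of \<beta>] \<beta> s c0[OF \<beta>] e
        by (intro mult_mono) auto
      also have "\<dots> = c \<beta> * C * (((1 + s) powr (- (K - real (mi_len \<beta>)) / d) * (1 + s) powr ((real (mi_len \<alpha>) - real (mi_len \<beta>)) / d)) * e)"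
        by (simp add: mult_ac)
      also have "(1 + s) powr (- (K - real (mi_len \<beta>)) / d) * (1 + s) powr ((real (mi_len \<alpha>) - real (mi_len \<beta>)) / d) = p"
        by (simp add: p_def powr_add[symmetric] add_divide_distrib[symmetric])
      finally show "\<bar>moment G h s \<beta> * (\<integral>x. mi_pow x \<alpha> * g_kernel G \<beta> s x \<partial>lborel)\<bar> \<le> c \<beta> * C * (p * e)" .
    qed
    have "\<bar>moment G h s \<alpha>\<bar> \<le> 2 * p * e + (\<Sum>\<beta>\<in>?B. c \<beta> * C * (p * e))"
      unfolding moment_borel[OF hm less.prems s] using 1 2 by linarith
    also have "\<dots> = A * p * e" by (simp add: A_def distrib_right sum_distrib_right mult.assoc)
    finally show ?thesis by (simp add: p_def)
  qed
  moreover have "0 \<le> A" unfolding A_def using c0 C0 by (intro add_nonneg_nonneg sum_nonneg mult_nonneg_nonneg) auto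
  ultimately show ?case by blast
qed

lemma moment_bound_uniform:
  obtains C where "0 \<le> C" "\<And>\<alpha> h s e. \<alpha> \<in> mi_upto K \<Longrightarrow> 0 \<le> s \<Longrightarrow> 0 \<le> e \<Longrightarrow> slice h s e \<Longrightarrow>
    \<bar>moment G h s \<alpha>\<bar> \<le> C * (1 + s) powr ((real (mi_len \<alpha>) - K) / d) * e"
proof -
  have "\<forall>\<alpha>\<in>(mi_upto K :: ('n \<Rightarrow> nat) set). \<exists>C\<ge>0. \<forall>h s e. 0 \<le> s \<longrightarrow> 0 \<le> e \<longrightarrow> slice h s e \<longrightarrow>
    \<bar>moment G h s \<alpha>\<bar> \<le> C * (1 + s) powr (- (K - real (mi_len \<alpha>)) / d) * e"
    using moment_bound by blast
  from bchoice[OF this] obtain c where cc: "\<forall>\<alpha>\<in>(mi_upto K :: ('n \<Rightarrow> nat) set). 0 \<le> c \<alpha> \<and> (\<forall>h s e. 0 \<le> s \<longrightarrow> 0 \<le> e \<longrightarrow> slice h s e \<longrightarrow>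
    \<bar>moment G h s \<alpha>\<bar> \<le> c \<alpha> * (1 + s) powr (- (K - real (mi_len \<alpha>)) / d) * e)" by blast
  have c0: "0 \<le> c \<alpha>" if "\<alpha> \<in> mi_upto K" for \<alpha> :: "'n \<Rightarrow> nat" using cc that by blast
  have c: "\<bar>moment G h s \<alpha>\<bar> \<le> c \<alpha> * (1 + s) powr (- (K - real (mi_len \<alpha>)) / d) * e"
    if "\<alpha> \<in> mi_upto K" "0 \<le> s" "0 \<le> e" "slice h s e" for \<alpha> h s e using cc that by blast
  define D where "D = (\<Sum>\<alpha>\<in>(mi_upto K :: ('n \<Rightarrow> nat) set). c \<alpha>)"
  have le: "c \<alpha> \<le> D" if "\<alpha> \<in> mi_upto K" for \<alpha>
    unfolding D_def using that c0 by (intro member_le_sum finite_mi_upto) auto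
  show ?thesis
  proof (rule that[of D])
    show "0 \<le> D" unfolding D_def using c0 by (rule sum_nonneg)
    fix \<alpha> :: "'n \<Rightarrow> nat" and h s e assume a: "\<alpha> \<in> mi_upto K" "0 \<le> s" "0 \<le> e" "slice h s e"
    have "\<bar>moment G h s \<alpha>\<bar> \<le> c \<alpha> * (1 + s) powr ((real (mi_len \<alpha>) - K) / d) * e"
      using c[OF a] by simp
    also have "\<dots> \<le> D * (1 + s) powr ((real (mi_len \<alpha>) - K) / d) * e"
      using le[OF a(1)] a by (intro mult_right_mono) auto
    finally show "\<bar>moment G h s \<alpha>\<bar> \<le> D * (1 + s) powr ((real (mi_len \<alpha>) - K) / d) * e" .
  qed
qed

lemma borel_measurable_P_op:
  assumes [measurable]: "h \<in> borel_measurable borel" and s: "0 \<le> s"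
  shows "P_op G K s h \<in> borel_measurable borel"
  unfolding P_op_def
  by (intro borel_measurable_diff borel_measurable_sum borel_measurable_times borel_measurable_const borel_measurable_g_kernel s)
    (use assms in auto)

text \<open>The integral of x^\<alpha> g_\<beta> is 0 unless \<beta> \<le> \<alpha>, and is 1 for
  \<beta> = \<alpha> thanks to the normalisation (-1)^|\<alpha>|/\<alpha>! and mass 1. Only the
  terms below \<alpha> survive, and the recursion for \<open>moment\<close> is exactly what makes
  them cancel the moment of h.\<close>

lemma P_op_moment:
  assumes m: "m\<Phi> = 1" and h: "slice h s e" and s: "0 \<le> s" and e: "0 \<le> e" and \<alpha>: "\<alpha> \<in> mi_upto K"
  shows "(\<integral>x. mi_pow x \<alpha> * P_op G K s h x \<partial>lborel) = 0"
proof -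
  have hm: "h \<in> borel_measurable borel" using h by (auto simp: slice_def Lq_le_1_iff)
  have s1: "-1 < s" "0 < s + 1" using s by auto
  have gi: "integrable lborel (\<lambda>x. mi_pow x \<alpha> * g_kernel G \<beta> s x)" if "\<beta> \<in> mi_upto K" for \<beta>
    using integrable_mi_pow_\<kappa>[OF s1(2), of "mi_list \<beta>" \<alpha>] mi_upto_\<gamma>[OF that] mi_upto_L[OF \<alpha>]
    by (simp add: g_kernel_eq s1 mult.left_commute[of "mi_pow _ _"])
  have gval: "(\<integral>x. mi_pow x \<alpha> * g_kernel G \<beta> s x \<partial>lborel)
    = (-1) ^ mi_len \<beta> / mi_fact \<beta> * (\<integral>x. mi_pow x \<alpha> * \<kappa> (mi_list \<beta>) (s + 1) x \<partial>lborel)" if "\<beta> \<in> mi_upto K" for \<beta>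
    using mi_upto_\<gamma>[OF that] by (simp add: g_kernel_eq s1 mult.left_commute[of "mi_pow _ _"])
  have g0: "(\<integral>x. mi_pow x \<alpha> * g_kernel G \<beta> s x \<partial>lborel) = 0" if "\<beta> \<in> mi_upto K" "\<not> \<beta> \<le> \<alpha>" for \<beta>
  proof -
    have "\<exists>i. \<alpha> i < count_list (mi_list \<beta>) i" using that(2) by (auto simp: le_fun_def not_le)
    then show ?thesis
      using \<kappa>_moments(1)[OF s1(2), of "mi_list \<beta>" \<alpha>] mi_upto_\<gamma>[OF that(1)] mi_upto_L[OF \<alpha>] gval[OF that(1)] by simp
  qed
  have g1: "(\<integral>x. mi_pow x \<alpha> * g_kernel G \<alpha> s x \<partial>lborel) = 1"
  proof -
    have "count_list (mi_list \<alpha>) = \<alpha>" by (simp add: fun_eq_iff)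
    then show ?thesis
      using \<kappa>_moments(2)[OF s1(2), of "mi_list \<alpha>" \<alpha>] mi_upto_\<gamma>[OF \<alpha>] mi_upto_L[OF \<alpha>] gval[OF \<alpha>] mi_fact_pos[of \<alpha>] m
      by (simp flip: power_add)
  qed
  have hi: "integrable lborel (\<lambda>x. mi_pow x \<alpha> * h x)"
  proof (rule integrable_mi_pow_mult[OF hm])
    have "wt (real (mi_len \<alpha>)) h \<le> ennreal (2 * (1 + s) powr ((real (mi_len \<alpha>) - K) / d) * e)"
      by (rule slice_wt[OF h s _ _ e]) (use \<alpha> in \<open>auto simp: mi_upto_def\<close>)
    then show "(\<integral>\<^sup>+x. ennreal (\<bar>h x\<bar> * norm x powr real (mi_len \<alpha>)) \<partial>lborel) < \<infinity>"
      unfolding wt_def by (auto intro: le_less_trans)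
  qed
  let ?B = "{\<beta>. \<beta> \<le> \<alpha> \<and> \<beta> \<noteq> \<alpha>}"
  let ?I = "\<lambda>\<beta>. (\<integral>x. mi_pow x \<alpha> * g_kernel G \<beta> s x \<partial>lborel)"
  have "(\<integral>x. mi_pow x \<alpha> * P_op G K s h x \<partial>lborel)
    = (\<integral>x. mi_pow x \<alpha> * h x - (\<Sum>\<beta>\<in>mi_upto K. moment G h s \<beta> * (mi_pow x \<alpha> * g_kernel G \<beta> s x)) \<partial>lborel)"
    unfolding P_op_def by (simp add: right_diff_distrib sum_distrib_left mult_ac)
  also have "\<dots> = (\<integral>x. mi_pow x \<alpha> * h x \<partial>lborel) - (\<Sum>\<beta>\<in>mi_upto K. moment G h s \<beta> * ?I \<beta>)"
    using hi gi by (subst Bochner_Integration.integral_diff) auto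
  also have "(\<Sum>\<beta>\<in>mi_upto K. moment G h s \<beta> * ?I \<beta>) = (\<Sum>\<beta>\<in>insert \<alpha> ?B. moment G h s \<beta> * ?I \<beta>)"
  proof (rule sum.mono_neutral_right[OF finite_mi_upto])
    show "insert \<alpha> ?B \<subseteq> mi_upto K" using \<alpha> mi_upto_below by auto
    show "\<forall>\<beta>\<in>mi_upto K - insert \<alpha> ?B. moment G h s \<beta> * ?I \<beta> = 0" using g0 by auto
  qed
  also have "\<dots> = moment G h s \<alpha> + (\<Sum>\<beta>\<in>?B. moment G h s \<beta> * ?I \<beta>)"
    using finite_mi_below[of \<alpha> "\<lambda>\<beta>. \<beta> \<noteq> \<alpha>"] g1 by simp
  also have "(\<integral>x. mi_pow x \<alpha> * h x \<partial>lborel) - (moment G h s \<alpha> + (\<Sum>\<beta>\<in>?B. moment G h s \<beta> * ?I \<beta>)) = 0"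
    using moment_borel[OF hm \<alpha> s] by simp
  finally show ?thesis .
qed

text \<open>In the term of \<alpha> the factor (1+s)^(|\<alpha>|/d) of the moment cancels against
  the decay of the kernel's derivative; what is left is (1+s)^(-\<sigma>-K/d), with
  (1+s)^(-\<sigma>) <= s^(-\<sigma>).\<close>

lemma P_op_Lq:
  assumes q: "1 \<le> q"
  obtains C where "0 \<le> C" "\<And>h s e. 0 < s \<Longrightarrow> 0 \<le> e \<Longrightarrow> slice h s e \<Longrightarrow>
    Lq_le q h (s powr (- scal_exp TYPE('n) d q) * (1 + s) powr (- K / d) * e) \<Longrightarrow>
    Lq_le q (P_op G K s h) (C * (s powr (- scal_exp TYPE('n) d q) * (1 + s) powr (- K / d) * e))"
proof -
  define \<sigma> where "\<sigma> = scal_exp TYPE('n) d q"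
  have \<sigma>: "0 \<le> \<sigma>" unfolding \<sigma>_def by (rule scal_exp_nonneg[OF d q])
  obtain C where C0: "0 \<le> C" and C: "\<And>is \<tau>. length is \<le> \<gamma> \<Longrightarrow> 0 < \<tau> \<Longrightarrow>
      Lq_le q (\<kappa> is \<tau>) (C * \<tau> powr (- (\<sigma> + real (length is) / d)))"
    using \<kappa>_Lq[OF q] unfolding \<sigma>_def by blast
  obtain M where M0: "0 \<le> M" and M: "\<And>\<alpha> h s e. \<alpha> \<in> mi_upto K \<Longrightarrow> 0 \<le> s \<Longrightarrow> 0 \<le> e \<Longrightarrow> slice h s e \<Longrightarrow>
    \<bar>moment G h s \<alpha>\<bar> \<le> M * (1 + s) powr ((real (mi_len \<alpha>) - K) / d) * e"
    using moment_bound_uniform by blast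
  define A where "A = 1 + real (card (mi_upto K :: ('n \<Rightarrow> nat) set)) * (M * C)"
  have "Lq_le q (P_op G K s h) (A * (s powr (- \<sigma>) * (1 + s) powr (- K / d) * e))"
    if s: "0 < s" and e: "0 \<le> e" and h: "slice h s e" and hq: "Lq_le q h (s powr (- \<sigma>) * (1 + s) powr (- K / d) * e)" for h s e
  proof -
    define B where "B = s powr (- \<sigma>) * (1 + s) powr (- K / d) * e"
    \<comment> \<open>The index type \<open>option\<close> joins h itself, as \<open>None\<close>,
      with the subtracted terms, so that one application of \<open>Lq_le_sum\<close>
      suffices.\<close>
    define H where "H i = (case i of None \<Rightarrow> h | Some \<alpha> \<Rightarrow> (\<lambda>x. moment G h s \<alpha> * g_kernel G \<alpha> s x))" for i
    define c where "c i = (case i of None \<Rightarrow> B | Some \<alpha> \<Rightarrow> M * C * B)" for i :: "('n \<Rightarrow> nat) option"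
    let ?I = "insert None (Some ` mi_upto K) :: ('n \<Rightarrow> nat) option set"
    have hm: "h \<in> borel_measurable borel" using h by (auto simp: slice_def Lq_le_1_iff)
    have trm: "Lq_le q (\<lambda>x. moment G h s \<alpha> * g_kernel G \<alpha> s x) (M * C * B)" if \<alpha>: "\<alpha> \<in> mi_upto K" for \<alpha>
    proof -
      define a where "a = moment G h s \<alpha> * ((-1) ^ mi_len \<alpha> / mi_fact \<alpha>)"
      have eq: "(\<lambda>x. moment G h s \<alpha> * g_kernel G \<alpha> s x) = (\<lambda>x. a * \<kappa> (mi_list \<alpha>) (s + 1) x)"
        using s mi_upto_\<gamma>[OF \<alpha>] by (intro ext) (simp add: a_def g_kernel_eq)
      have "\<bar>a\<bar> = \<bar>moment G h s \<alpha>\<bar> / mi_fact \<alpha>" using mi_fact_pos[of \<alpha>] by (simp add: a_def abs_mult power_abs)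
      also have "\<dots> \<le> \<bar>moment G h s \<alpha>\<bar> / 1" using mi_fact_ge_1[of \<alpha>] mi_fact_pos[of \<alpha>] by (intro divide_left_mono) auto
      also have "\<dots> \<le> M * (1 + s) powr ((real (mi_len \<alpha>) - K) / d) * e" using M[OF \<alpha> _ e h] s by simp
      finally have a: "\<bar>a\<bar> \<le> M * (1 + s) powr ((real (mi_len \<alpha>) - K) / d) * e" .
      have "Lq_le q (\<lambda>x. a * \<kappa> (mi_list \<alpha>) (s + 1) x) (\<bar>a\<bar> * (C * (s + 1) powr (- (\<sigma> + real (mi_len \<alpha>) / d))))"
        using Lq_le_cmult[OF C[of "mi_list \<alpha>" "s + 1"] q] s mi_upto_\<gamma>[OF \<alpha>] by simp
      moreover have "\<bar>a\<bar> * (C * (s + 1) powr (- (\<sigma> + real (mi_len \<alpha>) / d))) \<le> M * C * B"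
      proof -
        have "\<bar>a\<bar> * (C * (s + 1) powr (- (\<sigma> + real (mi_len \<alpha>) / d)))
          \<le> (M * (1 + s) powr ((real (mi_len \<alpha>) - K) / d) * e) * (C * (s + 1) powr (- (\<sigma> + real (mi_len \<alpha>) / d)))"
          using a C0 by (intro mult_right_mono) auto
        also have "\<dots> = M * C * (((1 + s) powr ((real (mi_len \<alpha>) - K) / d) * (1 + s) powr (- (\<sigma> + real (mi_len \<alpha>) / d))) * e)"
          by (simp add: mult_ac add.commute)
        also have "(1 + s) powr ((real (mi_len \<alpha>) - K) / d) * (1 + s) powr (- (\<sigma> + real (mi_len \<alpha>) / d)) = (1 + s) powr (- \<sigma>) * (1 + s) powr (- K / d)"
          unfolding powr_add[symmetric] by (simp add: diff_divide_distrib algebra_simps)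
        also have "M * C * (((1 + s) powr (- \<sigma>) * (1 + s) powr (- K / d)) * e) \<le> M * C * B"
          unfolding B_def using s \<sigma> e M0 C0 by (intro mult_left_mono mult_right_mono powr_mono2') auto
        finally show ?thesis .
      qed
      ultimately show ?thesis unfolding eq by (rule Lq_le_mono)
    qed
    have "Lq_le q (P_op G K s h) (\<Sum>i\<in>?I. c i)"
    proof (rule Lq_le_sum[where h = H])
      show "finite ?I" using finite_mi_upto by auto
      show "Lq_le q (H i) (c i)" if "i \<in> ?I" for i
        using that trm hq by (auto simp: H_def c_def B_def)
      show "P_op G K s h \<in> borel_measurable borel" using borel_measurable_P_op[OF hm] s by simp
      show "AE x in lborel. \<bar>P_op G K s h x\<bar> \<le> (\<Sum>i\<in>?I. \<bar>H i x\<bar>)"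
      proof (rule AE_I2)
        fix x
        have "(\<Sum>i\<in>?I. \<bar>H i x\<bar>) = \<bar>h x\<bar> + (\<Sum>\<alpha>\<in>mi_upto K. \<bar>moment G h s \<alpha> * g_kernel G \<alpha> s x\<bar>)"
          using finite_mi_upto[of K] by (subst sum.insert) (auto simp: H_def sum.reindex)
        then show "\<bar>P_op G K s h x\<bar> \<le> (\<Sum>i\<in>?I. \<bar>H i x\<bar>)"
          using sum_abs[of "\<lambda>\<alpha>. moment G h s \<alpha> * g_kernel G \<alpha> s x" "mi_upto K"] unfolding P_op_def by linarith
      qed
    qed (rule q)
    also have "(\<Sum>i\<in>?I. c i) = A * B"
      using finite_mi_upto[of K] by (subst sum.insert) (auto simp: c_def sum.reindex A_def algebra_simps)
    finally show ?thesis unfolding B_def .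
  qed
  moreover have "0 \<le> A" using M0 C0 by (simp add: A_def)
  ultimately show ?thesis using that unfolding \<sigma>_def by blast
qed

lemma P_op_L1:
  obtains C where "0 \<le> C" "\<And>h s e. 0 < s \<Longrightarrow> 0 \<le> e \<Longrightarrow> slice h s e \<Longrightarrow>
    Lq_le 1 (P_op G K s h) (C * (1 + s) powr (- K / d) * e)"
proof -
  have \<sigma>: "scal_exp TYPE('n) d 1 = 0" by (simp add: scal_exp_def)
  obtain C where C: "0 \<le> C" "\<And>h s e. 0 < s \<Longrightarrow> 0 \<le> e \<Longrightarrow> slice h s e \<Longrightarrow>
    Lq_le 1 h (s powr (- scal_exp TYPE('n) d 1) * (1 + s) powr (- K / d) * e) \<Longrightarrow>
    Lq_le 1 (P_op G K s h) (C * (s powr (- scal_exp TYPE('n) d 1) * (1 + s) powr (- K / d) * e))"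
    using P_op_Lq[of 1] by blast
  show ?thesis
  proof (rule that[OF C(1)])
    fix h s e assume a: "0 < s" "0 \<le> e" "slice h s e"
    show "Lq_le 1 (P_op G K s h) (C * (1 + s) powr (- K / d) * e)"
      using C(2)[OF a] a by (simp add: \<sigma> slice_def mult.assoc)
  qed
qed

text \<open>As for the L^q bound, |\<alpha>| cancels between moment and kernel, now leaving (l-K)/d;
  the 2 in the constant is that of \<open>slice_wt\<close>.\<close>

lemma P_op_wt:
  assumes l: "0 \<le> l" "l \<le> K"
  obtains C where "0 \<le> C" "\<And>h s e. 0 \<le> s \<Longrightarrow> 0 \<le> e \<Longrightarrow> slice h s e \<Longrightarrow>
    wt l (P_op G K s h) \<le> ennreal (C * (1 + s) powr ((l - K) / d) * e)"
proof -
  have lL: "l < L" using l K by simp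
  obtain C where C0: "0 \<le> C" and C: "\<And>is \<tau>. length is \<le> \<gamma> \<Longrightarrow> 0 < \<tau> \<Longrightarrow>
      wt l (\<kappa> is \<tau>) \<le> ennreal (C * \<tau> powr ((l - real (length is)) / d))"
    using \<kappa>_weighted[OF l(1) lL] unfolding wt_def by blast
  obtain M where M0: "0 \<le> M" and M: "\<And>\<alpha> h s e. \<alpha> \<in> mi_upto K \<Longrightarrow> 0 \<le> s \<Longrightarrow> 0 \<le> e \<Longrightarrow> slice h s e \<Longrightarrow>
    \<bar>moment G h s \<alpha>\<bar> \<le> M * (1 + s) powr ((real (mi_len \<alpha>) - K) / d) * e"
    using moment_bound_uniform by blast
  define A where "A = 2 + real (card (mi_upto K :: ('n \<Rightarrow> nat) set)) * (M * C)"
  have "wt l (P_op G K s h) \<le> ennreal (A * (1 + s) powr ((l - K) / d) * e)"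
    if s: "0 \<le> s" and e: "0 \<le> e" and h: "slice h s e" for h s e
  proof -
    have hm[measurable]: "h \<in> borel_measurable borel" using h by (auto simp: slice_def Lq_le_1_iff)
    define B where "B = (1 + s) powr ((l - K) / d) * e"
    have B0: "0 \<le> B" using e by (simp add: B_def)
    have s1: "0 < s + 1" using s by simp
    have \<kappa>m: "(\<lambda>x. ennreal (\<bar>\<kappa> (mi_list \<alpha>) (s + 1) x\<bar> * norm x powr l)) \<in> borel_measurable borel" if "\<alpha> \<in> mi_upto K" for \<alpha>
    proof -
      have "length (mi_list \<alpha>) \<le> \<gamma>" using mi_upto_\<gamma>[OF that] by simp
      note [measurable] = borel_measurable_\<kappa>[OF this, of "s + 1"]
      show ?thesis by measurable
    qed
    have "wt l (P_op G K s h) \<le> (\<integral>\<^sup>+x. ennreal (\<bar>h x\<bar> * norm x powr l)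
      + (\<Sum>\<alpha>\<in>mi_upto K. ennreal \<bar>moment G h s \<alpha>\<bar> * ennreal (\<bar>\<kappa> (mi_list \<alpha>) (s + 1) x\<bar> * norm x powr l)) \<partial>lborel)"
      unfolding wt_def
    proof (rule nn_integral_mono)
      fix x
      have "\<bar>P_op G K s h x\<bar> \<le> \<bar>h x\<bar> + (\<Sum>\<alpha>\<in>mi_upto K. \<bar>moment G h s \<alpha> * g_kernel G \<alpha> s x\<bar>)"
        using sum_abs[of "\<lambda>\<alpha>. moment G h s \<alpha> * g_kernel G \<alpha> s x" "mi_upto K"] unfolding P_op_def by linarith
      also have "\<dots> \<le> \<bar>h x\<bar> + (\<Sum>\<alpha>\<in>mi_upto K. \<bar>moment G h s \<alpha>\<bar> * \<bar>\<kappa> (mi_list \<alpha>) (s + 1) x\<bar>)"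
        unfolding abs_mult by (intro add_left_mono sum_mono mult_left_mono abs_g_kernel_le s) auto
      finally have "\<bar>P_op G K s h x\<bar> * norm x powr l \<le> (\<bar>h x\<bar> + (\<Sum>\<alpha>\<in>mi_upto K. \<bar>moment G h s \<alpha>\<bar> * \<bar>\<kappa> (mi_list \<alpha>) (s + 1) x\<bar>)) * norm x powr l"
        by (rule mult_right_mono) simp
      also have "\<dots> = \<bar>h x\<bar> * norm x powr l + (\<Sum>\<alpha>\<in>mi_upto K. \<bar>moment G h s \<alpha>\<bar> * (\<bar>\<kappa> (mi_list \<alpha>) (s + 1) x\<bar> * norm x powr l))"
        by (simp add: distrib_right sum_distrib_right mult.assoc)
      finally have "ennreal (\<bar>P_op G K s h x\<bar> * norm x powr l) \<le> ennreal (\<bar>h x\<bar> * norm x powr l + (\<Sum>\<alpha>\<in>mi_upto K. \<bar>moment G h s \<alpha>\<bar> * (\<bar>\<kappa> (mi_list \<alpha>) (s + 1) x\<bar> * norm x powr l)))"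
        by (rule ennreal_leI)
      also have "\<dots> = ennreal (\<bar>h x\<bar> * norm x powr l) + (\<Sum>\<alpha>\<in>mi_upto K. ennreal \<bar>moment G h s \<alpha>\<bar> * ennreal (\<bar>\<kappa> (mi_list \<alpha>) (s + 1) x\<bar> * norm x powr l))"
      proof -
        have "(\<Sum>\<alpha>\<in>mi_upto K. ennreal \<bar>moment G h s \<alpha>\<bar> * ennreal (\<bar>\<kappa> (mi_list \<alpha>) (s + 1) x\<bar> * norm x powr l))
          = ennreal (\<Sum>\<alpha>\<in>mi_upto K. \<bar>moment G h s \<alpha>\<bar> * (\<bar>\<kappa> (mi_list \<alpha>) (s + 1) x\<bar> * norm x powr l))"
          by (simp add: sum_ennreal flip: ennreal_mult)
        then show ?thesis by (simp add: sum_nonneg)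
      qed
      finally show "ennreal (\<bar>P_op G K s h x\<bar> * norm x powr l) \<le> ennreal (\<bar>h x\<bar> * norm x powr l) + (\<Sum>\<alpha>\<in>mi_upto K. ennreal \<bar>moment G h s \<alpha>\<bar> * ennreal (\<bar>\<kappa> (mi_list \<alpha>) (s + 1) x\<bar> * norm x powr l))" .
    qed
    also have "\<dots> = wt l h + (\<Sum>\<alpha>\<in>mi_upto K. ennreal \<bar>moment G h s \<alpha>\<bar> * wt l (\<kappa> (mi_list \<alpha>) (s + 1)))"
      unfolding wt_def using \<kappa>m
      by (subst nn_integral_add) (auto intro!: borel_measurable_sum borel_measurable_times_ennreal simp: nn_integral_sum nn_integral_cmult)
    also have "\<dots> \<le> ennreal (2 * B) + (\<Sum>\<alpha>\<in>(mi_upto K :: ('n \<Rightarrow> nat) set). ennreal (M * C * B))"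
    proof (intro add_mono sum_mono)
      show "wt l h \<le> ennreal (2 * B)" using slice_wt[OF h s l e] by (simp add: B_def mult.assoc)
      fix \<alpha> :: "'n \<Rightarrow> nat" assume \<alpha>: "\<alpha> \<in> mi_upto K"
      have "ennreal \<bar>moment G h s \<alpha>\<bar> * wt l (\<kappa> (mi_list \<alpha>) (s + 1))
        \<le> ennreal (M * (1 + s) powr ((real (mi_len \<alpha>) - K) / d) * e) * ennreal (C * (s + 1) powr ((l - real (mi_len \<alpha>)) / d))"
        using M[OF \<alpha> s e h] C[of "mi_list \<alpha>" "s + 1"] mi_upto_\<gamma>[OF \<alpha>] s1 by (intro mult_mono ennreal_leI) auto
      also have "\<dots> = ennreal (M * C * (((1 + s) powr ((real (mi_len \<alpha>) - K) / d) * (1 + s) powr ((l - real (mi_len \<alpha>)) / d)) * e))"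
        using M0 C0 e by (simp add: ennreal_mult[symmetric] mult_ac add.commute)
      also have "(1 + s) powr ((real (mi_len \<alpha>) - K) / d) * (1 + s) powr ((l - real (mi_len \<alpha>)) / d) = (1 + s) powr ((l - K) / d)"
        by (simp add: powr_add[symmetric] add_divide_distrib[symmetric])
      finally show "ennreal \<bar>moment G h s \<alpha>\<bar> * wt l (\<kappa> (mi_list \<alpha>) (s + 1)) \<le> ennreal (M * C * B)" by (simp add: B_def)
    qed
    also have "\<dots> = ennreal (A * B)"
      using M0 C0 B0 by (simp add: A_def ring_distribs ennreal_plus ennreal_mult ennreal_of_nat_eq_real_of_nat mult_ac)
    finally show ?thesis by (simp add: B_def mult.assoc)
  qed
  moreover have "0 \<le> A" using M0 C0 by (simp add: A_def)
  ultimately show ?thesis using that by blast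
qed

end

section \<open>Decay of the convolution with functions of vanishing moments\<close>

context duhamel_kernel
begin

text \<open>The monomial that multiplies \<open>D\<Phi> is\<close> in the Taylor expansion of
  \<Phi>(X - Y) in Y, hence the minus signs. Summing over lists of directions instead of
  multi-indices keeps the multinomial coefficients implicit: order m carries the plain factor
  1/m!.\<close>

definition lprod :: "real ^ 'n \<Rightarrow> 'n list \<Rightarrow> real" where
  "lprod Y is = prod_list (map (\<lambda>i. - Y $ i) is)"

lemma lprod_simps [simp]: "lprod Y [] = 1" "lprod Y (i # is) = - Y $ i * lprod Y is"
  by (simp_all add: lprod_def)

lemma lprod_eq: "lprod Y is = (-1) ^ length is * mi_pow Y (count_list is)"
proof (induction "is")
  case (Cons i "is")
  have "mi_pow Y (count_list (i # is)) = Y $ i * mi_pow Y (count_list is)"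
  proof -
    have "mi_pow Y (count_list (i # is)) = (\<Prod>k\<in>UNIV. (if k = i then Y $ i else 1) * (Y $ k) ^ count_list is k)"
      unfolding mi_pow_def by (intro prod.cong) auto
    also have "\<dots> = Y $ i * mi_pow Y (count_list is)" by (simp add: prod.distrib mi_pow_def)
    finally show ?thesis .
  qed
  with Cons show ?case by (simp del: count_list.simps)
qed (simp add: mi_pow_def)

lemma abs_lprod_le: "\<bar>lprod Y is\<bar> \<le> norm Y ^ length is"
  using abs_mi_pow_le[of Y "count_list is"] by (simp add: lprod_eq abs_mult power_abs length_eq_mi_len)

lemma lprod_scaleR: "lprod (c *\<^sub>R Y) is = c ^ length is * lprod Y is"
  by (induction "is") simp_all

lemma borel_measurable_lprod [measurable]: "(\<lambda>y. lprod y is) \<in> borel_measurable borel"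
  unfolding lprod_eq by measurable

definition lists_of :: "nat \<Rightarrow> 'n list set" where "lists_of m = {is. length is = m}"

lemma finite_lists_of: "finite (lists_of m)"
  using finite_lists_length_eq[of "UNIV :: 'n set" m] by (simp add: lists_of_def)

lemma sum_lists_of_Suc: "(\<Sum>is\<in>lists_of (Suc m). F is) = (\<Sum>is\<in>lists_of m. \<Sum>i\<in>UNIV. F (i # is))"
proof -
  have eq: "lists_of (Suc m) = (\<lambda>(is, i). i # is) ` (lists_of m \<times> UNIV)"
    by (auto simp: lists_of_def length_Suc_conv image_iff)
  have "(\<Sum>is\<in>lists_of (Suc m). F is) = (\<Sum>z\<in>lists_of m \<times> UNIV. F (snd z # fst z))"
    unfolding eq by (subst sum.reindex) (auto simp: inj_on_def case_prod_beta' intro!: sum.cong)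
  then show ?thesis by (simp add: sum.cartesian_product case_prod_beta')
qed

section \<open>Taylor remainder of the profile\<close>

text \<open>The remainder of \<Phi>(X - Y) after its Taylor polynomial in Y of order [K]; that
  polynomial has degree at most K in Y and is therefore annihilated by vanishing moments.\<close>

definition Rem :: "real ^ 'n \<Rightarrow> real ^ 'n \<Rightarrow> real" where
  "Rem X Y = \<Phi> (X - Y) - (\<Sum>m\<le>k0. (\<Sum>is\<in>lists_of m. lprod Y is * D\<Phi> is X) / fact m)"

text \<open>The one-dimensional Maclaurin formula for r |-> \<Phi>(X - rY) on [0,1]; the chain rule
  passes from lists of length m to those of length m+1.\<close>

lemma Rem_Taylor: "\<exists>t. 0 < t \<and> t < 1 \<and> Rem X Y = (\<Sum>is\<in>lists_of (Suc k0). lprod Y is * D\<Phi> is (X - t *\<^sub>R Y)) / fact (Suc k0)"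
proof -
  define diff where "diff m r = (\<Sum>is\<in>lists_of m. lprod Y is * D\<Phi> is (X - r *\<^sub>R Y))" for m r
  have der: "(diff m has_real_derivative diff (Suc m) r) (at r)" if m: "m < Suc k0" for m r
  proof -
    have D1: "((\<lambda>r. D\<Phi> is (X - r *\<^sub>R Y)) has_real_derivative (\<Sum>i\<in>UNIV. - Y $ i * D\<Phi> (i # is) (X - r *\<^sub>R Y))) (at r)"
      if "is \<in> lists_of m" for "is"
    proof -
      have "length is < \<gamma>" using that m k0 by (simp add: lists_of_def)
      then have "Ck_on (Suc (\<gamma> - Suc (length is))) UNIV (D\<Phi> is)"
        unfolding D\<Phi>_def using Ck_on_foldr_partial[OF Ck_\<Phi>, of "is"] by (simp add: Suc_diff_Suc)
      from Ck_on_Suc_partial(3)[OF this, of "X - r *\<^sub>R Y"]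
      have "(D\<Phi> is has_derivative (\<lambda>v. \<Sum>i\<in>UNIV. v $ i * D\<Phi> (i # is) (X - r *\<^sub>R Y))) (at (X - r *\<^sub>R Y))"
        by (simp add: D\<Phi>_def)
      moreover have "((\<lambda>r. X - r *\<^sub>R Y) has_derivative (\<lambda>h. - h *\<^sub>R Y)) (at r)"
        by (auto intro!: derivative_eq_intros)
      ultimately have "((\<lambda>r. D\<Phi> is (X - r *\<^sub>R Y)) has_derivative (\<lambda>h. \<Sum>i\<in>UNIV. (- h *\<^sub>R Y) $ i * D\<Phi> (i # is) (X - r *\<^sub>R Y))) (at r)"
        by (rule has_derivative_compose[rotated])
      moreover have "(\<lambda>h. \<Sum>i\<in>UNIV. (- h *\<^sub>R Y) $ i * D\<Phi> (i # is) (X - r *\<^sub>R Y)) = (*) (\<Sum>i\<in>UNIV. - Y $ i * D\<Phi> (i # is) (X - r *\<^sub>R Y))"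
        by (simp add: fun_eq_iff sum_distrib_left sum_distrib_right mult_ac sum_negf)
      ultimately show ?thesis by (simp add: has_field_derivative_def)
    qed
    have "(diff m has_real_derivative (\<Sum>is\<in>lists_of m. lprod Y is * (\<Sum>i\<in>UNIV. - Y $ i * D\<Phi> (i # is) (X - r *\<^sub>R Y)))) (at r)"
      unfolding diff_def[abs_def] by (intro DERIV_sum DERIV_cmult D1)
    also have "(\<Sum>is\<in>lists_of m. lprod Y is * (\<Sum>i\<in>UNIV. - Y $ i * D\<Phi> (i # is) (X - r *\<^sub>R Y))) = diff (Suc m) r"
      unfolding diff_def sum_lists_of_Suc by (simp add: sum_distrib_left mult_ac)
    finally show ?thesis .
  qed
  have "\<exists>t>0. t < 1 \<and> diff 0 1 = (\<Sum>m<Suc k0. diff m 0 / fact m * 1 ^ m) + diff (Suc k0) t / fact (Suc k0) * 1 ^ Suc k0"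
    by (rule Maclaurin) (use der in auto)
  then obtain t where t: "0 < t" "t < 1" "diff 0 1 = (\<Sum>m<Suc k0. diff m 0 / fact m) + diff (Suc k0) t / fact (Suc k0)"
    by (auto simp del: sum.lessThan_Suc fact_Suc)
  moreover have "diff 0 1 = \<Phi> (X - Y)"
    by (simp add: diff_def lists_of_def D\<Phi>_def)
  moreover have "(\<Sum>m<Suc k0. diff m 0 / fact m) = (\<Sum>m\<le>k0. (\<Sum>is\<in>lists_of m. lprod Y is * D\<Phi> is X) / fact m)"
    unfolding lessThan_Suc_atMost diff_def by simp
  ultimately show ?thesis
    unfolding Rem_def diff_def by (intro exI[of _ t]) (simp del: fact_Suc)
qed

text \<open>The Lagrange form evaluates derivatives at X - tY; as |tY| <= 1, 1+|X - tY| is at least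
  half of 1+|X|, which costs a factor 2^a with a = N+L.\<close>

lemma Rem_near:
  obtains C where "0 \<le> C" "\<And>X Y. norm Y \<le> 1 \<Longrightarrow> \<bar>Rem X Y\<bar> \<le> C * norm Y ^ Suc k0 * (1 + norm X) powr (- (real CARD('n) + L))"
proof -
  obtain C where C0: "0 < C" and C: "\<And>is x. length is \<le> \<gamma> \<Longrightarrow> \<bar>D\<Phi> is x\<bar> \<le> C * (1 + norm x) powr (- (real CARD('n) + L + real (length is)))"
    by (rule D\<Phi>_decay) blast
  define a where "a = real CARD('n) + L"
  have a0: "0 \<le> a" using L by (simp add: a_def)
  define A where "A = real (card (lists_of (Suc k0))) * (C * 2 powr a)"
  have "\<bar>Rem X Y\<bar> \<le> A * norm Y ^ Suc k0 * (1 + norm X) powr (- a)" if Y: "norm Y \<le> 1" for X Y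
  proof -
    obtain t where t: "0 < t" "t < 1" "Rem X Y = (\<Sum>is\<in>lists_of (Suc k0). lprod Y is * D\<Phi> is (X - t *\<^sub>R Y)) / fact (Suc k0)"
      using Rem_Taylor by blast
    have "norm X \<le> norm (X - t *\<^sub>R Y) + norm (t *\<^sub>R Y)" using norm_triangle_sub[of X "t *\<^sub>R Y"] by simp
    moreover have "norm (t *\<^sub>R Y) \<le> 1" using t Y by (simp add: mult_le_one)
    moreover have "(1 + c) / 2 \<le> 1 + a" if "c \<le> a + b" "b \<le> 1" "0 \<le> a" for a b c :: real
      using that by (simp add: field_simps)
    ultimately have half: "(1 + norm X) / 2 \<le> 1 + norm (X - t *\<^sub>R Y)" using norm_ge_zero by blast
    have pb: "(1 + norm (X - t *\<^sub>R Y)) powr (- a) \<le> 2 powr a * (1 + norm X) powr (- a)"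
    proof -
      have "(1 + norm (X - t *\<^sub>R Y)) powr (- a) \<le> ((1 + norm X) / 2) powr (- a)"
        using half a0 by (intro powr_mono2') (auto simp: add_pos_nonneg)
      also have "\<dots> = 2 powr a * (1 + norm X) powr (- a)"
        by (simp add: powr_divide powr_minus field_simps)
      finally show ?thesis .
    qed
    have "\<bar>\<Sum>is\<in>lists_of (Suc k0). lprod Y is * D\<Phi> is (X - t *\<^sub>R Y)\<bar> \<le> (\<Sum>is\<in>lists_of (Suc k0). norm Y ^ Suc k0 * (C * (2 powr a * (1 + norm X) powr (- a))))"
    proof (rule order_trans[OF sum_abs sum_mono])
      fix "is" assume "is \<in> lists_of (Suc k0)"
      then have l: "length is = Suc k0" "length is \<le> \<gamma>" using k0 by (auto simp: lists_of_def)
      have "(1 + norm (X - t *\<^sub>R Y)) powr (- (a + real (length is))) \<le> (1 + norm (X - t *\<^sub>R Y)) powr (- a)"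
        by (intro powr_mono) auto
      then have "\<bar>D\<Phi> is (X - t *\<^sub>R Y)\<bar> \<le> C * (1 + norm (X - t *\<^sub>R Y)) powr (- a)"
        using C[OF l(2), of "X - t *\<^sub>R Y"] C0 unfolding a_def by (meson mult_left_mono less_imp_le order_trans)
      also have "\<dots> \<le> C * (2 powr a * (1 + norm X) powr (- a))" using pb C0 by (intro mult_left_mono) auto
      finally show "\<bar>lprod Y is * D\<Phi> is (X - t *\<^sub>R Y)\<bar> \<le> norm Y ^ Suc k0 * (C * (2 powr a * (1 + norm X) powr (- a)))"
        unfolding abs_mult using abs_lprod_le[of Y "is"] l by (intro mult_mono) auto
    qed
    then have "\<bar>Rem X Y\<bar> \<le> (\<Sum>is\<in>lists_of (Suc k0). norm Y ^ Suc k0 * (C * (2 powr a * (1 + norm X) powr (- a)))) / fact (Suc k0)"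
      unfolding t(3) by (simp add: divide_right_mono del: fact_Suc power_Suc sum_constant)
    also have "\<dots> \<le> (\<Sum>is\<in>lists_of (Suc k0). norm Y ^ Suc k0 * (C * (2 powr a * (1 + norm X) powr (- a)))) / 1"
      using C0 by (intro divide_left_mono sum_nonneg mult_nonneg_nonneg fact_ge_1) auto
    also have "\<dots> = A * norm Y ^ Suc k0 * (1 + norm X) powr (- a)" by (simp add: A_def)
    finally show ?thesis .
  qed
  moreover have "0 \<le> A" using C0 by (simp add: A_def)
  ultimately show ?thesis using that unfolding a_def by blast
qed

text \<open>Equals r^([K]+1) on [0,1] and r^K beyond. The product form exhibits the gain over r^K as
  a factor that is at most 1 and vanishes as r -> 0.\<close>

definition rho :: "real \<Rightarrow> real" where
  "rho r = r powr K * min 1 (r powr (real (Suc k0) - K))"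

lemma rho_le_1: "0 \<le> r \<Longrightarrow> r \<le> 1 \<Longrightarrow> rho r = r ^ Suc k0"
proof (cases "r = 0")
  case False
  assume r: "0 \<le> r" "r \<le> 1"
  have "r powr (real (Suc k0) - K) \<le> 1" using r k0 by (intro powr_le1) auto
  then have "rho r = r powr real (Suc k0)" by (simp add: rho_def powr_add[symmetric])
  then show ?thesis using r False powr_realpow[of r "Suc k0"] by simp
qed (simp add: rho_def)

lemma rho_ge_1: "1 \<le> r \<Longrightarrow> rho r = r powr K"
proof -
  assume r: "1 \<le> r"
  have "1 \<le> r powr (real (Suc k0) - K)" using r k0 by (intro ge_one_powr_ge_zero) auto
  then show ?thesis by (simp add: rho_def)
qed

lemma borel_measurable_\<Phi> [measurable]: "\<Phi> \<in> borel_measurable borel"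
  using borel_measurable_\<kappa>[of "[]" 1] by (simp add: \<Phi>_eq)

lemma borel_measurable_Rem:
  assumes [measurable]: "f \<in> borel_measurable M" "g \<in> borel_measurable M"
  shows "(\<lambda>z. Rem (f z) (g z)) \<in> borel_measurable M"
proof -
  have [measurable]: "(\<lambda>z. D\<Phi> is (f z)) \<in> borel_measurable M" if "length is \<le> k0" for "is"
    using measurable_compose[OF assms(1) borel_measurable_D\<Phi>[of "is"]] that k0 by simp
  show ?thesis unfolding Rem_def
    by (intro borel_measurable_diff borel_measurable_sum borel_measurable_divide borel_measurable_times borel_measurable_const)
      (auto simp: lists_of_def)
qed

text \<open>For |Y| <= 1 the Taylor bound applies. For |Y| > 1 there is no cancellation to exploit:
  \<Phi>(X - Y) and the Taylor terms of each order m are bounded separately, all by multiples of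
  |Y|^K since m <= [K] <= K and l <= K.\<close>

lemma Rem_weighted:
  assumes l: "0 \<le> l" "l \<le> K"
  obtains C where "0 \<le> C" "\<And>Y. (\<integral>\<^sup>+X. ennreal (\<bar>Rem X Y\<bar> * norm X powr l) \<partial>lborel) \<le> ennreal (C * rho (norm Y))"
proof -
  have lL: "l < L" using l K by simp
  obtain J where J0: "0 \<le> J"
    and J1: "\<And>is. length is \<le> \<gamma> \<Longrightarrow> (\<integral>\<^sup>+x. ennreal (\<bar>D\<Phi> is x\<bar> * norm x powr l) \<partial>lborel) \<le> ennreal J"
    and J2: "\<And>is. length is \<le> \<gamma> \<Longrightarrow> (\<integral>\<^sup>+x. ennreal \<bar>D\<Phi> is x\<bar> \<partial>lborel) \<le> ennreal J"
    and J3: "(\<integral>\<^sup>+x. ennreal (norm (x::real^'n) powr l * (1 + norm x) powr (- (real CARD('n) + L))) \<partial>lborel) \<le> ennreal J"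
    using D\<Phi>_weighted_integral[OF l(1) lL] by blast
  obtain C where C0: "0 \<le> C" and C: "\<And>X Y. norm Y \<le> 1 \<Longrightarrow> \<bar>Rem X Y\<bar> \<le> C * norm Y ^ Suc k0 * (1 + norm X) powr (- (real CARD('n) + L))"
    using Rem_near by blast
  define S where "S = (\<Sum>m\<le>k0. real (card (lists_of m)))"
  define A where "A = C * J + (2 * 2 powr l * J + S * J)"
  have S0: "0 \<le> S" by (simp add: S_def sum_nonneg)
  have "(\<integral>\<^sup>+X. ennreal (\<bar>Rem X Y\<bar> * norm X powr l) \<partial>lborel) \<le> ennreal (A * rho (norm Y))" for Y
  proof (cases "norm Y \<le> 1")
    case True
    have "(\<integral>\<^sup>+X. ennreal (\<bar>Rem X Y\<bar> * norm X powr l) \<partial>lborel)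
      \<le> (\<integral>\<^sup>+X. ennreal (C * norm Y ^ Suc k0) * ennreal (norm (X :: real ^ 'n) powr l * (1 + norm X) powr (- (real CARD('n) + L))) \<partial>lborel)"
    proof (rule nn_integral_mono)
      fix X
      have "\<bar>Rem X Y\<bar> * norm X powr l \<le> C * norm Y ^ Suc k0 * (1 + norm X) powr (- (real CARD('n) + L)) * norm X powr l"
        by (intro mult_right_mono C True) simp
      then show "ennreal (\<bar>Rem X Y\<bar> * norm X powr l) \<le> ennreal (C * norm Y ^ Suc k0) * ennreal (norm X powr l * (1 + norm X) powr (- (real CARD('n) + L)))"
        using C0 by (simp add: mult_ac ennreal_leI flip: ennreal_mult)
    qed
    also have "\<dots> = ennreal (C * norm Y ^ Suc k0) * (\<integral>\<^sup>+x. ennreal (norm (x::real^'n) powr l * (1 + norm x) powr (- (real CARD('n) + L))) \<partial>lborel)"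
      by (rule nn_integral_cmult) measurable
    also have "\<dots> \<le> ennreal (C * norm Y ^ Suc k0) * ennreal J" by (rule mult_left_mono[OF J3]) simp
    also have "\<dots> = ennreal (C * J * rho (norm Y))"
      using C0 J0 True by (simp add: rho_le_1 mult_ac del: power_Suc flip: ennreal_mult)
    also have "\<dots> \<le> ennreal (A * rho (norm Y))"
      using J0 S0 by (intro ennreal_leI mult_right_mono) (auto simp: A_def rho_def)
    finally show ?thesis .
  next
    case False
    then have Y1: "1 \<le> norm Y" by simp
    define y where "y = norm Y powr K"
    have y1: "norm Y powr l \<le> y" "1 \<le> y" using Y1 l K by (auto simp: y_def intro!: powr_mono ge_one_powr_ge_zero)
    have ym: "norm Y ^ m \<le> y" if "m \<le> k0" for m
    proof -
      have "norm Y ^ m = norm Y powr real m" using Y1 by (subst powr_realpow) auto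
      also have "\<dots> \<le> y" unfolding y_def using Y1 that k0 by (intro powr_mono) auto
      finally show ?thesis .
    qed
    have pt: "\<bar>Rem X Y\<bar> * norm X powr l \<le> \<bar>\<Phi> (X - Y)\<bar> * norm X powr l + (\<Sum>m\<le>k0. \<Sum>is\<in>lists_of m. y * (\<bar>D\<Phi> is X\<bar> * norm X powr l))" for X
    proof -
      have "\<bar>(\<Sum>is\<in>lists_of m. lprod Y is * D\<Phi> is X) / fact m\<bar> \<le> (\<Sum>is\<in>lists_of m. y * \<bar>D\<Phi> is X\<bar>)" if m: "m \<le> k0" for m
      proof -
        have "\<bar>(\<Sum>is\<in>lists_of m. lprod Y is * D\<Phi> is X) / fact m\<bar> \<le> \<bar>\<Sum>is\<in>lists_of m. lprod Y is * D\<Phi> is X\<bar> / 1"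
          unfolding abs_divide by (intro divide_left_mono) (auto simp: fact_ge_1)
        also have "\<dots> \<le> (\<Sum>is\<in>lists_of m. \<bar>lprod Y is * D\<Phi> is X\<bar>)" by simp
        also have "\<dots> \<le> (\<Sum>is\<in>lists_of m. y * \<bar>D\<Phi> is X\<bar>)"
          unfolding abs_mult using ym[OF m] abs_lprod_le[of Y]
          by (intro sum_mono mult_right_mono) (auto simp: lists_of_def intro: order_trans)
        finally show ?thesis .
      qed
      then have "\<bar>Rem X Y\<bar> \<le> \<bar>\<Phi> (X - Y)\<bar> + (\<Sum>m\<le>k0. \<Sum>is\<in>lists_of m. y * \<bar>D\<Phi> is X\<bar>)"
        unfolding Rem_def
        by (intro order_trans[OF abs_triangle_ineq4] add_left_mono order_trans[OF sum_abs] sum_mono) auto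
      then have "\<bar>Rem X Y\<bar> * norm X powr l \<le> (\<bar>\<Phi> (X - Y)\<bar> + (\<Sum>m\<le>k0. \<Sum>is\<in>lists_of m. y * \<bar>D\<Phi> is X\<bar>)) * norm X powr l"
        by (rule mult_right_mono) simp
      also have "\<dots> = \<bar>\<Phi> (X - Y)\<bar> * norm X powr l + (\<Sum>m\<le>k0. \<Sum>is\<in>lists_of m. y * (\<bar>D\<Phi> is X\<bar> * norm X powr l))"
        by (simp add: distrib_right sum_distrib_right mult.assoc)
      finally show ?thesis .
    qed
    \<comment> \<open>Translation by Y turns the weight into |X+Y|^l, whose excess |Y|^l is at most
      y; the other term is absorbed by y >= 1, which gives the leading factor 2.\<close>
    have i1: "(\<integral>\<^sup>+X. ennreal (\<bar>\<Phi> (X - Y)\<bar> * norm X powr l) \<partial>lborel) \<le> ennreal (2 * 2 powr l * J * y)"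
    proof -
      have "(\<integral>\<^sup>+X. ennreal (\<bar>\<Phi> (X - Y)\<bar> * norm X powr l) \<partial>lborel) = (\<integral>\<^sup>+X. ennreal (\<bar>\<Phi> X\<bar> * norm (X + Y) powr l) \<partial>lborel)"
        using nn_integral_translate[of "\<lambda>X. ennreal (\<bar>\<Phi> X\<bar> * norm (X + Y) powr l)" Y] by simp
      also have "\<dots> \<le> (\<integral>\<^sup>+X. ennreal (2 powr l) * ennreal (\<bar>\<Phi> X\<bar> * norm X powr l) + ennreal (2 powr l * y) * ennreal \<bar>\<Phi> X\<bar> \<partial>lborel)"
      proof (rule nn_integral_mono)
        fix X
        have "\<bar>\<Phi> X\<bar> * norm (X + Y) powr l \<le> \<bar>\<Phi> X\<bar> * (2 powr l * (norm X powr l + norm Y powr l))"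
          by (intro mult_left_mono norm_powr_add_le l) simp
        also have "\<dots> \<le> \<bar>\<Phi> X\<bar> * (2 powr l * (norm X powr l + y))"
          using y1 by (intro mult_left_mono add_left_mono) auto
        also have "\<dots> = 2 powr l * (\<bar>\<Phi> X\<bar> * norm X powr l) + 2 powr l * y * \<bar>\<Phi> X\<bar>" by (simp add: algebra_simps)
        finally show "ennreal (\<bar>\<Phi> X\<bar> * norm (X + Y) powr l) \<le> ennreal (2 powr l) * ennreal (\<bar>\<Phi> X\<bar> * norm X powr l) + ennreal (2 powr l * y) * ennreal \<bar>\<Phi> X\<bar>"
          using y1 by (simp add: ennreal_leI flip: ennreal_mult ennreal_plus)
      qed
      also have "\<dots> = ennreal (2 powr l) * (\<integral>\<^sup>+X. ennreal (\<bar>\<Phi> X\<bar> * norm X powr l) \<partial>lborel) + ennreal (2 powr l * y) * (\<integral>\<^sup>+X. ennreal \<bar>\<Phi> X\<bar> \<partial>lborel)"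
        by (simp add: nn_integral_add nn_integral_cmult)
      also have "\<dots> \<le> ennreal (2 powr l) * ennreal J + ennreal (2 powr l * y) * ennreal J"
        using J1[of "[]"] J2[of "[]"] by (intro add_mono mult_left_mono) (auto simp: D\<Phi>_def)
      also have "\<dots> = ennreal (2 powr l * J + 2 powr l * y * J)" using J0 y1 by (simp flip: ennreal_mult ennreal_plus)
      also have "\<dots> \<le> ennreal (2 * 2 powr l * J * y)"
      proof (rule ennreal_leI)
        have "2 powr l * J * 1 \<le> 2 powr l * J * y" using y1 J0 by (intro mult_left_mono) auto
        then show "2 powr l * J + 2 powr l * y * J \<le> 2 * 2 powr l * J * y" by (simp add: mult_ac)
      qed
      finally show ?thesis .
    qed
    have DM: "(\<lambda>X. \<bar>D\<Phi> is X\<bar> * norm X powr l) \<in> borel_measurable borel" if "is \<in> lists_of m" "m \<le> k0" for "is" m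
    proof -
      note [measurable] = borel_measurable_D\<Phi>[of "is"]
      show ?thesis using that k0 by (simp add: lists_of_def)
    qed
    have "(\<integral>\<^sup>+X. ennreal (\<bar>Rem X Y\<bar> * norm X powr l) \<partial>lborel)
      \<le> (\<integral>\<^sup>+X. ennreal (\<bar>\<Phi> (X - Y)\<bar> * norm X powr l) + (\<Sum>m\<le>k0. \<Sum>is\<in>lists_of m. ennreal y * ennreal (\<bar>D\<Phi> is X\<bar> * norm X powr l)) \<partial>lborel)"
    proof (rule nn_integral_mono)
      fix X
      have "(\<Sum>m\<le>k0. \<Sum>is\<in>lists_of m. ennreal y * ennreal (\<bar>D\<Phi> is X\<bar> * norm X powr l)) = ennreal (\<Sum>m\<le>k0. \<Sum>is\<in>lists_of m. y * (\<bar>D\<Phi> is X\<bar> * norm X powr l))"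
        using y1 by (simp add: sum_ennreal sum_nonneg flip: ennreal_mult)
      then show "ennreal (\<bar>Rem X Y\<bar> * norm X powr l) \<le> ennreal (\<bar>\<Phi> (X - Y)\<bar> * norm X powr l) + (\<Sum>m\<le>k0. \<Sum>is\<in>lists_of m. ennreal y * ennreal (\<bar>D\<Phi> is X\<bar> * norm X powr l))"
        using ennreal_leI[OF pt[of X]] y1 by (simp add: ennreal_plus sum_nonneg)
    qed
    also have "\<dots> = (\<integral>\<^sup>+X. ennreal (\<bar>\<Phi> (X - Y)\<bar> * norm X powr l) \<partial>lborel)
        + (\<Sum>m\<le>k0. \<Sum>is\<in>lists_of m. ennreal y * (\<integral>\<^sup>+X. ennreal (\<bar>D\<Phi> is X\<bar> * norm X powr l) \<partial>lborel))"
    proof -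
      have "(\<integral>\<^sup>+X. (\<Sum>m\<le>k0. \<Sum>is\<in>lists_of m. ennreal y * ennreal (\<bar>D\<Phi> is X\<bar> * norm X powr l)) \<partial>lborel)
        = (\<Sum>m\<le>k0. \<integral>\<^sup>+X. (\<Sum>is\<in>lists_of m. ennreal y * ennreal (\<bar>D\<Phi> is X\<bar> * norm X powr l)) \<partial>lborel)"
        by (rule nn_integral_sum) (auto intro!: borel_measurable_sum borel_measurable_times_ennreal DM)
      also have "\<dots> = (\<Sum>m\<le>k0. \<Sum>is\<in>lists_of m. \<integral>\<^sup>+X. ennreal y * ennreal (\<bar>D\<Phi> is X\<bar> * norm X powr l) \<partial>lborel)"
        by (intro sum.cong refl nn_integral_sum) (auto intro!: borel_measurable_times_ennreal DM)
      also have "\<dots> = (\<Sum>m\<le>k0. \<Sum>is\<in>lists_of m. ennreal y * (\<integral>\<^sup>+X. ennreal (\<bar>D\<Phi> is X\<bar> * norm X powr l) \<partial>lborel))"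
        by (intro sum.cong refl nn_integral_cmult) (auto intro!: DM)
      finally show ?thesis
        by (subst nn_integral_add) (auto intro!: borel_measurable_sum borel_measurable_times_ennreal DM)
    qed
    also have "\<dots> \<le> ennreal (2 * 2 powr l * J * y) + (\<Sum>m\<le>k0. \<Sum>is\<in>lists_of m. ennreal y * ennreal J)"
      using k0 by (intro add_mono i1 sum_mono mult_left_mono J1) (auto simp: lists_of_def)
    also have "(\<Sum>m\<le>k0. \<Sum>is\<in>lists_of m. ennreal y * ennreal J) = ennreal (S * J * y)"
    proof -
      have "(\<Sum>m\<le>k0. \<Sum>is\<in>lists_of m. ennreal y * ennreal J) = ennreal (\<Sum>m\<le>k0. \<Sum>is\<in>lists_of m. y * J)"
        using y1 J0 by (simp add: sum_ennreal sum_nonneg flip: ennreal_mult del: sum_constant)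
      also have "(\<Sum>m\<le>k0. \<Sum>is\<in>lists_of m. y * J) = S * J * y"
        by (simp add: S_def mult.assoc[of _ J y] mult.commute[of y J] sum_distrib_right)
      finally show ?thesis .
    qed
    also have "ennreal (2 * 2 powr l * J * y) + ennreal (S * J * y) = ennreal ((2 * 2 powr l * J + S * J) * y)"
      using y1 J0 S0 by (simp add: algebra_simps flip: ennreal_plus)
    also have "\<dots> \<le> ennreal (A * rho (norm Y))"
      using C0 J0 y1 unfolding rho_ge_1[OF Y1] y_def[symmetric] by (intro ennreal_leI mult_right_mono) (auto simp: A_def)
    finally show ?thesis .
  qed
  moreover have "0 \<le> A" using C0 J0 S0 by (simp add: A_def)
  ultimately show ?thesis using that by blast
qed

text \<open>Every Taylor term is, as a function of y, a multiple of a monomial of order at most [K],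
  so it integrates to 0 against F and may be subtracted from the kernel.\<close>

lemma conv_eq_Rem:
  assumes \<tau>: "0 < \<tau>" and F: "integrable lborel F" and Fm: "\<And>\<alpha>. \<alpha> \<in> mi_upto K \<Longrightarrow> integrable lborel (\<lambda>y. mi_pow y \<alpha> * F y)"
    and F0: "\<And>\<alpha>. \<alpha> \<in> mi_upto K \<Longrightarrow> (\<integral>y. mi_pow y \<alpha> * F y \<partial>lborel) = 0"
  shows "conv (\<kappa> [] \<tau>) F x = (\<integral>y. \<tau> powr (- real CARD('n) / d) * Rem (\<tau> powr (- 1 / d) *\<^sub>R x) (\<tau> powr (- 1 / d) *\<^sub>R y) * F y \<partial>lborel)"
proof -
  define c where "c = \<tau> powr (- 1 / d)"
  define v where "v = \<tau> powr (- real CARD('n) / d)"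
  have \<kappa>0: "\<kappa> [] \<tau> z = v * \<Phi> (c *\<^sub>R z)" for z by (simp add: \<kappa>_def v_def c_def D\<Phi>_def)
  have ci: "integrable lborel (\<lambda>y. \<kappa> [] \<tau> (x - y) * F y)"
  proof -
    obtain B where B: "\<And>is x. length is \<le> \<gamma> \<Longrightarrow> \<bar>\<kappa> is \<tau> x\<bar> \<le> B" using \<kappa>_bounded[OF \<tau>] by metis
    show ?thesis by (rule conv_integrand_integrable[OF borel_measurable_\<kappa> B F]) auto
  qed
  have up: "count_list is \<in> mi_upto K" if "is \<in> lists_of m" "m \<le> k0" for "is" m
    using that k0 by (auto simp: mi_upto_def lists_of_def length_eq_mi_len[symmetric])
  have li: "integrable lborel (\<lambda>y. lprod (c *\<^sub>R y) is * D\<Phi> is (c *\<^sub>R x) * F y)"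
    and l0: "(\<integral>y. lprod (c *\<^sub>R y) is * D\<Phi> is (c *\<^sub>R x) * F y \<partial>lborel) = 0" if "is \<in> lists_of m" "m \<le> k0" for "is" m
  proof -
    have eq: "(\<lambda>y. lprod (c *\<^sub>R y) is * D\<Phi> is (c *\<^sub>R x) * F y) = (\<lambda>y. (c ^ length is * (-1) ^ length is * D\<Phi> is (c *\<^sub>R x)) * (mi_pow y (count_list is) * F y))"
      unfolding lprod_scaleR unfolding lprod_eq by (simp add: mult_ac)
    show "integrable lborel (\<lambda>y. lprod (c *\<^sub>R y) is * D\<Phi> is (c *\<^sub>R x) * F y)"
      unfolding eq by (intro integrable_mult_right Fm up[OF that])
    show "(\<integral>y. lprod (c *\<^sub>R y) is * D\<Phi> is (c *\<^sub>R x) * F y \<partial>lborel) = 0"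
      unfolding eq using F0[OF up[OF that]] by simp
  qed
  have "(\<integral>y. v * Rem (c *\<^sub>R x) (c *\<^sub>R y) * F y \<partial>lborel)
    = (\<integral>y. \<kappa> [] \<tau> (x - y) * F y - (\<Sum>m\<le>k0. \<Sum>is\<in>lists_of m. v / fact m * (lprod (c *\<^sub>R y) is * D\<Phi> is (c *\<^sub>R x) * F y)) \<partial>lborel)"
  proof (rule Bochner_Integration.integral_cong[OF refl])
    fix y
    have "v * Rem (c *\<^sub>R x) (c *\<^sub>R y) * F y = v * \<Phi> (c *\<^sub>R x - c *\<^sub>R y) * F y - (\<Sum>m\<le>k0. v * ((\<Sum>is\<in>lists_of m. lprod (c *\<^sub>R y) is * D\<Phi> is (c *\<^sub>R x)) / fact m) * F y)"
      unfolding Rem_def by (simp add: right_diff_distrib left_diff_distrib sum_distrib_left sum_distrib_right)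
    also have "(\<Sum>m\<le>k0. v * ((\<Sum>is\<in>lists_of m. lprod (c *\<^sub>R y) is * D\<Phi> is (c *\<^sub>R x)) / fact m) * F y)
      = (\<Sum>m\<le>k0. \<Sum>is\<in>lists_of m. v / fact m * (lprod (c *\<^sub>R y) is * D\<Phi> is (c *\<^sub>R x) * F y))"
      by (simp add: sum_distrib_left sum_distrib_right sum_divide_distrib mult_ac)
    finally show "v * Rem (c *\<^sub>R x) (c *\<^sub>R y) * F y = \<kappa> [] \<tau> (x - y) * F y - (\<Sum>m\<le>k0. \<Sum>is\<in>lists_of m. v / fact m * (lprod (c *\<^sub>R y) is * D\<Phi> is (c *\<^sub>R x) * F y))"
      by (simp add: \<kappa>0 scaleR_diff_right)
  qed
  also have "\<dots> = (\<integral>y. \<kappa> [] \<tau> (x - y) * F y \<partial>lborel) - (\<integral>y. (\<Sum>m\<le>k0. \<Sum>is\<in>lists_of m. v / fact m * (lprod (c *\<^sub>R y) is * D\<Phi> is (c *\<^sub>R x) * F y)) \<partial>lborel)"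
    by (intro Bochner_Integration.integral_diff ci Bochner_Integration.integrable_sum integrable_mult_right li) auto
  also have "(\<integral>y. (\<Sum>m\<le>k0. \<Sum>is\<in>lists_of m. v / fact m * (lprod (c *\<^sub>R y) is * D\<Phi> is (c *\<^sub>R x) * F y)) \<partial>lborel)
    = (\<Sum>m\<le>k0. \<Sum>is\<in>lists_of m. v / fact m * (\<integral>y. lprod (c *\<^sub>R y) is * D\<Phi> is (c *\<^sub>R x) * F y \<partial>lborel))"
    using li by (simp add: Bochner_Integration.integral_sum)
  also have "\<dots> = 0" using l0 by simp
  finally show ?thesis by (simp add: conv_def c_def v_def)
qed

text \<open>Tonelli and the substitution x = \<tau>^(1/d) X reduce the claim to
  \<open>Rem_weighted\<close>, the weight releasing \<tau>^(l/d). The moment condition is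
  conditional on mass 1: otherwise the kernel is identically 0 by \<open>mass_dichotomy\<close>, and
  so is the convolution.\<close>

lemma conv_decay:
  assumes l: "0 \<le> l" "l \<le> K"
  obtains C where "0 \<le> C" "\<And>F \<tau>. 0 < \<tau> \<Longrightarrow> integrable lborel F \<Longrightarrow>
    (\<And>\<alpha>. \<alpha> \<in> mi_upto K \<Longrightarrow> integrable lborel (\<lambda>y. mi_pow y \<alpha> * F y)) \<Longrightarrow>
    (m\<Phi> = 1 \<Longrightarrow> \<forall>\<alpha>\<in>mi_upto K. (\<integral>y. mi_pow y \<alpha> * F y \<partial>lborel) = 0) \<Longrightarrow>
    wt l (conv (\<kappa> [] \<tau>) F) \<le> ennreal (C * \<tau> powr (l / d)) * (\<integral>\<^sup>+y. ennreal (\<bar>F y\<bar> * rho (\<tau> powr (- 1 / d) * norm y)) \<partial>lborel)"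
proof -
  obtain C where C0: "0 \<le> C" and C: "\<And>Y. (\<integral>\<^sup>+X. ennreal (\<bar>Rem X Y\<bar> * norm X powr l) \<partial>lborel) \<le> ennreal (C * rho (norm Y))"
    using Rem_weighted[OF l] by blast
  have "wt l (conv (\<kappa> [] \<tau>) F) \<le> ennreal (C * \<tau> powr (l / d)) * (\<integral>\<^sup>+y. ennreal (\<bar>F y\<bar> * rho (\<tau> powr (- 1 / d) * norm y)) \<partial>lborel)"
    if \<tau>: "0 < \<tau>" and F: "integrable lborel F" and Fm: "\<And>\<alpha>. \<alpha> \<in> mi_upto K \<Longrightarrow> integrable lborel (\<lambda>y. mi_pow y \<alpha> * F y)"
      and F0: "m\<Phi> = 1 \<Longrightarrow> \<forall>\<alpha>\<in>mi_upto K. (\<integral>y. mi_pow y \<alpha> * F y \<partial>lborel) = 0" for F \<tau>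
  proof (cases "m\<Phi> = 1")
    case False
    then have "\<Phi> x = 0" for x using mass_dichotomy by simp
    then have "\<kappa> [] \<tau> = (\<lambda>x. 0)" by (simp add: \<kappa>_def fun_eq_iff D\<Phi>_def)
    then have "conv (\<kappa> [] \<tau>) F = (\<lambda>x. 0)" by (simp add: conv_def fun_eq_iff)
    then show ?thesis by (simp add: wt_def)
  next
    case True
    define c where "c = \<tau> powr (- 1 / d)"
    define v where "v = \<tau> powr (- real CARD('n) / d)"
    have c: "0 < c" using \<tau> by (simp add: c_def)
    have [measurable]: "F \<in> borel_measurable borel" using F by auto
    note [measurable] = borel_measurable_Rem
    have rhom[measurable]: "rho \<in> borel_measurable borel" unfolding rho_def[abs_def] by measurable
    have eq: "conv (\<kappa> [] \<tau>) F x = (\<integral>y. v * Rem (c *\<^sub>R x) (c *\<^sub>R y) * F y \<partial>lborel)" for x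
      unfolding c_def v_def by (rule conv_eq_Rem[OF \<tau> F Fm]) (use F0 True in auto)
    have "wt l (conv (\<kappa> [] \<tau>) F) \<le> (\<integral>\<^sup>+x. (\<integral>\<^sup>+y. ennreal (\<bar>v * Rem (c *\<^sub>R x) (c *\<^sub>R y) * F y\<bar> * norm x powr l) \<partial>lborel) \<partial>lborel)"
      unfolding wt_def
    proof (rule nn_integral_mono)
      fix x
      have "ennreal (\<bar>conv (\<kappa> [] \<tau>) F x\<bar> * norm x powr l) \<le> (\<integral>\<^sup>+y. ennreal \<bar>v * Rem (c *\<^sub>R x) (c *\<^sub>R y) * F y\<bar> \<partial>lborel) * ennreal (norm x powr l)"
        unfolding eq by (simp add: ennreal_mult integral_abs_le_nn_integral mult_right_mono)
      also have "\<dots> = (\<integral>\<^sup>+y. ennreal (\<bar>v * Rem (c *\<^sub>R x) (c *\<^sub>R y) * F y\<bar> * norm x powr l) \<partial>lborel)"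
        by (simp add: ennreal_mult nn_integral_multc)
      finally show "ennreal (\<bar>conv (\<kappa> [] \<tau>) F x\<bar> * norm x powr l) \<le> (\<integral>\<^sup>+y. ennreal (\<bar>v * Rem (c *\<^sub>R x) (c *\<^sub>R y) * F y\<bar> * norm x powr l) \<partial>lborel)" .
    qed
    also have "\<dots> = (\<integral>\<^sup>+y. (\<integral>\<^sup>+x. ennreal (\<bar>v * Rem (c *\<^sub>R x) (c *\<^sub>R y) * F y\<bar> * norm x powr l) \<partial>lborel) \<partial>lborel)"
      by (rule lborel_pair.Fubini') measurable
    also have "\<dots> \<le> (\<integral>\<^sup>+y. ennreal (C * \<tau> powr (l / d)) * ennreal (\<bar>F y\<bar> * rho (c * norm y)) \<partial>lborel)"
    proof (rule nn_integral_mono)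
      fix y
      have "(\<integral>\<^sup>+x. ennreal (\<bar>v * Rem (c *\<^sub>R x) (c *\<^sub>R y) * F y\<bar> * norm x powr l) \<partial>lborel)
        = ennreal (\<tau> powr (real CARD('n) / d)) * (\<integral>\<^sup>+X. ennreal (\<bar>v * Rem (c *\<^sub>R \<tau> powr (1 / d) *\<^sub>R X) (c *\<^sub>R y) * F y\<bar> * norm (\<tau> powr (1 / d) *\<^sub>R X) powr l) \<partial>lborel)"
        by (rule nn_integral_rescale[OF _ \<tau>]) measurable
      also have "\<dots> = ennreal (\<tau> powr (real CARD('n) / d)) * (\<integral>\<^sup>+X. ennreal (v * \<bar>F y\<bar> * \<tau> powr (l / d)) * ennreal (\<bar>Rem X (c *\<^sub>R y)\<bar> * norm X powr l) \<partial>lborel)"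
      proof -
        have "\<bar>v * Rem (c *\<^sub>R \<tau> powr (1 / d) *\<^sub>R X) (c *\<^sub>R y) * F y\<bar> * norm (\<tau> powr (1 / d) *\<^sub>R X) powr l
          = (v * \<bar>F y\<bar> * \<tau> powr (l / d)) * (\<bar>Rem X (c *\<^sub>R y)\<bar> * norm X powr l)" for X
        proof -
          have "norm (\<tau> powr (1 / d) *\<^sub>R X) powr l = \<tau> powr (l / d) * norm X powr l"
            using \<tau> by (simp add: powr_mult powr_powr)
          then show ?thesis unfolding c_def rescale_cancel[OF \<tau>] by (simp add: abs_mult v_def)
        qed
        then show ?thesis by (simp add: ennreal_mult v_def)
      qed
      also have "\<dots> = ennreal (\<tau> powr (real CARD('n) / d)) * (ennreal (v * \<bar>F y\<bar> * \<tau> powr (l / d)) * (\<integral>\<^sup>+X. ennreal (\<bar>Rem X (c *\<^sub>R y)\<bar> * norm X powr l) \<partial>lborel))"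
        by (subst nn_integral_cmult) simp_all
      also have "\<dots> \<le> ennreal (\<tau> powr (real CARD('n) / d)) * (ennreal (v * \<bar>F y\<bar> * \<tau> powr (l / d)) * ennreal (C * rho (norm (c *\<^sub>R y))))"
        by (intro mult_left_mono C) auto
      also have "\<dots> = ennreal ((\<tau> powr (real CARD('n) / d) * v) * (C * \<tau> powr (l / d)) * (\<bar>F y\<bar> * rho (norm (c *\<^sub>R y))))"
        using C0 by (simp add: v_def rho_def mult_ac flip: ennreal_mult)
      also have "\<tau> powr (real CARD('n) / d) * v = 1" using \<tau> by (simp add: v_def powr_add[symmetric])
      also have "norm (c *\<^sub>R y) = c * norm y" using c by simp
      finally show "(\<integral>\<^sup>+x. ennreal (\<bar>v * Rem (c *\<^sub>R x) (c *\<^sub>R y) * F y\<bar> * norm x powr l) \<partial>lborel) \<le> ennreal (C * \<tau> powr (l / d)) * ennreal (\<bar>F y\<bar> * rho (c * norm y))"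
        using C0 by (simp add: rho_def flip: ennreal_mult)
    qed
    also have "\<dots> = ennreal (C * \<tau> powr (l / d)) * (\<integral>\<^sup>+y. ennreal (\<bar>F y\<bar> * rho (c * norm y)) \<partial>lborel)"
      by (rule nn_integral_cmult) measurable
    finally show ?thesis unfolding c_def .
  qed
  with C0 that show ?thesis by blast
qed

end

section \<open>Estimates for the time slices of the Duhamel integral\<close>

lemma wt_conv:
  fixes h u :: "real ^ 'n::finite \<Rightarrow> real"
  assumes l: "0 \<le> l" and h: "Lq_le 1 h a" "wt l h \<le> ennreal a'" and u: "Lq_le 1 u b" "wt l u \<le> ennreal b'"
    and nn: "0 \<le> a'" "0 \<le> b'"
  shows "wt l (conv h u) \<le> ennreal (2 powr l * (a' * b + a * b'))"
proof -
  have [measurable]: "h \<in> borel_measurable borel" "u \<in> borel_measurable borel"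
    and a: "0 \<le> a" "(\<integral>\<^sup>+x. ennreal \<bar>h x\<bar> \<partial>lborel) \<le> ennreal a"
    and b: "0 \<le> b" "(\<integral>\<^sup>+x. ennreal \<bar>u x\<bar> \<partial>lborel) \<le> ennreal b"
    using h u by (auto simp: Lq_le_1_iff)
  have "wt l (conv h u) \<le> ennreal (2 powr l) * (wt l h * (\<integral>\<^sup>+x. ennreal \<bar>u x\<bar> \<partial>lborel) + (\<integral>\<^sup>+x. ennreal \<bar>h x\<bar> \<partial>lborel) * wt l u)"
    unfolding wt_def by (rule weighted_conv) (use l in auto)
  also have "\<dots> \<le> ennreal (2 powr l) * (ennreal a' * ennreal b + ennreal a * ennreal b')"
    using h u a b by (intro mult_left_mono add_mono mult_mono) auto
  also have "\<dots> = ennreal (2 powr l * (a' * b + a * b'))"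
    using a b nn by (simp flip: ennreal_mult ennreal_plus)
  finally show ?thesis .
qed

text \<open>The reflection s -> t-s moves the singularity to 0, where s^(-a) is integrable for a <
  1.\<close>

lemma nn_integral_singular_weight:
  assumes "a < 1" "0 < t"
  shows "(\<integral>\<^sup>+s. indicator {0<..<t} s * ennreal ((t - s) powr (- a)) \<partial>lborel) < \<infinity>"
proof -
  have "(\<integral>\<^sup>+s. indicator {0<..<t} s * ennreal ((t - s) powr (- a)) \<partial>lborel)
    = (\<integral>\<^sup>+s. indicator {0<..<t} (t - s) * ennreal (s powr (- a)) \<partial>lborel)"
    using nn_integral_reflect[of "\<lambda>s. indicator {0<..<t} (t - s) * ennreal (s powr (- a))" t] by simp
  also have "\<dots> \<le> (\<integral>\<^sup>+s. indicator {0..t} s * ennreal (s powr (- a)) \<partial>lborel)"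
    by (intro nn_integral_mono) (auto simp: indicator_def)
  also have "\<dots> = ennreal (t powr (- a + 1) / (- a + 1))"
  proof -
    have "(\<integral>\<^sup>+s. indicator {0..t} s * ennreal (s powr (- a)) \<partial>lborel) = (\<integral>\<^sup>+s. ennreal (indicator {0..t} s * s powr (- a)) \<partial>lborel)"
      by (intro nn_integral_cong) (auto simp: indicator_def)
    also have "\<dots> = ennreal (t powr (- a + 1) / (- a + 1))"
      by (rule nn_integral_has_integral_lebesgue[OF _ has_integral_powr_from_0]) (use assms in auto)
    finally show ?thesis .
  qed
  also have "\<dots> < \<infinity>" by simp
  finally show ?thesis .
qed

section \<open>The source, its moments and its projection\<close>

text \<open>\<open>f\<close> and \<open>e\<close> play the role of Borel representatives of the
  source and of E, as provided by \<open>Borel_reduction\<close>. Demanding the slice bounds at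
  every s > 0 spares the bookkeeping of null sets in time; only the local bound on \<open>e\<close>
  holds almost everywhere.\<close>

locale duhamel = duhamel_kernel G \<gamma> d L K
  for G :: "real ^ 'n::finite \<Rightarrow> real \<Rightarrow> real" and \<gamma> d L K +
  fixes f :: "real ^ 'n \<Rightarrow> real \<Rightarrow> real" and e :: "real \<Rightarrow> real" and q :: ennreal
  assumes q: "1 \<le> q"
    and f_borel [measurable]: "(\<lambda>(x, s). f x s) \<in> borel_measurable (borel \<Otimes>\<^sub>M borel)"
    and e_borel [measurable]: "e \<in> borel_measurable borel"
    and e_nonneg: "\<And>s. 0 \<le> e s"
    and f_slice: "\<And>s. 0 < s \<Longrightarrow> slice (\<lambda>x. f x s) s (e s)"
    and f_Lq: "\<And>s. 0 < s \<Longrightarrow> Lq_le q (\<lambda>x. f x s) (s powr (- scal_exp TYPE('n) d q) * (1 + s) powr (- K / d) * e s)"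
    and e_bdd: "\<And>T. \<exists>B\<ge>0. AE s in lborel. 0 < s \<and> s < T \<longrightarrow> e s \<le> B"
begin

definition \<sigma> :: real where "\<sigma> = scal_exp TYPE('n) d q"

lemma \<sigma>_nonneg: "0 \<le> \<sigma>"
  unfolding \<sigma>_def by (rule scal_exp_nonneg[OF d q])

text \<open>Set to 0 for s <= 0, where the slice bounds say nothing, so that measurability can be
  stated on the whole line.\<close>

definition Mf :: "('n \<Rightarrow> nat) \<Rightarrow> real \<Rightarrow> real" where
  "Mf \<alpha> s = (if 0 < s then moment G (\<lambda>x. f x s) s \<alpha> else 0)"

definition Pf :: "real \<Rightarrow> real ^ 'n \<Rightarrow> real" where
  "Pf s y = (if 0 < s then P_op G K s (\<lambda>x. f x s) y else 0)"

lemma f_borel_slice [measurable]: "(\<lambda>x. f x s) \<in> borel_measurable borel"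
  using measurable_compose[OF measurable_Pair2'[of s borel borel] f_borel] by simp

text \<open>Follows the recursion of \<open>moment\<close>. The kernels g_\<beta> are replaced by
  the scaled derivatives of the profile, whose joint measurability in (s,x) is at hand, before x is
  integrated out.\<close>

lemma Mf_borel: "\<alpha> \<in> mi_upto K \<Longrightarrow> Mf \<alpha> \<in> borel_measurable borel"
proof (induction "mi_len \<alpha>" arbitrary: \<alpha> rule: less_induct)
  case less
  let ?B = "{\<beta>. \<beta> \<le> \<alpha> \<and> \<beta> \<noteq> \<alpha>}"
  have eq: "Mf \<alpha> = (\<lambda>s. if 0 < s then (\<integral>x. mi_pow x \<alpha> * f x s \<partial>lborel) -
     (\<Sum>\<beta>\<in>?B. Mf \<beta> s * (\<integral>x. mi_pow x \<alpha> * ((-1) ^ mi_len \<beta> / mi_fact \<beta> * \<kappa> (mi_list \<beta>) (s + 1) x) \<partial>lborel)) else 0)"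
  proof
    fix s
    show "Mf \<alpha> s = (if 0 < s then (\<integral>x. mi_pow x \<alpha> * f x s \<partial>lborel) -
     (\<Sum>\<beta>\<in>?B. Mf \<beta> s * (\<integral>x. mi_pow x \<alpha> * ((-1) ^ mi_len \<beta> / mi_fact \<beta> * \<kappa> (mi_list \<beta>) (s + 1) x) \<partial>lborel)) else 0)"
    proof (cases "0 < s")
      case True
      have "Mf \<alpha> s = (\<integral>x. mi_pow x \<alpha> * f x s \<partial>lborel) -
        (\<Sum>\<beta>\<in>?B. moment G (\<lambda>x. f x s) s \<beta> * (\<integral>x. mi_pow x \<alpha> * g_kernel G \<beta> s x \<partial>lborel))"
        using moment_borel[OF f_borel_slice less.prems] True by (simp add: Mf_def)
      also have "(\<Sum>\<beta>\<in>?B. moment G (\<lambda>x. f x s) s \<beta> * (\<integral>x. mi_pow x \<alpha> * g_kernel G \<beta> s x \<partial>lborel))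
        = (\<Sum>\<beta>\<in>?B. Mf \<beta> s * (\<integral>x. mi_pow x \<alpha> * ((-1) ^ mi_len \<beta> / mi_fact \<beta> * \<kappa> (mi_list \<beta>) (s + 1) x) \<partial>lborel))"
      proof (rule sum.cong[OF refl])
        fix \<beta> assume "\<beta> \<in> ?B"
        then have "mi_len \<beta> \<le> \<gamma>" using mi_upto_\<gamma>[OF mi_upto_below[OF less.prems]] by simp
        then have "g_kernel G \<beta> s x = (-1) ^ mi_len \<beta> / mi_fact \<beta> * \<kappa> (mi_list \<beta>) (s + 1) x" for x
          using True by (intro g_kernel_eq) auto
        then show "moment G (\<lambda>x. f x s) s \<beta> * (\<integral>x. mi_pow x \<alpha> * g_kernel G \<beta> s x \<partial>lborel)
          = Mf \<beta> s * (\<integral>x. mi_pow x \<alpha> * ((-1) ^ mi_len \<beta> / mi_fact \<beta> * \<kappa> (mi_list \<beta>) (s + 1) x) \<partial>lborel)"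
          using True by (simp only: Mf_def if_True)
      qed
      finally show ?thesis using True by simp
    qed (simp add: Mf_def)
  qed
  have i1: "(\<lambda>s. \<integral>x. mi_pow x \<alpha> * f x s \<partial>lborel) \<in> borel_measurable borel" by measurable
  have i2: "(\<lambda>s. Mf \<beta> s * (\<integral>x. mi_pow x \<alpha> * ((-1) ^ mi_len \<beta> / mi_fact \<beta> * \<kappa> (mi_list \<beta>) (s + 1) x) \<partial>lborel)) \<in> borel_measurable borel"
    if "\<beta> \<in> ?B" for \<beta>
  proof -
    have b: "\<beta> \<in> mi_upto K" "mi_len \<beta> < mi_len \<alpha>" using that less.prems mi_upto_below mi_len_strict_mono by auto
    have [measurable]: "Mf \<beta> \<in> borel_measurable borel" by (rule less.hyps[OF b(2,1)])
    have len: "length (mi_list \<beta>) \<le> \<gamma>" using mi_upto_\<gamma>[OF b(1)] by simp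
    have [measurable]: "(\<lambda>z. \<kappa> (mi_list \<beta>) (fst z + 1) (snd z)) \<in> borel_measurable (borel \<Otimes>\<^sub>M lborel)"
      by (rule borel_measurable_\<kappa>_pair[OF len]) measurable
    show ?thesis by measurable
  qed
  have i3: "(\<lambda>s. \<Sum>\<beta>\<in>?B. Mf \<beta> s * (\<integral>x. mi_pow x \<alpha> * ((-1) ^ mi_len \<beta> / mi_fact \<beta> * \<kappa> (mi_list \<beta>) (s + 1) x) \<partial>lborel)) \<in> borel_measurable borel"
    by (rule borel_measurable_sum[OF i2])
  show ?case unfolding eq using i1 i3 by measurable
qed

lemma Pf_borel_pair:
  assumes [measurable]: "a \<in> borel_measurable M" "b \<in> borel_measurable M"
  shows "(\<lambda>z. Pf (a z) (b z)) \<in> borel_measurable M"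
proof -
  have eq: "(\<lambda>z. Pf (a z) (b z)) = (\<lambda>z. if 0 < a z then f (b z) (a z)
    - (\<Sum>\<alpha>\<in>mi_upto K. Mf \<alpha> (a z) * ((-1) ^ mi_len \<alpha> / mi_fact \<alpha> * \<kappa> (mi_list \<alpha>) (a z + 1) (b z))) else 0)"
  proof
    fix z
    have "(\<Sum>\<alpha>\<in>mi_upto K. moment G (\<lambda>x. f x (a z)) (a z) \<alpha> * g_kernel G \<alpha> (a z) (b z))
      = (\<Sum>\<alpha>\<in>mi_upto K. Mf \<alpha> (a z) * ((-1) ^ mi_len \<alpha> / mi_fact \<alpha> * \<kappa> (mi_list \<alpha>) (a z + 1) (b z)))" if "0 < a z"
      using that mi_upto_\<gamma> by (intro sum.cong refl arg_cong2[where f = "(*)"] g_kernel_eq) (auto simp: Mf_def)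
    then show "Pf (a z) (b z) = (if 0 < a z then f (b z) (a z)
    - (\<Sum>\<alpha>\<in>mi_upto K. Mf \<alpha> (a z) * ((-1) ^ mi_len \<alpha> / mi_fact \<alpha> * \<kappa> (mi_list \<alpha>) (a z + 1) (b z))) else 0)"
      by (simp add: Pf_def P_op_def)
  qed
  have [measurable]: "(\<lambda>z. \<Sum>\<alpha>\<in>mi_upto K. Mf \<alpha> (a z) * ((-1) ^ mi_len \<alpha> / mi_fact \<alpha> * \<kappa> (mi_list \<alpha>) (a z + 1) (b z))) \<in> borel_measurable M"
  proof (rule borel_measurable_sum)
    fix \<alpha> :: "'n \<Rightarrow> nat" assume \<alpha>: "\<alpha> \<in> mi_upto K"
    have [measurable]: "(\<lambda>z. Mf \<alpha> (a z)) \<in> borel_measurable M"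
      by (rule measurable_compose[OF assms(1) Mf_borel[OF \<alpha>]])
    have [measurable]: "(\<lambda>z. \<kappa> (mi_list \<alpha>) (a z + 1) (b z)) \<in> borel_measurable M"
      by (rule borel_measurable_\<kappa>_pair) (use mi_upto_\<gamma>[OF \<alpha>] in auto)
    show "(\<lambda>z. Mf \<alpha> (a z) * ((-1) ^ mi_len \<alpha> / mi_fact \<alpha> * \<kappa> (mi_list \<alpha>) (a z + 1) (b z))) \<in> borel_measurable M"
      by measurable
  qed
  show ?thesis unfolding eq by measurable
qed

lemma Pf_borel [measurable]: "Pf s \<in> borel_measurable borel"
  using Pf_borel_pair[of "\<lambda>_. s" borel "\<lambda>y. y"] by simp

lemma Pf_Lq: obtains C where "0 \<le> C" "\<And>s. 0 < s \<Longrightarrow> Lq_le q (Pf s) (C * (s powr (- \<sigma>) * (1 + s) powr (- K / d) * e s))"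
proof -
  obtain C where C: "0 \<le> C" "\<And>h s e. 0 < s \<Longrightarrow> 0 \<le> e \<Longrightarrow> slice h s e \<Longrightarrow>
    Lq_le q h (s powr (- \<sigma>) * (1 + s) powr (- K / d) * e) \<Longrightarrow>
    Lq_le q (P_op G K s h) (C * (s powr (- \<sigma>) * (1 + s) powr (- K / d) * e))"
    using P_op_Lq[OF q] unfolding \<sigma>_def by blast
  have "Pf s = P_op G K s (\<lambda>x. f x s)" if "0 < s" for s using that by (simp add: Pf_def fun_eq_iff)
  with C f_slice f_Lq[folded \<sigma>_def] e_nonneg that show ?thesis by metis
qed

lemma Pf_L1: obtains C where "0 \<le> C" "\<And>s. 0 < s \<Longrightarrow> Lq_le 1 (Pf s) (C * (1 + s) powr (- K / d) * e s)"
proof -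
  obtain C where C: "0 \<le> C" "\<And>h s e. 0 < s \<Longrightarrow> 0 \<le> e \<Longrightarrow> slice h s e \<Longrightarrow>
    Lq_le 1 (P_op G K s h) (C * (1 + s) powr (- K / d) * e)"
    using P_op_L1 by blast
  have "Pf s = P_op G K s (\<lambda>x. f x s)" if "0 < s" for s using that by (simp add: Pf_def fun_eq_iff)
  with C f_slice e_nonneg that show ?thesis by metis
qed

lemma Pf_wt:
  assumes "0 \<le> l" "l \<le> K"
  obtains C where "0 \<le> C" "\<And>s. 0 < s \<Longrightarrow> wt l (Pf s) \<le> ennreal (C * (1 + s) powr ((l - K) / d) * e s)"
proof -
  obtain C where C: "0 \<le> C" "\<And>h s e. 0 \<le> s \<Longrightarrow> 0 \<le> e \<Longrightarrow> slice h s e \<Longrightarrow>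
    wt l (P_op G K s h) \<le> ennreal (C * (1 + s) powr ((l - K) / d) * e)"
    using P_op_wt[OF assms] by blast
  have "Pf s = P_op G K s (\<lambda>x. f x s)" if "0 < s" for s using that by (simp add: Pf_def fun_eq_iff)
  with C f_slice e_nonneg that show ?thesis by (metis less_imp_le)
qed

lemma Pf_integrable: "0 < s \<Longrightarrow> integrable lborel (Pf s)"
  unfolding integrable_iff_Lq_le using Pf_L1 by metis

lemma Pf_mi_pow_integrable:
  assumes s: "0 < s" and \<alpha>: "\<alpha> \<in> mi_upto K"
  shows "integrable lborel (\<lambda>y. mi_pow y \<alpha> * Pf s y)"
proof -
  have "0 \<le> real (mi_len \<alpha>)" "real (mi_len \<alpha>) \<le> K" using \<alpha> by (auto simp: mi_upto_def)
  then obtain C where "\<And>s. 0 < s \<Longrightarrow> wt (real (mi_len \<alpha>)) (Pf s) \<le> ennreal (C * (1 + s) powr ((real (mi_len \<alpha>) - K) / d) * e s)"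
    using Pf_wt by metis
  from this[OF s] show ?thesis
    by (intro integrable_mi_pow_mult Pf_borel) (auto simp: wt_def intro: le_less_trans)
qed

lemma Pf_moment:
  assumes "m\<Phi> = 1" "0 < s" "\<alpha> \<in> mi_upto K"
  shows "(\<integral>y. mi_pow y \<alpha> * Pf s y \<partial>lborel) = 0"
  using P_op_moment[OF assms(1) f_slice[OF assms(2)] _ e_nonneg assms(3)] assms(2) by (simp add: Pf_def)

text \<open>Tends to \<open>0\<close> as \<open>r \<rightarrow> \<infinity>\<close> by dominated convergence; this is the source of the \<open>\<epsilon>\<close> in the theorem.\<close>

definition mu :: "real \<Rightarrow> real \<Rightarrow> ennreal" where
  "mu s r = (\<integral>\<^sup>+y. ennreal (\<bar>Pf s y\<bar> * (norm y powr K * min 1 ((r powr (- 1 / d) * norm y) powr (real (Suc k0) - K)))) \<partial>lborel)"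

lemma mu_borel [measurable]: "(\<lambda>s. mu s r) \<in> borel_measurable borel"
proof -
  note [measurable] = Pf_borel_pair
  show ?thesis unfolding mu_def by measurable
qed

lemma mu_le_wt: "mu s r \<le> wt K (Pf s)"
  unfolding mu_def wt_def
  by (intro nn_integral_mono ennreal_leI mult_left_mono) (auto intro: mult_left_le)

lemma mu_bound: obtains C where "0 \<le> C" "\<And>s r. 0 < s \<Longrightarrow> mu s r \<le> ennreal (C * e s)"
proof -
  obtain C where C: "0 \<le> C" "\<And>s. 0 < s \<Longrightarrow> wt K (Pf s) \<le> ennreal (C * (1 + s) powr ((K - K) / d) * e s)"
    using Pf_wt[OF K(1) order_refl] by blast
  have "mu s r \<le> ennreal (C * e s)" if "0 < s" for s r
    using mu_le_wt[of s r] C(2)[OF that] that by simp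
  with C(1) that show ?thesis by blast
qed

text \<open>\<open>rho\<close> is increasing, so \<tau> may be replaced by the smaller r; the factor
  (r^(-1/d)|y|)^K then yields r^(-K/d) and leaves the integrand of \<open>mu\<close>.\<close>

lemma rho_integral_le_mu:
  assumes "0 < r" "r \<le> \<tau>"
  shows "(\<integral>\<^sup>+y. ennreal (\<bar>Pf s y\<bar> * rho (\<tau> powr (- 1 / d) * norm y)) \<partial>lborel) \<le> ennreal (r powr (- K / d)) * mu s r"
proof -
  have "rho (\<tau> powr (- 1 / d) * norm y) \<le> r powr (- K / d) * (norm y powr K * min 1 ((r powr (- 1 / d) * norm y) powr (real (Suc k0) - K)))" for y :: "real ^ 'n"
  proof -
    have le: "\<tau> powr (- 1 / d) \<le> r powr (- 1 / d)" using assms d by (intro powr_mono2') auto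
    have le2: "\<tau> powr (- 1 / d) * norm y \<le> r powr (- 1 / d) * norm y"
      using le by (rule mult_right_mono) simp
    have "rho (\<tau> powr (- 1 / d) * norm y) \<le> (r powr (- 1 / d) * norm y) powr K * min 1 ((r powr (- 1 / d) * norm y) powr (real (Suc k0) - K))"
      unfolding rho_def using k0 K(1)
      by (intro mult_mono min.mono powr_mono2 le2) auto
    also have "(r powr (- 1 / d) * norm y) powr K = r powr (- K / d) * norm y powr K"
      by (simp add: powr_mult powr_powr)
    finally show ?thesis by (simp only: mult.assoc)
  qed
  then have "(\<integral>\<^sup>+y. ennreal (\<bar>Pf s y\<bar> * rho (\<tau> powr (- 1 / d) * norm y)) \<partial>lborel)
    \<le> (\<integral>\<^sup>+y. ennreal (r powr (- K / d)) * ennreal (\<bar>Pf s y\<bar> * (norm y powr K * min 1 ((r powr (- 1 / d) * norm y) powr (real (Suc k0) - K)))) \<partial>lborel)"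
    by (intro nn_integral_mono) (simp add: mult.left_commute[of "r powr _"] ennreal_leI mult_left_mono flip: ennreal_mult)
  also have "\<dots> = ennreal (r powr (- K / d)) * mu s r"
    unfolding mu_def by (rule nn_integral_cmult) measurable
  finally show ?thesis .
qed

text \<open>The majorant of the time slices of the Duhamel integral: vanishing moments are exploited for
  \<open>s < t / 2\<close>, Young's inequality for \<open>t / 2 \<le> s\<close>.\<close>

definition \<beta> :: "nat \<Rightarrow> real \<Rightarrow> real \<Rightarrow> real" where
  "\<beta> j t s = (if s < t / 2 then t powr (- real j / d) * enn2real (mu s (t / 4)) else (t - s) powr (- real j / d) * e s)"

lemma \<beta>_nonneg: "0 \<le> \<beta> j t s" by (simp add: \<beta>_def e_nonneg)

lemma \<beta>_borel [measurable]: "\<beta> j t \<in> borel_measurable borel"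
  unfolding \<beta>_def[abs_def] by measurable

lemma powr_neg_le: "0 < c \<Longrightarrow> 0 < t \<Longrightarrow> t / c \<le> x \<Longrightarrow> 0 \<le> a \<Longrightarrow> x powr (- a) \<le> c powr a * t powr (- a)" for c t x a :: real
proof -
  assume *: "0 < c" "0 < t" "t / c \<le> x" "0 \<le> a"
  have "x powr (- a) \<le> (t / c) powr (- a)" using * by (intro powr_mono2') auto
  also have "\<dots> = c powr a * t powr (- a)" using * by (simp add: powr_divide powr_minus field_simps)
  finally show ?thesis .
qed

section \<open>Time slices near the final time and far from it\<close>

text \<open>For s >= t/2 negative powers of s and 1+s turn into powers of t at the price of powers
  of 2. The L^q norm is put on \<open>Pf s\<close> and the L^1 norm on the kernel, so that
  (t-s)^(-j/d) is the only singularity.\<close>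

lemma slice_near:
  assumes l: "0 \<le> l" "l \<le> K" and "is": "length is \<le> \<gamma>"
  obtains C where "0 \<le> C" "\<And>t s. 1 \<le> t \<Longrightarrow> t / 2 \<le> s \<Longrightarrow> s < t \<Longrightarrow>
    Lq_le q (conv (\<kappa> is (t - s)) (Pf s)) (C * (t powr (- \<sigma>) * t powr (- K / d) * ((t - s) powr (- real (length is) / d) * e s))) \<and>
    Lq_le 1 (conv (\<kappa> is (t - s)) (Pf s)) (C * (t powr (- K / d) * ((t - s) powr (- real (length is) / d) * e s))) \<and>
    wt l (conv (\<kappa> is (t - s)) (Pf s)) \<le> ennreal (C * (t powr (l / d) * t powr (- K / d) * ((t - s) powr (- real (length is) / d) * e s)))"
proof -
  have lL: "l < L" using l K by simp
  obtain A where A0: "0 \<le> A" and A: "\<And>is \<tau>. length is \<le> \<gamma> \<Longrightarrow> 0 < \<tau> \<Longrightarrow> Lq_le 1 (\<kappa> is \<tau>) (A * \<tau> powr (- real (length is) / d))"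
    using \<kappa>_L1 by blast
  obtain A' where A'0: "0 \<le> A'" and A': "\<And>is \<tau>. length is \<le> \<gamma> \<Longrightarrow> 0 < \<tau> \<Longrightarrow> wt l (\<kappa> is \<tau>) \<le> ennreal (A' * \<tau> powr ((l - real (length is)) / d))"
    using \<kappa>_weighted[OF l(1) lL] unfolding wt_def by blast
  obtain B where B0: "0 \<le> B" and B: "\<And>s. 0 < s \<Longrightarrow> Lq_le q (Pf s) (B * (s powr (- \<sigma>) * (1 + s) powr (- K / d) * e s))" using Pf_Lq by blast
  obtain B1 where B10: "0 \<le> B1" and B1: "\<And>s. 0 < s \<Longrightarrow> Lq_le 1 (Pf s) (B1 * (1 + s) powr (- K / d) * e s)" using Pf_L1 by blast
  obtain B2 where B20: "0 \<le> B2" and B2: "\<And>s. 0 < s \<Longrightarrow> wt l (Pf s) \<le> ennreal (B2 * (1 + s) powr ((l - K) / d) * e s)" using Pf_wt[OF l] by blast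
  note \<sigma>0 = \<sigma>_nonneg
  define j where "j = real (length is)"
  define C1 where "C1 = A * (B * (2 powr \<sigma> * 2 powr (K / d)))"
  define C2 where "C2 = A * (B1 * 2 powr (K / d))"
  define C3 where "C3 = 2 powr l * (A' * (B1 * 2 powr (K / d)) + A * (B2 * 2 powr ((K - l) / d)))"
  have C0: "0 \<le> C1" "0 \<le> C2" "0 \<le> C3" using A0 A'0 B0 B10 B20 by (auto simp: C1_def C2_def C3_def)
  show ?thesis
  proof (rule that[of "C1 + C2 + C3"])
    show "0 \<le> C1 + C2 + C3" using C0 by simp
    fix t s :: real assume t: "1 \<le> t" "t / 2 \<le> s" "s < t"
    have s: "0 < s" "0 < t - s" using t by linarith+
    define T where "T = (t - s) powr (- j / d)"
    define E where "E = e s"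
    have nn: "0 \<le> T" "0 \<le> E" by (simp_all add: T_def E_def e_nonneg)
    have ps: "s powr (- \<sigma>) \<le> 2 powr \<sigma> * t powr (- \<sigma>)" using t \<sigma>0 by (intro powr_neg_le) auto
    have pK: "(1 + s) powr (- K / d) \<le> 2 powr (K / d) * t powr (- K / d)" using t K d powr_neg_le[of 2 t "1 + s" "K / d"] by simp
    have pKl: "(1 + s) powr ((l - K) / d) \<le> 2 powr ((K - l) / d) * t powr ((l - K) / d)"
    proof -
      have "- ((K - l) / d) = (l - K) / d" by (simp add: minus_divide_left)
      then show ?thesis using t l d powr_neg_le[of 2 t "1 + s" "(K - l) / d"] by simp
    qed
    have 1: "Lq_le q (conv (\<kappa> is (t - s)) (Pf s)) (C1 * (t powr (- \<sigma>) * t powr (- K / d) * (T * E)))"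
    proof (rule Lq_le_mono)
      have "Lq_le q (conv (Pf s) (\<kappa> is (t - s))) ((B * (s powr (- \<sigma>) * (1 + s) powr (- K / d) * E)) * (A * T))"
        unfolding T_def E_def j_def by (rule Lq_le_conv[OF q B[OF s(1)] A[OF "is" s(2)]])
      then show "Lq_le q (conv (\<kappa> is (t - s)) (Pf s)) ((B * (s powr (- \<sigma>) * (1 + s) powr (- K / d) * E)) * (A * T))"
        using conv_commute[OF Pf_borel borel_measurable_\<kappa>[OF "is"]] by simp
      have "(B * (s powr (- \<sigma>) * (1 + s) powr (- K / d) * E)) * (A * T)
        \<le> (B * ((2 powr \<sigma> * t powr (- \<sigma>)) * (2 powr (K / d) * t powr (- K / d)) * E)) * (A * T)"
        using ps pK A0 B0 nn by (intro mult_right_mono mult_left_mono mult_mono) auto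
      also have "\<dots> = C1 * (t powr (- \<sigma>) * t powr (- K / d) * (T * E))" by (simp add: C1_def mult_ac)
      finally show "(B * (s powr (- \<sigma>) * (1 + s) powr (- K / d) * E)) * (A * T) \<le> C1 * (t powr (- \<sigma>) * t powr (- K / d) * (T * E))" .
    qed
    have 2: "Lq_le 1 (conv (\<kappa> is (t - s)) (Pf s)) (C2 * (t powr (- K / d) * (T * E)))"
    proof (rule Lq_le_mono)
      show "Lq_le 1 (conv (\<kappa> is (t - s)) (Pf s)) ((A * T) * (B1 * (1 + s) powr (- K / d) * E))"
        unfolding T_def E_def j_def by (rule Lq_le_conv[OF _ A[OF "is" s(2)] B1[OF s(1)]]) simp
      have "(A * T) * (B1 * (1 + s) powr (- K / d) * E) \<le> (A * T) * (B1 * (2 powr (K / d) * t powr (- K / d)) * E)"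
        using pK A0 B10 nn by (intro mult_right_mono mult_left_mono) auto
      also have "\<dots> = C2 * (t powr (- K / d) * (T * E))" by (simp add: C2_def mult_ac)
      finally show "(A * T) * (B1 * (1 + s) powr (- K / d) * E) \<le> C2 * (t powr (- K / d) * (T * E))" .
    qed
    have 3: "wt l (conv (\<kappa> is (t - s)) (Pf s)) \<le> ennreal (C3 * (t powr (l / d) * t powr (- K / d) * (T * E)))"
    proof -
      have "wt l (conv (\<kappa> is (t - s)) (Pf s)) \<le> ennreal (2 powr l * ((A' * (t - s) powr ((l - j) / d)) * (B1 * (1 + s) powr (- K / d) * E) + (A * T) * (B2 * (1 + s) powr ((l - K) / d) * E)))"
        unfolding T_def E_def j_def
        by (rule wt_conv[OF l(1) A[OF "is" s(2)] A'[OF "is" s(2)] B1[OF s(1)] B2[OF s(1)]])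
          (use A'0 B20 e_nonneg in auto)
      also have "\<dots> \<le> ennreal (C3 * (t powr (l / d) * t powr (- K / d) * (T * E)))"
      proof (rule ennreal_leI)
        have "(t - s) powr ((l - j) / d) = (t - s) powr (l / d) * T"
          by (simp add: T_def powr_add[symmetric] diff_divide_distrib)
        also have "\<dots> \<le> t powr (l / d) * T" using t s l d nn by (intro mult_right_mono powr_mono2) auto
        finally have u1: "(t - s) powr ((l - j) / d) \<le> t powr (l / d) * T" .
        have u2: "t powr ((l - K) / d) = t powr (l / d) * t powr (- K / d)" by (simp add: powr_add[symmetric] diff_divide_distrib)
        have "2 powr l * ((A' * (t - s) powr ((l - j) / d)) * (B1 * (1 + s) powr (- K / d) * E) + (A * T) * (B2 * (1 + s) powr ((l - K) / d) * E))
          \<le> 2 powr l * ((A' * (t powr (l / d) * T)) * (B1 * (2 powr (K / d) * t powr (- K / d)) * E) + (A * T) * (B2 * (2 powr ((K - l) / d) * (t powr (l / d) * t powr (- K / d))) * E))"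
          using u1 pK pKl[unfolded u2] A0 A'0 B10 B20 nn
          by (intro mult_left_mono add_mono mult_mono mult_right_mono) auto
        also have "\<dots> = C3 * (t powr (l / d) * t powr (- K / d) * (T * E))" by (simp add: C3_def algebra_simps)
        finally show "2 powr l * ((A' * (t - s) powr ((l - j) / d)) * (B1 * (1 + s) powr (- K / d) * E) + (A * T) * (B2 * (1 + s) powr ((l - K) / d) * E))
          \<le> C3 * (t powr (l / d) * t powr (- K / d) * (T * E))" .
      qed
      finally show ?thesis .
    qed
    have nnz: "0 \<le> t powr (- \<sigma>) * t powr (- K / d) * (T * E)" "0 \<le> t powr (- K / d) * (T * E)" "0 \<le> t powr (l / d) * t powr (- K / d) * (T * E)"
      using nn by auto
    show "Lq_le q (conv (\<kappa> is (t - s)) (Pf s)) ((C1 + C2 + C3) * (t powr (- \<sigma>) * t powr (- K / d) * ((t - s) powr (- real (length is) / d) * e s))) \<and>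
      Lq_le 1 (conv (\<kappa> is (t - s)) (Pf s)) ((C1 + C2 + C3) * (t powr (- K / d) * ((t - s) powr (- real (length is) / d) * e s))) \<and>
      wt l (conv (\<kappa> is (t - s)) (Pf s)) \<le> ennreal ((C1 + C2 + C3) * (t powr (l / d) * t powr (- K / d) * ((t - s) powr (- real (length is) / d) * e s)))"
      unfolding E_def[symmetric] j_def[symmetric] T_def[symmetric]
      using C0 nnz
      by (intro conjI Lq_le_mono[OF 1] Lq_le_mono[OF 2] order_trans[OF 3] ennreal_leI mult_right_mono) auto
  qed
qed

text \<open>The time t-s is halved. The outer factor \<open>\<kappa> is \<tau>\<close> takes the
  derivatives and the L^q norm, while the inner one acts on \<open>Pf s\<close> with the decay of
  \<open>conv_decay\<close>. Since s < t/2, the half time \<tau> is at least t/4, which is the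
  argument of \<open>mu\<close> and the origin of the powers of 4.\<close>

lemma slice_far:
  assumes l: "0 \<le> l" "l \<le> K" and "is": "length is \<le> \<gamma>"
  obtains C where "0 \<le> C" "\<And>t s. 1 \<le> t \<Longrightarrow> 0 < s \<Longrightarrow> s < t / 2 \<Longrightarrow>
    Lq_le q (conv (\<kappa> is (t - s)) (Pf s)) (C * (t powr (- \<sigma>) * t powr (- K / d) * (t powr (- real (length is) / d) * enn2real (mu s (t / 4))))) \<and>
    Lq_le 1 (conv (\<kappa> is (t - s)) (Pf s)) (C * (t powr (- K / d) * (t powr (- real (length is) / d) * enn2real (mu s (t / 4))))) \<and>
    wt l (conv (\<kappa> is (t - s)) (Pf s)) \<le> ennreal (C * (t powr (l / d) * t powr (- K / d) * (t powr (- real (length is) / d) * enn2real (mu s (t / 4)))))"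
proof -
  have lL: "l < L" using l K by simp
  obtain A where A0: "0 \<le> A" and A: "\<And>is \<tau>. length is \<le> \<gamma> \<Longrightarrow> 0 < \<tau> \<Longrightarrow> Lq_le 1 (\<kappa> is \<tau>) (A * \<tau> powr (- real (length is) / d))"
    using \<kappa>_L1 by blast
  obtain A' where A'0: "0 \<le> A'" and A': "\<And>is \<tau>. length is \<le> \<gamma> \<Longrightarrow> 0 < \<tau> \<Longrightarrow> wt l (\<kappa> is \<tau>) \<le> ennreal (A' * \<tau> powr ((l - real (length is)) / d))"
    using \<kappa>_weighted[OF l(1) lL] unfolding wt_def by blast
  obtain Q where Q0: "0 \<le> Q" and Q: "\<And>is \<tau>. length is \<le> \<gamma> \<Longrightarrow> 0 < \<tau> \<Longrightarrow> Lq_le q (\<kappa> is \<tau>) (Q * \<tau> powr (- (\<sigma> + real (length is) / d)))"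
    using \<kappa>_Lq[OF q] unfolding \<sigma>_def by blast
  \<comment> \<open>\<open>conv_decay\<close> specialised to \<open>Pf s\<close>; it is wanted for
    weight 0, feeding Young's inequality, and for weight l.\<close>
  have dec: "wt l' (conv (\<kappa> [] \<tau>) (Pf s)) \<le> ennreal (D * \<tau> powr (l' / d)) * (\<integral>\<^sup>+y. ennreal (\<bar>Pf s y\<bar> * rho (\<tau> powr (- 1 / d) * norm y)) \<partial>lborel)"
    if "\<And>F \<tau>. 0 < \<tau> \<Longrightarrow> integrable lborel F \<Longrightarrow>
    (\<And>\<alpha>. \<alpha> \<in> mi_upto K \<Longrightarrow> integrable lborel (\<lambda>y. mi_pow y \<alpha> * F y)) \<Longrightarrow>
    (m\<Phi> = 1 \<Longrightarrow> \<forall>\<alpha>\<in>mi_upto K. (\<integral>y. mi_pow y \<alpha> * F y \<partial>lborel) = 0) \<Longrightarrow>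
    wt l' (conv (\<kappa> [] \<tau>) F) \<le> ennreal (D * \<tau> powr (l' / d)) * (\<integral>\<^sup>+y. ennreal (\<bar>F y\<bar> * rho (\<tau> powr (- 1 / d) * norm y)) \<partial>lborel)"
      "0 < \<tau>" "0 < s" for l' D \<tau> s
    by (rule that(1)[OF that(2) Pf_integrable[OF that(3)] Pf_mi_pow_integrable[OF that(3)]]) (use Pf_moment that(3) in auto)
  obtain D0 where D00: "0 \<le> D0" and D0: "\<And>s \<tau>. 0 < s \<Longrightarrow> 0 < \<tau> \<Longrightarrow> wt 0 (conv (\<kappa> [] \<tau>) (Pf s)) \<le> ennreal (D0 * \<tau> powr (0 / d)) * (\<integral>\<^sup>+y. ennreal (\<bar>Pf s y\<bar> * rho (\<tau> powr (- 1 / d) * norm y)) \<partial>lborel)"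
    by (rule conv_decay[OF order_refl K(1)]) (use dec in blast)
  obtain D1 where D10: "0 \<le> D1" and D1: "\<And>s \<tau>. 0 < s \<Longrightarrow> 0 < \<tau> \<Longrightarrow> wt l (conv (\<kappa> [] \<tau>) (Pf s)) \<le> ennreal (D1 * \<tau> powr (l / d)) * (\<integral>\<^sup>+y. ennreal (\<bar>Pf s y\<bar> * rho (\<tau> powr (- 1 / d) * norm y)) \<partial>lborel)"
    by (rule conv_decay[OF l]) (use dec in blast)
  note \<sigma>0 = \<sigma>_nonneg
  obtain Cm where "0 \<le> Cm" and Cm: "\<And>s r. 0 < s \<Longrightarrow> mu s r \<le> ennreal (Cm * e s)" by (rule mu_bound[OF that])
  define j where "j = real (length is)"
  have j0: "0 \<le> j" by (simp add: j_def)
  define k where "k = (4::real) powr (K / d)"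
  define C1 where "C1 = Q * 4 powr (\<sigma> + j / d) * (D0 * k)"
  define C2 where "C2 = A * 4 powr (j / d) * (D0 * k)"
  define C3 where "C3 = 2 powr l * (A' * 4 powr (j / d) * (D0 * k) + A * 4 powr (j / d) * (D1 * k))"
  have C0: "0 \<le> C1" "0 \<le> C2" "0 \<le> C3" using A0 A'0 Q0 D00 D10 by (auto simp: C1_def C2_def C3_def k_def)
  show ?thesis
  proof (rule that[of "C1 + C2 + C3"])
    show "0 \<le> C1 + C2 + C3" using C0 by simp
    fix t s :: real assume t: "1 \<le> t" "0 < s" "s < t / 2"
    define \<tau> where "\<tau> = (t - s) / 2"
    have \<tau>: "0 < \<tau>" "t / 4 \<le> \<tau>" "\<tau> \<le> t" "\<tau> + \<tau> = t - s" using t by (auto simp: \<tau>_def)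
    \<comment> \<open>\<open>mu\<close> is finite for s > 0 by \<open>mu_bound\<close>, so nothing
      is lost by \<open>enn2real\<close>.\<close>
    define m where "m = enn2real (mu s (t / 4))"
    have m: "mu s (t / 4) = ennreal m" "0 \<le> m"
    proof -
      have "mu s (t / 4) < top" using Cm[OF t(2), of "t / 4"] by (auto intro: le_less_trans)
      then show "mu s (t / 4) = ennreal m" "0 \<le> m" by (simp_all add: m_def)
    qed
    define u where "u = conv (\<kappa> [] \<tau>) (Pf s)"
    have um: "u \<in> borel_measurable borel" unfolding u_def by (intro borel_measurable_conv borel_measurable_\<kappa> Pf_borel) simp
    have rb: "(\<integral>\<^sup>+y. ennreal (\<bar>Pf s y\<bar> * rho (\<tau> powr (- 1 / d) * norm y)) \<partial>lborel) \<le> ennreal (k * t powr (- K / d) * m)"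
    proof -
      have "(\<integral>\<^sup>+y. ennreal (\<bar>Pf s y\<bar> * rho (\<tau> powr (- 1 / d) * norm y)) \<partial>lborel) \<le> ennreal ((t / 4) powr (- K / d)) * mu s (t / 4)"
        using t \<tau> by (intro rho_integral_le_mu) auto
      also have "\<dots> = ennreal ((t / 4) powr (- K / d) * m)" using m by (simp add: ennreal_mult)
      also have "(t / 4) powr (- K / d) * m = k * t powr (- K / d) * m"
        using t by (simp add: k_def powr_divide powr_minus field_simps)
      finally show ?thesis .
    qed
    define X where "X = t powr (- K / d) * m"
    have X0: "0 \<le> X" using m by (simp add: X_def)
    have u1: "Lq_le 1 u (D0 * (k * X))"
    proof -
      have "wt 0 u \<le> ennreal (D0 * \<tau> powr (0 / d)) * ennreal (k * t powr (- K / d) * m)"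
        unfolding u_def using D0[OF t(2) \<tau>(1)] rb by (meson mult_left_mono order_trans zero_le)
      also have "\<dots> = ennreal (D0 * (k * X))" using D00 m \<tau> by (simp add: X_def k_def mult_ac flip: ennreal_mult)
      finally show ?thesis using um D00 X0 by (simp add: Lq_le_1_iff wt_0 k_def)
    qed
    have u2: "wt l u \<le> ennreal (D1 * t powr (l / d) * (k * X))"
    proof -
      have "wt l u \<le> ennreal (D1 * \<tau> powr (l / d)) * ennreal (k * t powr (- K / d) * m)"
        unfolding u_def using D1[OF t(2) \<tau>(1)] rb by (meson mult_left_mono order_trans zero_le)
      also have "\<dots> \<le> ennreal (D1 * t powr (l / d)) * ennreal (k * t powr (- K / d) * m)"
        using D10 l d \<tau> by (intro mult_right_mono ennreal_leI mult_left_mono powr_mono2) auto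
      also have "\<dots> = ennreal (D1 * t powr (l / d) * (k * X))" using D10 m by (simp add: X_def k_def mult_ac flip: ennreal_mult)
      finally show ?thesis .
    qed
    have eq: "conv (\<kappa> is (t - s)) (Pf s) = conv (\<kappa> is \<tau>) u"
    proof
      fix x
      obtain B where B: "\<And>is x. length is \<le> \<gamma> \<Longrightarrow> \<bar>\<kappa> is \<tau> x\<bar> \<le> B" using \<kappa>_bounded[OF \<tau>(1)] by metis
      have "conv (\<kappa> is (t - s)) (Pf s) x = conv (conv (\<kappa> is \<tau>) (\<kappa> [] \<tau>)) (Pf s) x"
        using conv_\<kappa>_\<kappa>(1)[OF \<tau>(1,1) "is"] \<tau>(4) by simp
      also have "\<dots> = conv (\<kappa> is \<tau>) u x"
        unfolding u_def by (rule conv_assoc[OF borel_measurable_\<kappa>[OF "is"] B[OF "is"] integrable_\<kappa>[OF _ \<tau>(1)] Pf_integrable[OF t(2)]]) simp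
      finally show "conv (\<kappa> is (t - s)) (Pf s) x = conv (\<kappa> is \<tau>) u x" .
    qed
    define T where "T = t powr (- j / d)"
    have T0: "0 \<le> T" by (simp add: T_def)
    have \<tau>j: "\<tau> powr (- j / d) \<le> 4 powr (j / d) * T" unfolding T_def using t \<tau> j0 d powr_neg_le[of 4 t \<tau> "j / d"] by simp
    have 1: "Lq_le q (conv (\<kappa> is \<tau>) u) (C1 * (t powr (- \<sigma>) * t powr (- K / d) * (T * m)))"
    proof (rule Lq_le_mono)
      show "Lq_le q (conv (\<kappa> is \<tau>) u) ((Q * \<tau> powr (- (\<sigma> + j / d))) * (D0 * (k * X)))"
        unfolding j_def by (rule Lq_le_conv[OF q Q[OF "is" \<tau>(1)] u1])
      have "\<tau> powr (- (\<sigma> + j / d)) \<le> 4 powr (\<sigma> + j / d) * t powr (- (\<sigma> + j / d))"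
        using t \<tau> \<sigma>0 j0 d by (intro powr_neg_le) auto
      also have "t powr (- (\<sigma> + j / d)) = t powr (- \<sigma>) * T" by (simp add: T_def powr_add[symmetric])
      finally have "(Q * \<tau> powr (- (\<sigma> + j / d))) * (D0 * (k * X)) \<le> (Q * (4 powr (\<sigma> + j / d) * (t powr (- \<sigma>) * T))) * (D0 * (k * X))"
        using Q0 D00 X0 by (intro mult_right_mono mult_left_mono) (auto simp: k_def)
      also have "\<dots> = C1 * (t powr (- \<sigma>) * t powr (- K / d) * (T * m))" by (simp add: C1_def X_def mult_ac)
      finally show "(Q * \<tau> powr (- (\<sigma> + j / d))) * (D0 * (k * X)) \<le> C1 * (t powr (- \<sigma>) * t powr (- K / d) * (T * m))" .
    qed
    have 2: "Lq_le 1 (conv (\<kappa> is \<tau>) u) (C2 * (t powr (- K / d) * (T * m)))"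
    proof (rule Lq_le_mono)
      show "Lq_le 1 (conv (\<kappa> is \<tau>) u) ((A * \<tau> powr (- j / d)) * (D0 * (k * X)))"
        unfolding j_def by (rule Lq_le_conv[OF _ A[OF "is" \<tau>(1)] u1]) simp
      have "(A * \<tau> powr (- j / d)) * (D0 * (k * X)) \<le> (A * (4 powr (j / d) * T)) * (D0 * (k * X))"
        using \<tau>j A0 D00 X0 by (intro mult_right_mono mult_left_mono) (auto simp: k_def)
      also have "\<dots> = C2 * (t powr (- K / d) * (T * m))" by (simp add: C2_def X_def mult_ac)
      finally show "(A * \<tau> powr (- j / d)) * (D0 * (k * X)) \<le> C2 * (t powr (- K / d) * (T * m))" .
    qed
    have 3: "wt l (conv (\<kappa> is \<tau>) u) \<le> ennreal (C3 * (t powr (l / d) * t powr (- K / d) * (T * m)))"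
    proof -
      have "wt l (conv (\<kappa> is \<tau>) u) \<le> ennreal (2 powr l * ((A' * \<tau> powr ((l - j) / d)) * (D0 * (k * X)) + (A * \<tau> powr (- j / d)) * (D1 * t powr (l / d) * (k * X))))"
        unfolding j_def by (rule wt_conv[OF l(1) A[OF "is" \<tau>(1)] A'[OF "is" \<tau>(1)] u1 u2]) (use A'0 D10 X0 in \<open>auto simp: k_def\<close>)
      also have "\<dots> \<le> ennreal (C3 * (t powr (l / d) * t powr (- K / d) * (T * m)))"
      proof (rule ennreal_leI)
        have "\<tau> powr ((l - j) / d) = \<tau> powr (l / d) * \<tau> powr (- j / d)"
          by (simp add: powr_add[symmetric] diff_divide_distrib)
        also have "\<dots> \<le> t powr (l / d) * (4 powr (j / d) * T)"
          using \<tau> l d \<tau>j by (intro mult_mono powr_mono2) auto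
        finally have v1: "\<tau> powr ((l - j) / d) \<le> t powr (l / d) * (4 powr (j / d) * T)" .
        have "2 powr l * ((A' * \<tau> powr ((l - j) / d)) * (D0 * (k * X)) + (A * \<tau> powr (- j / d)) * (D1 * t powr (l / d) * (k * X)))
          \<le> 2 powr l * ((A' * (t powr (l / d) * (4 powr (j / d) * T))) * (D0 * (k * X)) + (A * (4 powr (j / d) * T)) * (D1 * t powr (l / d) * (k * X)))"
          using v1 \<tau>j A0 A'0 D00 D10 X0 by (intro mult_left_mono add_mono mult_right_mono) (auto simp: k_def)
        also have "\<dots> = C3 * (t powr (l / d) * t powr (- K / d) * (T * m))" by (simp add: C3_def X_def algebra_simps)
        finally show "2 powr l * ((A' * \<tau> powr ((l - j) / d)) * (D0 * (k * X)) + (A * \<tau> powr (- j / d)) * (D1 * t powr (l / d) * (k * X)))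
          \<le> C3 * (t powr (l / d) * t powr (- K / d) * (T * m))" .
      qed
      finally show ?thesis .
    qed
    have nnz: "0 \<le> t powr (- \<sigma>) * t powr (- K / d) * (T * m)" "0 \<le> t powr (- K / d) * (T * m)" "0 \<le> t powr (l / d) * t powr (- K / d) * (T * m)"
      using m T0 by auto
    show "Lq_le q (conv (\<kappa> is (t - s)) (Pf s)) ((C1 + C2 + C3) * (t powr (- \<sigma>) * t powr (- K / d) * (t powr (- real (length is) / d) * enn2real (mu s (t / 4))))) \<and>
      Lq_le 1 (conv (\<kappa> is (t - s)) (Pf s)) ((C1 + C2 + C3) * (t powr (- K / d) * (t powr (- real (length is) / d) * enn2real (mu s (t / 4))))) \<and>
      wt l (conv (\<kappa> is (t - s)) (Pf s)) \<le> ennreal ((C1 + C2 + C3) * (t powr (l / d) * t powr (- K / d) * (t powr (- real (length is) / d) * enn2real (mu s (t / 4)))))"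
      unfolding eq j_def[symmetric] T_def[symmetric] m_def[symmetric]
      using C0 nnz
      by (intro conjI Lq_le_mono[OF 1] Lq_le_mono[OF 2] order_trans[OF 3] ennreal_leI mult_right_mono) auto
  qed
qed

lemma slice_estimate:
  assumes l: "0 \<le> l" "l \<le> K" and "is": "length is \<le> \<gamma>"
  obtains C where "0 \<le> C" "\<And>t s. 1 \<le> t \<Longrightarrow> 0 < s \<Longrightarrow> s < t \<Longrightarrow>
    Lq_le q (conv (\<kappa> is (t - s)) (Pf s)) (C * (t powr (- \<sigma>) * t powr (- K / d) * \<beta> (length is) t s)) \<and>
    Lq_le 1 (conv (\<kappa> is (t - s)) (Pf s)) (C * (t powr (- K / d) * \<beta> (length is) t s)) \<and>
    wt l (conv (\<kappa> is (t - s)) (Pf s)) \<le> ennreal (C * (t powr (l / d) * t powr (- K / d) * \<beta> (length is) t s))"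
proof -
  obtain C1 where C10: "0 \<le> C1" and C1: "\<And>t s. 1 \<le> t \<Longrightarrow> t / 2 \<le> s \<Longrightarrow> s < t \<Longrightarrow>
    Lq_le q (conv (\<kappa> is (t - s)) (Pf s)) (C1 * (t powr (- \<sigma>) * t powr (- K / d) * ((t - s) powr (- real (length is) / d) * e s))) \<and>
    Lq_le 1 (conv (\<kappa> is (t - s)) (Pf s)) (C1 * (t powr (- K / d) * ((t - s) powr (- real (length is) / d) * e s))) \<and>
    wt l (conv (\<kappa> is (t - s)) (Pf s)) \<le> ennreal (C1 * (t powr (l / d) * t powr (- K / d) * ((t - s) powr (- real (length is) / d) * e s)))"
    using slice_near[OF l "is"] by blast
  obtain C2 where C20: "0 \<le> C2" and C2: "\<And>t s. 1 \<le> t \<Longrightarrow> 0 < s \<Longrightarrow> s < t / 2 \<Longrightarrow>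
    Lq_le q (conv (\<kappa> is (t - s)) (Pf s)) (C2 * (t powr (- \<sigma>) * t powr (- K / d) * (t powr (- real (length is) / d) * enn2real (mu s (t / 4))))) \<and>
    Lq_le 1 (conv (\<kappa> is (t - s)) (Pf s)) (C2 * (t powr (- K / d) * (t powr (- real (length is) / d) * enn2real (mu s (t / 4))))) \<and>
    wt l (conv (\<kappa> is (t - s)) (Pf s)) \<le> ennreal (C2 * (t powr (l / d) * t powr (- K / d) * (t powr (- real (length is) / d) * enn2real (mu s (t / 4)))))"
    using slice_far[OF l "is"] by blast
  define P where "P C b t s \<longleftrightarrow> Lq_le q (conv (\<kappa> is (t - s)) (Pf s)) (C * (t powr (- \<sigma>) * t powr (- K / d) * b)) \<and>
    Lq_le 1 (conv (\<kappa> is (t - s)) (Pf s)) (C * (t powr (- K / d) * b)) \<and>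
    wt l (conv (\<kappa> is (t - s)) (Pf s)) \<le> ennreal (C * (t powr (l / d) * t powr (- K / d) * b))" for C b t s
  have mono: "P C' b t s" if "P C b t s" "C \<le> C'" "0 \<le> b" for C C' b t s
  proof -
    have z: "C * Z \<le> C' * Z" if "0 \<le> Z" for Z using \<open>C \<le> C'\<close> that by (rule mult_right_mono)
    have 1: "Lq_le q (conv (\<kappa> is (t - s)) (Pf s)) (C * (t powr (- \<sigma>) * t powr (- K / d) * b))"
      and 2: "Lq_le 1 (conv (\<kappa> is (t - s)) (Pf s)) (C * (t powr (- K / d) * b))"
      and 3: "wt l (conv (\<kappa> is (t - s)) (Pf s)) \<le> ennreal (C * (t powr (l / d) * t powr (- K / d) * b))"
      using that(1) unfolding P_def by blast+
    show ?thesis unfolding P_def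
      by (intro conjI Lq_le_mono[OF 1] Lq_le_mono[OF 2] order_trans[OF 3] ennreal_leI z) (use that(3) in auto)
  qed
  have "P (C1 + C2) (\<beta> (length is) t s) t s" if "1 \<le> t" "0 < s" "s < t" for t s
  proof (cases "s < t / 2")
    case True
    then have "P C2 (\<beta> (length is) t s) t s" using C2[of t s] that by (simp add: P_def \<beta>_def)
    then show ?thesis by (rule mono) (use C10 \<beta>_nonneg in auto)
  next
    case False
    then have "P C1 (\<beta> (length is) t s) t s" using C1[of t s] that by (simp add: P_def \<beta>_def)
    then show ?thesis by (rule mono) (use C20 \<beta>_nonneg in auto)
  qed
  then show ?thesis using that[of "C1 + C2"] C10 C20 unfolding P_def by auto
qed

end

section \<open>The Duhamel integral and its weak derivatives\<close>

lemma integrable_pairI: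
  fixes H :: "real \<Rightarrow> 'a::euclidean_space \<Rightarrow> real"
  assumes m: "(\<lambda>z. H (fst z) (snd z)) \<in> borel_measurable (lborel \<Otimes>\<^sub>M lborel)"
    and fin: "(\<integral>\<^sup>+s. (\<integral>\<^sup>+x. ennreal \<bar>H s x\<bar> \<partial>lborel) \<partial>lborel) < \<infinity>"
  shows "integrable (lborel \<Otimes>\<^sub>M lborel) (\<lambda>(s, x). H s x)"
proof -
  have "(\<integral>\<^sup>+z. ennreal \<bar>H (fst z) (snd z)\<bar> \<partial>(lborel \<Otimes>\<^sub>M lborel)) = (\<integral>\<^sup>+s. (\<integral>\<^sup>+x. ennreal \<bar>H s x\<bar> \<partial>lborel) \<partial>lborel)"
    using m by (subst lborel.nn_integral_fst[symmetric]) auto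
  then show ?thesis using m fin by (simp add: integrable_iff_bounded case_prod_beta')
qed

text \<open>The complement of the compact set C is open, so \<phi> vanishes near each of its points
  and the derivative vanishes there too.\<close>

lemma test_function_partial:
  assumes "test_function \<phi>"
  shows "test_function (partial i \<phi>)"
proof -
  obtain C where C: "compact C" "\<And>x. x \<notin> C \<Longrightarrow> \<phi> x = 0" and sm: "\<And>k. Ck_on k UNIV \<phi>"
    using assms by (auto simp: test_function_def)
  have "partial i \<phi> x = 0" if x: "x \<notin> C" for x
  proof -
    have "open (- C)" using C(1) compact_imp_closed by blast
    then obtain r where r: "0 < r" "ball x r \<subseteq> - C" using x by (auto simp: open_contains_ball)
    have "((\<lambda>_. 0) has_real_derivative 0) (at (0::real))" by simp
    then have "((\<lambda>h. \<phi> (x + h *\<^sub>R axis i 1)) has_real_derivative 0) (at 0)"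
    proof (rule has_field_derivative_transform_within_open[of _ _ _ "ball 0 r"])
      fix h :: real assume "h \<in> ball 0 r"
      then have "x + h *\<^sub>R axis i 1 \<in> ball x r" by (simp add: dist_norm norm_axis_1)
      then show "0 = \<phi> (x + h *\<^sub>R axis i 1)" using r C(2) by auto
    qed (use r in auto)
    then show ?thesis unfolding partial_def by (rule DERIV_imp_deriv)
  qed
  moreover have "Ck_on k UNIV (partial i \<phi>)" for k using Ck_on_Suc_partial(2)[OF sm] .
  ultimately show ?thesis using C(1) unfolding test_function_def by blast
qed

lemma test_function_foldr_partial: "test_function \<phi> \<Longrightarrow> test_function (foldr partial is \<phi>)"
  by (induction "is") (auto intro: test_function_partial)

lemma test_function_bounded:
  assumes "test_function \<phi>"
  obtains B where "0 \<le> B" "\<And>x. \<bar>\<phi> x\<bar> \<le> B"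
proof -
  obtain C where C: "compact C" "\<And>x. x \<notin> C \<Longrightarrow> \<phi> x = 0" using assms by (auto simp: test_function_def)
  have "bounded (\<phi> ` C)"
    using compact_continuous_image[OF continuous_on_subset[OF test_function_continuous[OF assms]] C(1)] compact_imp_bounded by blast
  then obtain B where B: "\<And>x. x \<in> C \<Longrightarrow> \<bar>\<phi> x\<bar> \<le> B" by (auto simp: bounded_iff)
  have "\<bar>\<phi> x\<bar> \<le> \<bar>B\<bar>" for x using C(2)[of x] B[of x] by (cases "x \<in> C") auto
  then show ?thesis using that[of "\<bar>B\<bar>"] by simp
qed

lemma test_function_borel: "test_function \<phi> \<Longrightarrow> \<phi> \<in> borel_measurable borel"
  by (rule borel_measurable_continuous_onI[OF test_function_continuous])

lemma integrable_mult_test_function: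
  fixes W :: "real ^ 'n::finite \<Rightarrow> real"
  assumes W: "integrable lborel W" and \<phi>: "test_function \<phi>"
  shows "integrable lborel (\<lambda>x. W x * \<phi> x)"
proof -
  note [measurable] = test_function_borel[OF \<phi>]
  have [measurable]: "W \<in> borel_measurable borel" using W by auto
  obtain B where B: "0 \<le> B" "\<And>x. \<bar>\<phi> x\<bar> \<le> B" using test_function_bounded[OF \<phi>] by blast
  show ?thesis
  proof (rule Bochner_Integration.integrable_bound[where f = "\<lambda>x. B * W x"])
    show "AE x in lborel. norm (W x * \<phi> x) \<le> norm (B * W x)"
      using B by (intro AE_I2) (auto simp: abs_mult mult.commute[of B] intro!: mult_left_mono)
  qed (use W in auto)
qed

lemma locally_integrable_integrable:
  fixes u :: "real ^ 'n::finite \<Rightarrow> real"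
  assumes "integrable lborel u"
  shows "locally_integrable u"
  unfolding locally_integrable_def set_integrable_def
proof (intro allI impI)
  fix C :: "(real ^ 'n) set" assume "compact C"
  have "integrable lebesgue u" using assms by (simp add: integrable_completion borel_measurable_integrable)
  then show "integrable lebesgue (\<lambda>x. indicat_real C x *\<^sub>R u x)"
    using lmeasurable_compact[OF \<open>compact C\<close>, THEN fmeasurableD] by (intro integrable_mult_indicator)
qed

context duhamel_kernel
begin

text \<open>Symmetry of the mixed derivatives; integration by parts hands the derivatives over in
  reversed order, and this undoes the reversal.\<close>

lemma \<kappa>_rev: "length is \<le> \<gamma> \<Longrightarrow> \<kappa> (rev is) = \<kappa> is"
  using foldr_partial_perm[OF _ Ck_\<Phi>, of "rev is" "is"] by (simp add: \<kappa>_def fun_eq_iff D\<Phi>_def)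

text \<open>The derivatives are shifted from \<phi> to the kernel one at a time, outermost first,
  and each lands in front of \<open>js\<close>; this reverses the list.\<close>

lemma conv_\<kappa>_by_parts:
  assumes \<tau>: "0 < \<tau>" and u: "integrable lborel u" and \<phi>: "test_function \<phi>"
  shows "length is + length js \<le> \<gamma> \<Longrightarrow> (\<integral>x. conv (\<kappa> js \<tau>) u x * foldr partial is \<phi> x \<partial>lborel)
    = (-1) ^ length is * (\<integral>x. conv (\<kappa> (rev is @ js) \<tau>) u x * \<phi> x \<partial>lborel)"
proof (induction "is" arbitrary: js)
  case (Cons i "is")
  define \<psi> where "\<psi> = foldr partial is \<phi>"
  have \<psi>: "test_function \<psi>" unfolding \<psi>_def by (rule test_function_foldr_partial[OF \<phi>])
  have sm: "Ck_on (Suc 0) UNIV \<psi>" using \<psi> unfolding test_function_def by blast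
  have ci: "integrable lborel (conv (\<kappa> ks \<tau>) u)" if "length ks \<le> \<gamma>" for ks
    using integrable_conv[OF integrable_\<kappa>[OF that \<tau>] u] .
  have "(\<integral>x. conv (\<kappa> js \<tau>) u x * partial i \<psi> x \<partial>lborel) = - (\<integral>x. conv (\<kappa> (i # js) \<tau>) u x * \<psi> x \<partial>lborel)"
  proof (rule integration_by_parts)
    show "has_pd i (conv (\<kappa> js \<tau>) u) (conv (\<kappa> (i # js) \<tau>) u)"
      by (rule conv_\<kappa>_has_pd[OF \<tau> _ u]) (use Cons.prems in simp)
    show "has_pd i \<psi> (partial i \<psi>)" by (rule Ck_on_Suc_partial(1)[OF sm])
    have len: "length js \<le> \<gamma>" "length (i # js) \<le> \<gamma>" using Cons.prems by auto
    note \<psi>' = test_function_partial[OF \<psi>, of i]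
    show "continuous_on UNIV (conv (\<kappa> js \<tau>) u)" "continuous_on UNIV (conv (\<kappa> (i # js) \<tau>) u)"
      using continuous_conv_\<kappa>[OF \<tau> _ u] len by blast+
    show "continuous_on UNIV \<psi>" "continuous_on UNIV (partial i \<psi>)"
      using test_function_continuous \<psi> \<psi>' by blast+
    show "integrable lborel (\<lambda>x. conv (\<kappa> js \<tau>) u x * \<psi> x)" "integrable lborel (\<lambda>x. conv (\<kappa> js \<tau>) u x * partial i \<psi> x)"
      "integrable lborel (\<lambda>x. conv (\<kappa> (i # js) \<tau>) u x * \<psi> x)"
      using integrable_mult_test_function ci len \<psi> \<psi>' by blast+
  qed
  also have "(\<integral>x. conv (\<kappa> (i # js) \<tau>) u x * \<psi> x \<partial>lborel) = (-1) ^ length is * (\<integral>x. conv (\<kappa> (rev is @ i # js) \<tau>) u x * \<phi> x \<partial>lborel)"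
    unfolding \<psi>_def using Cons.IH[of "i # js"] Cons.prems by simp
  finally show ?case by (simp add: \<psi>_def)
qed simp

end

context duhamel
begin

definition w :: "'n list \<Rightarrow> real \<Rightarrow> real \<Rightarrow> real ^ 'n \<Rightarrow> real" where
  "w is t s x = indicator {0<..<t} s * conv (\<kappa> is (t - s)) (Pf s) x"

text \<open>\<open>v [] t\<close> is the Duhamel integral; \<open>v is t\<close> is the candidate
  for its derivative along \<open>is\<close>, with the derivative placed on the kernel under both
  integrals.\<close>

definition v :: "'n list \<Rightarrow> real \<Rightarrow> real ^ 'n \<Rightarrow> real" where
  "v is t x = (\<integral>s. w is t s x \<partial>lborel)"

lemma w_borel_pair:
  assumes "is": "length is \<le> \<gamma>" and [measurable]: "a \<in> borel_measurable M" "b \<in> borel_measurable M"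
  shows "(\<lambda>z. w is t (a z) (b z)) \<in> borel_measurable M"
proof -
  have [measurable]: "(\<lambda>z. \<kappa> is (t - a (fst z)) (b (fst z) - snd z)) \<in> borel_measurable (M \<Otimes>\<^sub>M lborel)"
    by (rule borel_measurable_\<kappa>_pair[OF "is"]) measurable
  have [measurable]: "(\<lambda>z. Pf (a (fst z)) (snd z)) \<in> borel_measurable (M \<Otimes>\<^sub>M lborel)"
    by (rule Pf_borel_pair) measurable
  show ?thesis unfolding w_def conv_def by measurable
qed

lemma v_borel: "length is \<le> \<gamma> \<Longrightarrow> v is t \<in> borel_measurable borel"
proof -
  assume "is": "length is \<le> \<gamma>"
  have [measurable]: "(\<lambda>z. w is t (snd z) (fst z)) \<in> borel_measurable (borel \<Otimes>\<^sub>M lborel)"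
    by (rule w_borel_pair[OF "is"]) measurable
  show ?thesis unfolding v_def by measurable
qed

lemma singular_integral_finite:
  assumes "a < 1" "0 < t"
  shows "(\<integral>\<^sup>+s. ennreal (indicator {0<..<t} s * ((t - s) powr (- a) * e s)) \<partial>lborel) < \<infinity>"
proof -
  obtain B where B: "0 \<le> B" "AE s in lborel. 0 < s \<and> s < t \<longrightarrow> e s \<le> B" using e_bdd[of t] by blast
  have "(\<integral>\<^sup>+s. ennreal (indicator {0<..<t} s * ((t - s) powr (- a) * e s)) \<partial>lborel)
    \<le> (\<integral>\<^sup>+s. ennreal B * (indicator {0<..<t} s * ennreal ((t - s) powr (- a))) \<partial>lborel)"
  proof (rule nn_integral_mono_AE, use B(2) in eventually_elim)
    fix s assume "0 < s \<and> s < t \<longrightarrow> e s \<le> B"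
    then show "ennreal (indicator {0<..<t} s * ((t - s) powr (- a) * e s)) \<le> ennreal B * (indicator {0<..<t} s * ennreal ((t - s) powr (- a)))"
      using B(1) by (auto simp: indicator_def mult.commute[of B] simp flip: ennreal_mult intro!: ennreal_leI mult_left_mono)
  qed
  also have "\<dots> = ennreal B * (\<integral>\<^sup>+s. indicator {0<..<t} s * ennreal ((t - s) powr (- a)) \<partial>lborel)"
    by (rule nn_integral_cmult) measurable
  also have "\<dots> < \<infinity>" using nn_integral_singular_weight[OF assms] by (simp add: ennreal_mult_less_top)
  finally show ?thesis .
qed

lemma e_integral_finite: "(\<integral>\<^sup>+s. ennreal (indicator {0<..<t} s * e s) \<partial>lborel) < \<infinity>"
proof (cases "0 < t")
  case True
  have "(\<integral>\<^sup>+s. ennreal (indicator {0<..<t} s * e s) \<partial>lborel) = (\<integral>\<^sup>+s. ennreal (indicator {0<..<t} s * ((t - s) powr (- 0) * e s)) \<partial>lborel)"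
    by (intro nn_integral_cong) (auto simp: indicator_def)
  then show ?thesis using singular_integral_finite[of 0 t] True by simp
next
  case False
  then have "(\<integral>\<^sup>+s. ennreal (indicator {0<..<t} s * e s) \<partial>lborel) = (\<integral>\<^sup>+s. 0 \<partial>(lborel :: real measure))"
    by (intro nn_integral_cong) (auto simp: indicator_def)
  then show ?thesis by simp
qed

text \<open>A slice costs a multiple of (t-s)^(-j/d) e(s) in L^1, with j the length of the list; as
  e is essentially bounded on (0,t), j < d makes this integrable up to s = t.\<close>

lemma w_L1:
  assumes "is": "length is \<le> \<gamma>" and j: "real (length is) < d" and t: "0 < t"
  shows "(\<integral>\<^sup>+s. (\<integral>\<^sup>+x. ennreal \<bar>w is t s x\<bar> \<partial>lborel) \<partial>lborel) < \<infinity>"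
proof -
  obtain A where A0: "0 \<le> A" and A: "\<And>is \<tau>. length is \<le> \<gamma> \<Longrightarrow> 0 < \<tau> \<Longrightarrow> Lq_le 1 (\<kappa> is \<tau>) (A * \<tau> powr (- real (length is) / d))"
    using \<kappa>_L1 by blast
  obtain B where B0: "0 \<le> B" and B: "\<And>s. 0 < s \<Longrightarrow> Lq_le 1 (Pf s) (B * (1 + s) powr (- K / d) * e s)" using Pf_L1 by blast
  have "(\<integral>\<^sup>+s. (\<integral>\<^sup>+x. ennreal \<bar>w is t s x\<bar> \<partial>lborel) \<partial>lborel)
    \<le> (\<integral>\<^sup>+s. ennreal (A * B) * ennreal (indicator {0<..<t} s * ((t - s) powr (- (real (length is) / d)) * e s)) \<partial>lborel)"
  proof (rule nn_integral_mono)
    fix s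
    show "(\<integral>\<^sup>+x. ennreal \<bar>w is t s x\<bar> \<partial>lborel) \<le> ennreal (A * B) * ennreal (indicator {0<..<t} s * ((t - s) powr (- (real (length is) / d)) * e s))"
    proof (cases "s \<in> {0<..<t}")
      case True
      then have s: "0 < s" "0 < t - s" by auto
      have "Lq_le 1 (conv (\<kappa> is (t - s)) (Pf s)) ((A * (t - s) powr (- real (length is) / d)) * (B * (1 + s) powr (- K / d) * e s))"
        by (rule Lq_le_conv[OF _ A[OF "is" s(2)] B[OF s(1)]]) simp
      then have "(\<integral>\<^sup>+x. ennreal \<bar>w is t s x\<bar> \<partial>lborel) \<le> ennreal ((A * (t - s) powr (- real (length is) / d)) * (B * (1 + s) powr (- K / d) * e s))"
        using True by (simp add: w_def Lq_le_1_iff)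
      also have "\<dots> \<le> ennreal ((A * (t - s) powr (- real (length is) / d)) * (B * 1 * e s))"
      proof (intro ennreal_leI mult_left_mono mult_right_mono)
        have "(1 + s) powr (- K / d) \<le> (1 + s) powr 0" using s K d by (intro powr_mono) auto
        then show "(1 + s) powr (- K / d) \<le> 1" using s by simp
      qed (use A0 B0 e_nonneg in auto)
      also have "\<dots> = ennreal (A * B) * ennreal (indicator {0<..<t} s * ((t - s) powr (- (real (length is) / d)) * e s))"
        using True A0 B0 e_nonneg[of s] by (simp add: mult_ac flip: ennreal_mult)
      finally show ?thesis .
    next
      case False
      then show ?thesis by (simp add: w_def)
    qed
  qed
  also have "\<dots> = ennreal (A * B) * (\<integral>\<^sup>+s. ennreal (indicator {0<..<t} s * ((t - s) powr (- (real (length is) / d)) * e s)) \<partial>lborel)"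
    by (rule nn_integral_cmult) measurable
  also have "\<dots> < \<infinity>" using singular_integral_finite[of "real (length is) / d" t] j t d by (simp add: ennreal_mult_less_top)
  finally show ?thesis .
qed

lemma w_integrable_pair:
  assumes "is": "length is \<le> \<gamma>" and j: "real (length is) < d" and t: "0 < t"
    and \<psi>: "\<psi> \<in> borel_measurable borel" "\<And>x. \<bar>\<psi> x\<bar> \<le> B"
  shows "integrable (lborel \<Otimes>\<^sub>M lborel) (\<lambda>(s, x). w is t s x * \<psi> x)"
proof (rule integrable_pairI)
  have [measurable]: "(\<lambda>z. w is t (fst z) (snd z)) \<in> borel_measurable (lborel \<Otimes>\<^sub>M lborel)"
    by (rule w_borel_pair[OF "is"]) measurable
  note [measurable] = \<psi>(1)
  show "(\<lambda>z. w is t (fst z) (snd z) * \<psi> (snd z)) \<in> borel_measurable (lborel \<Otimes>\<^sub>M lborel)" by measurable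
  have "(\<integral>\<^sup>+s. (\<integral>\<^sup>+x. ennreal \<bar>w is t s x * \<psi> x\<bar> \<partial>lborel) \<partial>lborel) \<le> (\<integral>\<^sup>+s. (\<integral>\<^sup>+x. ennreal \<bar>B\<bar> * ennreal \<bar>w is t s x\<bar> \<partial>lborel) \<partial>lborel)"
  proof (intro nn_integral_mono)
    fix s x
    have "\<bar>w is t s x * \<psi> x\<bar> \<le> \<bar>B\<bar> * \<bar>w is t s x\<bar>"
    proof -
      have "\<bar>w is t s x\<bar> * \<bar>\<psi> x\<bar> \<le> \<bar>w is t s x\<bar> * \<bar>B\<bar>"
        using \<psi>(2)[of x] by (intro mult_left_mono) auto
      then show ?thesis by (simp only: abs_mult mult.commute[of "\<bar>B\<bar>"])
    qed
    then show "ennreal \<bar>w is t s x * \<psi> x\<bar> \<le> ennreal \<bar>B\<bar> * ennreal \<bar>w is t s x\<bar>"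
      by (simp add: ennreal_leI flip: ennreal_mult)
  qed
  also have "\<dots> = (\<integral>\<^sup>+s. ennreal \<bar>B\<bar> * (\<integral>\<^sup>+x. ennreal \<bar>w is t s x\<bar> \<partial>lborel) \<partial>lborel)"
  proof (intro nn_integral_cong nn_integral_cmult)
    fix s show "(\<lambda>x. ennreal \<bar>w is t s x\<bar>) \<in> borel_measurable lborel"
      using w_borel_pair[OF "is", of "\<lambda>_. s" borel "\<lambda>x. x" t] by simp
  qed
  also have "\<dots> = ennreal \<bar>B\<bar> * (\<integral>\<^sup>+s. (\<integral>\<^sup>+x. ennreal \<bar>w is t s x\<bar> \<partial>lborel) \<partial>lborel)"
    by (rule nn_integral_cmult) measurable
  also have "\<dots> < \<infinity>" using w_L1[OF "is" j t] by (simp add: ennreal_mult_less_top)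
  finally show "(\<integral>\<^sup>+s. (\<integral>\<^sup>+x. ennreal \<bar>w is t s x * \<psi> x\<bar> \<partial>lborel) \<partial>lborel) < \<infinity>" .
qed

lemma v_integrable:
  assumes "is": "length is \<le> \<gamma>" and j: "real (length is) < d" and t: "0 < t"
  shows "integrable lborel (v is t)"
proof -
  have "integrable (lborel \<Otimes>\<^sub>M lborel) (\<lambda>(s, x). w is t s x)"
    using w_integrable_pair[OF assms, of "\<lambda>_. 1" 1] by simp
  from lborel_pair.integrable_snd[OF this] show ?thesis by (simp add: v_def[abs_def])
qed

text \<open>Fubini rewrites the pairing with a test function as an integral over s of pairings with
  differentiable slices; there classical integration by parts applies, and Fubini is undone with the
  derivatives on the kernel.\<close>

lemma v_weak_derivative:
  assumes \<alpha>: "mi_len \<alpha> \<le> \<gamma>" "real (mi_len \<alpha>) < d" and t: "0 < t"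
  shows "has_weak_mpartial \<alpha> (v [] t) (v (mi_list \<alpha>) t)"
  unfolding has_weak_mpartial_def
proof (intro conjI allI impI)
  show "locally_integrable (v [] t)" by (rule locally_integrable_integrable[OF v_integrable]) (use d t in auto)
  show "locally_integrable (v (mi_list \<alpha>) t)" by (rule locally_integrable_integrable[OF v_integrable]) (use \<alpha> t in auto)
  fix \<phi> :: "real ^ 'n \<Rightarrow> real" assume \<phi>: "test_function \<phi>"
  have fub: "(\<integral>x. v is t x * \<psi> x \<partial>lborel) = (\<integral>s. indicator {0<..<t} s * (\<integral>x. conv (\<kappa> is (t - s)) (Pf s) x * \<psi> x \<partial>lborel) \<partial>lborel)"
    if "is": "length is \<le> \<gamma>" "real (length is) < d" and \<psi>: "test_function \<psi>" for "is" \<psi>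
  proof -
    obtain B where B: "\<And>x. \<bar>\<psi> x\<bar> \<le> B" using test_function_bounded[OF \<psi>] by blast
    note int = w_integrable_pair[OF "is" t test_function_borel[OF \<psi>] B]
    have "(\<integral>x. v is t x * \<psi> x \<partial>lborel) = (\<integral>x. (\<integral>s. w is t s x * \<psi> x \<partial>lborel) \<partial>lborel)"
      by (simp add: v_def)
    also have "\<dots> = (\<integral>s. (\<integral>x. w is t s x * \<psi> x \<partial>lborel) \<partial>lborel)"
      by (rule lborel_pair.Fubini_integral[OF int])
    finally show ?thesis by (simp add: w_def mult.assoc)
  qed
  have leb: "(LINT x|lebesgue. v is t x * \<psi> x) = (\<integral>x. v is t x * \<psi> x \<partial>lborel)"
    if "length is \<le> \<gamma>" "test_function \<psi>" for "is" \<psi>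
  proof -
    note [measurable] = v_borel[OF that(1)] test_function_borel[OF that(2)]
    show ?thesis by (rule lebesgue_integral_borel) measurable
  qed
  define "is" where "is = mi_list \<alpha>"
  have l: "length is \<le> \<gamma>" "real (length is) < d" "length is = mi_len \<alpha>" using \<alpha> by (auto simp: is_def)
  note tf = test_function_foldr_partial[OF \<phi>]
  have "(LINT x|lebesgue. v [] t x * mpartial \<alpha> \<phi> x) = (\<integral>x. v [] t x * foldr partial is \<phi> x \<partial>lborel)"
    unfolding mpartial_eq is_def[symmetric] by (rule leb) (use tf in auto)
  also have "\<dots> = (\<integral>s. indicator {0<..<t} s * (\<integral>x. conv (\<kappa> [] (t - s)) (Pf s) x * foldr partial is \<phi> x \<partial>lborel) \<partial>lborel)"
    by (rule fub) (use d tf in auto)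
  also have "\<dots> = (\<integral>s. (-1) ^ mi_len \<alpha> * (indicator {0<..<t} s * (\<integral>x. conv (\<kappa> is (t - s)) (Pf s) x * \<phi> x \<partial>lborel)) \<partial>lborel)"
  proof (intro Bochner_Integration.integral_cong refl)
    fix s
    show "indicator {0<..<t} s * (\<integral>x. conv (\<kappa> [] (t - s)) (Pf s) x * foldr partial is \<phi> x \<partial>lborel)
      = (-1) ^ mi_len \<alpha> * (indicator {0<..<t} s * (\<integral>x. conv (\<kappa> is (t - s)) (Pf s) x * \<phi> x \<partial>lborel))"
    proof (cases "s \<in> {0<..<t}")
      case True
      then show ?thesis
        using conv_\<kappa>_by_parts[OF _ Pf_integrable \<phi>, of "t - s" s "is" "[]"] l \<kappa>_rev[OF l(1)] by simp
    qed simp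
  qed
  also have "\<dots> = (-1) ^ mi_len \<alpha> * (\<integral>x. v is t x * \<phi> x \<partial>lborel)"
    using fub[OF l(1,2) \<phi>] by simp
  also have "(\<integral>x. v is t x * \<phi> x \<partial>lborel) = (LINT x|lebesgue. v is t x * \<phi> x)" using leb[OF l(1) \<phi>] by simp
  finally show "(LINT x|lebesgue. v [] t x * mpartial \<alpha> \<phi> x) = (-1) ^ mi_len \<alpha> * (LINT x|lebesgue. v (mi_list \<alpha>) t x * \<phi> x)"
    by (simp add: is_def)
qed

lemma semigrp_eq_conv:
  assumes "0 < \<tau>" and [measurable]: "u \<in> borel_measurable borel"
  shows "semigrp G \<tau> u x = conv (\<kappa> [] \<tau>) u x"
proof -
  note [measurable] = borel_measurable_\<kappa>[of "[]" \<tau>, simplified]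
  have "(LINT y|lebesgue. \<kappa> [] \<tau> (x - y) * u y) = (\<integral>y. \<kappa> [] \<tau> (x - y) * u y \<partial>lborel)"
    by (rule lebesgue_integral_borel) measurable
  then show ?thesis using assms(1) by (simp add: semigrp_def conv_def G_eq_\<kappa>)
qed

lemma set_lebesgue_integral_borel:
  fixes h :: "real \<Rightarrow> real"
  assumes "(\<lambda>s. indicator A s * h s) \<in> borel_measurable borel"
  shows "(LINT s:A|lebesgue. h s) = (\<integral>s. indicator A s * h s \<partial>lborel)"
  unfolding set_lebesgue_integral_def using lebesgue_integral_borel[OF assms] by simp

text \<open>Holds at every x: both sides integrate the same Borel function of s and share the
  default value 0 where it is not integrable.\<close>

lemma R_op_eq_v: "R_op G K f t x = v [] t x"
proof -
  have eq: "indicator {0<..<t} s * semigrp G (t - s) (P_op G K s (\<lambda>y. f y s)) x = w [] t s x" for s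
  proof (cases "s \<in> {0<..<t}")
    case True
    then have "P_op G K s (\<lambda>y. f y s) = Pf s" by (simp add: Pf_def fun_eq_iff)
    then show ?thesis using True semigrp_eq_conv[of "t - s" "Pf s" x] by (simp add: w_def)
  qed (simp add: w_def)
  have "(\<lambda>s. w [] t s x) \<in> borel_measurable borel" using w_borel_pair[of "[]" "\<lambda>s. s" borel "\<lambda>_. x" t] by simp
  then show ?thesis
    unfolding R_op_def v_def by (subst set_lebesgue_integral_borel) (simp_all add: eq)
qed

text \<open>The semigroup carries g_\<alpha>(s) to g_\<alpha>(t), since t-s and s+1 add up to t+1;
  in the subtracted terms s then enters through the coefficients only.\<close>

lemma w_split:
  assumes s: "0 < s" "s < t"
  shows "conv (\<kappa> [] (t - s)) (Pf s) x = conv (\<kappa> [] (t - s)) (\<lambda>y. f y s) x - (\<Sum>\<alpha>\<in>mi_upto K. Mf \<alpha> s * g_kernel G \<alpha> t x)"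
proof -
  have ts: "0 < t - s" using s by simp
  obtain B where B: "\<And>is x. length is \<le> \<gamma> \<Longrightarrow> \<bar>\<kappa> is (t - s) x\<bar> \<le> B" using \<kappa>_bounded[OF ts] by metis
  have ci: "integrable lborel (\<lambda>y. \<kappa> [] (t - s) (x - y) * u y)" if "integrable lborel u" for u
    by (rule conv_integrand_integrable[OF borel_measurable_\<kappa> B that]) auto
  define c where "c \<alpha> = (-1) ^ mi_len \<alpha> / mi_fact \<alpha>" for \<alpha> :: "'n \<Rightarrow> nat"
  have len: "length (mi_list \<alpha>) \<le> \<gamma>" if "\<alpha> \<in> mi_upto K" for \<alpha> using mi_upto_\<gamma>[OF that] by simp
  have gs: "g_kernel G \<alpha> s y = c \<alpha> * \<kappa> (mi_list \<alpha>) (s + 1) y" if "\<alpha> \<in> mi_upto K" for \<alpha> y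
    using mi_upto_\<gamma>[OF that] s by (simp add: g_kernel_eq c_def)
  have gt: "g_kernel G \<alpha> t y = c \<alpha> * \<kappa> (mi_list \<alpha>) (t + 1) y" if "\<alpha> \<in> mi_upto K" for \<alpha> y
    using mi_upto_\<gamma>[OF that] s by (simp add: g_kernel_eq c_def)
  have ki: "integrable lborel (\<lambda>y. \<kappa> [] (t - s) (x - y) * \<kappa> (mi_list \<alpha>) (s + 1) y)" if "\<alpha> \<in> mi_upto K" for \<alpha>
    using s by (intro ci integrable_\<kappa> len that) auto
  have kv: "(\<integral>y. \<kappa> [] (t - s) (x - y) * \<kappa> (mi_list \<alpha>) (s + 1) y \<partial>lborel) = \<kappa> (mi_list \<alpha>) (t + 1) x" if "\<alpha> \<in> mi_upto K" for \<alpha>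
    using conv_\<kappa>_\<kappa>(2)[OF _ ts len[OF that], of "s + 1"] s by (simp add: conv_def fun_eq_iff add.commute)
  have fi: "integrable lborel (\<lambda>y. f y s)" using slice_integrable[OF f_slice[OF s(1)]] .
  have "conv (\<kappa> [] (t - s)) (Pf s) x = (\<integral>y. \<kappa> [] (t - s) (x - y) * f y s
      - (\<Sum>\<alpha>\<in>mi_upto K. (Mf \<alpha> s * c \<alpha>) * (\<kappa> [] (t - s) (x - y) * \<kappa> (mi_list \<alpha>) (s + 1) y)) \<partial>lborel)"
    unfolding conv_def using s
    by (intro Bochner_Integration.integral_cong refl)
      (simp add: Pf_def P_op_def Mf_def gs right_diff_distrib sum_distrib_left mult_ac)
  also have "\<dots> = conv (\<kappa> [] (t - s)) (\<lambda>y. f y s) x - (\<Sum>\<alpha>\<in>mi_upto K. (Mf \<alpha> s * c \<alpha>) * \<kappa> (mi_list \<alpha>) (t + 1) x)"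
    using ci[OF fi] ki by (subst Bochner_Integration.integral_diff) (simp_all add: conv_def kv)
  finally show ?thesis using gt by (simp add: mult.assoc)
qed

lemma Mf_integrable:
  assumes \<alpha>: "\<alpha> \<in> mi_upto K"
  shows "integrable lborel (\<lambda>s. indicator {0<..<t} s * Mf \<alpha> s)"
proof -
  note [measurable] = Mf_borel[OF \<alpha>]
  obtain M where M0: "0 \<le> M" and M: "\<And>\<alpha> h s e. \<alpha> \<in> mi_upto K \<Longrightarrow> 0 \<le> s \<Longrightarrow> 0 \<le> e \<Longrightarrow> slice h s e \<Longrightarrow>
    \<bar>moment G h s \<alpha>\<bar> \<le> M * (1 + s) powr ((real (mi_len \<alpha>) - K) / d) * e"
    using moment_bound_uniform by blast
  have "(\<integral>\<^sup>+s. ennreal (norm (indicator {0<..<t} s * Mf \<alpha> s)) \<partial>lborel) \<le> (\<integral>\<^sup>+s. ennreal M * ennreal (indicator {0<..<t} s * e s) \<partial>lborel)"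
  proof (rule nn_integral_mono)
    fix s
    show "ennreal (norm (indicator {0<..<t} s * Mf \<alpha> s)) \<le> ennreal M * ennreal (indicator {0<..<t} s * e s)"
    proof (cases "s \<in> {0<..<t}")
      case True
      then have "\<bar>Mf \<alpha> s\<bar> \<le> M * (1 + s) powr ((real (mi_len \<alpha>) - K) / d) * e s"
        using M[OF \<alpha> _ e_nonneg f_slice, of s] by (simp add: Mf_def)
      also have "\<dots> \<le> M * 1 * e s"
      proof (intro mult_left_mono mult_right_mono)
        have "(1 + s) powr ((real (mi_len \<alpha>) - K) / d) \<le> (1 + s) powr 0"
          using True \<alpha> d by (intro powr_mono) (auto simp: mi_upto_def divide_nonpos_pos)
        then show "(1 + s) powr ((real (mi_len \<alpha>) - K) / d) \<le> 1" using True by simp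
      qed (use M0 e_nonneg in auto)
      finally show ?thesis using True M0 e_nonneg[of s] by (simp add: ennreal_leI flip: ennreal_mult)
    qed simp
  qed
  also have "\<dots> = ennreal M * (\<integral>\<^sup>+s. ennreal (indicator {0<..<t} s * e s) \<partial>lborel)"
    by (rule nn_integral_cmult) measurable
  also have "\<dots> < \<infinity>" using e_integral_finite[of t] by (simp add: ennreal_mult_less_top)
  finally show ?thesis by (simp add: integrable_iff_bounded)
qed

text \<open>Fubini supplies integrability of s |-> \<open>w [] t s x\<close> for almost every x, and
  at these x the integral is split term by term.\<close>

lemma v_split:
  assumes t: "0 < t"
  shows "AE x in lborel. v [] t x = (\<integral>s. indicator {0<..<t} s * conv (\<kappa> [] (t - s)) (\<lambda>y. f y s) x \<partial>lborel)
    - (\<Sum>\<alpha>\<in>mi_upto K. (\<integral>s. indicator {0<..<t} s * Mf \<alpha> s \<partial>lborel) * g_kernel G \<alpha> t x)"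
proof -
  have "integrable (lborel \<Otimes>\<^sub>M lborel) (\<lambda>(s, x). w [] t s x)"
    using w_integrable_pair[of "[]" t "\<lambda>_. 1" 1] t d by simp
  from lborel_pair.AE_integrable_snd[OF this]
  have "AE x in lborel. integrable lborel (\<lambda>s. w [] t s x)" by simp
  then show ?thesis
  proof eventually_elim
    fix x assume wi: "integrable lborel (\<lambda>s. w [] t s x)"
    define S where "S s = (\<Sum>\<alpha>\<in>mi_upto K. indicator {0<..<t} s * Mf \<alpha> s * g_kernel G \<alpha> t x)" for s
    have Si: "integrable lborel S" unfolding S_def
      by (intro Bochner_Integration.integrable_sum integrable_mult_left Mf_integrable) auto
    have eq: "indicator {0<..<t} s * conv (\<kappa> [] (t - s)) (\<lambda>y. f y s) x = w [] t s x + S s" for s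
      by (auto simp: w_def S_def w_split indicator_def sum_distrib_left)
    have "(\<integral>s. indicator {0<..<t} s * conv (\<kappa> [] (t - s)) (\<lambda>y. f y s) x \<partial>lborel) = v [] t x + (\<integral>s. S s \<partial>lborel)"
      unfolding eq v_def using wi Si by (rule Bochner_Integration.integral_add)
    also have "(\<integral>s. S s \<partial>lborel) = (\<Sum>\<alpha>\<in>mi_upto K. (\<integral>s. indicator {0<..<t} s * Mf \<alpha> s \<partial>lborel) * g_kernel G \<alpha> t x)"
      unfolding S_def using Mf_integrable by (simp add: Bochner_Integration.integral_sum)
    finally show "v [] t x = (\<integral>s. indicator {0<..<t} s * conv (\<kappa> [] (t - s)) (\<lambda>y. f y s) x \<partial>lborel)
      - (\<Sum>\<alpha>\<in>mi_upto K. (\<integral>s. indicator {0<..<t} s * Mf \<alpha> s \<partial>lborel) * g_kernel G \<alpha> t x)" by simp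
  qed
qed

end

section \<open>The Duhamel integral for large times\<close>

context duhamel
begin

lemma mu_antimono:
  assumes "0 < r" "r \<le> r'"
  shows "mu s r' \<le> mu s r"
proof -
  have "r' powr (- 1 / d) \<le> r powr (- 1 / d)" using assms d by (intro powr_mono2') auto
  then have le: "r' powr (- 1 / d) * norm y \<le> r powr (- 1 / d) * norm y" for y :: "real ^ 'n"
    by (rule mult_right_mono) simp
  show ?thesis unfolding mu_def
    using k0 by (intro nn_integral_mono ennreal_leI mult_left_mono min.mono powr_mono2 le) auto
qed

text \<open>The exponent \<theta> = [K]+1-K is positive, so the factor min(1, ...) tends to 0 at
  every y, under the integrable majorant |Pf s y| |y|^K.\<close>

lemma mu_tendsto_0:
  assumes s: "0 < s"
  shows "(\<lambda>n. mu s (real n)) \<longlonglongrightarrow> 0"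
proof -
  define \<theta> where "\<theta> = real (Suc k0) - K"
  have \<theta>: "0 < \<theta>" using k0 by (simp add: \<theta>_def)
  have fin: "wt K (Pf s) < \<infinity>"
  proof -
    obtain C where "\<And>s. 0 < s \<Longrightarrow> wt K (Pf s) \<le> ennreal (C * (1 + s) powr ((K - K) / d) * e s)"
      using Pf_wt[OF K(1) order_refl] by blast
    from this[OF s] show ?thesis by (auto intro: le_less_trans)
  qed
  have "(\<lambda>n. mu s (real n)) \<longlonglongrightarrow> (\<integral>\<^sup>+y. 0 \<partial>(lborel :: (real ^ 'n) measure))"
    unfolding mu_def \<theta>_def[symmetric]
  proof (rule nn_integral_dominated_convergence[where w = "\<lambda>y. ennreal (\<bar>Pf s y\<bar> * norm y powr K)"])
    show "(\<integral>\<^sup>+y. ennreal (\<bar>Pf s y\<bar> * norm y powr K) \<partial>lborel) < \<infinity>" using fin by (simp add: wt_def)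
    show "AE y in lborel. ennreal (\<bar>Pf s y\<bar> * (norm y powr K * min 1 ((real n powr (- 1 / d) * norm y) powr \<theta>))) \<le> ennreal (\<bar>Pf s y\<bar> * norm y powr K)" for n
      by (intro AE_I2 ennreal_leI mult_left_mono) (auto intro: mult_left_le)
    show "AE y in lborel. (\<lambda>n. ennreal (\<bar>Pf s y\<bar> * (norm y powr K * min 1 ((real n powr (- 1 / d) * norm y) powr \<theta>)))) \<longlonglongrightarrow> 0"
    proof (rule AE_I2)
      fix y :: "real ^ 'n"
      have "(\<lambda>n. real n powr (- 1 / d)) \<longlonglongrightarrow> 0"
        using d by (intro tendsto_neg_powr filterlim_real_sequentially) auto
      then have "(\<lambda>n. real n powr (- 1 / d) * norm y) \<longlonglongrightarrow> 0 * norm y" by (intro tendsto_intros)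
      then have "(\<lambda>n. real n powr (- 1 / d) * norm y) \<longlonglongrightarrow> 0" by simp
      then have "(\<lambda>n. (real n powr (- 1 / d) * norm y) powr \<theta>) \<longlonglongrightarrow> 0 powr \<theta>"
        using \<theta> by (intro tendsto_powr' tendsto_const) auto
      then have "(\<lambda>n. \<bar>Pf s y\<bar> * (norm y powr K * min 1 ((real n powr (- 1 / d) * norm y) powr \<theta>))) \<longlonglongrightarrow> \<bar>Pf s y\<bar> * (norm y powr K * min 1 (0 powr \<theta>))"
        by (intro tendsto_mult tendsto_min tendsto_const)
      then show "(\<lambda>n. ennreal (\<bar>Pf s y\<bar> * (norm y powr K * min 1 ((real n powr (- 1 / d) * norm y) powr \<theta>)))) \<longlonglongrightarrow> 0"
        using tendsto_ennrealI by fastforce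
    qed
  qed measurable
  then show ?thesis by simp
qed

text \<open>Dominated convergence over (0,T] with majorant C e(s), along the integers; monotonicity
  of \<open>mu\<close> in its second argument transfers the bound to all large real t.\<close>

lemma mu_integral_eventually:
  assumes \<epsilon>: "0 < \<epsilon>"
  shows "\<forall>\<^sub>F t in at_top. (\<integral>\<^sup>+s. indicator {0<..T} s * mu s (t / 4) \<partial>lborel) \<le> ennreal \<epsilon>"
proof -
  obtain C where C0: "0 \<le> C" and C: "\<And>s r. 0 < s \<Longrightarrow> mu s r \<le> ennreal (C * e s)" by (rule mu_bound[OF that])
  have "(\<lambda>n. \<integral>\<^sup>+s. indicator {0<..T} s * mu s (real n) \<partial>lborel) \<longlonglongrightarrow> (\<integral>\<^sup>+s. 0 \<partial>(lborel :: real measure))"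
  \<comment> \<open>The majorant lives on (0,T+1) because integrability of e is stated on open
    intervals, while (0,T] contains its right end point.\<close>
  proof (rule nn_integral_dominated_convergence[where w = "\<lambda>s. ennreal C * ennreal (indicator {0<..<T + 1} s * e s)"])
    have "(\<integral>\<^sup>+s. ennreal C * ennreal (indicator {0<..<T + 1} s * e s) \<partial>lborel) = ennreal C * (\<integral>\<^sup>+s. ennreal (indicator {0<..<T + 1} s * e s) \<partial>lborel)"
      by (rule nn_integral_cmult) measurable
    then show "(\<integral>\<^sup>+s. ennreal C * ennreal (indicator {0<..<T + 1} s * e s) \<partial>lborel) < \<infinity>"
      using e_integral_finite[of "T + 1"] by (simp add: ennreal_mult_less_top)
    show "AE s in lborel. indicator {0<..T} s * mu s (real n) \<le> ennreal C * ennreal (indicator {0<..<T + 1} s * e s)" for n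
      using C C0 e_nonneg by (intro AE_I2) (auto simp: indicator_def simp flip: ennreal_mult)
    show "AE s in lborel. (\<lambda>n. indicator {0<..T} s * mu s (real n)) \<longlonglongrightarrow> 0"
    proof (rule AE_I2)
      fix s show "(\<lambda>n. indicator {0<..T} s * mu s (real n)) \<longlonglongrightarrow> 0"
        using mu_tendsto_0[of s] by (cases "s \<in> {0<..T}") auto
    qed
  qed measurable
  then have "(\<lambda>n. \<integral>\<^sup>+s. indicator {0<..T} s * mu s (real n) \<partial>lborel) \<longlonglongrightarrow> 0" by simp
  then have "\<forall>\<^sub>F n in sequentially. (\<integral>\<^sup>+s. indicator {0<..T} s * mu s (real n) \<partial>lborel) < ennreal \<epsilon>"
    using \<epsilon> by (intro order_tendstoD(2)) auto
  then obtain n0 where n0: "\<And>n. n0 \<le> n \<Longrightarrow> (\<integral>\<^sup>+s. indicator {0<..T} s * mu s (real n) \<partial>lborel) < ennreal \<epsilon>"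
    by (auto simp: eventually_sequentially)
  \<comment> \<open>The successor makes n positive, as \<open>mu_antimono\<close> requires.\<close>
  define n where "n = Suc n0"
  show ?thesis using eventually_ge_at_top[of "4 * real n"]
  proof eventually_elim
    fix t assume t: "4 * real n \<le> t"
    have "(\<integral>\<^sup>+s. indicator {0<..T} s * mu s (t / 4) \<partial>lborel) \<le> (\<integral>\<^sup>+s. indicator {0<..T} s * mu s (real n) \<partial>lborel)"
      using t by (intro nn_integral_mono mult_left_mono mu_antimono) (auto simp: n_def)
    also have "\<dots> \<le> ennreal \<epsilon>" using n0[of n] by (simp add: n_def less_imp_le)
    finally show "(\<integral>\<^sup>+s. indicator {0<..T} s * mu s (t / 4) \<partial>lborel) \<le> ennreal \<epsilon>" .
  qed
qed

text \<open>On (0,T] the integral of \<open>mu\<close> is at most \<epsilon>. On (T,t/2) the bounds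
  \<open>mu\<close> <= C e and t^(-j/d) <= (t-s)^(-j/d) lead to the tail integral, and on [t/2,t)
  the majorant is the tail integrand itself. The constant involves neither T nor \<epsilon>.\<close>

lemma \<beta>_integral:
  assumes j: "real j < d"
  obtains C where "0 \<le> C" "\<And>T \<epsilon>. 0 < T \<Longrightarrow> 0 < \<epsilon> \<Longrightarrow> \<forall>\<^sub>F t in at_top. \<exists>b\<ge>0.
    (\<integral>\<^sup>+s. ennreal (indicator {0<..<t} s * \<beta> j t s) \<partial>lborel) \<le> ennreal b \<and>
    ennreal b \<le> ennreal (\<epsilon> * t powr (- real j / d)) + ennreal C * (\<integral>\<^sup>+s. ennreal (indicator {T<..<t} s * ((t - s) powr (- real j / d) * e s)) \<partial>lborel)"
proof -
  obtain C where C0: "0 \<le> C" and C: "\<And>s r. 0 < s \<Longrightarrow> mu s r \<le> ennreal (C * e s)" by (rule mu_bound[OF that])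
  have "\<forall>\<^sub>F t in at_top. \<exists>b\<ge>0.
    (\<integral>\<^sup>+s. ennreal (indicator {0<..<t} s * \<beta> j t s) \<partial>lborel) \<le> ennreal b \<and>
    ennreal b \<le> ennreal (\<epsilon> * t powr (- real j / d)) + ennreal (1 + C) * (\<integral>\<^sup>+s. ennreal (indicator {T<..<t} s * ((t - s) powr (- real j / d) * e s)) \<partial>lborel)"
    if T: "0 < T" and \<epsilon>: "0 < \<epsilon>" for T \<epsilon>
    \<comment> \<open>t > 2T places (0,T] inside the region s < t/2, where \<open>\<beta>\<close> is
      given by \<open>mu\<close>.\<close>
    using mu_integral_eventually[OF \<epsilon>, of T] eventually_gt_at_top[of "2 * T"]
  proof eventually_elim
    fix t assume mu: "(\<integral>\<^sup>+s. indicator {0<..T} s * mu s (t / 4) \<partial>lborel) \<le> ennreal \<epsilon>" and t: "2 * T < t"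
    define p where "p = t powr (- real j / d)"
    define I where "I = (\<integral>\<^sup>+s. ennreal (indicator {T<..<t} s * ((t - s) powr (- real j / d) * e s)) \<partial>lborel)"
    define X where "X = ennreal (\<epsilon> * p) + ennreal (1 + C) * I"
    have pt: "ennreal (indicator {0<..<t} s * \<beta> j t s) \<le> ennreal p * (indicator {0<..T} s * mu s (t / 4))
      + ennreal (1 + C) * ennreal (indicator {T<..<t} s * ((t - s) powr (- real j / d) * e s))" for s
    proof -
      consider "s \<notin> {0<..<t}" | "0 < s" "s \<le> T" | "T < s" "s < t / 2" | "t / 2 \<le> s" "s < t" by fastforce
      then show ?thesis
      proof cases
        case 2
        then have "s < t / 2" "s < t" using t T by auto
        have "mu s (t / 4) < top" using C[OF 2(1), of "t / 4"] by (auto intro: le_less_trans)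
        then have "ennreal (p * enn2real (mu s (t / 4))) = ennreal p * mu s (t / 4)"
          by (simp add: p_def ennreal_mult)
        then show ?thesis using 2 \<open>s < t / 2\<close> \<open>s < t\<close> by (simp add: \<beta>_def p_def)
      next
        case 3
        then have s: "0 < s" "s < t" using t T by auto
        have "enn2real (mu s (t / 4)) \<le> C * e s" using C[OF s(1)] C0 e_nonneg by (intro enn2real_leI) auto
        moreover have "p \<le> (t - s) powr (- real j / d)" unfolding p_def using s d by (intro powr_mono2') auto
        ultimately have "p * enn2real (mu s (t / 4)) \<le> (t - s) powr (- real j / d) * (C * e s)"
          by (intro mult_mono) auto
        also have "\<dots> \<le> (1 + C) * ((t - s) powr (- real j / d) * e s)" using e_nonneg[of s] by (simp add: algebra_simps)
        finally have "ennreal (p * enn2real (mu s (t / 4))) \<le> ennreal ((1 + C) * ((t - s) powr (- real j / d) * e s))" by (rule ennreal_leI)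
        then show ?thesis using 3 s C0 e_nonneg[of s] by (simp add: \<beta>_def p_def ennreal_mult)
      next
        case 4
        then have s: "0 < s" "T < s" using t T by auto
        have "1 * ((t - s) powr (- real j / d) * e s) \<le> (1 + C) * ((t - s) powr (- real j / d) * e s)"
          using C0 e_nonneg[of s] by (intro mult_right_mono) auto
        then have "ennreal ((t - s) powr (- real j / d) * e s) \<le> ennreal ((1 + C) * ((t - s) powr (- real j / d) * e s))"
          by (intro ennreal_leI) simp
        then show ?thesis using 4 s C0 e_nonneg[of s] by (simp add: \<beta>_def ennreal_mult)
      qed simp
    qed
    have le: "(\<integral>\<^sup>+s. ennreal (indicator {0<..<t} s * \<beta> j t s) \<partial>lborel) \<le> X"
    proof -
      have "(\<integral>\<^sup>+s. ennreal (indicator {0<..<t} s * \<beta> j t s) \<partial>lborel)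
        \<le> (\<integral>\<^sup>+s. ennreal p * (indicator {0<..T} s * mu s (t / 4)) + ennreal (1 + C) * ennreal (indicator {T<..<t} s * ((t - s) powr (- real j / d) * e s)) \<partial>lborel)"
        by (intro nn_integral_mono pt)
      also have "\<dots> = ennreal p * (\<integral>\<^sup>+s. indicator {0<..T} s * mu s (t / 4) \<partial>lborel) + ennreal (1 + C) * I"
        unfolding I_def by (subst nn_integral_add) (auto simp: nn_integral_cmult)
      also have "\<dots> \<le> ennreal p * ennreal \<epsilon> + ennreal (1 + C) * I" by (intro add_right_mono mult_left_mono mu) simp
      also have "\<dots> = X" using \<epsilon> by (simp add: X_def p_def mult.commute flip: ennreal_mult)
      finally show ?thesis .
    qed
    \<comment> \<open>j < d makes the tail integral finite, so the bound X is a real number and can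
      serve as b.\<close>
    have "I \<le> (\<integral>\<^sup>+s. ennreal (indicator {0<..<t} s * ((t - s) powr (- (real j / d)) * e s)) \<partial>lborel)"
      unfolding I_def using T e_nonneg by (intro nn_integral_mono ennreal_leI) (auto simp: indicator_def)
    also have "\<dots> < \<infinity>" using j d t T by (intro singular_integral_finite) auto
    finally have "X < \<infinity>" by (simp add: X_def ennreal_mult_less_top)
    then have "ennreal (enn2real X) = X" by simp
    then show "\<exists>b\<ge>0. (\<integral>\<^sup>+s. ennreal (indicator {0<..<t} s * \<beta> j t s) \<partial>lborel) \<le> ennreal b \<and>
      ennreal b \<le> ennreal (\<epsilon> * t powr (- real j / d)) + ennreal (1 + C) * (\<integral>\<^sup>+s. ennreal (indicator {T<..<t} s * ((t - s) powr (- real j / d) * e s)) \<partial>lborel)"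
      using le by (intro exI[of _ "enn2real X"]) (simp add: X_def I_def p_def)
  qed
  then show ?thesis using that[of "1 + C"] C0 by simp
qed

section \<open>Norm bounds for the Duhamel integral\<close>

text \<open>Minkowski's inequality over s sums the slice bounds for the two Lebesgue norms; the
  weighted integral is summed directly by Tonelli.\<close>

lemma v_estimate:
  assumes l: "0 \<le> l" "l \<le> K" and "is": "length is \<le> \<gamma>"
  obtains C where "0 \<le> C" "\<And>t b. 1 \<le> t \<Longrightarrow> 0 \<le> b \<Longrightarrow>
    (\<integral>\<^sup>+s. ennreal (indicator {0<..<t} s * \<beta> (length is) t s) \<partial>lborel) \<le> ennreal b \<Longrightarrow>
    Lq_le q (v is t) (C * (t powr (- \<sigma>) * t powr (- K / d) * b)) \<and>
    Lq_le 1 (v is t) (C * (t powr (- K / d) * b)) \<and>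
    wt l (v is t) \<le> ennreal (C * (t powr (l / d) * t powr (- K / d) * b))"
proof -
  obtain C where C0: "0 \<le> C" and C: "\<And>t s. 1 \<le> t \<Longrightarrow> 0 < s \<Longrightarrow> s < t \<Longrightarrow>
    Lq_le q (conv (\<kappa> is (t - s)) (Pf s)) (C * (t powr (- \<sigma>) * t powr (- K / d) * \<beta> (length is) t s)) \<and>
    Lq_le 1 (conv (\<kappa> is (t - s)) (Pf s)) (C * (t powr (- K / d) * \<beta> (length is) t s)) \<and>
    wt l (conv (\<kappa> is (t - s)) (Pf s)) \<le> ennreal (C * (t powr (l / d) * t powr (- K / d) * \<beta> (length is) t s))"
    using slice_estimate[OF l "is"] by blast
  show ?thesis
  proof (rule that[OF C0])
    fix t b :: real assume t: "1 \<le> t" and b: "0 \<le> b"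
      and int: "(\<integral>\<^sup>+s. ennreal (indicator {0<..<t} s * \<beta> (length is) t s) \<partial>lborel) \<le> ennreal b"
    note [measurable] = v_borel[OF "is"]
    have wm: "(\<lambda>z. w is t (snd z) (fst z)) \<in> borel_measurable (borel \<Otimes>\<^sub>M lborel)"
      by (rule w_borel_pair[OF "is"]) measurable
    have intX: "(\<integral>\<^sup>+s. ennreal (X * (indicator {0<..<t} s * \<beta> (length is) t s)) \<partial>lborel) \<le> ennreal (X * b)" if X: "0 \<le> X" for X
    proof -
      have "(\<integral>\<^sup>+s. ennreal (X * (indicator {0<..<t} s * \<beta> (length is) t s)) \<partial>lborel) = ennreal X * (\<integral>\<^sup>+s. ennreal (indicator {0<..<t} s * \<beta> (length is) t s) \<partial>lborel)"
        using X \<beta>_nonneg by (simp add: ennreal_mult nn_integral_cmult)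
      also have "\<dots> \<le> ennreal X * ennreal b" by (rule mult_left_mono[OF int]) simp
      finally show ?thesis using X b by (simp flip: ennreal_mult)
    qed
    have mink: "Lq_le r (v is t) (X * b)"
      if r: "1 \<le> r" and X: "0 \<le> X" and sl: "\<And>s. 0 < s \<Longrightarrow> s < t \<Longrightarrow> Lq_le r (conv (\<kappa> is (t - s)) (Pf s)) (X * \<beta> (length is) t s)" for r X
    proof (rule Lq_le_Minkowski[where M = lborel and k = "\<lambda>x s. w is t s x" and A = "\<lambda>s. X * (indicator {0<..<t} s * \<beta> (length is) t s)"])
      show "(\<lambda>(x, s). w is t s x) \<in> borel_measurable (borel \<Otimes>\<^sub>M lborel)" using wm by (simp add: case_prod_beta')
      show "Lq_le r (\<lambda>x. w is t s x) (X * (indicator {0<..<t} s * \<beta> (length is) t s))" for s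
        using sl[of s] Lq_le_zero[OF r, of 0] by (cases "s \<in> {0<..<t}") (auto simp: w_def)
      show "AE x in lborel. ennreal \<bar>v is t x\<bar> \<le> (\<integral>\<^sup>+s. ennreal \<bar>w is t s x\<bar> \<partial>lborel)"
        unfolding v_def by (intro AE_I2 integral_abs_le_nn_integral)
    qed (use r X b intX[OF X] in \<open>auto intro: lborel.sigma_finite_measure_axioms\<close>)
    have 1: "Lq_le q (v is t) ((C * (t powr (- \<sigma>) * t powr (- K / d))) * b)"
      by (rule mink[OF q]) (use C[OF t] C0 in \<open>auto simp: mult.assoc\<close>)
    have 2: "Lq_le 1 (v is t) ((C * t powr (- K / d)) * b)"
      by (rule mink) (use C[OF t] C0 in \<open>auto simp: mult.assoc\<close>)
    have 3: "wt l (v is t) \<le> ennreal ((C * (t powr (l / d) * t powr (- K / d))) * b)"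
    proof -
      have [measurable]: "(\<lambda>z. w is t (snd z) (fst z)) \<in> borel_measurable (lborel \<Otimes>\<^sub>M lborel)"
        by (rule w_borel_pair[OF "is"]) measurable
      have "wt l (v is t) \<le> (\<integral>\<^sup>+x. (\<integral>\<^sup>+s. ennreal (\<bar>w is t s x\<bar> * norm x powr l) \<partial>lborel) \<partial>lborel)"
        unfolding wt_def
      proof (rule nn_integral_mono)
        fix x :: "real ^ 'n"
        have [measurable]: "(\<lambda>s. w is t s x) \<in> borel_measurable borel"
          using w_borel_pair[OF "is", of "\<lambda>s. s" borel "\<lambda>_. x" t] by simp
        have "ennreal (\<bar>v is t x\<bar> * norm x powr l) \<le> (\<integral>\<^sup>+s. ennreal \<bar>w is t s x\<bar> \<partial>lborel) * ennreal (norm x powr l)"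
          unfolding v_def by (simp add: ennreal_mult integral_abs_le_nn_integral mult_right_mono)
        also have "\<dots> = (\<integral>\<^sup>+s. ennreal (\<bar>w is t s x\<bar> * norm x powr l) \<partial>lborel)"
          by (simp add: ennreal_mult nn_integral_multc)
        finally show "ennreal (\<bar>v is t x\<bar> * norm x powr l) \<le> (\<integral>\<^sup>+s. ennreal (\<bar>w is t s x\<bar> * norm x powr l) \<partial>lborel)" .
      qed
      also have "\<dots> = (\<integral>\<^sup>+s. (\<integral>\<^sup>+x. ennreal (\<bar>w is t s x\<bar> * norm x powr l) \<partial>lborel) \<partial>lborel)"
        by (rule lborel_pair.Fubini'[symmetric]) measurable
      also have "\<dots> \<le> (\<integral>\<^sup>+s. ennreal ((C * (t powr (l / d) * t powr (- K / d))) * (indicator {0<..<t} s * \<beta> (length is) t s)) \<partial>lborel)"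
      proof (rule nn_integral_mono)
        fix s
        show "(\<integral>\<^sup>+x. ennreal (\<bar>w is t s x\<bar> * norm x powr l) \<partial>lborel) \<le> ennreal ((C * (t powr (l / d) * t powr (- K / d))) * (indicator {0<..<t} s * \<beta> (length is) t s))"
          using C[OF t, of s] by (cases "s \<in> {0<..<t}") (auto simp: w_def wt_def mult.assoc)
      qed
      also have "\<dots> \<le> ennreal ((C * (t powr (l / d) * t powr (- K / d))) * b)" by (rule intX) (use C0 in simp)
      finally show ?thesis .
    qed
    show "Lq_le q (v is t) (C * (t powr (- \<sigma>) * t powr (- K / d) * b)) \<and>
      Lq_le 1 (v is t) (C * (t powr (- K / d) * b)) \<and>
      wt l (v is t) \<le> ennreal (C * (t powr (l / d) * t powr (- K / d) * b))"
      using 1 2 3 by (simp add: mult.assoc)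
  qed
qed

text \<open>The constants of the finitely many lists of length j are replaced by one, D. The L^1
  bound is weakened by t^(l/d) >= 1, so that the L^1 part and the homogeneous part both have the
  size required of the weighted norm.\<close>

lemma v_final:
  assumes l: "0 \<le> l" "l \<le> K" and j: "j \<le> \<gamma>" "real j < d"
  obtains C where "0 \<le> C" "\<And>T \<epsilon>. 0 < T \<Longrightarrow> 0 < \<epsilon> \<Longrightarrow> \<forall>\<^sub>F t in at_top. \<exists>c\<ge>0.
    (\<forall>is. length is = j \<longrightarrow> Lq_le q (v is t) (t powr (- \<sigma>) * c) \<and> Lq_le 1 (v is t) (t powr (l / d) * c) \<and>
      wt l (v is t) \<le> ennreal (t powr (l / d) * c)) \<and>
    ennreal c \<le> ennreal (\<epsilon> * t powr (- (K + real j) / d))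
      + ennreal (C * t powr (- K / d)) * (\<integral>\<^sup>+s. ennreal (indicator {T<..<t} s * ((t - s) powr (- real j / d) * e s)) \<partial>lborel)"
proof -
  have "\<forall>is\<in>lists_of j. \<exists>C\<ge>0. \<forall>t b. 1 \<le> t \<longrightarrow> 0 \<le> b \<longrightarrow>
    (\<integral>\<^sup>+s. ennreal (indicator {0<..<t} s * \<beta> j t s) \<partial>lborel) \<le> ennreal b \<longrightarrow>
    Lq_le q (v is t) (C * (t powr (- \<sigma>) * t powr (- K / d) * b)) \<and>
    Lq_le 1 (v is t) (C * (t powr (- K / d) * b)) \<and>
    wt l (v is t) \<le> ennreal (C * (t powr (l / d) * t powr (- K / d) * b))"
  proof
    fix "is" assume "is \<in> lists_of j"
    then have len: "length is \<le> \<gamma>" "length is = j" using j by (auto simp: lists_of_def)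
    show "\<exists>C\<ge>0. \<forall>t b. 1 \<le> t \<longrightarrow> 0 \<le> b \<longrightarrow>
    (\<integral>\<^sup>+s. ennreal (indicator {0<..<t} s * \<beta> j t s) \<partial>lborel) \<le> ennreal b \<longrightarrow>
    Lq_le q (v is t) (C * (t powr (- \<sigma>) * t powr (- K / d) * b)) \<and>
    Lq_le 1 (v is t) (C * (t powr (- K / d) * b)) \<and>
    wt l (v is t) \<le> ennreal (C * (t powr (l / d) * t powr (- K / d) * b))"
      by (rule v_estimate[OF l len(1)]) (unfold len(2), blast)
  qed
  from bchoice[OF this] obtain cv where cv: "\<forall>is\<in>lists_of j. 0 \<le> cv is \<and> (\<forall>t b. 1 \<le> t \<longrightarrow> 0 \<le> b \<longrightarrow>
    (\<integral>\<^sup>+s. ennreal (indicator {0<..<t} s * \<beta> j t s) \<partial>lborel) \<le> ennreal b \<longrightarrow>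
    Lq_le q (v is t) (cv is * (t powr (- \<sigma>) * t powr (- K / d) * b)) \<and>
    Lq_le 1 (v is t) (cv is * (t powr (- K / d) * b)) \<and>
    wt l (v is t) \<le> ennreal (cv is * (t powr (l / d) * t powr (- K / d) * b)))" by blast
  define D where "D = 1 + (\<Sum>is\<in>lists_of j. cv is)"
  have D: "cv is \<le> D" if "is \<in> lists_of j" for "is"
  proof -
    have "cv is \<le> (\<Sum>is\<in>lists_of j. cv is)" using that cv by (intro member_le_sum finite_lists_of) auto
    then show ?thesis by (simp add: D_def)
  qed
  have D0: "0 < D" using cv by (auto simp: D_def intro!: add_pos_nonneg sum_nonneg)
  obtain C where C0: "0 \<le> C" and C: "\<And>T \<epsilon>. 0 < T \<Longrightarrow> 0 < \<epsilon> \<Longrightarrow> \<forall>\<^sub>F t in at_top. \<exists>b\<ge>0.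
    (\<integral>\<^sup>+s. ennreal (indicator {0<..<t} s * \<beta> j t s) \<partial>lborel) \<le> ennreal b \<and>
    ennreal b \<le> ennreal (\<epsilon> * t powr (- real j / d)) + ennreal C * (\<integral>\<^sup>+s. ennreal (indicator {T<..<t} s * ((t - s) powr (- real j / d) * e s)) \<partial>lborel)"
    using \<beta>_integral[OF j(2)] by blast
  show ?thesis
  proof (rule that[of "D * C"])
    show "0 \<le> D * C" using D0 C0 by simp
    fix T \<epsilon> :: real assume T: "0 < T" and \<epsilon>: "0 < \<epsilon>"
    \<comment> \<open>Compensates the factor D in the definition of c.\<close>
    have "0 < \<epsilon> / D" using \<epsilon> D0 by simp
    show "\<forall>\<^sub>F t in at_top. \<exists>c\<ge>0.
      (\<forall>is. length is = j \<longrightarrow> Lq_le q (v is t) (t powr (- \<sigma>) * c) \<and> Lq_le 1 (v is t) (t powr (l / d) * c) \<and>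
        wt l (v is t) \<le> ennreal (t powr (l / d) * c)) \<and>
      ennreal c \<le> ennreal (\<epsilon> * t powr (- (K + real j) / d))
        + ennreal (D * C * t powr (- K / d)) * (\<integral>\<^sup>+s. ennreal (indicator {T<..<t} s * ((t - s) powr (- real j / d) * e s)) \<partial>lborel)"
      using C[OF T \<open>0 < \<epsilon> / D\<close>] eventually_ge_at_top[of 1]
    proof eventually_elim
      fix t :: real
      assume "\<exists>b\<ge>0. (\<integral>\<^sup>+s. ennreal (indicator {0<..<t} s * \<beta> j t s) \<partial>lborel) \<le> ennreal b \<and>
        ennreal b \<le> ennreal (\<epsilon> / D * t powr (- real j / d)) + ennreal C * (\<integral>\<^sup>+s. ennreal (indicator {T<..<t} s * ((t - s) powr (- real j / d) * e s)) \<partial>lborel)"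
        and t: "1 \<le> t"
      then obtain b where b: "0 \<le> b" "(\<integral>\<^sup>+s. ennreal (indicator {0<..<t} s * \<beta> j t s) \<partial>lborel) \<le> ennreal b"
        "ennreal b \<le> ennreal (\<epsilon> / D * t powr (- real j / d)) + ennreal C * (\<integral>\<^sup>+s. ennreal (indicator {T<..<t} s * ((t - s) powr (- real j / d) * e s)) \<partial>lborel)"
        by blast
      define I where "I = (\<integral>\<^sup>+s. ennreal (indicator {T<..<t} s * ((t - s) powr (- real j / d) * e s)) \<partial>lborel)"
      define c where "c = D * (t powr (- K / d) * b)"
      have c0: "0 \<le> c" using D0 b by (simp add: c_def)
      have tl: "1 \<le> t powr (l / d)" using t l d by (intro ge_one_powr_ge_zero) auto
      have A: "Lq_le q (v is t) (t powr (- \<sigma>) * c) \<and> Lq_le 1 (v is t) (t powr (l / d) * c) \<and> wt l (v is t) \<le> ennreal (t powr (l / d) * c)"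
        if "length is = j" for "is"
      proof -
        have m: "is \<in> lists_of j" using that by (simp add: lists_of_def)
        have 1: "Lq_le q (v is t) (cv is * (t powr (- \<sigma>) * t powr (- K / d) * b))"
          and 2: "Lq_le 1 (v is t) (cv is * (t powr (- K / d) * b))"
          and 3: "wt l (v is t) \<le> ennreal (cv is * (t powr (l / d) * t powr (- K / d) * b))"
          using cv m t b(1,2) by blast+
        have z: "cv is * Z \<le> D * Z" if "0 \<le> Z" for Z using D[OF m] that by (rule mult_right_mono)
        have "cv is * (t powr (- \<sigma>) * t powr (- K / d) * b) \<le> t powr (- \<sigma>) * c"
          using z[of "t powr (- \<sigma>) * t powr (- K / d) * b"] b by (simp add: c_def mult_ac)
        moreover have "cv is * (t powr (- K / d) * b) \<le> t powr (l / d) * c"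
        proof -
          have "cv is * (t powr (- K / d) * b) \<le> c" using z[of "t powr (- K / d) * b"] b by (simp add: c_def)
          also have "\<dots> \<le> t powr (l / d) * c" using tl c0 by (simp add: mult_le_cancel_right1)
          finally show ?thesis .
        qed
        moreover have "cv is * (t powr (l / d) * t powr (- K / d) * b) \<le> t powr (l / d) * c"
          using z[of "t powr (l / d) * t powr (- K / d) * b"] b by (simp add: c_def mult_ac)
        ultimately show ?thesis using Lq_le_mono[OF 1] Lq_le_mono[OF 2] order_trans[OF 3 ennreal_leI] by blast
      qed
      have B: "ennreal c \<le> ennreal (\<epsilon> * t powr (- (K + real j) / d)) + ennreal (D * C * t powr (- K / d)) * I"
      proof -
        have "ennreal c = ennreal (D * t powr (- K / d)) * ennreal b"
          using D0 b by (simp add: c_def mult.assoc flip: ennreal_mult)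
        also have "\<dots> \<le> ennreal (D * t powr (- K / d)) * (ennreal (\<epsilon> / D * t powr (- real j / d)) + ennreal C * I)"
          using b(3) unfolding I_def by (rule mult_left_mono) simp
        also have "\<dots> = ennreal (D * t powr (- K / d)) * ennreal (\<epsilon> / D * t powr (- real j / d)) + (ennreal (D * t powr (- K / d)) * ennreal C) * I"
          by (simp add: distrib_left mult.assoc)
        also have "ennreal (D * t powr (- K / d)) * ennreal C = ennreal (D * C * t powr (- K / d))"
          using D0 C0 by (simp add: mult_ac flip: ennreal_mult)
        also have "ennreal (D * t powr (- K / d)) * ennreal (\<epsilon> / D * t powr (- real j / d)) = ennreal (\<epsilon> * t powr (- (K + real j) / d))"
        proof -
          have "D * t powr (- K / d) * (\<epsilon> / D * t powr (- real j / d)) = \<epsilon> * (t powr (- K / d) * t powr (- real j / d))"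
            using D0 by simp
          also have "t powr (- K / d) * t powr (- real j / d) = t powr (- (K + real j) / d)"
            by (simp add: powr_add[symmetric] add_divide_distrib diff_divide_distrib)
          finally show ?thesis using D0 \<epsilon> by (simp flip: ennreal_mult)
        qed
        finally show ?thesis .
      qed
      show "\<exists>c\<ge>0. (\<forall>is. length is = j \<longrightarrow> Lq_le q (v is t) (t powr (- \<sigma>) * c) \<and> Lq_le 1 (v is t) (t powr (l / d) * c) \<and>
        wt l (v is t) \<le> ennreal (t powr (l / d) * c)) \<and>
      ennreal c \<le> ennreal (\<epsilon> * t powr (- (K + real j) / d))
        + ennreal (D * C * t powr (- K / d)) * (\<integral>\<^sup>+s. ennreal (indicator {T<..<t} s * ((t - s) powr (- real j / d) * e s)) \<partial>lborel)"
        using c0 A B unfolding I_def by blast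
    qed
  qed
qed

end

section \<open>Reduction to Borel measurable sources\<close>

text \<open>Lebesgue measure is complete, so f and g are measurable together; if neither is, both
  integrals have the default value 0.\<close>

lemma lebesgue_integral_cong_AE:
  fixes f g :: "'a::euclidean_space \<Rightarrow> real"
  assumes ae: "AE x in lebesgue. f x = g x"
  shows "(LINT x|lebesgue. f x) = (LINT x|lebesgue. g x)"
proof (cases "f \<in> borel_measurable lebesgue")
  case True
  then have "g \<in> borel_measurable lebesgue" using ae by (rule borel_measurable_AE)
  with True ae show ?thesis by (intro integral_cong_AE)
next
  case False
  have "AE x in lebesgue. g x = f x" using ae by eventually_elim simp
  then have "g \<notin> borel_measurable lebesgue" using False borel_measurable_AE[of g f] by blast
  with False have "\<not> integrable lebesgue f" "\<not> integrable lebesgue g" by (auto dest: borel_measurable_integrable)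
  then show ?thesis by (simp add: not_integrable_integral_eq)
qed

lemma moment_cong_AE:
  assumes ae: "AE x in lebesgue. h x = h' x"
  shows "moment G h t \<alpha> = moment G h' t \<alpha>"
proof (induction "mi_len \<alpha>" arbitrary: \<alpha> rule: less_induct)
  case less
  have "(LINT x|lebesgue. mi_pow x \<alpha> * h x) = (LINT x|lebesgue. mi_pow x \<alpha> * h' x)"
    by (rule lebesgue_integral_cong_AE, use ae in eventually_elim) simp
  moreover have "(\<Sum>\<beta> | \<beta> \<le> \<alpha> \<and> \<beta> \<noteq> \<alpha>. moment G h t \<beta> * (LINT x|lebesgue. mi_pow x \<alpha> * g_kernel G \<beta> t x))
    = (\<Sum>\<beta> | \<beta> \<le> \<alpha> \<and> \<beta> \<noteq> \<alpha>. moment G h' t \<beta> * (LINT x|lebesgue. mi_pow x \<alpha> * g_kernel G \<beta> t x))"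
  proof (rule sum.cong[OF refl])
    fix \<beta> assume "\<beta> \<in> {\<beta>. \<beta> \<le> \<alpha> \<and> \<beta> \<noteq> \<alpha>}"
    then have "mi_len \<beta> < mi_len \<alpha>" by (auto intro: mi_len_strict_mono)
    then show "moment G h t \<beta> * (LINT x|lebesgue. mi_pow x \<alpha> * g_kernel G \<beta> t x)
      = moment G h' t \<beta> * (LINT x|lebesgue. mi_pow x \<alpha> * g_kernel G \<beta> t x)"
      using less by simp
  qed
  ultimately show ?case by (simp only: moment.simps[of G h t \<alpha>] moment.simps[of G h' t \<alpha>])
qed

lemma semigrp_cong_AE:
  assumes ae: "AE y in lebesgue. h y = h' y"
  shows "semigrp G t h x = semigrp G t h' x"
  unfolding semigrp_def by (rule lebesgue_integral_cong_AE, use ae in eventually_elim) simp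

lemma P_op_cong_AE:
  assumes ae: "AE y in lebesgue. h y = h' y"
  shows "AE y in lebesgue. P_op G K s h y = P_op G K s h' y"
  using ae by eventually_elim (simp add: P_op_def moment_cong_AE[OF ae])

lemma R_op_cong_AE:
  fixes f f' :: "real ^ 'n::finite \<Rightarrow> real \<Rightarrow> real"
  assumes ae: "AE s in lebesgue. 0 < s \<longrightarrow> (AE x in lebesgue. f x s = f' x s)"
  shows "R_op G K f t x = R_op G K f' t x"
  unfolding R_op_def set_lebesgue_integral_def
proof (rule lebesgue_integral_cong_AE, use ae in eventually_elim)
  fix s assume *: "0 < s \<longrightarrow> (AE x in lebesgue. f x s = f' x s)"
  show "indicat_real {0<..<t} s *\<^sub>R semigrp G (t - s) (P_op G K s (\<lambda>y. f y s)) x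
    = indicat_real {0<..<t} s *\<^sub>R semigrp G (t - s) (P_op G K s (\<lambda>y. f' y s)) x"
  proof (cases "s \<in> {0<..<t}")
    case True
    then have "AE x in lebesgue. f x s = f' x s" using * by simp
    from semigrp_cong_AE[OF P_op_cong_AE[OF this]] show ?thesis by simp
  qed simp
qed

lemma Lnorm_imp_Lq_le:
  fixes h h' :: "real ^ 'n::finite \<Rightarrow> real"
  assumes q: "1 \<le> q" and ae: "AE x in lborel. h x = h' x" and h': "h' \<in> borel_measurable borel"
    and c: "Lnorm q h \<le> ennreal c" "0 \<le> c"
  shows "Lq_le q h' c"
proof -
  have hm: "h \<in> borel_measurable lebesgue"
    using c by (cases "h \<in> borel_measurable lebesgue") (auto simp: Lnorm_def top_unique)
  show ?thesis
  proof (cases "q = \<infinity>")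
    case True
    then have le: "esssup lebesgue (\<lambda>x. ennreal \<bar>h x\<bar>) \<le> ennreal c" using c hm by (simp add: Lnorm_def)
    have "AE x in lborel. ennreal \<bar>h x\<bar> \<le> esssup lebesgue (\<lambda>x. ennreal \<bar>h x\<bar>)"
      using esssup_AE[of "\<lambda>x. ennreal \<bar>h x\<bar>" lebesgue] by (simp add: AE_completion_iff)
    then have "AE x in lborel. \<bar>h x\<bar> \<le> c"
    proof eventually_elim
      fix x assume "ennreal \<bar>h x\<bar> \<le> esssup lebesgue (\<lambda>x. ennreal \<bar>h x\<bar>)"
      then have "ennreal \<bar>h x\<bar> \<le> ennreal c" using le by (rule order_trans)
      then show "\<bar>h x\<bar> \<le> c" using c(2) by simp
    qed
    with ae have "AE x in lborel. \<bar>h' x\<bar> \<le> c" by eventually_elim simp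
    then show ?thesis using True h' c by (simp add: Lq_le_def)
  next
    case False
    define p where "p = enn2real q"
    have p: "1 \<le> p" unfolding p_def by (rule enn2real_ge_1[OF q False])
    define I where "I = (\<integral>\<^sup>+x. ennreal (\<bar>h x\<bar> powr p) \<partial>lebesgue)"
    have If: "I \<noteq> \<infinity>" "ennreal (enn2real I powr (1 / p)) \<le> ennreal c"
      using c(1) hm False unfolding Lnorm_def Let_def p_def[symmetric] I_def[symmetric] by (auto split: if_splits simp: top_unique)
    then have "enn2real I powr (1 / p) \<le> c" using c(2) by simp
    then have "(enn2real I powr (1 / p)) powr p \<le> c powr p" using p by (intro powr_mono2) auto
    then have le: "enn2real I \<le> c powr p" using p by (simp add: powr_powr)
    have "ennreal (enn2real I) = I" using If(1) by (simp add: less_top)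
    then have IB: "I \<le> ennreal (c powr p)" using ennreal_leI[OF le] by (simp only:)
    have "I = (\<integral>\<^sup>+x. ennreal (\<bar>h' x\<bar> powr p) \<partial>lborel)"
      unfolding I_def nn_integral_completion by (rule nn_integral_cong_AE, use ae in eventually_elim) simp
    with IB show ?thesis using False h' c by (simp add: Lq_le_def p_def)
  qed
qed

lemma Lnorm_le:
  fixes h V :: "real ^ 'n::finite \<Rightarrow> real"
  assumes q: "1 \<le> q" and h: "h \<in> borel_measurable lebesgue" and V: "Lq_le q V c"
    and ae: "AE x in lborel. \<bar>h x\<bar> \<le> \<bar>V x\<bar>"
  shows "Lnorm q h \<le> ennreal c"
proof (cases "q = \<infinity>")
  case True
  have "AE x in lborel. \<bar>V x\<bar> \<le> c" using V True by (simp add: Lq_le_def)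
  with ae have "AE x in lborel. ennreal \<bar>h x\<bar> \<le> ennreal c" by eventually_elim (auto intro: ennreal_leI)
  then have "AE x in lebesgue. ennreal \<bar>h x\<bar> \<le> ennreal c" by (rule AE_completion)
  then have "esssup lebesgue (\<lambda>x. ennreal \<bar>h x\<bar>) \<le> ennreal c" using h by (intro esssup_I) auto
  then show ?thesis using True h by (simp add: Lnorm_def)
next
  case False
  define p where "p = enn2real q"
  have p: "1 \<le> p" unfolding p_def by (rule enn2real_ge_1[OF q False])
  have c: "0 \<le> c" using V by (simp add: Lq_le_def)
  define I where "I = (\<integral>\<^sup>+x. ennreal (\<bar>h x\<bar> powr p) \<partial>lebesgue)"
  have "I \<le> (\<integral>\<^sup>+x. ennreal (\<bar>V x\<bar> powr p) \<partial>lborel)"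
    unfolding I_def nn_integral_completion
    by (rule nn_integral_mono_AE, use ae in eventually_elim) (use p in \<open>auto intro!: ennreal_leI powr_mono2\<close>)
  also have "\<dots> \<le> ennreal (c powr p)" using V False by (simp add: Lq_le_def p_def)
  finally have I: "I \<le> ennreal (c powr p)" .
  then have If: "I \<noteq> \<infinity>" by (auto simp: top_unique)
  have "enn2real I powr (1 / p) \<le> (c powr p) powr (1 / p)"
    using p enn2real_leI[OF _ I] by (intro powr_mono2) auto
  also have "\<dots> = c" using p c by (simp add: powr_powr)
  finally have "ennreal (enn2real I powr (1 / p)) \<le> ennreal c" by (rule ennreal_leI)
  then show ?thesis
    using h False If unfolding Lnorm_def Let_def p_def[symmetric] I_def[symmetric] by simp
qed

lemma wnorm_le:
  fixes h V :: "real ^ 'n::finite \<Rightarrow> real"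
  assumes h: "h \<in> borel_measurable lebesgue" and V: "Lq_le 1 V a" "wt l V \<le> ennreal b" "0 \<le> b"
    and ae: "AE x in lborel. \<bar>h x\<bar> \<le> \<bar>V x\<bar>"
  shows "wnorm l h \<le> ennreal (a + b)"
proof -
  have [measurable]: "V \<in> borel_measurable borel" and a: "0 \<le> a" "(\<integral>\<^sup>+x. ennreal \<bar>V x\<bar> \<partial>lborel) \<le> ennreal a"
    using V by (auto simp: Lq_le_1_iff)
  have "wnorm l h = (\<integral>\<^sup>+x. ennreal (\<bar>h x\<bar> * (1 + norm x powr l)) \<partial>lborel)"
    using h by (simp add: wnorm_def nn_integral_completion)
  also have "\<dots> \<le> (\<integral>\<^sup>+x. ennreal \<bar>V x\<bar> + ennreal (\<bar>V x\<bar> * norm x powr l) \<partial>lborel)"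
  proof (rule nn_integral_mono_AE, use ae in eventually_elim)
    fix x assume "\<bar>h x\<bar> \<le> \<bar>V x\<bar>"
    then have "\<bar>h x\<bar> * (1 + norm x powr l) \<le> \<bar>V x\<bar> * (1 + norm x powr l)" by (rule mult_right_mono) simp
    then show "ennreal (\<bar>h x\<bar> * (1 + norm x powr l)) \<le> ennreal \<bar>V x\<bar> + ennreal (\<bar>V x\<bar> * norm x powr l)"
      by (simp add: distrib_left ennreal_leI flip: ennreal_plus)
  qed
  also have "\<dots> = (\<integral>\<^sup>+x. ennreal \<bar>V x\<bar> \<partial>lborel) + wt l V"
    unfolding wt_def by (simp add: nn_integral_add)
  also have "\<dots> \<le> ennreal a + ennreal b" using a V by (intro add_mono) auto
  finally show ?thesis using a V by simp
qed

lemma wt_le_wnorm: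
  fixes h h' :: "real ^ 'n::finite \<Rightarrow> real"
  assumes ae: "AE x in lborel. h x = h' x"
  shows "wt k h' \<le> wnorm k h"
proof (cases "h \<in> borel_measurable lebesgue")
  case True
  have "wt k h' \<le> (\<integral>\<^sup>+x. ennreal (\<bar>h x\<bar> * (1 + norm x powr k)) \<partial>lborel)"
    unfolding wt_def
    by (rule nn_integral_mono_AE, use ae in eventually_elim) (auto intro!: ennreal_leI mult_left_mono)
  then show ?thesis using True by (simp add: wnorm_def nn_integral_completion)
qed (simp add: wnorm_def)

lemma ennreal_cancel_left:
  assumes "0 < a" "ennreal a * X \<le> ennreal b" "0 \<le> b"
  shows "X \<le> ennreal (b / a)"
proof (cases X)
  case (real x)
  then have "ennreal (a * x) \<le> ennreal b" using assms by (simp add: ennreal_mult)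
  then have "a * x \<le> b" using assms by simp
  then show ?thesis using real assms by (simp add: ennreal_leI field_simps)
next
  case top
  then show ?thesis using assms by (simp add: ennreal_mult_top top_unique)
qed

text \<open>Each summand of \<open>E_fun\<close> is at most e, and its positive prefactor can be
  divided out.\<close>

lemma E_fun_imp_bounds:
  fixes f :: "real ^ 'n::finite \<Rightarrow> real \<Rightarrow> real"
  assumes q: "1 \<le> q" and s: "0 < s" and e: "0 \<le> e" and E: "E_fun d K q f s \<le> ennreal e"
    and h: "h \<in> borel_measurable borel" and ae: "AE x in lborel. f x s = h x"
  shows "Lq_le 1 h ((1 + s) powr (- K / d) * e)" "wt K h \<le> ennreal e"
    "Lq_le q h (s powr (- scal_exp TYPE('n) d q) * (1 + s) powr (- K / d) * e)"
proof -
  let ?A = "ennreal ((1 + s) powr (K / d))" and ?B = "ennreal (s powr scal_exp TYPE('n) d q)"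
  let ?q = "Lnorm q (\<lambda>x. f x s)" and ?r = "Lnorm 1 (\<lambda>x. f x s)" and ?w = "wnorm K (\<lambda>x. f x s)"
  have p: "0 < (1 + s) powr (K / d)" "0 < s powr scal_exp TYPE('n) d q" using s by auto
  have E': "?A * (?B * ?q + ?r) + ?w \<le> ennreal e" using E by (simp add: E_fun_def)
  then have "?w \<le> ennreal e" by (rule order_trans[rotated]) (simp add: add_increasing)
  then show "wt K h \<le> ennreal e" using wt_le_wnorm[OF ae] order_trans by blast
  have "?A * (?B * ?q + ?r) \<le> ennreal e" using E' by (rule order_trans[rotated]) (simp add: add_increasing2)
  then have c: "?B * ?q + ?r \<le> ennreal (e / (1 + s) powr (K / d))" using p e by (intro ennreal_cancel_left)
  have eq: "e / (1 + s) powr (K / d) = (1 + s) powr (- K / d) * e" by (simp add: powr_minus field_simps)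
  have "?r \<le> ennreal ((1 + s) powr (- K / d) * e)"
    using c unfolding eq by (rule order_trans[rotated]) (simp add: add_increasing)
  then show "Lq_le 1 h ((1 + s) powr (- K / d) * e)" using e by (intro Lnorm_imp_Lq_le[OF _ ae h]) auto
  have "?B * ?q \<le> ennreal ((1 + s) powr (- K / d) * e)"
    using c unfolding eq by (rule order_trans[rotated]) (simp add: add_increasing2)
  then have "?q \<le> ennreal ((1 + s) powr (- K / d) * e / s powr scal_exp TYPE('n) d q)" using p e by (intro ennreal_cancel_left) auto
  also have "(1 + s) powr (- K / d) * e / s powr scal_exp TYPE('n) d q = s powr (- scal_exp TYPE('n) d q) * (1 + s) powr (- K / d) * e"
    by (simp add: powr_minus field_simps)
  finally show "Lq_le q h (s powr (- scal_exp TYPE('n) d q) * (1 + s) powr (- K / d) * e)"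
    using e by (intro Lnorm_imp_Lq_le[OF q ae h]) auto
qed

section \<open>Borel representatives of E and f\<close>

text \<open>E is known to be measurable only on each (0,T); the supremum over n of its truncations
  to (0,n) is measurable on the line and equals E for s > 0. There E is finite almost everywhere, so
  \<open>enn2real\<close> of a Borel version represents it.\<close>

lemma in_Linfty_Borel_representative:
  fixes E :: "real \<Rightarrow> ennreal"
  assumes E: "\<forall>T>0. in_Linfty T E"
  obtains e where "e \<in> borel_measurable borel" "\<And>s. 0 \<le> e s" "AE s in lborel. 0 < s \<longrightarrow> E s = ennreal (e s)"
    "\<And>T. \<exists>B\<ge>0. AE s in lborel. 0 < s \<and> s < T \<longrightarrow> e s \<le> B"
proof -
  have bd: "\<exists>B\<ge>0. AE s in lborel. 0 < s \<and> s < T \<longrightarrow> E s \<le> ennreal B" for T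
  proof (cases "0 < T")
    case True
    then have fin: "esssup (lebesgue_on {0<..<T}) E < \<infinity>" using E by (simp add: in_Linfty_def)
    define B where "B = enn2real (esssup (lebesgue_on {0<..<T}) E)"
    have B: "esssup (lebesgue_on {0<..<T}) E = ennreal B" using fin by (simp add: B_def)
    have "AE s in lebesgue_on {0<..<T}. E s \<le> ennreal B" using esssup_AE[of E "lebesgue_on {0<..<T}"] by (simp add: B)
    then have "AE s in lebesgue. s \<in> {0<..<T} \<longrightarrow> E s \<le> ennreal B"
      by (subst (asm) AE_restrict_space_iff) auto
    then have "AE s in lborel. 0 < s \<and> s < T \<longrightarrow> E s \<le> ennreal B" by (simp add: AE_completion_iff)
    moreover have "0 \<le> B" by (simp add: B_def)
    ultimately show ?thesis by blast
  next
    case False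
    then have "AE s in lborel. 0 < s \<and> s < T \<longrightarrow> E s \<le> ennreal 0" by (intro AE_I2) auto
    then show ?thesis by blast
  qed
  have meas: "(\<lambda>s. E s * indicator {0<..<real n} s) \<in> borel_measurable lebesgue" for n
  proof (cases "0 < real n")
    case True
    then have "esssup (lebesgue_on {0<..<real n}) E < \<infinity>" using E by (simp add: in_Linfty_def)
    then have "E \<in> borel_measurable (lebesgue_on {0<..<real n})"
      by (cases "E \<in> borel_measurable (lebesgue_on {0<..<real n})") (auto simp: esssup_non_measurable)
    then show ?thesis by (subst (asm) borel_measurable_restrict_space_iff_ennreal) auto
  qed simp
  have "(\<lambda>s. SUP n::nat. E s * indicator {0<..<real n} s) \<in> borel_measurable lebesgue"
    by (intro borel_measurable_SUP meas) auto
  then obtain E' where E'[measurable]: "E' \<in> borel_measurable borel" and EE': "AE s in lborel. (SUP n::nat. E s * indicator {0<..<real n} s) = E' s"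
    using completion_ex_borel_measurable[of "\<lambda>s. SUP n::nat. E s * indicator {0<..<real n} s" lborel] by auto
  have sup: "(SUP n::nat. E s * indicator {0<..<real n} s) = E s" if "0 < s" for s
  proof (rule antisym)
    show "(SUP n::nat. E s * indicator {0<..<real n} s) \<le> E s" by (intro SUP_least) (auto simp: indicator_def)
    obtain n :: nat where "s < real n" using reals_Archimedean2 by blast
    then show "E s \<le> (SUP n::nat. E s * indicator {0<..<real n} s)"
      using that by (intro SUP_upper2[of n]) auto
  qed
  define e where "e s = enn2real (E' s)" for s
  have "\<forall>n::nat. \<exists>B\<ge>0. AE s in lborel. 0 < s \<and> s < real n \<longrightarrow> E s \<le> ennreal B" using bd by blast
  then obtain B where B: "\<And>n::nat. AE s in lborel. 0 < s \<and> s < real n \<longrightarrow> E s \<le> ennreal (B n)" by metis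
  have "AE s in lborel. \<forall>n::nat. 0 < s \<and> s < real n \<longrightarrow> E s \<le> ennreal (B n)"
    unfolding AE_all_countable using B by blast
  with EE' have main: "AE s in lborel. 0 < s \<longrightarrow> E s = ennreal (e s)"
  proof eventually_elim
    fix s assume 1: "(SUP n::nat. E s * indicator {0<..<real n} s) = E' s" and 2: "\<forall>n::nat. 0 < s \<and> s < real n \<longrightarrow> E s \<le> ennreal (B n)"
    show "0 < s \<longrightarrow> E s = ennreal (e s)"
    proof
      assume s: "0 < s"
      obtain n :: nat where "s < real n" using reals_Archimedean2 by blast
      then have "E s < top" using 2 s by (auto intro: le_less_trans)
      then show "E s = ennreal (e s)" using 1 sup[OF s] by (simp add: e_def)
    qed
  qed
  show ?thesis
  proof
    show "e \<in> borel_measurable borel" unfolding e_def by measurable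
    show "0 \<le> e s" for s by (simp add: e_def)
    show "AE s in lborel. 0 < s \<longrightarrow> E s = ennreal (e s)" by fact
    fix T
    obtain b where b: "0 \<le> b" "AE s in lborel. 0 < s \<and> s < T \<longrightarrow> E s \<le> ennreal b" using bd by blast
    from main b(2) have "AE s in lborel. 0 < s \<and> s < T \<longrightarrow> e s \<le> b"
      by eventually_elim (use b(1) in auto)
    with b(1) show "\<exists>B\<ge>0. AE s in lborel. 0 < s \<and> s < T \<longrightarrow> e s \<le> B" by blast
  qed
qed

text \<open>f, extended by 0, agrees with a Borel function off a Borel null set, almost all of whose
  sections are null by Fubini. The product theorem speaks of sections in s for fixed x, and the
  quantifiers are exchanged to obtain sections in x.\<close>

lemma lebesgue_measurable_Borel_representative:
  fixes f :: "real ^ 'n::finite \<Rightarrow> real \<Rightarrow> real"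
  assumes f: "(\<lambda>(x, t). f x t) \<in> borel_measurable (lebesgue_on (UNIV \<times> {0<..}))"
  obtains f0 where "f0 \<in> borel_measurable (borel \<Otimes>\<^sub>M borel)" "AE s in lborel. 0 < s \<longrightarrow> (AE x in lborel. f x s = f0 (x, s))"
proof -
  let ?S = "UNIV \<times> {0<..} :: ((real ^ 'n) \<times> real) set"
  have "?S \<in> sets lebesgue"
    by (intro sets_completionI_sets) (simp add: open_Times borel_open)
  define F where "F = (\<lambda>z. if z \<in> ?S then (\<lambda>(x, t). f x t) z else 0)"
  have "F \<in> borel_measurable lebesgue"
    unfolding F_def by (rule borel_measurable_if_I) fact+
  from completion_ex_borel_measurable_real[OF this]
  obtain f0 where f0: "f0 \<in> borel_measurable lborel" and ae: "AE z in lborel. F z = f0 z" by blast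
  from AE_E[OF ae] obtain N where N1: "{z \<in> space lborel. \<not> F z = f0 z} \<subseteq> N"
    and N: "emeasure lborel N = 0" "N \<in> sets lborel" by blast
  have NP: "F z = f0 z" if "z \<notin> N" for z using N1 that by auto
  have Ns: "N \<in> sets (lborel \<Otimes>\<^sub>M lborel)" unfolding lborel_prod by (rule N(2))
  have "AE z in lborel \<Otimes>\<^sub>M lborel. z \<notin> N"
    unfolding lborel_prod using N(1,2) by (intro AE_not_in) (simp add: null_sets_def)
  then have "AE x in lborel. AE s in lborel. (x, s) \<notin> N" by (rule lborel_pair.AE_pair)
  moreover have "{z \<in> space (lborel \<Otimes>\<^sub>M lborel). (fst z, snd z) \<notin> N} \<in> sets (lborel \<Otimes>\<^sub>M lborel)"
  proof -
    have "{z \<in> space (lborel \<Otimes>\<^sub>M lborel). (fst z, snd z) \<notin> N} = space (lborel \<Otimes>\<^sub>M lborel) - N" by auto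
    then show ?thesis using Ns by (simp only: sets.Diff sets.top)
  qed
  ultimately have "AE s in lborel. AE x in lborel. (x, s) \<notin> N"
    using lborel_pair.AE_commute[where P = "\<lambda>x s. (x, s) \<notin> N"] by blast
  then have "AE s in lborel. 0 < s \<longrightarrow> (AE x in lborel. f x s = f0 (x, s))"
  proof eventually_elim
    fix s assume "AE x in lborel. (x, s) \<notin> N"
    then have "AE x in lborel. 0 < s \<longrightarrow> f x s = f0 (x, s)"
    proof eventually_elim
      fix x assume "(x, s) \<notin> N"
      from NP[OF this] show "0 < s \<longrightarrow> f x s = f0 (x, s)" by (cases "0 < s") (simp_all add: F_def)
    qed
    then show "0 < s \<longrightarrow> (AE x in lborel. f x s = f0 (x, s))" by auto
  qed
  moreover have "f0 \<in> borel_measurable (borel \<Otimes>\<^sub>M borel)" using f0 by (simp add: borel_prod)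
  ultimately show ?thesis using that by blast
qed

text \<open>The source is set to 0 on a null set of times that contains all those at which E or the
  section of f departs from its representative. The slice bounds then hold at every s > 0, trivially
  at the removed times, and f is changed only on a null set.\<close>

lemma (in duhamel_kernel) Borel_reduction:
  assumes q: "1 \<le> q"
    and f: "(\<lambda>(x, t). f x t) \<in> borel_measurable (lebesgue_on (UNIV \<times> {0<..}))"
    and E: "\<forall>T>0. in_Linfty T (E_fun d K q f)"
  obtains f' e where "duhamel G \<gamma> d L K f' e q"
    "AE s in lborel. 0 < s \<longrightarrow> E_fun d K q f s = ennreal (e s) \<and> (AE x in lebesgue. f x s = f' x s)"
proof -
  obtain e where e: "e \<in> borel_measurable borel" "\<And>s. 0 \<le> e s" "AE s in lborel. 0 < s \<longrightarrow> E_fun d K q f s = ennreal (e s)"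
    "\<And>T. \<exists>B\<ge>0. AE s in lborel. 0 < s \<and> s < T \<longrightarrow> e s \<le> B"
    using in_Linfty_Borel_representative[OF E] by blast
  obtain f0 where f0[measurable]: "f0 \<in> borel_measurable (borel \<Otimes>\<^sub>M borel)" and f0f: "AE s in lborel. 0 < s \<longrightarrow> (AE x in lborel. f x s = f0 (x, s))"
    using lebesgue_measurable_Borel_representative[OF f] by blast
  \<comment> \<open>Both requirements are combined so that one Borel null set N covers the failure
    of either.\<close>
  define P where "P s \<longleftrightarrow> (0 < s \<longrightarrow> E_fun d K q f s = ennreal (e s) \<and> (AE x in lborel. f x s = f0 (x, s)))" for s
  from e(3) f0f have "AE s in lborel. P s" unfolding P_def by eventually_elim blast
  from AE_E[OF this] obtain N where N1: "{s \<in> space lborel. \<not> P s} \<subseteq> N"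
    and N0: "emeasure lborel N = 0" and N': "N \<in> sets lborel" by blast
  have N[measurable]: "N \<in> sets borel" using N' by simp
  have NP: "E_fun d K q f s = ennreal (e s) \<and> (AE x in lborel. f x s = f0 (x, s))" if "s \<notin> N" "0 < s" for s
  proof -
    have "P s" using N1 that(1) by auto
    then show ?thesis using that(2) unfolding P_def by blast
  qed
  define f' where "f' x s = (if s \<in> N \<or> s \<le> 0 then 0 else f0 (x, s))" for x s
  have f'm: "(\<lambda>(x, s). f' x s) \<in> borel_measurable (borel \<Otimes>\<^sub>M borel)"
  proof -
    have "(\<lambda>(x, s). f' x s) = (\<lambda>z. if snd z \<in> N \<or> snd z \<le> 0 then 0 else f0 z)"
      by (auto simp: f'_def)
    also have "\<dots> \<in> borel_measurable (borel \<Otimes>\<^sub>M borel)" by measurable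
    finally show ?thesis .
  qed
  have f's: "(\<lambda>x. f' x s) \<in> borel_measurable borel" for s
    using measurable_compose[OF measurable_Pair2'[of s borel borel] f'm] by simp
  have bounds: "slice (\<lambda>x. f' x s) s (e s) \<and> Lq_le q (\<lambda>x. f' x s) (s powr (- scal_exp TYPE('n) d q) * (1 + s) powr (- K / d) * e s)"
    if s: "0 < s" for s
  proof (cases "s \<in> N")
    case True
    then have "(\<lambda>x. f' x s) = (\<lambda>x. 0)" by (simp add: f'_def)
    then show ?thesis using q e(2)[of s] by (simp add: slice_def Lq_le_zero wt_def)
  next
    case False
    have "E_fun d K q f s \<le> ennreal (e s)" "AE x in lborel. f x s = f' x s"
      using NP[OF False s] False s by (auto simp: f'_def)
    from E_fun_imp_bounds[OF q s e(2) this(1) f's this(2)] show ?thesis unfolding slice_def by blast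
  qed
  have "duhamel G \<gamma> d L K f' e q"
    by unfold_locales (use q f'm e bounds in auto)
  moreover have "AE s in lborel. 0 < s \<longrightarrow> E_fun d K q f s = ennreal (e s) \<and> (AE x in lebesgue. f x s = f' x s)"
  proof -
    have "AE s in lborel. s \<notin> N" using N N0 by (intro AE_not_in) (simp add: null_sets_def)
    then show ?thesis
    proof eventually_elim
      fix s assume s: "s \<notin> N"
      show "0 < s \<longrightarrow> E_fun d K q f s = ennreal (e s) \<and> (AE x in lebesgue. f x s = f' x s)"
      proof
        assume "0 < s"
        then show "E_fun d K q f s = ennreal (e s) \<and> (AE x in lebesgue. f x s = f' x s)"
          using NP[OF s] s by (simp add: f'_def AE_completion_iff)
      qed
    qed
  qed
  ultimately show ?thesis using that by blast
qed

context duhamel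
begin

section \<open>Norms of the weak gradients\<close>

text \<open>\<open>weak_mpartial\<close> is only a choice, but it agrees almost everywhere with the
  functions \<open>v\<close>, from which it inherits measurability by completeness; the Euclidean
  length of the gradient is at most the sum of absolute values.\<close>

lemma weak_nabla_bound:
  assumes j: "j \<le> \<gamma>" "real j < d" and t: "0 < t"
  shows "weak_nabla j (v [] t) \<in> borel_measurable lebesgue"
    "AE x in lborel. \<bar>weak_nabla j (v [] t) x\<bar> \<le> \<bar>\<Sum>\<alpha> | mi_len \<alpha> = j. \<bar>v (mi_list \<alpha>) t x\<bar>\<bar>"
proof -
  let ?A = "{\<alpha>::'n \<Rightarrow> nat. mi_len \<alpha> = j}"
  have fin: "finite ?A" by (rule finite_subset[OF _ finite_mi_len[of j]]) auto
  have ae: "AE x in lebesgue. v (mi_list \<alpha>) t x = weak_mpartial \<alpha> (v [] t) x" if "\<alpha> \<in> ?A" for \<alpha>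
  proof -
    have W: "has_weak_mpartial \<alpha> (v [] t) (v (mi_list \<alpha>) t)" using that j t by (intro v_weak_derivative) auto
    then have "has_weak_mpartial \<alpha> (v [] t) (weak_mpartial \<alpha> (v [] t))" unfolding weak_mpartial_def by (rule someI[where P = "has_weak_mpartial \<alpha> (v [] t)"])
    from weak_mpartial_unique[OF W this] show ?thesis .
  qed
  have m: "weak_mpartial \<alpha> (v [] t) \<in> borel_measurable lebesgue" if "\<alpha> \<in> ?A" for \<alpha>
  proof (rule borel_measurable_AE[OF _ ae[OF that]])
    show "v (mi_list \<alpha>) t \<in> borel_measurable lebesgue"
      using v_borel[of "mi_list \<alpha>" t] that j by (intro measurable_completion) simp
  qed
  show "weak_nabla j (v [] t) \<in> borel_measurable lebesgue"
    unfolding weak_nabla_def order_len_def[abs_def]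
    by (intro borel_measurable_sqrt[THEN measurable_compose[rotated]] borel_measurable_sum borel_measurable_power m)
  have "AE x in lebesgue. \<forall>\<alpha>\<in>?A. v (mi_list \<alpha>) t x = weak_mpartial \<alpha> (v [] t) x"
    using ae fin by (intro AE_finite_allI) auto
  then have "AE x in lborel. \<forall>\<alpha>\<in>?A. v (mi_list \<alpha>) t x = weak_mpartial \<alpha> (v [] t) x" by (simp only: AE_completion_iff)
  then show "AE x in lborel. \<bar>weak_nabla j (v [] t) x\<bar> \<le> \<bar>\<Sum>\<alpha> | mi_len \<alpha> = j. \<bar>v (mi_list \<alpha>) t x\<bar>\<bar>"
  proof eventually_elim
    fix x assume eq: "\<forall>\<alpha>\<in>?A. v (mi_list \<alpha>) t x = weak_mpartial \<alpha> (v [] t) x"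
    have "weak_nabla j (v [] t) x = L2_set (\<lambda>\<alpha>. weak_mpartial \<alpha> (v [] t) x) ?A"
      by (simp add: weak_nabla_def order_len_def L2_set_def)
    also have "\<dots> = L2_set (\<lambda>\<alpha>. v (mi_list \<alpha>) t x) ?A" using eq by (intro L2_set_cong) auto
    finally have "weak_nabla j (v [] t) x = L2_set (\<lambda>\<alpha>. v (mi_list \<alpha>) t x) ?A" .
    then show "\<bar>weak_nabla j (v [] t) x\<bar> \<le> \<bar>\<Sum>\<alpha> | mi_len \<alpha> = j. \<bar>v (mi_list \<alpha>) t x\<bar>\<bar>"
      using L2_set_le_sum_abs[of "\<lambda>\<alpha>. v (mi_list \<alpha>) t x" ?A] L2_set_nonneg[of "\<lambda>\<alpha>. v (mi_list \<alpha>) t x" ?A] by linarith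
  qed
qed

text \<open>The factor 3 counts c once for the L^q term and twice for the weighted norm, which is an
  L^1 part plus a homogeneous part.\<close>

lemma norms_le:
  assumes h: "h \<in> borel_measurable lebesgue" and ae: "AE x in lborel. \<bar>h x\<bar> \<le> \<bar>V x\<bar>"
    and t: "0 < t" and c: "0 \<le> c"
    and V: "Lq_le q V (t powr (- \<sigma>) * c)" "Lq_le 1 V (t powr (l / d) * c)" "wt l V \<le> ennreal (t powr (l / d) * c)"
  shows "ennreal (t powr scal_exp TYPE('n) d q) * Lnorm q h + ennreal (t powr (- l / d)) * wnorm l h \<le> ennreal (3 * c)"
proof -
  have "ennreal (t powr scal_exp TYPE('n) d q) * Lnorm q h + ennreal (t powr (- l / d)) * wnorm l h
    \<le> ennreal (t powr \<sigma>) * ennreal (t powr (- \<sigma>) * c) + ennreal (t powr (- l / d)) * ennreal (t powr (l / d) * c + t powr (l / d) * c)"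
    unfolding \<sigma>_def[symmetric]
    using c by (intro add_mono mult_left_mono Lnorm_le[OF q h V(1) ae] wnorm_le[OF h V(2,3) _ ae]) auto
  also have "\<dots> = ennreal ((t powr \<sigma> * t powr (- \<sigma>)) * c + (t powr (- l / d) * t powr (l / d)) * (2 * c))"
    using c by (simp add: mult.assoc distrib_left flip: ennreal_mult ennreal_plus)
  also have "(t powr \<sigma> * t powr (- \<sigma>)) * c + (t powr (- l / d) * t powr (l / d)) * (2 * c) = 3 * c"
    using t by (simp add: powr_add[symmetric])
  finally show ?thesis .
qed

text \<open>The pointwise sum U over the multi-indices of order j majorises the gradient, so the
  bounds add up and their number enters as a factor.\<close>

lemma norms_weak_nabla:
  assumes j: "j \<le> \<gamma>" "real j < d" and t: "0 < t" and c: "0 \<le> c"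
    and V: "\<And>is. length is = j \<Longrightarrow> Lq_le q (v is t) (t powr (- \<sigma>) * c) \<and> Lq_le 1 (v is t) (t powr (l / d) * c) \<and>
      wt l (v is t) \<le> ennreal (t powr (l / d) * c)"
  shows "ennreal (t powr scal_exp TYPE('n) d q) * Lnorm q (weak_nabla j (v [] t)) + ennreal (t powr (- l / d)) * wnorm l (weak_nabla j (v [] t))
    \<le> ennreal (3 * real (card {\<alpha>::'n \<Rightarrow> nat. mi_len \<alpha> = j}) * c)"
proof -
  let ?A = "{\<alpha>::'n \<Rightarrow> nat. mi_len \<alpha> = j}"
  have fin: "finite ?A" by (rule finite_subset[OF _ finite_mi_len[of j]]) auto
  define n where "n = real (card ?A)"
  define U where "U x = (\<Sum>\<alpha>\<in>?A. \<bar>v (mi_list \<alpha>) t x\<bar>)" for x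
  have vm: "v (mi_list \<alpha>) t \<in> borel_measurable borel" if "\<alpha> \<in> ?A" for \<alpha>
    using v_borel[of "mi_list \<alpha>" t] that j by simp
  have Um: "U \<in> borel_measurable borel" unfolding U_def
    using vm by (intro borel_measurable_sum borel_measurable_abs)
  have Lq: "Lq_le r U (n * X)" if r: "1 \<le> r" and X: "\<And>is. length is = j \<Longrightarrow> Lq_le r (v is t) X" for r X
  proof -
    have "Lq_le r U (\<Sum>\<alpha>\<in>?A. X)"
      by (rule Lq_le_sum[OF fin r, where h = "\<lambda>\<alpha>. v (mi_list \<alpha>) t"]) (use X Um in \<open>auto simp: U_def abs_of_nonneg sum_nonneg\<close>)
    then show ?thesis by (simp add: n_def)
  qed
  have Uw: "wt l U \<le> ennreal (t powr (l / d) * (n * c))"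
  proof -
    have "wt l U = (\<integral>\<^sup>+x. (\<Sum>\<alpha>\<in>?A. ennreal (\<bar>v (mi_list \<alpha>) t x\<bar> * norm x powr l)) \<partial>lborel)"
      unfolding wt_def U_def by (intro nn_integral_cong) (simp add: sum_nonneg sum_distrib_right sum_ennreal)
    also have "\<dots> = (\<Sum>\<alpha>\<in>?A. wt l (v (mi_list \<alpha>) t))"
      unfolding wt_def using vm by (intro nn_integral_sum) simp
    also have "\<dots> \<le> (\<Sum>\<alpha>\<in>?A. ennreal (t powr (l / d) * c))" using V by (intro sum_mono) auto
    also have "\<dots> = ennreal (t powr (l / d) * (n * c))" using c by (simp add: sum_ennreal n_def mult_ac del: sum_constant) (simp add: mult_ac)
    finally show ?thesis .
  qed
  have "ennreal (t powr scal_exp TYPE('n) d q) * Lnorm q (weak_nabla j (v [] t)) + ennreal (t powr (- l / d)) * wnorm l (weak_nabla j (v [] t))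
    \<le> ennreal (3 * (n * c))"
  proof (rule norms_le[where V = U])
    show "weak_nabla j (v [] t) \<in> borel_measurable lebesgue" by (rule weak_nabla_bound(1)[OF j t])
    show "AE x in lborel. \<bar>weak_nabla j (v [] t) x\<bar> \<le> \<bar>U x\<bar>" using weak_nabla_bound(2)[OF j t] by (simp add: U_def)
    show "Lq_le q U (t powr (- \<sigma>) * (n * c))" using Lq[OF q, of "t powr (- \<sigma>) * c"] V by (simp add: mult.left_commute)
    show "Lq_le 1 U (t powr (l / d) * (n * c))" using Lq[of 1 "t powr (l / d) * c"] V by (simp add: mult.left_commute)
    show "wt l U \<le> ennreal (t powr (l / d) * (n * c))" by (rule Uw)
  qed (use t c in \<open>auto simp: n_def\<close>)
  then show ?thesis by (simp add: n_def mult.assoc)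
qed

end

text \<open>Dominated convergence: the indicators of (n,\<infinity>) tend to 0 pointwise, under the
  integrable majorant e.\<close>

lemma (in duhamel) e_tail:
  assumes fin: "(\<integral>\<^sup>+s. ennreal (indicator {0<..} s * e s) \<partial>lborel) < \<infinity>" and \<delta>: "0 < \<delta>"
  obtains T where "0 < T" "(\<integral>\<^sup>+s. ennreal (indicator {T<..} s * e s) \<partial>lborel) \<le> ennreal \<delta>"
proof -
  have "(\<lambda>n. \<integral>\<^sup>+s. ennreal (indicator {real n<..} s * e s) \<partial>lborel) \<longlonglongrightarrow> (\<integral>\<^sup>+s. 0 \<partial>(lborel :: real measure))"
  proof (rule nn_integral_dominated_convergence[where w = "\<lambda>s. ennreal (indicator {0<..} s * e s)"])
    show "AE s in lborel. ennreal (indicator {real n<..} s * e s) \<le> ennreal (indicator {0<..} s * e s)" for n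
      using e_nonneg by (intro AE_I2 ennreal_leI mult_right_mono) (auto simp: indicator_def)
    show "AE s in lborel. (\<lambda>n. ennreal (indicator {real n<..} s * e s)) \<longlonglongrightarrow> 0"
    proof (rule AE_I2)
      fix s
      obtain n0 :: nat where n0: "s < real n0" using reals_Archimedean2 by blast
      have "\<forall>\<^sub>F n in sequentially. 0 = ennreal (indicator {real n<..} s * e s)"
        using eventually_ge_at_top[of n0] by eventually_elim (use n0 in simp)
      then show "(\<lambda>n. ennreal (indicator {real n<..} s * e s)) \<longlonglongrightarrow> 0"
        by (rule Lim_transform_eventually[OF tendsto_const])
    qed
  qed (use fin in auto)
  then have "\<forall>\<^sub>F n in sequentially. (\<integral>\<^sup>+s. ennreal (indicator {real n<..} s * e s) \<partial>lborel) < ennreal \<delta>"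
    using \<delta> by (intro order_tendstoD(2)) auto
  then obtain n0 where "\<And>n. n0 \<le> n \<Longrightarrow> (\<integral>\<^sup>+s. ennreal (indicator {real n<..} s * e s) \<partial>lborel) < ennreal \<delta>"
    by (auto simp: eventually_sequentially)
  from this[of "Suc n0"] show ?thesis by (intro that[of "real (Suc n0)"]) (auto simp: less_imp_le)
qed

theorem theorem1p2:
  fixes G f :: "real ^ 'n::finite \<Rightarrow> real \<Rightarrow> real"
    and \<gamma> :: nat and d L K :: real and q :: ennreal
  assumes "1 \<le> \<gamma>" and "0 < d" and "0 < L"
    and "condition_G \<gamma> d L G"
    and "0 \<le> K" and "K < L" and "\<lfloor>K\<rfloor> + 1 \<le> int \<gamma>"
    and "1 \<le> q"
    and "(\<lambda>(x, t). f x t) \<in> borel_measurable (lebesgue_on (UNIV \<times> {0<..}))"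
    and "\<forall>T>0. in_Linfty T (E_fun d K q f)"
  shows
    "(\<forall>\<alpha>\<in>mi_upto K. \<exists>C1::real. AE t in lebesgue. 0 < t \<longrightarrow>
        ennreal \<bar>moment G (\<lambda>x. f x t) t \<alpha>\<bar>
          \<le> ennreal (C1 * (1 + t) powr (- (K - real (mi_len \<alpha>)) / d)) * E_fun d K q f t)
     \<and>
     (\<forall>t>0. AE x in lebesgue.
        R_op G K f t x =
          (LINT s:{0<..<t}|lebesgue. semigrp G (t - s) (\<lambda>y. f y s) x)
          - (\<Sum>\<alpha>\<in>mi_upto K.
               (LINT s:{0<..<t}|lebesgue. moment G (\<lambda>y. f y s) s \<alpha>) * g_kernel G \<alpha> t x))
     \<and>
     (\<forall>l j. 0 \<le> l \<and> l \<le> K \<and> j \<le> \<gamma> \<and> real j < d \<longrightarrow>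
        (\<forall>t>0. \<forall>\<alpha>. mi_len \<alpha> = j \<longrightarrow> (\<exists>v. has_weak_mpartial \<alpha> (R_op G K f t) v)) \<and>
        (\<forall>T0>0. \<exists>C2::real. \<forall>\<epsilon>>0. \<forall>T\<ge>T0. \<forall>\<^sub>F t in at_top.
           ennreal (t powr scal_exp TYPE('n) d q) * Lnorm q (weak_nabla j (R_op G K f t))
           + ennreal (t powr (- l / d)) * wnorm l (weak_nabla j (R_op G K f t))
           \<le> ennreal (\<epsilon> * t powr (- (K + real j) / d))
             + ennreal (C2 * t powr (- K / d)) *
                 (\<integral>\<^sup>+ s\<in>{T<..<t}. (ennreal ((t - s) powr (- real j / d)) * E_fun d K q f s) \<partial>lebesgue)))
     \<and>
     (\<forall>l. 0 \<le> l \<and> l \<le> K \<and> (\<integral>\<^sup>+ s\<in>{0<..}. E_fun d K q f s \<partial>lebesgue) < \<infinity> \<longrightarrow>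
        ((\<lambda>t. ennreal (t powr (K / d)) *
            (ennreal (t powr scal_exp TYPE('n) d q) * Lnorm q (R_op G K f t)
             + ennreal (t powr (- l / d)) * wnorm l (R_op G K f t)))
          \<longlongrightarrow> 0) at_top)"
proof -
  interpret H: duhamel_kernel G \<gamma> d L K
    by unfold_locales (use assms(2-7) in auto)
  obtain f' e where D: "duhamel G \<gamma> d L K f' e q"
    and ae: "AE s in lborel. 0 < s \<longrightarrow> E_fun d K q f s = ennreal (e s) \<and> (AE x in lebesgue. f x s = f' x s)"
    using H.Borel_reduction[OF assms(8,9,10)] by blast
  interpret D: duhamel G \<gamma> d L K f' e q by (rule D)
  have ae': "AE s in lebesgue. 0 < s \<longrightarrow> E_fun d K q f s = ennreal (e s) \<and> (AE x in lebesgue. f x s = f' x s)"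
    using ae by (rule AE_completion)
  \<comment> \<open>Valid at every x: altering almost every slice of f on a null set changes neither
    its moments nor the semigroup values.\<close>
  have R: "R_op G K f t = D.v [] t" for t
  proof
    fix x
    have "R_op G K f t x = R_op G K f' t x"
      by (rule R_op_cong_AE, use ae' in eventually_elim) blast
    then show "R_op G K f t x = D.v [] t x" by (simp add: D.R_op_eq_v)
  qed
  \<comment> \<open>For T > 0 the interval (T,t) avoids s <= 0, where E and e are unrelated.\<close>
  have I: "(\<integral>\<^sup>+ s\<in>{T<..<t}. (ennreal ((t - s) powr (- real j / d)) * E_fun d K q f s) \<partial>lebesgue)
    = (\<integral>\<^sup>+s. ennreal (indicator {T<..<t} s * ((t - s) powr (- real j / d) * e s)) \<partial>lborel)" if "0 < T" for T t j
    unfolding nn_integral_completion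
  proof (rule nn_integral_cong_AE, use ae in eventually_elim)
    fix s assume s: "0 < s \<longrightarrow> E_fun d K q f s = ennreal (e s) \<and> (AE x in lebesgue. f x s = f' x s)"
    show "ennreal ((t - s) powr (- real j / d)) * E_fun d K q f s * indicator {T<..<t} s
      = ennreal (indicator {T<..<t} s * ((t - s) powr (- real j / d) * e s))"
      using s that D.e_nonneg[of s] by (cases "s \<in> {T<..<t}") (auto simp: ennreal_mult)
  qed
  have 1: "\<exists>C1::real. AE t in lebesgue. 0 < t \<longrightarrow>
        ennreal \<bar>moment G (\<lambda>x. f x t) t \<alpha>\<bar>
          \<le> ennreal (C1 * (1 + t) powr (- (K - real (mi_len \<alpha>)) / d)) * E_fun d K q f t"
    if \<alpha>: "\<alpha> \<in> mi_upto K" for \<alpha>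
  proof -
    obtain C where C: "0 \<le> C" "\<And>h s e. 0 \<le> s \<Longrightarrow> 0 \<le> e \<Longrightarrow> H.slice h s e \<Longrightarrow>
      \<bar>moment G h s \<alpha>\<bar> \<le> C * (1 + s) powr (- (K - real (mi_len \<alpha>)) / d) * e"
      using H.moment_bound[OF \<alpha>] by blast
    have "AE t in lebesgue. 0 < t \<longrightarrow>
        ennreal \<bar>moment G (\<lambda>x. f x t) t \<alpha>\<bar>
          \<le> ennreal (C * (1 + t) powr (- (K - real (mi_len \<alpha>)) / d)) * E_fun d K q f t"
      using ae'
    proof eventually_elim
      fix t assume t: "0 < t \<longrightarrow> E_fun d K q f t = ennreal (e t) \<and> (AE x in lebesgue. f x t = f' x t)"
      show "0 < t \<longrightarrow> ennreal \<bar>moment G (\<lambda>x. f x t) t \<alpha>\<bar>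
          \<le> ennreal (C * (1 + t) powr (- (K - real (mi_len \<alpha>)) / d)) * E_fun d K q f t"
      proof
        assume t0: "0 < t"
        have "moment G (\<lambda>x. f x t) t \<alpha> = moment G (\<lambda>x. f' x t) t \<alpha>"
          using t t0 by (intro moment_cong_AE) blast
        then have "\<bar>moment G (\<lambda>x. f x t) t \<alpha>\<bar> \<le> C * (1 + t) powr (- (K - real (mi_len \<alpha>)) / d) * e t"
          using C(2)[OF _ D.e_nonneg D.f_slice[OF t0]] t0 by simp
        then have "ennreal \<bar>moment G (\<lambda>x. f x t) t \<alpha>\<bar> \<le> ennreal (C * (1 + t) powr (- (K - real (mi_len \<alpha>)) / d) * e t)"
          by (rule ennreal_leI)
        also have "\<dots> = ennreal (C * (1 + t) powr (- (K - real (mi_len \<alpha>)) / d)) * ennreal (e t)"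
          using C(1) D.e_nonneg[of t] by (intro ennreal_mult) auto
        finally show "ennreal \<bar>moment G (\<lambda>x. f x t) t \<alpha>\<bar>
          \<le> ennreal (C * (1 + t) powr (- (K - real (mi_len \<alpha>)) / d)) * E_fun d K q f t" using t t0 by simp
      qed
    qed
    then show ?thesis by blast
  qed
  have 2: "AE x in lebesgue. R_op G K f t x =
          (LINT s:{0<..<t}|lebesgue. semigrp G (t - s) (\<lambda>y. f y s) x)
          - (\<Sum>\<alpha>\<in>mi_upto K.
               (LINT s:{0<..<t}|lebesgue. moment G (\<lambda>y. f y s) s \<alpha>) * g_kernel G \<alpha> t x)"
    if t: "0 < t" for t
  proof -
    have s1: "(LINT s:{0<..<t}|lebesgue. semigrp G (t - s) (\<lambda>y. f y s) x)
      = (\<integral>s. indicator {0<..<t} s * conv (H.\<kappa> [] (t - s)) (\<lambda>y. f' y s) x \<partial>lborel)" for x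
    proof -
      have m: "(\<lambda>s. indicator {0<..<t} s * conv (H.\<kappa> [] (t - s)) (\<lambda>y. f' y s) x) \<in> borel_measurable borel"
      proof -
        have [measurable]: "(\<lambda>z. H.\<kappa> [] (t - fst z) (x - snd z)) \<in> borel_measurable (borel \<Otimes>\<^sub>M lborel)"
          by (rule H.borel_measurable_\<kappa>_pair) simp_all
        show ?thesis unfolding conv_def by measurable
      qed
      have "(LINT s:{0<..<t}|lebesgue. semigrp G (t - s) (\<lambda>y. f y s) x)
        = (LINT s|lebesgue. indicator {0<..<t} s * conv (H.\<kappa> [] (t - s)) (\<lambda>y. f' y s) x)"
        unfolding set_lebesgue_integral_def
      proof (rule lebesgue_integral_cong_AE, use ae' in eventually_elim)
        fix s assume s: "0 < s \<longrightarrow> E_fun d K q f s = ennreal (e s) \<and> (AE x in lebesgue. f x s = f' x s)"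
        show "indicat_real {0<..<t} s *\<^sub>R semigrp G (t - s) (\<lambda>y. f y s) x = indicat_real {0<..<t} s * conv (H.\<kappa> [] (t - s)) (\<lambda>y. f' y s) x"
        proof (cases "s \<in> {0<..<t}")
          case True
          then have "semigrp G (t - s) (\<lambda>y. f y s) x = semigrp G (t - s) (\<lambda>y. f' y s) x"
            using s by (intro semigrp_cong_AE) simp
          then show ?thesis using True D.semigrp_eq_conv[of "t - s" "\<lambda>y. f' y s" x] by simp
        qed simp
      qed
      then show ?thesis using lebesgue_integral_borel[OF m] by simp
    qed
    have s2: "(LINT s:{0<..<t}|lebesgue. moment G (\<lambda>y. f y s) s \<alpha>) = (\<integral>s. indicator {0<..<t} s * D.Mf \<alpha> s \<partial>lborel)"
      if \<alpha>: "\<alpha> \<in> mi_upto K" for \<alpha>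
    proof -
      note [measurable] = D.Mf_borel[OF \<alpha>]
      have "(LINT s:{0<..<t}|lebesgue. moment G (\<lambda>y. f y s) s \<alpha>) = (LINT s|lebesgue. indicator {0<..<t} s * D.Mf \<alpha> s)"
        unfolding set_lebesgue_integral_def
      proof (rule lebesgue_integral_cong_AE, use ae' in eventually_elim)
        fix s assume s: "0 < s \<longrightarrow> E_fun d K q f s = ennreal (e s) \<and> (AE x in lebesgue. f x s = f' x s)"
        show "indicat_real {0<..<t} s *\<^sub>R moment G (\<lambda>y. f y s) s \<alpha> = indicat_real {0<..<t} s * D.Mf \<alpha> s"
        proof (cases "s \<in> {0<..<t}")
          case True
          then have "moment G (\<lambda>y. f y s) s \<alpha> = moment G (\<lambda>y. f' y s) s \<alpha>"
            using s by (intro moment_cong_AE) simp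
          then show ?thesis using True by (simp add: D.Mf_def)
        qed simp
      qed
      also have "\<dots> = (\<integral>s. indicator {0<..<t} s * D.Mf \<alpha> s \<partial>lborel)"
        by (rule lebesgue_integral_borel) measurable
      finally show ?thesis .
    qed
    have "AE x in lebesgue. D.v [] t x = (\<integral>s. indicator {0<..<t} s * conv (H.\<kappa> [] (t - s)) (\<lambda>y. f' y s) x \<partial>lborel)
      - (\<Sum>\<alpha>\<in>mi_upto K. (\<integral>s. indicator {0<..<t} s * D.Mf \<alpha> s \<partial>lborel) * g_kernel G \<alpha> t x)"
      by (rule AE_completion[OF D.v_split[OF t]])
    then show ?thesis by (simp add: R s1 s2)
  qed
  have 3: "\<exists>v. has_weak_mpartial \<alpha> (R_op G K f t) v" if "mi_len \<alpha> \<le> \<gamma>" "real (mi_len \<alpha>) < d" "0 < t" for \<alpha> t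
    using D.v_weak_derivative[OF that] unfolding R by blast
  have 4: "\<exists>C2::real. \<forall>\<epsilon>>0. \<forall>T\<ge>T0. \<forall>\<^sub>F t in at_top.
           ennreal (t powr scal_exp TYPE('n) d q) * Lnorm q (weak_nabla j (R_op G K f t))
           + ennreal (t powr (- l / d)) * wnorm l (weak_nabla j (R_op G K f t))
           \<le> ennreal (\<epsilon> * t powr (- (K + real j) / d))
             + ennreal (C2 * t powr (- K / d)) *
                 (\<integral>\<^sup>+ s\<in>{T<..<t}. (ennreal ((t - s) powr (- real j / d)) * E_fun d K q f s) \<partial>lebesgue)"
    if l: "0 \<le> l" "l \<le> K" and j: "j \<le> \<gamma>" "real j < d" and T0: "0 < T0" for l j T0
  proof -
    obtain C where C0: "0 \<le> C" and C: "\<And>T \<epsilon>. 0 < T \<Longrightarrow> 0 < \<epsilon> \<Longrightarrow> \<forall>\<^sub>F t in at_top. \<exists>c\<ge>0.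
      (\<forall>is. length is = j \<longrightarrow> Lq_le q (D.v is t) (t powr (- D.\<sigma>) * c) \<and> Lq_le 1 (D.v is t) (t powr (l / d) * c) \<and>
        wt l (D.v is t) \<le> ennreal (t powr (l / d) * c)) \<and>
      ennreal c \<le> ennreal (\<epsilon> * t powr (- (K + real j) / d))
        + ennreal (C * t powr (- K / d)) * (\<integral>\<^sup>+s. ennreal (indicator {T<..<t} s * ((t - s) powr (- real j / d) * e s)) \<partial>lborel)"
      using D.v_final[OF l j] by blast
    define n where "n = 3 * real (card {\<alpha>::'n \<Rightarrow> nat. mi_len \<alpha> = j})"
    have n0: "0 \<le> n" by (simp add: n_def)
    show ?thesis
    \<comment> \<open>The constant n C is fixed before \<epsilon> and T are introduced; the factor n
      is that of \<open>norms_weak_nabla\<close>.\<close>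
    proof (intro exI[of _ "n * C"] allI impI)
      fix \<epsilon> T :: real assume \<epsilon>: "0 < \<epsilon>" and "T0 \<le> T"
      then have T: "0 < T" using T0 by simp
      \<comment> \<open>The denominator n+1 is positive without any knowledge of n beyond n >= 0,
        and n/(n+1) <= 1 restores \<epsilon> below.\<close>
      have "0 < \<epsilon> / (n + 1)" using \<epsilon> n0 by simp
      show "\<forall>\<^sub>F t in at_top.
           ennreal (t powr scal_exp TYPE('n) d q) * Lnorm q (weak_nabla j (R_op G K f t))
           + ennreal (t powr (- l / d)) * wnorm l (weak_nabla j (R_op G K f t))
           \<le> ennreal (\<epsilon> * t powr (- (K + real j) / d))
             + ennreal (n * C * t powr (- K / d)) *
                 (\<integral>\<^sup>+ s\<in>{T<..<t}. (ennreal ((t - s) powr (- real j / d)) * E_fun d K q f s) \<partial>lebesgue)"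
        using C[OF T \<open>0 < \<epsilon> / (n + 1)\<close>] eventually_gt_at_top[of 0]
      proof eventually_elim
        fix t :: real
        define X where "X = (\<integral>\<^sup>+s. ennreal (indicator {T<..<t} s * ((t - s) powr (- real j / d) * e s)) \<partial>lborel)"
        assume "\<exists>c\<ge>0. (\<forall>is. length is = j \<longrightarrow> Lq_le q (D.v is t) (t powr (- D.\<sigma>) * c) \<and> Lq_le 1 (D.v is t) (t powr (l / d) * c) \<and>
            wt l (D.v is t) \<le> ennreal (t powr (l / d) * c)) \<and>
          ennreal c \<le> ennreal (\<epsilon> / (n + 1) * t powr (- (K + real j) / d))
            + ennreal (C * t powr (- K / d)) * (\<integral>\<^sup>+s. ennreal (indicator {T<..<t} s * ((t - s) powr (- real j / d) * e s)) \<partial>lborel)"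
          and t: "0 < t"
        then obtain c where c: "0 \<le> c" "\<And>is. length is = j \<Longrightarrow> Lq_le q (D.v is t) (t powr (- D.\<sigma>) * c) \<and> Lq_le 1 (D.v is t) (t powr (l / d) * c) \<and>
            wt l (D.v is t) \<le> ennreal (t powr (l / d) * c)"
          "ennreal c \<le> ennreal (\<epsilon> / (n + 1) * t powr (- (K + real j) / d)) + ennreal (C * t powr (- K / d)) * X"
          unfolding X_def by blast
        have "ennreal (t powr scal_exp TYPE('n) d q) * Lnorm q (weak_nabla j (D.v [] t))
           + ennreal (t powr (- l / d)) * wnorm l (weak_nabla j (D.v [] t)) \<le> ennreal (n * c)"
          unfolding n_def by (rule D.norms_weak_nabla[OF j t c(1,2)])
        also have "\<dots> = ennreal n * ennreal c" using n0 c(1) by (rule ennreal_mult)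
        also have "\<dots> \<le> ennreal n * (ennreal (\<epsilon> / (n + 1) * t powr (- (K + real j) / d)) + ennreal (C * t powr (- K / d)) * X)"
          by (rule mult_left_mono[OF c(3)]) simp
        also have "\<dots> = ennreal (n * (\<epsilon> / (n + 1) * t powr (- (K + real j) / d))) + ennreal (n * (C * t powr (- K / d))) * X"
        proof -
          have 1: "ennreal (n * (\<epsilon> / (n + 1) * t powr (- (K + real j) / d))) = ennreal n * ennreal (\<epsilon> / (n + 1) * t powr (- (K + real j) / d))"
            using n0 \<epsilon> by (intro ennreal_mult) auto
          have 2: "ennreal (n * (C * t powr (- K / d))) = ennreal n * ennreal (C * t powr (- K / d))"
            using n0 C0 by (intro ennreal_mult) auto
          show ?thesis by (simp only: 1 2 distrib_left mult.assoc)
        qed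
        also have "\<dots> \<le> ennreal (\<epsilon> * t powr (- (K + real j) / d)) + ennreal (n * C * t powr (- K / d)) * X"
        proof (rule add_mono)
          have "n * (\<epsilon> / (n + 1) * t powr (- (K + real j) / d)) = (n / (n + 1)) * (\<epsilon> * t powr (- (K + real j) / d))" by simp
          also have "\<dots> \<le> 1 * (\<epsilon> * t powr (- (K + real j) / d))" using n0 \<epsilon> by (intro mult_right_mono) auto
          finally show "ennreal (n * (\<epsilon> / (n + 1) * t powr (- (K + real j) / d))) \<le> ennreal (\<epsilon> * t powr (- (K + real j) / d))"
            by (intro ennreal_leI) simp
        qed (simp add: mult.assoc)
        finally show "ennreal (t powr scal_exp TYPE('n) d q) * Lnorm q (weak_nabla j (R_op G K f t))
           + ennreal (t powr (- l / d)) * wnorm l (weak_nabla j (R_op G K f t))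
           \<le> ennreal (\<epsilon> * t powr (- (K + real j) / d))
             + ennreal (n * C * t powr (- K / d)) *
                 (\<integral>\<^sup>+ s\<in>{T<..<t}. (ennreal ((t - s) powr (- real j / d)) * E_fun d K q f s) \<partial>lebesgue)"
          unfolding R I[OF T] X_def .
      qed
    qed
  qed
  \<comment> \<open>The limit concerns the Duhamel integral itself and not
    \<open>weak_nabla 0\<close>, so the bounds on \<open>v [] t\<close> enter directly, with j =
    0.\<close>
  have 5: "((\<lambda>t. ennreal (t powr (K / d)) *
            (ennreal (t powr scal_exp TYPE('n) d q) * Lnorm q (R_op G K f t)
             + ennreal (t powr (- l / d)) * wnorm l (R_op G K f t)))
          \<longlongrightarrow> 0) at_top"
    if l: "0 \<le> l" "l \<le> K" and fin: "(\<integral>\<^sup>+ s\<in>{0<..}. E_fun d K q f s \<partial>lebesgue) < \<infinity>" for l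
  proof -
    have fin': "(\<integral>\<^sup>+s. ennreal (indicator {0<..} s * e s) \<partial>lborel) < \<infinity>"
    proof -
      have "(\<integral>\<^sup>+ s\<in>{0<..}. E_fun d K q f s \<partial>lebesgue) = (\<integral>\<^sup>+s. ennreal (indicator {0<..} s * e s) \<partial>lborel)"
        unfolding nn_integral_completion
      proof (rule nn_integral_cong_AE, use ae in eventually_elim)
        fix s assume s: "0 < s \<longrightarrow> E_fun d K q f s = ennreal (e s) \<and> (AE x in lebesgue. f x s = f' x s)"
        show "E_fun d K q f s * indicator {0<..} s = ennreal (indicator {0<..} s * e s)"
          using s by (cases "0 < s") auto
      qed
      with fin show ?thesis by simp
    qed
    have d0: "real 0 < d" using assms(2) by simp
    obtain C where C0: "0 \<le> C" and C: "\<And>T \<epsilon>. 0 < T \<Longrightarrow> 0 < \<epsilon> \<Longrightarrow> \<forall>\<^sub>F t in at_top. \<exists>c\<ge>0.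
      (\<forall>is. length is = 0 \<longrightarrow> Lq_le q (D.v is t) (t powr (- D.\<sigma>) * c) \<and> Lq_le 1 (D.v is t) (t powr (l / d) * c) \<and>
        wt l (D.v is t) \<le> ennreal (t powr (l / d) * c)) \<and>
      ennreal c \<le> ennreal (\<epsilon> * t powr (- (K + real 0) / d))
        + ennreal (C * t powr (- K / d)) * (\<integral>\<^sup>+s. ennreal (indicator {T<..<t} s * ((t - s) powr (- real 0 / d) * e s)) \<partial>lborel)"
      using D.v_final[OF l le0 d0] by blast
    have main: "\<forall>\<^sub>F t in at_top. ennreal (t powr (K / d)) *
            (ennreal (t powr scal_exp TYPE('n) d q) * Lnorm q (R_op G K f t)
             + ennreal (t powr (- l / d)) * wnorm l (R_op G K f t)) \<le> ennreal (3 * (1 + C) * \<delta>)" if \<delta>: "0 < \<delta>" for \<delta>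
    proof -
      \<comment> \<open>T is chosen so that the tail integral is at most \<delta>; with \<epsilon> =
        \<delta> as well, both contributions are multiples of \<delta>.\<close>
      obtain T where T: "0 < T" "(\<integral>\<^sup>+s. ennreal (indicator {T<..} s * e s) \<partial>lborel) \<le> ennreal \<delta>"
        using D.e_tail[OF fin' \<delta>] by blast
      show ?thesis using C[OF T(1) \<delta>] eventually_gt_at_top[of 0]
      proof eventually_elim
        fix t :: real
        define X where "X = (\<integral>\<^sup>+s. ennreal (indicator {T<..<t} s * ((t - s) powr (- real 0 / d) * e s)) \<partial>lborel)"
        assume "\<exists>c\<ge>0. (\<forall>is. length is = 0 \<longrightarrow> Lq_le q (D.v is t) (t powr (- D.\<sigma>) * c) \<and> Lq_le 1 (D.v is t) (t powr (l / d) * c) \<and>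
            wt l (D.v is t) \<le> ennreal (t powr (l / d) * c)) \<and>
          ennreal c \<le> ennreal (\<delta> * t powr (- (K + real 0) / d))
            + ennreal (C * t powr (- K / d)) * (\<integral>\<^sup>+s. ennreal (indicator {T<..<t} s * ((t - s) powr (- real 0 / d) * e s)) \<partial>lborel)"
          and t: "0 < t"
        then obtain c where c: "0 \<le> c" "Lq_le q (D.v [] t) (t powr (- D.\<sigma>) * c)" "Lq_le 1 (D.v [] t) (t powr (l / d) * c)"
            "wt l (D.v [] t) \<le> ennreal (t powr (l / d) * c)"
          "ennreal c \<le> ennreal (\<delta> * t powr (- K / d)) + ennreal (C * t powr (- K / d)) * X"
          unfolding X_def by auto
        have X: "X \<le> ennreal \<delta>"
        proof -
          have "X \<le> (\<integral>\<^sup>+s. ennreal (indicator {T<..} s * e s) \<partial>lborel)"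
            unfolding X_def using D.e_nonneg by (intro nn_integral_mono ennreal_leI) (auto simp: indicator_def)
          with T(2) show ?thesis by simp
        qed
        have "ennreal c \<le> ennreal (\<delta> * t powr (- K / d)) + ennreal (C * t powr (- K / d)) * ennreal \<delta>"
          using c(5) X by (meson add_left_mono mult_left_mono order_trans zero_le)
        also have "\<dots> = ennreal ((1 + C) * \<delta> * t powr (- K / d))"
          using \<delta> C0 by (simp add: algebra_simps flip: ennreal_mult ennreal_plus)
        finally have cb: "c \<le> (1 + C) * \<delta> * t powr (- K / d)" using \<delta> C0 by simp
        have vm: "D.v [] t \<in> borel_measurable lebesgue"
          using D.v_borel[of "[]" t] by (intro measurable_completion) simp
        have "ennreal (t powr scal_exp TYPE('n) d q) * Lnorm q (D.v [] t) + ennreal (t powr (- l / d)) * wnorm l (D.v [] t) \<le> ennreal (3 * c)"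
          by (rule D.norms_le[OF vm _ t c(1-4)]) simp
        then have "ennreal (t powr (K / d)) * (ennreal (t powr scal_exp TYPE('n) d q) * Lnorm q (D.v [] t) + ennreal (t powr (- l / d)) * wnorm l (D.v [] t))
          \<le> ennreal (t powr (K / d)) * ennreal (3 * c)" by (rule mult_left_mono) simp
        also have "\<dots> = ennreal (t powr (K / d) * (3 * c))" using c(1) by (simp add: ennreal_mult)
        also have "\<dots> \<le> ennreal (3 * (1 + C) * \<delta>)"
        proof (rule ennreal_leI)
          have "t powr (K / d) * (3 * c) \<le> t powr (K / d) * (3 * ((1 + C) * \<delta> * t powr (- K / d)))"
            using cb by (intro mult_left_mono) auto
          also have "\<dots> = 3 * (1 + C) * \<delta> * (t powr (K / d) * t powr (- K / d))" by (simp add: mult_ac)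
          also have "t powr (K / d) * t powr (- K / d) = 1" using t by (simp add: powr_add[symmetric])
          finally show "t powr (K / d) * (3 * c) \<le> 3 * (1 + C) * \<delta>" by simp
        qed
        finally show "ennreal (t powr (K / d)) *
            (ennreal (t powr scal_exp TYPE('n) d q) * Lnorm q (R_op G K f t)
             + ennreal (t powr (- l / d)) * wnorm l (R_op G K f t)) \<le> ennreal (3 * (1 + C) * \<delta>)"
          unfolding R .
      qed
    qed
    show ?thesis
    proof (rule order_tendstoI)
      fix a :: ennreal assume "0 < a"
      then obtain r where r: "0 < r" "r < a" using dense by blast
      then obtain x where x: "r = ennreal x" "0 < x" by (cases r) auto
      \<comment> \<open>Chosen to cancel the constant 3(1+C) of \<open>main\<close>.\<close>
      have "0 < x / (3 * (1 + C))" using x C0 by simp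
      from main[OF this]
      show "\<forall>\<^sub>F t in at_top. ennreal (t powr (K / d)) *
            (ennreal (t powr scal_exp TYPE('n) d q) * Lnorm q (R_op G K f t)
             + ennreal (t powr (- l / d)) * wnorm l (R_op G K f t)) < a"
      proof eventually_elim
        fix t assume "ennreal (t powr (K / d)) *
            (ennreal (t powr scal_exp TYPE('n) d q) * Lnorm q (R_op G K f t)
             + ennreal (t powr (- l / d)) * wnorm l (R_op G K f t)) \<le> ennreal (3 * (1 + C) * (x / (3 * (1 + C))))"
        also have "3 * (1 + C) * (x / (3 * (1 + C))) = x" using C0 by simp
        also have "ennreal x < a" using r x by simp
        finally show "ennreal (t powr (K / d)) *
            (ennreal (t powr scal_exp TYPE('n) d q) * Lnorm q (R_op G K f t)
             + ennreal (t powr (- l / d)) * wnorm l (R_op G K f t)) < a" .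
      qed
    qed simp
  qed
  show ?thesis
    using 1 2 3 4 5 by blast
qed

end
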